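(* Suppose that $1\le p,q,r_1,r_2\le\infty$ satisfy $$q\le p'\qquad\text{and}\qquad \max\{r_1,r_2,r_1',r_2'\}\le p .$$ Let $m\in\mathcal{M}_v(\mathbb{R}^{2d})$ and $a\in W(\mathcal{F}L^p_{v_J},L^q)(\mathbb{R}^{2d})$. Then for every $\tau\in(0,1)$ the $\tau$-pseudodifferential operator $\operatorname{Op}_\tau(a)$ is a bounded operator on $M^{r_1,r_2}_m(\mathbb{R}^d)$. Moreover, there exists a constant $C>0$ independent of $\tau$ (and of $a$ and $f$) such that $$\|\operatorname{Op}_\tau(a)f\|_{M^{r_1,r_2}_m}\le C\,\alpha_{(r_1,r_2)}(\tau)\,\|a\|_{W(\mathcal{F}L^p_{v_J},L^q)}\,\|f\|_{M^{r_1,r_2}_m},\qquad \tau\in(0,1),\ f\in M^{r_1,r_2}_m(\mathbb{R}^d),$$ where $$\alpha_{(r_1,r_2)}(\tau)=\frac{1}{\tau^{d\left(\frac1{r_1'}+\frac1{r_2}\right)}(1-\tau)^{d\left(\frac1{r_1}+\frac1{r_2'}\right)}},\qquad \tau\in(0,1).$$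
   Context: $p'$ denotes the conjugate exponent of $p\in[1,\infty]$: $1/p+1/p'=1$. $\langle\cdot,\cdot\rangle$ is the $L^2$ inner product or the duality pairing between $\mathcal{S}'$ and $\mathcal{S}$ (antilinear in the second argument), extended where possible to dual pairs of function spaces. Weights: $v$ is a fixed continuous, positive, even, submultiplicative weight on $\mathbb{R}^{2d}$: $v(0)=1$, $v(z)=v(-z)$, $v(z_1+z_2)\le v(z_1)v(z_2)$. $\mathcal{M}_v(\mathbb{R}^{2d})$ is the set of $v$-moderate weights: positive functions $m$ on $\mathbb{R}^{2d}$ for which there is $C>0$ with $m(z_1+z_2)\le Cv(z_1)m(z_2)$ for all $z_1,z_2$. $v_J(z)=v(Jz)$, with $J=\begin{pmatrix}0&I_d\\-I_d&0\end{pmatrix}$. Short-time Fourier transform on $\mathbb{R}^n$ ($n=d$ or $2d$): for a nonzero $g\in\mathcal{S}(\mathbb{R}^n)$ and $f\in\mathcal{S}'(\mathbb{R}^n)$, $V_gf(x,\xi)=\langle f,M_\xi T_xg\rangle=\int_{\mathbb{R}^n}f(t)\overline{g(t-x)}e^{-2\pi i t\xi}\,dt$, where $T_xg(t)=g(t-x)$, $M_\xi g(t)=e^{2\pi i\xi t}g(t)$, $x,\xi\in\mathbb{R}^n$. Modulation space $M^{p,q}_m(\mathbb{R}^d)$: all $f\in\mathcal{S}'(\mathbb{R}^d)$ with $\|f\|_{M^{p,q}_m}=\big(\int(\int|V_gf(x,\xi)|^pm(x,\xi)^p\,dx)^{q/p}d\xi\big)^{1/q}<\infty$. Wiener amalgam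 space $W(\mathcal{F}L^p_u,L^q)(\mathbb{R}^{2d})$, $u$ an even weight on $\mathbb{R}^{2d}$: all $a\in\mathcal{S}'(\mathbb{R}^{2d})$ with $\|a\|_{W(\mathcal{F}L^p_u,L^q)}=\big(\int_{\mathbb{R}^{2d}}(\int_{\mathbb{R}^{2d}}|V_\Phi a(z,\zeta)|^pu(\zeta)^p\,d\zeta)^{q/p}dz\big)^{1/q}<\infty$. Usual sup modifications if $p$ or $q$ is $\infty$; fixed nonzero Schwartz windows $g,\Phi$ are used, and different windows give equivalent norms. For $\tau\in[0,1]$ the (cross-)$\tau$-Wigner distribution is $W_\tau(f,g)(x,\xi)=\int_{\mathbb{R}^d}e^{-2\pi it\xi}f(x+\tau t)\overline{g(x-(1-\tau)t)}\,dt$ (extended to tempered distributions in the usual way). For $a\in\mathcal{S}'(\mathbb{R}^{2d})$ the $\tau$-pseudodifferential operator with symbol $a$ is defined by $\langle\operatorname{Op}_\tau(a)f,g\rangle=\langle a,W_\tau(g,f)\rangle$, $f,g\in\mathcal{S}(\mathbb{R}^d)$; formally $\operatorname{Op}_\tau(a)f(x)=\iint e^{2\pi i(x-y)\xi}a((1-\tau)x+\tau y,\xi)f(y)\,dy\,d\xi$. The same duality formula defines $\operatorname{Op}_\tau(a)f$ for $f\in M^{r_1,r_2}_m(\mathbb{R}^d)$, tested against $g\in M^{r_1',r_2'}_{1/m}(\mathbb{R}^d)$.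
   Formalization: The weight v is additionally assumed to grow at most polynomially; without this, different Schwartz windows do not give equivalent norms on the modulation and amalgam spaces, and the bound can fail for exponential v. *)

theory Defs
  imports "HOL-Analysis.Analysis"
begin

section \<open>Exponents and mixed Lebesgue norms\<close>

text \<open>Exponents range over \<open>[1,\<infinity>]\<close> inside \<^typ>\<open>ennreal\<close>, where \<open>inverse \<infinity> = 0\<close> and
  \<open>inverse 0 = \<infinity>\<close>.\<close>

definition conj_exp :: "ennreal \<Rightarrow> ennreal"
  where "conj_exp p = inverse (1 - inverse p)"

lemma conj_exp_conjugate:
  assumes "1 \<le> p"
  shows "inverse p + inverse (conj_exp p) = 1"
proof -
  have "inverse p \<le> 1"
    using assms by (cases p)
      (auto simp: inverse_ennreal ennreal_le_1 ennreal_1[symmetric] inverse_le_1_iff simp del: ennreal_1)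
  moreover have "inverse (inverse x) = x" for x :: ennreal
    by (cases x; cases "x = 0") (auto simp: inverse_ennreal)
  ultimately show ?thesis
    by (simp add: conj_exp_def add_diff_self_ennreal)
qed

definition epowr :: "ennreal \<Rightarrow> real \<Rightarrow> ennreal"
  where "epowr x s = (if x = top then top else ennreal (enn2real x powr s))"

text \<open>The limes superior along \<^term>\<open>ae_filter lborel\<close> is the essential supremum. It is used
  in place of the constant \<open>esssup\<close>, which has the value \<open>top\<close> on nonmeasurable functions;
  moderate weights are not assumed measurable.\<close>

definition Lnorm :: "ennreal \<Rightarrow> ('a::euclidean_space \<Rightarrow> ennreal) \<Rightarrow> ennreal"
  where "Lnorm p F =
    (if p = top then Limsup (ae_filter lborel) F
     else epowr (\<integral>\<^sup>+ x. epowr (F x) (enn2real p) \<partial>lborel) (1 / enn2real p))"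


section \<open>Schwartz functions and tempered distributions\<close>

fun iter_deriv :: "'a list \<Rightarrow> ('a::euclidean_space \<Rightarrow> complex) \<Rightarrow> 'a \<Rightarrow> complex"
  where
    "iter_deriv [] f = f"
  | "iter_deriv (b # bs) f = (\<lambda>x. frechet_derivative (iter_deriv bs f) (at x) b)"

definition schwartz :: "('a::euclidean_space \<Rightarrow> complex) set"
  where "schwartz = {f. \<forall>bs. set bs \<subseteq> Basis \<longrightarrow>
      iter_deriv bs f differentiable_on UNIV \<and>
      (\<forall>k::nat. \<exists>C. \<forall>x. (1 + norm x) ^ k * cmod (iter_deriv bs f x) \<le> C)}"

definition schwartz_norm :: "nat \<Rightarrow> ('a::euclidean_space \<Rightarrow> complex) \<Rightarrow> real"
  where "schwartz_norm N f =
    (\<Sum>bs\<in>{bs. set bs \<subseteq> Basis \<and> length bs \<le> N}.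
       SUP x. (1 + norm x) ^ N * cmod (iter_deriv bs f x))"

text \<open>Continuous linear functionals on the Schwartz space. The values of such a functional
  outside \<^const>\<open>schwartz\<close> are irrelevant.\<close>

definition tempered :: "(('a::euclidean_space \<Rightarrow> complex) \<Rightarrow> complex) set"
  where "tempered = {u.
      (\<forall>\<phi>\<in>schwartz. \<forall>\<psi>\<in>schwartz. u (\<lambda>x. \<phi> x + \<psi> x) = u \<phi> + u \<psi>) \<and>
      (\<forall>c. \<forall>\<phi>\<in>schwartz. u (\<lambda>x. c * \<phi> x) = c * u \<phi>) \<and>
      (\<exists>C N. \<forall>\<phi>\<in>schwartz. cmod (u \<phi>) \<le> C * schwartz_norm N \<phi>)}"

definition dist_of_fun :: "('a::euclidean_space \<Rightarrow> complex) \<Rightarrow> ('a \<Rightarrow> complex) \<Rightarrow> complex"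
  where "dist_of_fun f = (\<lambda>\<phi>. LINT x|lborel. f x * \<phi> x)"

text \<open>The pairing between distributions and Schwartz functions, antilinear in the second
  argument.\<close>

definition duality :: "(('a::euclidean_space \<Rightarrow> complex) \<Rightarrow> complex) \<Rightarrow> ('a \<Rightarrow> complex) \<Rightarrow> complex"
  where "duality u \<phi> = u (\<lambda>x. cnj (\<phi> x))"


section \<open>Short-time Fourier transform\<close>

definition translation :: "'a::euclidean_space \<Rightarrow> ('a \<Rightarrow> complex) \<Rightarrow> 'a \<Rightarrow> complex"
  where "translation x g = (\<lambda>t. g (t - x))"

definition modulation :: "'a::euclidean_space \<Rightarrow> ('a \<Rightarrow> complex) \<Rightarrow> 'a \<Rightarrow> complex"
  where "modulation \<xi> g = (\<lambda>t. cis (2 * pi * (\<xi> \<bullet> t)) * g t)"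

definition stft :: "('a::euclidean_space \<Rightarrow> complex) \<Rightarrow> (('a \<Rightarrow> complex) \<Rightarrow> complex) \<Rightarrow> 'a \<Rightarrow> 'a \<Rightarrow> complex"
  where "stft g f x \<xi> = duality f (modulation \<xi> (translation x g))"

text \<open>The pairing of two tempered distributions belonging to dual modulation or amalgam spaces.
  By Moyal's identity \<open>\<langle>V\<^sub>\<Phi> a, V\<^sub>\<Phi> b\<rangle> = \<langle>a, b\<rangle> \<parallel>\<Phi>\<parallel>\<^sup>2\<close> it extends the \<open>L\<^sup>2\<close> inner product as well as
  \<^const>\<open>duality\<close>, and it does not depend on the window.\<close>

definition ext_duality :: "('a::euclidean_space \<Rightarrow> complex) \<Rightarrow>
    (('a \<Rightarrow> complex) \<Rightarrow> complex) \<Rightarrow> (('a \<Rightarrow> complex) \<Rightarrow> complex) \<Rightarrow> complex"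
  where "ext_duality \<Phi> a b =
    (LINT w|lborel. stft \<Phi> a (fst w) (snd w) * cnj (stft \<Phi> b (fst w) (snd w)))
      / of_real (LINT z|lborel. (cmod (\<Phi> z))\<^sup>2)"


section \<open>Weights\<close>

definition submult_weight :: "('a::euclidean_space \<Rightarrow> real) \<Rightarrow> bool"
  where "submult_weight v \<longleftrightarrow>
    continuous_on UNIV v \<and> (\<forall>z. 0 < v z) \<and> v 0 = 1 \<and> (\<forall>z. v (- z) = v z) \<and>
    (\<forall>z w. v (z + w) \<le> v z * v w)"

text \<open>Inside the space of tempered distributions, all Schwartz windows give equivalent norms for
  every \<open>v\<close>-moderate weight exactly when \<open>v\<close> has polynomial growth.\<close>

definition polynomial_growth :: "('a::euclidean_space \<Rightarrow> real) \<Rightarrow> bool"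
  where "polynomial_growth v \<longleftrightarrow> (\<exists>C. \<exists>N::nat. \<forall>z. v z \<le> C * (1 + norm z) ^ N)"

definition moderate_weights :: "('a::euclidean_space \<Rightarrow> real) \<Rightarrow> ('a \<Rightarrow> real) set"
  where "moderate_weights v =
    {m. (\<forall>z. 0 < m z) \<and> (\<exists>C>0. \<forall>z w. m (z + w) \<le> C * v z * m w)}"

definition symplectic_J :: "'a::euclidean_space \<times> 'a \<Rightarrow> 'a \<times> 'a"
  where "symplectic_J z = (snd z, - fst z)"


section \<open>Modulation and Wiener amalgam spaces\<close>

text \<open>In both spaces the first argument is the window.\<close>

definition modulation_norm :: "('a::euclidean_space \<Rightarrow> complex) \<Rightarrow> ennreal \<Rightarrow> ennreal \<Rightarrow>
    ('a \<times> 'a \<Rightarrow> real) \<Rightarrow> (('a \<Rightarrow> complex) \<Rightarrow> complex) \<Rightarrow> ennreal"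
  where "modulation_norm g p q m f =
    Lnorm q (\<lambda>\<xi>. Lnorm p (\<lambda>x. ennreal (cmod (stft g f x \<xi>) * m (x, \<xi>))))"

definition modulation_space :: "('a::euclidean_space \<Rightarrow> complex) \<Rightarrow> ennreal \<Rightarrow> ennreal \<Rightarrow>
    ('a \<times> 'a \<Rightarrow> real) \<Rightarrow> (('a \<Rightarrow> complex) \<Rightarrow> complex) set"
  where "modulation_space g p q m = {f \<in> tempered. modulation_norm g p q m f < top}"

definition wiener_norm :: "('a::euclidean_space \<Rightarrow> complex) \<Rightarrow> ennreal \<Rightarrow> ('a \<Rightarrow> real) \<Rightarrow> ennreal \<Rightarrow>
    (('a \<Rightarrow> complex) \<Rightarrow> complex) \<Rightarrow> ennreal"
  where "wiener_norm \<Phi> p u q a =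
    Lnorm q (\<lambda>z. Lnorm p (\<lambda>\<zeta>. ennreal (cmod (stft \<Phi> a z \<zeta>) * u \<zeta>)))"

definition wiener_space :: "('a::euclidean_space \<Rightarrow> complex) \<Rightarrow> ennreal \<Rightarrow> ('a \<Rightarrow> real) \<Rightarrow> ennreal \<Rightarrow>
    (('a \<Rightarrow> complex) \<Rightarrow> complex) set"
  where "wiener_space \<Phi> p u q = {a \<in> tempered. wiener_norm \<Phi> p u q a < top}"


section \<open>The \<open>\<tau>\<close>-Wigner distribution and \<open>\<tau>\<close>-pseudodifferential operators\<close>

definition tau_wigner :: "real \<Rightarrow> ('a::euclidean_space \<Rightarrow> complex) \<Rightarrow> ('a \<Rightarrow> complex) \<Rightarrow>
    'a \<times> 'a \<Rightarrow> complex"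
  where "tau_wigner \<tau> f g = (\<lambda>(x, \<xi>). LINT t|lborel.
    cis (- (2 * pi * (t \<bullet> \<xi>))) * f (x + \<tau> *\<^sub>R t) * cnj (g (x - (1 - \<tau>) *\<^sub>R t)))"

definition fourier_snd :: "('a::euclidean_space \<times> 'a \<Rightarrow> complex) \<Rightarrow> 'a \<times> 'a \<Rightarrow> complex"
  where "fourier_snd \<Psi> = (\<lambda>(x, t). LINT \<xi>|lborel. cis (- (2 * pi * (t \<bullet> \<xi>))) * \<Psi> (x, \<xi>))"

text \<open>The \<open>\<tau>\<close>-Wigner distribution of two tempered distributions is the tensor product of \<open>f\<close> with
  the conjugate of \<open>g\<close>, composed with the change of variables of determinant \<open>\<plusminus>1\<close> in
  \<^const>\<open>tau_wigner\<close> and the Fourier transform in \<open>t\<close>, all moved to the test function \<open>\<Psi>\<close>. The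
  change of variables \<open>u = x + \<tau>t\<close>, \<open>s = x - (1-\<tau>)t\<close> has the inverse \<open>x = (1-\<tau>)u + \<tau>s\<close>,
  \<open>t = u - s\<close>, and the distribution conjugate to \<open>g\<close> maps \<open>\<phi>\<close> to \<open>cnj (duality g \<phi>)\<close>.\<close>

definition tau_wigner_dist :: "real \<Rightarrow> (('a::euclidean_space \<Rightarrow> complex) \<Rightarrow> complex) \<Rightarrow>
    (('a \<Rightarrow> complex) \<Rightarrow> complex) \<Rightarrow> ('a \<times> 'a \<Rightarrow> complex) \<Rightarrow> complex"
  where "tau_wigner_dist \<tau> f g = (\<lambda>\<Psi>.
    f (\<lambda>u. cnj (duality g (\<lambda>s. fourier_snd \<Psi> ((1 - \<tau>) *\<^sub>R u + \<tau> *\<^sub>R s, u - s)))))"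

text \<open>The tempered distribution \<open>Op\<^sub>\<tau>(a)f\<close>, determined by \<open>\<langle>Op\<^sub>\<tau>(a)f, g\<rangle> = \<langle>a, W\<^sub>\<tau>(g, f)\<rangle>\<close> for
  Schwartz functions \<open>g\<close>. A functional is applied to \<open>\<psi> = cnj g\<close>, so \<open>g = cnj \<psi>\<close>. The window
  \<open>\<Phi>\<close> only serves to evaluate the pairing on the right.\<close>

definition op_tau :: "real \<Rightarrow> ('a::euclidean_space \<times> 'a \<Rightarrow> complex) \<Rightarrow>
    (('a \<times> 'a \<Rightarrow> complex) \<Rightarrow> complex) \<Rightarrow> (('a \<Rightarrow> complex) \<Rightarrow> complex) \<Rightarrow> ('a \<Rightarrow> complex) \<Rightarrow> complex"
  where "op_tau \<tau> \<Phi> a f = (\<lambda>\<psi>.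
    ext_duality \<Phi> a (tau_wigner_dist \<tau> (dist_of_fun (\<lambda>x. cnj (\<psi> x))) f))"

definition alpha_tau :: "nat \<Rightarrow> ennreal \<Rightarrow> ennreal \<Rightarrow> real \<Rightarrow> real"
  where "alpha_tau d r1 r2 \<tau> =
    1 / (\<tau> powr (real d * enn2real (inverse (conj_exp r1) + inverse r2))
         * (1 - \<tau>) powr (real d * enn2real (inverse r1 + inverse (conj_exp r2))))"

end

(* Write pi(x, xi) = M_xi T_x. The inversion formula of the short-time Fourier transform,
   f = |g|^-2 int V_g f(w') pi(w') g dw', and Moyal's identity give
     |V_g (Op_tau(a) f)(w)| <= C int |V_Phi a(z, zeta)| |V_Phi W_tau(pi(w) g, pi(w') g)(z, zeta)| |V_g f(w')| dz dzeta dw',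
   and by covariance the Wigner term is a time-frequency shift of a Schwartz function, so it decays
   rapidly, uniformly in tau, away from z = ((1-tau) x + tau x', tau xi + (1-tau) xi') and
   zeta = J(w - w'). The weights are absorbed by moderateness and m(w) <= C v(w - w') m(w'). What is
   left is an integral operator with a kernel b(z(w, w'), J(w - w')), b in L^q(L^p), on a mixed
   Lebesgue space. One application of Hoelder's inequality in x and one in xi, joined by Minkowski's
   inequality, bound it; the Jacobians of the changes of variables produce the powers of tau and
   1 - tau. *)
theory Submission
  imports Defs "HOL-Probability.Probability"
begin

section \<open>Quantitative Schwartz bounds\<close>

text \<open>The exponent hypotheses place \<open>r1\<close> and \<open>r2\<close> between the
  conjugate exponent \<open>S\<close> of \<open>p\<close> and \<open>p\<close> itself. This is what
  makes the Hoelder weights \<open>1 / R - 1 / P\<close> and \<open>1 / S - 1 / R\<close>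
  nonnegative, while the hypothesis on \<open>q\<close> lets convolution with a rapidly decaying
  function lift an \<open>L^q\<close> norm to an \<open>L^S\<close> norm. The exponents in
  \<open>alpha_tau\<close> are those of the endpoint \<open>p = top\<close>, \<open>q = 1\<close>;
  for finite \<open>p\<close> smaller ones come out and are enlarged using
  \<open>0 < \<tau> < 1\<close>. Schwartz estimates carry explicit constants, because the change of
  variables in the Wigner distribution and its inverse are bounded uniformly in
  \<open>\<tau>\<close>; singular powers arise only when one of two variables is frozen. The
  obstacle is that \<open>a\<close> and \<open>f\<close> are bare functionals. The inversion formula
  requires exchanging a tempered functional with a Schwartz-valued integral. Convergence of the
  pairing that defines \<open>op_tau\<close> follows from the norm estimate itself: a finite mixed
  norm of the majorant forces a finite value at one phase space point, and every test function is a
  time-frequency shift to that point.\<close>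

definition pd :: "'a \<Rightarrow> ('a::euclidean_space \<Rightarrow> complex) \<Rightarrow> 'a \<Rightarrow> complex"
  where "pd b f = (\<lambda>x. frechet_derivative f (at x) b)"

text \<open>Schwartz bounds with one explicit constant: \<open>C\<close> controls all iterated
  partial derivatives up to order \<open>n\<close> against the weight
  \<open>(1 + norm x) ^ k\<close>. The visible constant later gives estimates uniform in
  \<open>\<tau>\<close> and linear in the seminorms of the data. Derivatives of the top order
  \<open>n\<close> are required to be differentiable as well, so \<open>sbd_has_derivative\<close>
  applies at every level.\<close>

primrec sbd :: "nat \<Rightarrow> nat \<Rightarrow> real \<Rightarrow> ('a::euclidean_space \<Rightarrow> complex) \<Rightarrow> bool" where
  "sbd 0 k C f \<longleftrightarrow> f differentiable_on UNIV \<and> (\<forall>x. (1 + norm x) ^ k * cmod (f x) \<le> C)"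
| "sbd (Suc n) k C f \<longleftrightarrow> f differentiable_on UNIV \<and> (\<forall>x. (1 + norm x) ^ k * cmod (f x) \<le> C) \<and>
     (\<forall>b\<in>Basis. sbd n k C (pd b f))"

lemma sbd_diff: "sbd n k C f \<Longrightarrow> f differentiable_on UNIV"
  by (cases n) auto

lemma sbd_bound: "sbd n k C f \<Longrightarrow> (1 + norm x) ^ k * cmod (f x) \<le> C"
  by (cases n) auto

lemma sbd_nonneg: "sbd n k C f \<Longrightarrow> 0 \<le> C"
  using sbd_bound[of n k C f 0] by (meson norm_ge_zero order_trans mult_nonneg_nonneg zero_le_power add_nonneg_nonneg zero_le_one)

lemma sbd_has_derivative:
  assumes "sbd n k C f" shows "(f has_derivative (\<lambda>v. pd v f x)) (at x)"
  using sbd_diff[OF assms] unfolding pd_def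
  by (simp add: differentiable_on_def frechet_derivative_works[symmetric] eta_contract_eq)

lemma pd_eqI: "(f has_derivative f') (at x) \<Longrightarrow> pd b f x = f' b"
  using frechet_derivative_at[of f f' x] by (simp add: pd_def)

lemma differentiable_onI_UNIV:
  "(\<And>x. (f has_derivative F x) (at x)) \<Longrightarrow> f differentiable_on UNIV"
  by (auto simp: differentiable_on_def differentiable_def)

lemma pd_sum_Basis:
  assumes "f differentiable (at x)"
  shows "pd v f x = (\<Sum>b\<in>Basis. of_real (v \<bullet> b) * pd b f x)"
proof -
  have l: "linear (frechet_derivative f (at x))"
    by (rule linear_frechet_derivative[OF assms])
  have "pd v f x = frechet_derivative f (at x) (\<Sum>b\<in>Basis. (v \<bullet> b) *\<^sub>R b)"
    by (simp add: pd_def euclidean_representation)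
  also have "\<dots> = (\<Sum>b\<in>Basis. (v \<bullet> b) *\<^sub>R frechet_derivative f (at x) b)"
    by (simp only: linear_sum[OF l] linear_cmul[OF l])
  finally show ?thesis by (simp add: pd_def scaleR_conv_of_real)
qed

lemma sbd_mono:
  assumes "sbd n k C f" "m \<le> n" "j \<le> k" "C \<le> D" shows "sbd m j D f"
  using assms
proof (induction m arbitrary: n f)
  case 0
  have "(1 + norm x) ^ j * cmod (f x) \<le> D" for x
  proof -
    have "(1 + norm x) ^ j * cmod (f x) \<le> (1 + norm x) ^ k * cmod (f x)"
      using 0 by (intro mult_right_mono power_increasing) auto
    also have "\<dots> \<le> D" using sbd_bound[OF 0(1), of x] 0 by linarith
    finally show ?thesis .
  qed
  then show ?case using sbd_diff[OF 0(1)] by simp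
next
  case (Suc m)
  then obtain n' where n: "n = Suc n'" "m \<le> n'" by (cases n) auto
  have "(1 + norm x) ^ j * cmod (f x) \<le> D" for x
  proof -
    have "(1 + norm x) ^ j * cmod (f x) \<le> (1 + norm x) ^ k * cmod (f x)"
      using Suc by (intro mult_right_mono power_increasing) auto
    also have "\<dots> \<le> D" using sbd_bound[OF Suc(2), of x] Suc by linarith
    finally show ?thesis .
  qed
  moreover have "sbd m j D (pd b f)" if "b \<in> Basis" for b
    using Suc.IH[of n' "pd b f"] Suc.prems n that by auto
  ultimately show ?case using sbd_diff[OF Suc(2)] by simp
qed

lemma sbd_pd: "sbd (Suc n) k C f \<Longrightarrow> b \<in> Basis \<Longrightarrow> sbd n k C (pd b f)"
  by simp

lemma iter_deriv_snoc: "iter_deriv (bs @ [b]) f = iter_deriv bs (pd b f)"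
  by (induction bs) (auto simp: pd_def)

text \<open>The recursion of \<open>sbd\<close> peels off the derivative taken first, that of
  \<open>iter_deriv\<close> the one taken last; hence the decomposition of the list from its
  end.\<close>

lemma sbd_iff:
  "sbd n k C f \<longleftrightarrow> (\<forall>bs. set bs \<subseteq> Basis \<and> length bs \<le> n \<longrightarrow>
     iter_deriv bs f differentiable_on UNIV \<and> (\<forall>x. (1 + norm x) ^ k * cmod (iter_deriv bs f x) \<le> C))"
proof (induction n arbitrary: f)
  case 0 then show ?case by auto
next
  case (Suc n)
  show ?case
  proof (intro iffI allI impI)
    fix bs :: "'a list" assume s: "sbd (Suc n) k C f" and bs: "set bs \<subseteq> Basis \<and> length bs \<le> Suc n"
    show "iter_deriv bs f differentiable_on UNIV \<and> (\<forall>x. (1 + norm x) ^ k * cmod (iter_deriv bs f x) \<le> C)"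
    proof (cases bs rule: rev_cases)
      case Nil then show ?thesis using s by auto
    next
      case (snoc cs b)
      then show ?thesis using s bs Suc[of "pd b f"] unfolding snoc iter_deriv_snoc by auto
    qed
  next
    assume *: "\<forall>bs. set bs \<subseteq> Basis \<and> length bs \<le> Suc n \<longrightarrow>
     iter_deriv bs f differentiable_on UNIV \<and> (\<forall>x. (1 + norm x) ^ k * cmod (iter_deriv bs f x) \<le> C)"
    have "sbd n k C (pd b f)" if "b \<in> Basis" for b
      unfolding Suc
    proof (intro allI impI)
      fix bs :: "'a list" assume "set bs \<subseteq> Basis \<and> length bs \<le> n"
      then show "iter_deriv bs (pd b f) differentiable_on UNIV \<and>
          (\<forall>x. (1 + norm x) ^ k * cmod (iter_deriv bs (pd b f) x) \<le> C)"
        using *[rule_format, of "bs @ [b]"] that by (simp add: iter_deriv_snoc)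
    qed
    then show "sbd (Suc n) k C f"
      using *[rule_format, of "[]"] by simp
  qed
qed

lemma finite_lists_Basis: "finite {bs. set bs \<subseteq> (Basis::'a::euclidean_space set) \<and> length bs \<le> n}"
  by (rule finite_lists_length_le) simp

lemma schwartz_iff_sbd: "f \<in> schwartz \<longleftrightarrow> (\<forall>n k. \<exists>C. sbd n k C f)"
proof
  assume f: "f \<in> schwartz"
  show "\<forall>n k. \<exists>C. sbd n k C f"
  proof (intro allI)
    fix n k
    let ?L = "{bs. set bs \<subseteq> (Basis::'a set) \<and> length bs \<le> n}"
    have "\<forall>bs\<in>?L. \<exists>C. \<forall>x. (1 + norm x) ^ k * cmod (iter_deriv bs f x) \<le> C"
      using f unfolding schwartz_def by auto
    then obtain c where c: "\<And>bs x. bs \<in> ?L \<Longrightarrow> (1 + norm x) ^ k * cmod (iter_deriv bs f x) \<le> c bs"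
      by metis
    have c0: "bs \<in> ?L \<Longrightarrow> 0 \<le> c bs" for bs
      using c[of bs 0] by (simp) (meson norm_ge_zero order_trans)
    have "c bs \<le> sum c ?L" if "bs \<in> ?L" for bs
      by (rule member_le_sum[OF that _ finite_lists_Basis]) (use c0 in auto)
    then have "sbd n k (sum c ?L) f"
      unfolding sbd_iff using c f unfolding schwartz_def by (auto intro: order_trans)
    then show "\<exists>C. sbd n k C f" ..
  qed
next
  assume *: "\<forall>n k. \<exists>C. sbd n k C f"
  show "f \<in> schwartz"
    unfolding schwartz_def
  proof (safe)
    fix bs :: "'a list" assume bs: "set bs \<subseteq> Basis"
    show "iter_deriv bs f differentiable_on UNIV"
      using * bs unfolding sbd_iff by blast
    fix k
    obtain C where "sbd (length bs) k C f" using * by blast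
    then show "\<exists>C. \<forall>x. (1 + norm x) ^ k * cmod (iter_deriv bs f x) \<le> C"
      using bs unfolding sbd_iff by blast
  qed
qed

lemma schwartz_sbd: "f \<in> schwartz \<Longrightarrow> \<exists>C. sbd n k C f"
  by (simp add: schwartz_iff_sbd)

text \<open>With the converse \<open>sbd_schwartz_norm\<close>, the seminorm
  \<open>schwartz_norm N\<close> is, up to the number of lists of basis vectors, the best constant
  in \<open>sbd N N\<close>. This ties continuity of tempered functionals to
  \<open>sbd\<close>.\<close>

lemma schwartz_norm_le:
  assumes "sbd N N C f"
  shows "schwartz_norm N (f::'a::euclidean_space \<Rightarrow> complex)
    \<le> real (card {bs. set bs \<subseteq> (Basis::'a set) \<and> length bs \<le> N}) * C"
proof -
  have "(SUP x. (1 + norm x) ^ N * cmod (iter_deriv bs f x)) \<le> C"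
    if "set bs \<subseteq> Basis \<and> length bs \<le> N" for bs
    by (rule cSUP_least) (use assms that in \<open>auto simp: sbd_iff\<close>)
  then show ?thesis
    unfolding schwartz_norm_def by (intro sum_bounded_above) auto
qed

lemma sbd_schwartz_norm:
  assumes "f \<in> schwartz"
  shows "sbd N N (schwartz_norm N f) f"
  unfolding sbd_iff
proof (intro allI impI conjI)
  fix bs :: "'a list" assume bs: "set bs \<subseteq> Basis \<and> length bs \<le> N"
  show "iter_deriv bs f differentiable_on UNIV" using assms bs by (auto simp: schwartz_def)
  let ?S = "\<lambda>bs. SUP x. (1 + norm x) ^ N * cmod (iter_deriv bs f x)"
  have bdd: "bdd_above (range (\<lambda>x. (1 + norm x) ^ N * cmod (iter_deriv bs f x)))"
    if "set bs \<subseteq> Basis" for bs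
    using assms that unfolding schwartz_def bdd_above_def by auto
  have up: "(1 + norm x) ^ N * cmod (iter_deriv bs f x) \<le> ?S bs" if "set bs \<subseteq> Basis" for bs x
    by (rule cSUP_upper[OF _ bdd[OF that]]) simp
  have nn: "0 \<le> ?S bs" if "set bs \<subseteq> Basis" for bs
    using up[OF that, of 0] by simp (meson norm_ge_zero order_trans)
  fix x
  have "?S bs \<le> schwartz_norm N f"
    unfolding schwartz_norm_def
    by (rule member_le_sum[OF _ _ finite_lists_Basis]) (use bs nn in auto)
  then show "(1 + norm x) ^ N * cmod (iter_deriv bs f x) \<le> schwartz_norm N f"
    using up[of bs x] bs by auto
qed

section \<open>Stability of Schwartz bounds under algebraic operations and changes of
  variables\<close>

lemma sbd_add:
  assumes "sbd n k A f" "sbd n k B g"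
  shows "sbd n k (A + B) (\<lambda>x. f x + g x)"
  using assms
proof (induction n arbitrary: f g)
  case (Suc n)
  have "pd b (\<lambda>x. f x + g x) = (\<lambda>x. pd b f x + pd b g x)" for b
    by (rule ext, rule pd_eqI, rule has_derivative_add)
      (rule sbd_has_derivative[OF Suc(2)] sbd_has_derivative[OF Suc(3)])+
  moreover have "(1 + norm x) ^ k * cmod (f x + g x) \<le> A + B" for x
  proof -
    have "(1 + norm x) ^ k * cmod (f x + g x) \<le> (1 + norm x) ^ k * (cmod (f x) + cmod (g x))"
      by (intro mult_left_mono norm_triangle_ineq) auto
    also have "\<dots> \<le> A + B"
      using sbd_bound[OF Suc(2), of x] sbd_bound[OF Suc(3), of x] by (simp add: distrib_left)
    finally show ?thesis .
  qed
  ultimately show ?case using Suc by (auto intro!: differentiable_on_add simp: Suc)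
next
  case 0
  have "(1 + norm x) ^ k * cmod (f x + g x) \<le> A + B" for x
  proof -
    have "(1 + norm x) ^ k * cmod (f x + g x) \<le> (1 + norm x) ^ k * (cmod (f x) + cmod (g x))"
      by (intro mult_left_mono norm_triangle_ineq) auto
    also have "\<dots> \<le> A + B"
      using sbd_bound[OF 0(1), of x] sbd_bound[OF 0(2), of x] by (simp add: distrib_left)
    finally show ?thesis .
  qed
  then show ?case using 0 by (auto intro!: differentiable_on_add)
qed


lemma sbd_cnj:
  assumes "sbd n k A f"
  shows "sbd n k A (\<lambda>x. cnj (f x))"
  using assms
proof (induction n arbitrary: f)
  case 0
  have "(\<lambda>x. cnj (f x)) differentiable_on UNIV"
    by (rule differentiable_onI_UNIV, rule has_derivative_cnj, rule sbd_has_derivative[OF 0])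
  then show ?case using 0 by simp
next
  case (Suc n)
  have "pd b (\<lambda>x. cnj (f x)) = (\<lambda>x. cnj (pd b f x))" for b
    by (rule ext, rule pd_eqI, rule has_derivative_cnj) (rule sbd_has_derivative[OF Suc(2)])
  moreover have "(\<lambda>x. cnj (f x)) differentiable_on UNIV"
    by (rule differentiable_onI_UNIV, rule has_derivative_cnj, rule sbd_has_derivative[OF Suc(2)])
  ultimately show ?case using Suc by auto
qed

text \<open>Each use of the Leibniz rule doubles the number of terms, whence \<open>2 ^ n\<close>;
  the powers of decay add up.\<close>

lemma sbd_mult:
  assumes "sbd n k A f" "sbd n j B g"
  shows "sbd n (k + j) (2 ^ n * (A * B)) (\<lambda>x. f x * g x)"
proof -
  have bd: "(1 + norm x) ^ (k + j) * cmod (f x * g x) \<le> A * B"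
    if "sbd n k A f" "sbd n j B g" for f g :: "'a \<Rightarrow> complex" and x n
  proof -
    have "(1 + norm x) ^ (k + j) * cmod (f x * g x)
      = ((1 + norm x) ^ k * cmod (f x)) * ((1 + norm x) ^ j * cmod (g x))"
      by (simp add: power_add norm_mult)
    also have "\<dots> \<le> A * B"
      by (intro mult_mono sbd_bound[OF that(1)] sbd_bound[OF that(2)] sbd_nonneg[OF that(1)]) auto
    finally show ?thesis .
  qed
  show ?thesis using assms
  proof (induction n arbitrary: f g)
    case 0
    then show ?case using bd[OF 0] by (auto intro!: differentiable_on_mult)
  next
    case (Suc n)
    have AB: "0 \<le> A * B" using Suc.prems sbd_nonneg by (metis mult_nonneg_nonneg)
    have "pd b (\<lambda>x. f x * g x) = (\<lambda>x. f x * pd b g x + pd b f x * g x)" for b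
      by (rule ext, rule pd_eqI, rule has_derivative_mult)
        (rule sbd_has_derivative[OF Suc(2)] sbd_has_derivative[OF Suc(3)])+
    moreover have "sbd n (k + j) (2 ^ Suc n * (A * B)) (\<lambda>x. f x * pd b g x + pd b f x * g x)"
      if b: "b \<in> Basis" for b
    proof -
      have f: "sbd n k A f" and g: "sbd n j B g"
        using Suc.prems by (auto intro: sbd_mono[of "Suc n"])
      show ?thesis
        using sbd_add[OF Suc.IH[OF f sbd_pd[OF Suc(3) b]] Suc.IH[OF sbd_pd[OF Suc(2) b] g]]
        by (simp add: algebra_simps)
    qed
    moreover have "(1 + norm x) ^ (k + j) * cmod (f x * g x) \<le> 2 ^ Suc n * (A * B)" for x
      using bd[OF Suc(2,3), of x] mult_right_mono[OF one_le_power[of 2 "Suc n"] AB] by simp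
    ultimately show ?case using sbd_diff[OF Suc(2)] sbd_diff[OF Suc(3)]
      by (auto intro!: differentiable_on_mult)
  qed
qed

lemma sbd_cmult:
  assumes "sbd n k A f"
  shows "sbd n k (cmod c * A) (\<lambda>x. c * f x)"
  using assms
proof (induction n arbitrary: f)
  case 0
  then show ?case
    by (auto intro!: differentiable_on_mult simp: norm_mult mult.left_commute intro: mult_left_mono)
next
  case (Suc n)
  have "pd b (\<lambda>x. c * f x) = (\<lambda>x. c * pd b f x)" for b
    by (rule ext, rule pd_eqI, rule has_derivative_mult_right) (rule sbd_has_derivative[OF Suc(2)])
  then show ?case using Suc
    by (auto intro!: differentiable_on_mult simp: norm_mult mult.left_commute intro: mult_left_mono)
qed

lemma sbd_zero: "sbd n k 0 (\<lambda>x. 0)"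
proof (induction n)
  case (Suc n)
  have "pd b (\<lambda>x. 0) = (\<lambda>x. 0)" for b :: 'a
    by (rule ext, rule pd_eqI) simp
  then show ?case using Suc by simp
qed simp

lemma sbd_sum:
  assumes "finite I" "\<And>i. i \<in> I \<Longrightarrow> sbd n k (A i) (f i)"
  shows "sbd n k (sum A I) (\<lambda>x. \<Sum>i\<in>I. f i x)"
  using assms by (induction I) (auto simp: sbd_zero intro: sbd_add)

lemma sbd_diff_fun:
  assumes "sbd n k A f" "sbd n k B g"
  shows "sbd n k (A + B) (\<lambda>x. f x - g x)"
  using sbd_add[OF assms(1) sbd_cmult[OF assms(2), of "-1"]] by simp

text \<open>By the chain rule a derivative in direction \<open>b\<close> becomes one in direction
  \<open>L b\<close>; expanding it in the basis of the target gives \<open>DIM('b)\<close> terms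
  with coefficients at most \<open>K\<close>, once per order. The factor \<open>D ^ k\<close> pays
  for comparing the weight at \<open>x\<close> with that at \<open>c + L x\<close>.\<close>

lemma sbd_affine:
  fixes f :: "'b::euclidean_space \<Rightarrow> complex" and L :: "'a::euclidean_space \<Rightarrow> 'b" and K A D :: real
  assumes f: "sbd n k A f" and L: "linear L" and L': "\<And>b. b \<in> Basis \<Longrightarrow> norm (L b) \<le> K"
    and K: "\<And>x. 1 + norm x \<le> D * (1 + norm (c + L x))" and D: "1 \<le> D" and K1: "1 \<le> K"
  shows "sbd n k ((DIM('b) * K) ^ n * (D ^ k * A)) (\<lambda>x. f (c + L x))"
proof -
  have bd: "(1 + norm x) ^ k * cmod (f (c + L x)) \<le> D ^ k * A" if "sbd n k A f" for f n x
  proof -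
    have "(1 + norm x) ^ k * cmod (f (c + L x)) \<le> (D * (1 + norm (c + L x))) ^ k * cmod (f (c + L x))"
      by (intro mult_right_mono power_mono K) auto
    also have "\<dots> = D ^ k * ((1 + norm (c + L x)) ^ k * cmod (f (c + L x)))"
      by (simp add: power_mult_distrib)
    also have "\<dots> \<le> D ^ k * A"
      using D by (intro mult_left_mono sbd_bound[OF that]) auto
    finally show ?thesis .
  qed
  have hd: "((\<lambda>x. f (c + L x)) has_derivative (\<lambda>v. pd (L v) f (c + L x))) (at x)" if "sbd n k A f" for f n x
  proof -
    have 1: "((\<lambda>x. c + L x) has_derivative L) (at x)"
      using has_derivative_add[OF has_derivative_const[of c] linear_imp_has_derivative[OF L]] by simp
    have 2: "(f has_derivative (\<lambda>v. pd v f (c + L x))) (at (c + L x))"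
      by (rule sbd_has_derivative[OF that])
    show ?thesis using diff_chain_at[OF 1 2] by (simp add: o_def)
  qed
  have dk: "1 \<le> (DIM('b) * K)" using K1 DIM_positive[where 'a='b]
    by (metis One_nat_def Suc_leI mult_mono' mult_1 of_nat_1 of_nat_le_iff zero_le_one)
  show ?thesis using f
  proof (induction n arbitrary: f)
  case 0
  have "(\<lambda>x. f (c + L x)) differentiable_on UNIV"
    using hd[OF 0] by (auto simp: differentiable_on_def differentiable_def)
  then show ?case using bd[OF 0] by simp
  next
  case (Suc n)
  have df: "(\<lambda>x. f (c + L x)) differentiable_on UNIV"
    using hd[OF Suc(2)] by (auto simp: differentiable_on_def differentiable_def)
  have pos: "0 \<le> D ^ k * A" using sbd_nonneg[OF Suc(2)] D by simp
  have p: "pd b (\<lambda>x. f (c + L x)) = (\<lambda>x. \<Sum>b'\<in>Basis. of_real (L b \<bullet> b') * pd b' f (c + L x))" for b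
  proof
    fix x
    have "pd b (\<lambda>x. f (c + L x)) x = pd (L b) f (c + L x)"
      by (rule pd_eqI[OF hd[OF Suc(2)]])
    also have "\<dots> = (\<Sum>b'\<in>Basis. of_real (L b \<bullet> b') * pd b' f (c + L x))"
      by (rule pd_sum_Basis) (use sbd_diff[OF Suc(2)] in \<open>auto simp: differentiable_on_def\<close>)
    finally show "pd b (\<lambda>x. f (c + L x)) x = \<dots>" .
  qed
  have "sbd n k ((DIM('b) * K) ^ Suc n * (D ^ k * A)) (pd b (\<lambda>x. f (c + L x)))" if b: "b \<in> Basis" for b
  proof -
    have s: "sbd n k (\<Sum>b'\<in>(Basis::'b set). cmod (of_real (L b \<bullet> b')) * ((DIM('b) * K) ^ n * (D ^ k * A)))
        (pd b (\<lambda>x. f (c + L x)))"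
      unfolding p by (intro sbd_sum sbd_cmult Suc.IH sbd_pd[OF Suc(2)]) auto
    have "cmod (of_real (L b \<bullet> b')) \<le> K" if "b' \<in> Basis" for b'
      using Basis_le_norm[OF that, of "L b"] L'[OF b] by simp
    then have "(\<Sum>b'\<in>(Basis::'b set). cmod (of_real (L b \<bullet> b')) * ((DIM('b) * K) ^ n * (D ^ k * A)))
      \<le> (\<Sum>b'\<in>(Basis::'b set). K * ((DIM('b) * K) ^ n * (D ^ k * A)))"
      using dk pos by (intro sum_mono mult_right_mono) auto
    also have "\<dots> = (DIM('b) * K) ^ Suc n * (D ^ k * A)" by simp
    finally show ?thesis using sbd_mono[OF s] by blast
  qed
  moreover have "(1 + norm x) ^ k * cmod (f (c + L x)) \<le> (DIM('b) * K) ^ Suc n * (D ^ k * A)" for x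
    using bd[OF Suc(2), of x] mult_right_mono[OF one_le_power[OF dk, of "Suc n"] pos] by simp
  ultimately show ?case using df by simp
  qed
qed

lemma sbd_translate:
  assumes "sbd n k A f"
  shows "sbd n k (DIM('a) ^ n * ((1 + norm c) ^ k * A)) (\<lambda>x. f (x - c :: 'a::euclidean_space))"
proof -
  have "sbd n k ((real DIM('a) * 1) ^ n * ((1 + norm c) ^ k * A)) (\<lambda>x. f (- c + x))"
  proof (rule sbd_affine[OF assms linear_id[unfolded id_def]])
    fix x :: 'a
    have "1 + norm x \<le> 1 + norm c + norm (- c + x)"
      using norm_triangle_ineq[of c "- c + x"] by simp
    also have "\<dots> \<le> (1 + norm c) * (1 + norm (- c + x))" by (simp add: algebra_simps)
    finally show "1 + norm x \<le> (1 + norm c) * (1 + norm (- c + x))" .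
  qed auto
  then show ?thesis by simp
qed

lemma sbd_linear:
  fixes f :: "'b::euclidean_space \<Rightarrow> complex" and L :: "'a::euclidean_space \<Rightarrow> 'b" and K A :: real
  assumes f: "sbd n k A f" and L: "linear L" and L': "\<And>x. norm (L x) \<le> K * norm x"
    and K: "\<And>x. norm x \<le> K * norm (L x)" and K1: "1 \<le> K"
  shows "sbd n k ((DIM('b) * K) ^ n * (K ^ k * A)) (\<lambda>x. f (L x))"
proof -
  have "sbd n k ((DIM('b) * K) ^ n * (K ^ k * A)) (\<lambda>x. f (0 + L x))"
  proof (rule sbd_affine[OF f L])
    show "norm (L b) \<le> K" if "b \<in> Basis" for b using L'[of b] that by simp
    show "1 + norm x \<le> K * (1 + norm (0 + L x))" for x
      using K[of x] K1 by (simp add: distrib_left)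
  qed (use K1 in auto)
  then show ?thesis by simp
qed

text \<open>An instance of \<open>sbd_affine\<close> for an embedding. As \<open>norm (u, y)\<close>
  dominates \<open>norm y\<close>, the constant is the same for all \<open>u\<close>; this
  uniformity later justifies an exchange of integrals.\<close>

lemma sbd_slice:
  fixes f :: "'a::euclidean_space \<times> 'b::euclidean_space \<Rightarrow> complex"
  assumes "sbd n k A f"
  shows "sbd n k (real (DIM('a) + DIM('b)) ^ n * A) (\<lambda>y. f (u, y))"
proof -
  have l: "linear (\<lambda>y::'b. (0::'a, y))" by (auto intro!: linearI)
  have "sbd n k ((real DIM('a\<times>'b) * 1) ^ n * (1 ^ k * A)) (\<lambda>y. f ((u, 0) + (0, y)))"
  proof (rule sbd_affine[OF assms l])
    show "1 + norm x \<le> 1 * (1 + norm ((u, 0) + (0, x)))" for x :: 'b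
      using norm_snd_le[of x u] by simp
  qed auto
  then show ?thesis by simp
qed

text \<open>A basis vector of the product space lies in one of the factors, so every partial
  derivative falls on a single factor and no binomial constant appears.\<close>

lemma sbd_tensor:
  fixes f :: "'a::euclidean_space \<Rightarrow> complex" and g :: "'b::euclidean_space \<Rightarrow> complex"
  assumes "sbd n k A f" "sbd n k B g"
  shows "sbd n k (A * B) (\<lambda>w. f (fst w) * g (snd w))"
proof -
  have bd: "(1 + norm w) ^ k * cmod (f (fst w) * g (snd w)) \<le> A * B" if "sbd n k A f" "sbd n k B g" 
    for f :: "'a \<Rightarrow> complex" and g :: "'b \<Rightarrow> complex" and n w
  proof -
    have "1 + norm w \<le> 1 + norm (fst w) + norm (snd w)"
      using norm_Pair_le[of "fst w" "snd w"] by simp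
    also have "\<dots> \<le> (1 + norm (fst w)) * (1 + norm (snd w))" by (simp add: algebra_simps)
    finally have "(1 + norm w) ^ k \<le> (1 + norm (fst w)) ^ k * (1 + norm (snd w)) ^ k"
      by (metis power_mono power_mult_distrib add_nonneg_nonneg norm_ge_zero zero_le_one)
    then have "(1 + norm w) ^ k * cmod (f (fst w) * g (snd w)) \<le> ((1 + norm (fst w)) ^ k * (1 + norm (snd w)) ^ k) * cmod (f (fst w) * g (snd w))"
      by (rule mult_right_mono) simp
    also have "\<dots> = ((1 + norm (fst w)) ^ k * cmod (f (fst w))) * ((1 + norm (snd w)) ^ k * cmod (g (snd w)))"
      by (simp add: norm_mult)
    also have "\<dots> \<le> A * B"
      by (intro mult_mono sbd_bound[OF that(1)] sbd_bound[OF that(2)] sbd_nonneg[OF that(1)]) auto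
    finally show ?thesis .
  qed
  have hd: "((\<lambda>w. f (fst w) * g (snd w)) has_derivative 
     (\<lambda>v. f (fst w) * pd (snd v) g (snd w) + pd (fst v) f (fst w) * g (snd w))) (at w)"
    if "sbd n k A f" "sbd n k B g" 
    for f :: "'a \<Rightarrow> complex" and g :: "'b \<Rightarrow> complex" and n w
  proof -
    have 1: "((\<lambda>w::'a\<times>'b. f (fst w)) has_derivative (\<lambda>v. pd (fst v) f (fst w))) (at w)"
      using diff_chain_at[OF has_derivative_fst[OF has_derivative_ident] sbd_has_derivative[OF that(1)], of w]
      by (simp add: o_def)
    have 2: "((\<lambda>w::'a\<times>'b. g (snd w)) has_derivative (\<lambda>v. pd (snd v) g (snd w))) (at w)"
      using diff_chain_at[OF has_derivative_snd[OF has_derivative_ident] sbd_has_derivative[OF that(2)], of w]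
      by (simp add: o_def)
    show ?thesis by (rule has_derivative_mult[OF 1 2])
  qed
  show ?thesis using assms
  proof (induction n arbitrary: f g)
  case 0
  then show ?case using bd[OF 0] differentiable_onI_UNIV[OF hd[OF 0]] by simp
  next
  case (Suc n)
  have z: "pd 0 f x = 0" if "sbd n k A f" for f :: "'c::euclidean_space \<Rightarrow> complex" and x A n
    using linear_0[OF has_derivative_linear[OF sbd_has_derivative[OF that]]] .
  have "sbd n k (A * B) (pd b (\<lambda>w. f (fst w) * g (snd w)))" if "b \<in> Basis" for b
  proof -
    have e: "pd b (\<lambda>w. f (fst w) * g (snd w)) = (\<lambda>w. f (fst w) * pd (snd b) g (snd w) + pd (fst b) f (fst w) * g (snd w))"
      by (rule ext, rule pd_eqI[OF hd[OF Suc(2,3)]])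
    have f: "sbd n k A f" and g: "sbd n k B g"
      using Suc.prems by (auto intro: sbd_mono[of "Suc n"])
    from that consider i where "i \<in> Basis" "b = (i, 0)" | j where "j \<in> Basis" "b = (0, j)"
      by (auto simp: Basis_prod_def)
    then show ?thesis
    proof cases
      case 1
      then show ?thesis unfolding e using Suc.IH[OF sbd_pd[OF Suc(2)] g, of i] z[OF Suc(3)] by simp
    next
      case 2
      then show ?thesis unfolding e using Suc.IH[OF f sbd_pd[OF Suc(3)], of j] z[OF Suc(2)] by simp
    qed
  qed
  then show ?case using bd[OF Suc(2,3)] differentiable_onI_UNIV[OF hd[OF Suc(2,3)]] by simp
  qed
qed

text \<open>Differentiating the exponential costs at most \<open>2 * pi * norm \<xi>\<close> per
  order, so the seminorms grow polynomially in the frequency.\<close>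

lemma sbd_modulation:
  assumes "sbd n k A f"
  shows "sbd n k ((1 + 2 * pi * norm \<xi>) ^ n * A) (modulation \<xi> f)"
proof -
  have hd: "(modulation \<xi> f has_derivative (\<lambda>v. cis (2 * pi * (\<xi> \<bullet> x)) * pd v f x + (\<i> * of_real (2 * pi * (\<xi> \<bullet> v)) * cis (2 * pi * (\<xi> \<bullet> x))) * f x)) (at x)"
    if "sbd n k A f" for f n x
  proof -
    have 1: "((\<lambda>t. cis (2 * pi * (\<xi> \<bullet> t))) has_derivative (\<lambda>v. \<i> * of_real (2 * pi * (\<xi> \<bullet> v)) * cis (2 * pi * (\<xi> \<bullet> x)))) (at x)"
    proof -
      have a: "((\<lambda>t. 2 * pi * (\<xi> \<bullet> t)) has_derivative (\<lambda>v. 2 * pi * (\<xi> \<bullet> v))) (at x)"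
        by (auto intro!: derivative_eq_intros)
      show ?thesis using has_derivative_cis[OF a] by (simp add: scaleR_conv_of_real mult_ac)
    qed
    show ?thesis unfolding modulation_def
      using has_derivative_mult[OF 1 sbd_has_derivative[OF that]] by simp
  qed
  show ?thesis using assms
  proof (induction n arbitrary: f)
  case 0
  then show ?case using differentiable_onI_UNIV[OF hd[OF 0]] by (simp add: modulation_def norm_mult)
  next
  case (Suc n)
  let ?K = "1 + 2 * pi * norm \<xi>"
  have A: "0 \<le> A" by (rule sbd_nonneg[OF Suc(2)])
  have "sbd n k (?K ^ Suc n * A) (pd b (modulation \<xi> f))" if b: "b \<in> Basis" for b
  proof -
    have e: "pd b (modulation \<xi> f) = (\<lambda>x. modulation \<xi> (pd b f) x + (\<i> * of_real (2 * pi * (\<xi> \<bullet> b))) * modulation \<xi> f x)"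
      by (rule ext, subst pd_eqI[OF hd[OF Suc(2)]]) (simp add: modulation_def)
    have f: "sbd n k A f" using Suc.prems by (auto intro: sbd_mono[of "Suc n"])
    have "sbd n k (?K ^ n * A + cmod (\<i> * of_real (2 * pi * (\<xi> \<bullet> b))) * (?K ^ n * A)) (pd b (modulation \<xi> f))"
      unfolding e by (intro sbd_add sbd_cmult Suc.IH f sbd_pd[OF Suc(2) b])
    moreover have "?K ^ n * A + cmod (\<i> * of_real (2 * pi * (\<xi> \<bullet> b))) * (?K ^ n * A) \<le> ?K ^ Suc n * A"
    proof -
      have "cmod (\<i> * of_real (2 * pi * (\<xi> \<bullet> b))) \<le> 2 * pi * norm \<xi>"
        using Basis_le_norm[OF b, of \<xi>] by (simp add: norm_mult abs_mult)
      then have "cmod (\<i> * of_real (2 * pi * (\<xi> \<bullet> b))) * (?K ^ n * A) \<le> 2 * pi * norm \<xi> * (?K ^ n * A)"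
        using A by (intro mult_right_mono) auto
      then show ?thesis by (simp add: algebra_simps)
    qed
    ultimately show ?thesis using sbd_mono by blast
  qed
  moreover have "(1 + norm x) ^ k * cmod (modulation \<xi> f x) \<le> ?K ^ Suc n * A" for x
  proof -
    have "(1 + norm x) ^ k * cmod (modulation \<xi> f x) \<le> A" 
      using sbd_bound[OF Suc(2), of x] by (simp add: modulation_def norm_mult)
    also have "\<dots> \<le> ?K ^ Suc n * A" 
      using A mult_right_mono[OF one_le_power[of ?K "Suc n"], of A] by simp
    finally show ?thesis .
  qed
  ultimately show ?case using differentiable_onI_UNIV[OF hd[OF Suc(2)]] by simp
  qed
qed

text \<open>A linear factor spends one power of decay. Its derivative is constant, so each order
  contributes one further term and the constant grows linearly in \<open>n\<close>.\<close>

lemma sbd_inner_mult: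
  assumes "sbd n (Suc k) A f"
  shows "sbd n k (real (Suc n) * (norm v * A)) (\<lambda>x. of_real (x \<bullet> v) * f x)"
proof -
  have bd: "(1 + norm x) ^ k * cmod (of_real (x \<bullet> v) * f x) \<le> norm v * A" if "sbd n (Suc k) A f" for f n x
  proof -
    have "(1 + norm x) ^ k * cmod (of_real (x \<bullet> v) * f x) \<le> (1 + norm x) ^ k * ((norm x * norm v) * cmod (f x))"
      by (auto simp: norm_mult intro!: mult_left_mono mult_right_mono Cauchy_Schwarz_ineq2)
    also have "\<dots> \<le> (1 + norm x) ^ k * (((1 + norm x) * norm v) * cmod (f x))"
      by (intro mult_left_mono mult_right_mono) auto
    also have "\<dots> = norm v * ((1 + norm x) ^ Suc k * cmod (f x))" by simp
    also have "\<dots> \<le> norm v * A" by (intro mult_left_mono sbd_bound[OF that]) auto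
    finally show ?thesis .
  qed
  have hd: "((\<lambda>x. of_real (x \<bullet> v) * f x) has_derivative (\<lambda>w. of_real (x \<bullet> v) * pd w f x + of_real (w \<bullet> v) * f x)) (at x)"
    if "sbd n (Suc k) A f" for f n x
  proof -
    have "((\<lambda>x. complex_of_real (x \<bullet> v)) has_derivative (\<lambda>w. complex_of_real (w \<bullet> v))) (at x)"
      by (auto intro!: derivative_eq_intros)
    from has_derivative_mult[OF this sbd_has_derivative[OF that]] show ?thesis .
  qed
  show ?thesis using assms
  proof (induction n arbitrary: f)
  case 0
  then show ?case using differentiable_onI_UNIV[OF hd[OF 0]] bd[OF 0] by simp
  next
  case (Suc n)
  have A: "0 \<le> norm v * A" using sbd_nonneg[OF Suc(2)] by simp
  have "sbd n k (real (Suc (Suc n)) * (norm v * A)) (pd b (\<lambda>x. of_real (x \<bullet> v) * f x))" if b: "b \<in> Basis" for b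
  proof -
    have e: "pd b (\<lambda>x. of_real (x \<bullet> v) * f x) = (\<lambda>x. of_real (x \<bullet> v) * pd b f x + of_real (b \<bullet> v) * f x)"
      by (rule ext, rule pd_eqI[OF hd[OF Suc(2)]])
    have f: "sbd n k A f" using Suc.prems by (auto elim!: sbd_mono simp del: sbd.simps)
    have "sbd n k (real (Suc n) * (norm v * A) + cmod (of_real (b \<bullet> v)) * A) (pd b (\<lambda>x. of_real (x \<bullet> v) * f x))"
      unfolding e by (intro sbd_add sbd_cmult Suc.IH f sbd_pd[OF Suc(2) b])
    moreover have "cmod (of_real (b \<bullet> v)) * A \<le> norm v * A"
      using Basis_le_norm[OF b, of v] sbd_nonneg[OF Suc(2)] by (intro mult_right_mono) (auto simp: inner_commute)
    ultimately show ?thesis by (auto elim!: sbd_mono simp: algebra_simps)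
  qed
  moreover have "(1 + norm x) ^ k * cmod (of_real (x \<bullet> v) * f x) \<le> real (Suc (Suc n)) * (norm v * A)" for x
    using bd[OF Suc(2), of x] mult_right_mono[of 1 "real (Suc (Suc n))", OF _ A] by simp
  ultimately show ?case using differentiable_onI_UNIV[OF hd[OF Suc(2)]] by simp
  qed
qed

section \<open>Integration of Schwartz functions\<close>

definition dec :: "nat \<Rightarrow> 'a::real_normed_vector \<Rightarrow> real"
  where "dec k x = inverse ((1 + norm x) ^ k)"

lemma dec_pos [simp]: "0 < dec k x" and dec_nonneg [simp]: "0 \<le> dec k x" and dec_le_1: "dec k x \<le> 1"
proof -
  have "1 \<le> (1 + norm x) ^ k" by (rule one_le_power) simp
  then show "0 < dec k x" "0 \<le> dec k x" "dec k x \<le> 1"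
    by (auto simp: dec_def inverse_le_1_iff zero_less_power add_pos_nonneg)
qed

lemma dec_antimono: "j \<le> k \<Longrightarrow> dec k x \<le> dec j x"
  unfolding dec_def by (intro le_imp_inverse_le power_increasing zero_less_power) (auto intro: add_pos_nonneg)

lemma dec_add: "dec (j + k) x = dec j x * dec k x"
  by (simp add: dec_def power_add)

lemma le_dec_iff: "a \<le> A * dec k x \<longleftrightarrow> (1 + norm x) ^ k * a \<le> A"
  unfolding dec_def by (simp add: divide_inverse[symmetric] pos_le_divide_eq zero_less_power add_pos_nonneg mult.commute)

lemma sbd_dec: "sbd n k A f \<Longrightarrow> cmod (f x) \<le> A * dec k x"
  by (simp add: le_dec_iff sbd_bound)

lemma dec_peetre: "dec k x \<le> (1 + norm y) ^ k * dec k (x + y)"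
proof -
  have "1 + norm (x + y) \<le> 1 + norm x + norm y" using norm_triangle_ineq[of x y] by simp
  also have "\<dots> \<le> (1 + norm x) * (1 + norm y)" by (simp add: algebra_simps)
  finally have "(1 + norm (x + y)) ^ k \<le> (1 + norm x) ^ k * (1 + norm y) ^ k"
    by (metis power_mono power_mult_distrib add_nonneg_nonneg norm_ge_zero zero_le_one)
  then have "(1 + norm (x + y)) ^ k * dec k x \<le> ((1 + norm x) ^ k * (1 + norm y) ^ k) * dec k x"
    by (rule mult_right_mono) simp
  also have "\<dots> = (1 + norm y) ^ k"
    using zero_less_power[of "1 + norm x" k] norm_ge_zero[of x]
    by (simp add: dec_def del: norm_ge_zero zero_less_power)
  finally show ?thesis by (simp add: le_dec_iff)
qed

lemma continuous_dec: "continuous_on UNIV (dec k)"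
  unfolding dec_def
  by (intro continuous_intros) (metis power_not_zero add_nonneg_eq_0_iff norm_ge_zero zero_le_one zero_neq_one)

lemma borel_measurable_dec [measurable]: "(dec k :: 'a::euclidean_space \<Rightarrow> real) \<in> borel_measurable borel"
  by (rule borel_measurable_continuous_onI[OF continuous_dec])

text \<open>Each factor \<open>1 + (x \<bullet> b)\<^sup>2\<close> is at most
  \<open>(1 + norm x) ^ 2\<close>, so \<open>2 * DIM('a)\<close> powers of the weight dominate the
  product of one-dimensional functions \<open>1 + s\<^sup>2\<close>, and the integral of the inverse
  product factorizes.\<close>

lemma integrable_dec:
  assumes "2 * DIM('a) \<le> k"
  shows "integrable lborel (dec k :: 'a::euclidean_space \<Rightarrow> real)"
proof -
  let ?h = "\<lambda>x::real. inverse (1 + x\<^sup>2)"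
  have i: "integrable lborel ?h"
    using integrable_inverse_1_plus_square by (simp add: set_integrable_def)
  have fin: "(\<integral>\<^sup>+x. ennreal (?h x) \<partial>lborel) < \<infinity>"
    using nn_integral_eq_integral[OF i] by (simp add: less_top[symmetric])
  have le: "dec k x \<le> (\<Prod>b\<in>Basis. ?h (x \<bullet> b))" for x :: 'a
  proof -
    have "(\<Prod>b\<in>(Basis::'a set). 1 + (x \<bullet> b)\<^sup>2) \<le> (\<Prod>b\<in>(Basis::'a set). (1 + norm x) ^ 2)"
    proof (intro prod_mono conjI)
      fix b :: 'a assume b: "b \<in> Basis"
      have "(x \<bullet> b)\<^sup>2 \<le> (norm x)\<^sup>2"
        using Basis_le_norm[OF b, of x] by (metis abs_ge_zero power2_abs power_mono)
      then show "1 + (x \<bullet> b)\<^sup>2 \<le> (1 + norm x)\<^sup>2" by (simp add: power2_eq_square algebra_simps) (use norm_ge_zero[of x] in linarith)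
    qed simp
    also have "\<dots> = (1 + norm x) ^ (2 * DIM('a))" by (simp add: power_mult)
    also have "\<dots> \<le> (1 + norm x) ^ k" using assms by (intro power_increasing) auto
    finally have "inverse ((1 + norm x) ^ k) \<le> inverse (\<Prod>b\<in>(Basis::'a set). 1 + (x \<bullet> b)\<^sup>2)"
      by (rule le_imp_inverse_le) (auto intro!: prod_pos add_pos_nonneg)
    then show ?thesis unfolding dec_def by (simp only: prod_inversef[symmetric] o_def)
  qed
  have "(\<integral>\<^sup>+x. ennreal (norm (dec k x)) \<partial>(lborel::'a measure))
     \<le> (\<integral>\<^sup>+x. (\<Prod>b\<in>Basis. ennreal (?h (x \<bullet> b))) \<partial>(lborel::'a measure))"
    using le by (intro nn_integral_mono) (simp add: prod_ennreal ennreal_leI)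
  also have "\<dots> = (\<Prod>b\<in>(Basis::'a set). (\<integral>\<^sup>+x. ennreal (?h x) \<partial>lborel))"
    by (rule nn_integral_lborel_prod) auto
  also have "\<dots> < \<infinity>" using fin by (simp add: power_less_top_ennreal)
  finally show ?thesis by (intro integrableI_bounded) auto
qed

lemma sbd_continuous: "sbd n k A f \<Longrightarrow> continuous_on UNIV f"
  by (intro differentiable_imp_continuous_on sbd_diff)

lemma sbd_measurable: "sbd n k A f \<Longrightarrow> f \<in> borel_measurable borel"
  by (intro borel_measurable_continuous_onI sbd_continuous)

lemma sbd_integrable:
  fixes f :: "'a::euclidean_space \<Rightarrow> complex"
  assumes "sbd n k A f" "2 * DIM('a) \<le> k" shows "integrable lborel f"
proof (rule Bochner_Integration.integrable_bound)
  show "integrable lborel (\<lambda>x::'a. A * dec k x)" using integrable_dec[OF assms(2)] by simp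
  show "f \<in> borel_measurable lborel" using sbd_measurable[OF assms(1)] by simp
  show "AE x in lborel. norm (f x) \<le> norm (A * dec k x)"
    by (rule AE_I2, rule order_trans[OF sbd_dec[OF assms(1)]]) simp
qed

section \<open>Difference quotients; continuity of translations and modulations in Schwartz
  bounds\<close>

lemma differentiable_has_derivative_pd:
  "f differentiable (at x) \<Longrightarrow> (f has_derivative (\<lambda>v. pd v f x)) (at x)"
  unfolding pd_def by (simp add: frechet_derivative_works[symmetric])

text \<open>Presents a derivative as the limit of a sequence, which gives its measurability in
  parameters and opens the way to dominated convergence.\<close>

lemma difference_quotient_pd:
  fixes f :: "'a::euclidean_space \<Rightarrow> complex"
  assumes "f differentiable (at x)"
  shows "(\<lambda>n. real (Suc n) *\<^sub>R (f (x + (1 / real (Suc n)) *\<^sub>R v) - f x)) \<longlonglongrightarrow> pd v f x"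
proof -
  let ?t = "\<lambda>n. 1 / real (Suc n)"
  note hd = differentiable_has_derivative_pd[OF assms]
  have "((\<lambda>t. x + t *\<^sub>R v) has_derivative (\<lambda>t. t *\<^sub>R v)) (at 0)" by (auto intro!: derivative_eq_intros)
  from diff_chain_at[OF this, of f "\<lambda>v. pd v f x"] hd
  have "((\<lambda>t. f (x + t *\<^sub>R v)) has_derivative (\<lambda>t. t *\<^sub>R pd v f x)) (at 0)"
    using linear_simps(5)[OF has_derivative_bounded_linear[OF hd]] by (simp add: o_def)
  then have "(\<lambda>t. norm (f (x + t *\<^sub>R v) - f x - t *\<^sub>R pd v f x) / norm t) \<midarrow>0\<rightarrow> 0"
    unfolding has_derivative_at by simp
  moreover have "filterlim ?t (at 0) sequentially"
    unfolding filterlim_at using LIMSEQ_Suc[OF lim_1_over_n] by (intro conjI always_eventually allI) auto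
  ultimately have "(\<lambda>n. norm (f (x + ?t n *\<^sub>R v) - f x - ?t n *\<^sub>R pd v f x) / norm (?t n)) \<longlonglongrightarrow> 0"
    by (rule filterlim_compose)
  moreover have "norm (f (x + ?t n *\<^sub>R v) - f x - ?t n *\<^sub>R pd v f x) / norm (?t n)
    = norm (real (Suc n) *\<^sub>R (f (x + ?t n *\<^sub>R v) - f x) - pd v f x)" for n
  proof -
    have "real (Suc n) *\<^sub>R (f (x + ?t n *\<^sub>R v) - f x) - pd v f x
      = real (Suc n) *\<^sub>R (f (x + ?t n *\<^sub>R v) - f x - ?t n *\<^sub>R pd v f x)"
      by (simp add: scaleR_diff_right)
    then show ?thesis by (simp add: mult.commute)
  qed
  ultimately have "(\<lambda>n. norm (real (Suc n) *\<^sub>R (f (x + ?t n *\<^sub>R v) - f x) - pd v f x)) \<longlonglongrightarrow> 0"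
    by (simp only:)
  then show ?thesis
    by (rule LIM_zero_cancel[OF tendsto_norm_zero_cancel])
qed

lemma onorm_pd_le:
  fixes B :: real
  assumes "f differentiable (at y)" "\<And>b. b \<in> Basis \<Longrightarrow> cmod (pd b f y) \<le> B"
  shows "cmod (pd v f (y::'a::euclidean_space)) \<le> DIM('a) * B * norm v"
proof -
  have "cmod (pd v f y) \<le> (\<Sum>b\<in>Basis. cmod (of_real (v \<bullet> b) * pd b f y))"
    by (subst pd_sum_Basis[OF assms(1)]) (rule norm_sum)
  also have "\<dots> \<le> (\<Sum>b\<in>(Basis::'a set). norm v * B)"
  proof (rule sum_mono)
    fix b :: 'a assume b: "b \<in> Basis"
    have "\<bar>v \<bullet> b\<bar> * cmod (pd b f y) \<le> norm v * B"
      by (rule mult_mono[OF Basis_le_norm[OF b] assms(2)[OF b]]) auto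
    then show "cmod (of_real (v \<bullet> b) * pd b f y) \<le> norm v * B" by (simp add: norm_mult)
  qed
  finally show ?thesis by (simp add: mult_ac)
qed

lemma lipschitz_pd:
  fixes f :: "'a::euclidean_space \<Rightarrow> complex" and B :: real
  assumes S: "convex S" "x \<in> S" "y \<in> S"
    and d: "\<And>z. f differentiable (at z)"
    and B: "\<And>b z. b \<in> Basis \<Longrightarrow> z \<in> S \<Longrightarrow> cmod (pd b f z) \<le> B"
  shows "cmod (f x - f y) \<le> DIM('a) * B * norm (x - y)"
proof (rule differentiable_bound[OF S(1) _ _ S(2,3)])
  show "(f has_derivative (\<lambda>v. pd v f z)) (at z within S)" for z
    by (rule has_derivative_at_withinI[OF differentiable_has_derivative_pd[OF d]])
  have "0 \<le> B" using B[OF SOME_Basis S(2)] norm_ge_zero order_trans by blast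
  then show "onorm (\<lambda>v. pd v f z) \<le> DIM('a) * B" if "z \<in> S" for z
    by (intro onorm_le onorm_pd_le d B that)
qed

text \<open>Mean value inequality on the segment from \<open>x - h\<close> to \<open>x\<close>.
  Since \<open>norm h \<le> 1\<close>, the weight changes by at most \<open>2 ^ k\<close> along it,
  so the decay is kept while a factor \<open>norm h\<close> is gained.\<close>

lemma sbd_lipschitz:
  fixes f :: "'a::euclidean_space \<Rightarrow> complex"
  assumes f: "sbd (Suc n) k A f" and h: "norm h \<le> 1"
  shows "(1 + norm x) ^ k * cmod (f (x - h) - f x) \<le> 2 ^ k * (DIM('a) * (norm h * A))"
proof -
  let ?B = "2 ^ k * A * dec k x"
  have "cmod (pd b f z) \<le> ?B" if b: "b \<in> Basis" and z: "z \<in> closed_segment (x - h) x" for b z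
  proof -
    have "norm (z - x) \<le> 1"
      using segment_bound(2)[OF z] h by (simp add: norm_minus_commute)
    then have "(1 + norm (z - x)) ^ k \<le> 2 ^ k" by (intro power_mono) auto
    then have "dec k z \<le> 2 ^ k * dec k x"
      using dec_peetre[of k z "x - z"] mult_right_mono[OF \<open>(1 + norm (z - x)) ^ k \<le> 2 ^ k\<close> dec_nonneg[of k x]]
      by (simp only: norm_minus_commute[of x z] add_diff_cancel_left' add_diff_eq)
    then have "A * dec k z \<le> A * (2 ^ k * dec k x)"
      by (rule mult_left_mono[OF _ sbd_nonneg[OF f]])
    then show ?thesis using sbd_dec[OF sbd_pd[OF f b], of z] by (simp add: mult_ac)
  qed
  then have "cmod (f (x - h) - f x) \<le> DIM('a) * ?B * norm ((x - h) - x)"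
    using sbd_diff[OF f] by (intro lipschitz_pd[of "closed_segment (x - h) x"]) (auto simp: differentiable_on_def)
  also have "\<dots> = (2 ^ k * (DIM('a) * (norm h * A))) * dec k x" by simp
  finally show ?thesis by (simp only: le_dec_iff)
qed

lemma pd_translate:
  assumes "f differentiable (at (x - h))"
  shows "pd b (\<lambda>x. f (x - h)) x = pd b f (x - h)"
proof (rule pd_eqI)
  have 1: "((\<lambda>x. x - h) has_derivative (\<lambda>v. v)) (at x)" by (auto intro!: derivative_eq_intros)
  have 2: "(f has_derivative (\<lambda>v. pd v f (x - h))) (at (x - h))"
    by (rule differentiable_has_derivative_pd[OF assms])
  show "((\<lambda>x. f (x - h)) has_derivative (\<lambda>v. pd v f (x - h))) (at x)"
    using diff_chain_at[OF 1 2] by (simp add: o_def)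
qed

lemma sbd_translate_diff:
  fixes f :: "'a::euclidean_space \<Rightarrow> complex"
  assumes "sbd (Suc n) k A f" and h: "norm h \<le> 1"
  shows "sbd n k (2 ^ k * (DIM('a) * (norm h * A))) (\<lambda>x. f (x - h) - f x)"
  using assms(1)
proof (induction n arbitrary: f)
  case 0
  have "(\<lambda>x. f (x - h) - f x) differentiable_on UNIV"
    by (intro differentiable_on_diff sbd_diff[OF 0] sbd_diff[OF sbd_translate[OF 0]])
  then show ?case using sbd_lipschitz[OF 0 h] by simp
next
  case (Suc n)
  have d: "f differentiable at x" for x using sbd_diff[OF Suc(2)] by (simp add: differentiable_on_def)
  have "(\<lambda>x. f (x - h) - f x) differentiable_on UNIV"
    by (intro differentiable_on_diff sbd_diff[OF Suc(2)] sbd_diff[OF sbd_translate[OF Suc(2)]])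
  moreover have "pd b (\<lambda>x. f (x - h) - f x) = (\<lambda>x. pd b f (x - h) - pd b f x)" for b
  proof
    fix x
    have "pd b (\<lambda>x. f (x - h) - f x) x = pd b (\<lambda>x. f (x - h)) x - pd b f x"
      by (rule pd_eqI, rule has_derivative_diff)
         (rule sbd_has_derivative[OF sbd_translate[OF Suc(2)]] sbd_has_derivative[OF Suc(2)])+
    then show "pd b (\<lambda>x. f (x - h) - f x) x = pd b f (x - h) - pd b f x"
      by (simp add: pd_translate[OF d])
  qed
  ultimately show ?case using sbd_lipschitz[OF Suc(2) h] Suc.IH[OF sbd_pd[OF Suc(2)]]
    by (auto simp del: sbd.simps simp: sbd.simps(2)[of n])
qed

lemma cmod_cis_minus_1: "cmod (cis t - 1) \<le> \<bar>t\<bar>"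
proof -
  have "norm (cis t - cis 0) \<le> 1 * norm (t - 0)"
  proof (rule differentiable_bound[of UNIV])
    show "(cis has_derivative (\<lambda>v. v *\<^sub>R (\<i> * cis x))) (at x within UNIV)" for x
      by (rule has_derivative_cis) (rule has_derivative_ident)
    show "onorm (\<lambda>v. v *\<^sub>R (\<i> * cis x)) \<le> 1" for x
      by (rule onorm_le) (simp add: norm_mult)
  qed auto
  then show ?thesis by simp
qed

lemma sbd_modulation_has_derivative:
  assumes "sbd n k A f"
  shows "(modulation \<xi> f has_derivative (\<lambda>v. modulation \<xi> (pd v f) x + \<i> * of_real (2 * pi * (\<xi> \<bullet> v)) * modulation \<xi> f x)) (at x)"
proof -
  have "((\<lambda>t. 2 * pi * (\<xi> \<bullet> t)) has_derivative (\<lambda>v. 2 * pi * (\<xi> \<bullet> v))) (at x)"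
    by (auto intro!: derivative_eq_intros)
  from has_derivative_mult[OF has_derivative_cis[OF this] sbd_has_derivative[OF assms]]
  show ?thesis by (simp add: modulation_def scaleR_conv_of_real mult_ac)
qed

lemma pd_modulation:
  assumes "sbd n k A f"
  shows "pd b (modulation \<xi> f) = (\<lambda>x. modulation \<xi> (pd b f) x + \<i> * of_real (2 * pi * (\<xi> \<bullet> b)) * modulation \<xi> f x)"
  by (rule ext, rule pd_eqI[OF sbd_modulation_has_derivative[OF assms]])

text \<open>The modulus of \<open>cis (2 * pi * (h \<bullet> x)) - 1\<close> is at most
  \<open>2 * pi * norm h * norm x\<close>: the gain \<open>norm h\<close> is bought with one power
  of decay. Every derivative adds one term from the exponential that already carries
  \<open>norm h\<close>, whence the factor \<open>Suc n\<close>.\<close>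

lemma sbd_modulation_diff:
  fixes f :: "'a::euclidean_space \<Rightarrow> complex"
  assumes "sbd n (Suc k) A f" and h: "norm h \<le> 1"
  shows "sbd n k (real (Suc n) * (2 * pi) * (1 + 2 * pi) ^ n * (norm h * A)) (\<lambda>x. modulation h f x - f x)"
  using assms(1)
proof -
  have bd: "(1 + norm x) ^ k * cmod (modulation h f x - f x) \<le> (2 * pi) * (norm h * A)" if "sbd n (Suc k) A f" for f n and x :: 'a
  proof -
    have "cmod (modulation h f x - f x) = cmod (cis (2 * pi * (h \<bullet> x)) - 1) * cmod (f x)"
      by (simp add: modulation_def norm_mult[symmetric] left_diff_distrib)
    also have "\<dots> \<le> \<bar>2 * pi * (h \<bullet> x)\<bar> * cmod (f x)" by (intro mult_right_mono cmod_cis_minus_1) auto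
    also have "\<dots> \<le> (2 * pi * (norm h * (1 + norm x))) * cmod (f x)"
      using Cauchy_Schwarz_ineq2[of h x] mult_left_mono[of "norm x" "1 + norm x" "norm h"]
      by (intro mult_right_mono) (auto simp: abs_mult)
    finally have "(1 + norm x) ^ k * cmod (modulation h f x - f x) \<le> (1 + norm x) ^ k * ((2 * pi * (norm h * (1 + norm x))) * cmod (f x))"
      by (rule mult_left_mono) auto
    also have "\<dots> = 2 * pi * norm h * ((1 + norm x) ^ Suc k * cmod (f x))" by simp
    also have "\<dots> \<le> 2 * pi * norm h * A" by (intro mult_left_mono sbd_bound[OF that]) auto
    finally show ?thesis by simp
  qed
  show ?thesis using assms(1)
  proof (induction n arbitrary: f)
    case 0
    have "(\<lambda>x. modulation h f x - f x) differentiable_on UNIV"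
      by (intro differentiable_on_diff sbd_diff[OF 0] sbd_diff[OF sbd_modulation[OF 0]])
    then show ?case using bd[OF 0] by simp
  next
    case (Suc n)
    let ?c = "\<lambda>n. real (Suc n) * (2 * pi) * (1 + 2 * pi) ^ n * (norm h * A)"
    have A: "0 \<le> norm h * A" using sbd_nonneg[OF Suc(2)] by simp
    have c: "?c n + 2 * pi * (1 + 2 * pi) ^ n * (norm h * A) \<le> ?c (Suc n)"
    proof -
      have "?c n + 2 * pi * (1 + 2 * pi) ^ n * (norm h * A) = real (Suc (Suc n)) * (2 * pi) * (1 + 2 * pi) ^ n * (norm h * A)"
        by (simp add: algebra_simps)
      also have "\<dots> \<le> ?c (Suc n)"
        using A by (intro mult_right_mono mult_left_mono power_increasing) auto
      finally show ?thesis .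
    qed
    have df: "(\<lambda>x. modulation h f x - f x) differentiable_on UNIV"
      by (intro differentiable_on_diff sbd_diff[OF Suc(2)] sbd_diff[OF sbd_modulation[OF Suc(2)]])
    have p: "pd b (\<lambda>x. modulation h f x - f x) = (\<lambda>x. (modulation h (pd b f) x - pd b f x) + \<i> * of_real (2 * pi * (h \<bullet> b)) * modulation h f x)" for b
    proof
      fix x
      have "pd b (\<lambda>x. modulation h f x - f x) x = pd b (modulation h f) x - pd b f x"
        by (rule pd_eqI, rule has_derivative_diff)
         (rule sbd_has_derivative[OF sbd_modulation[OF Suc(2)]] sbd_has_derivative[OF Suc(2)])+
      then show "pd b (\<lambda>x. modulation h f x - f x) x = (modulation h (pd b f) x - pd b f x) + \<i> * of_real (2 * pi * (h \<bullet> b)) * modulation h f x"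
        by (simp add: pd_modulation[OF Suc(2)])
    qed
    have pb: "sbd n k (?c (Suc n)) (pd b (\<lambda>x. modulation h f x - f x))" if b: "b \<in> Basis" for b
    proof -
      have f: "sbd n k A f" by (rule sbd_mono[OF Suc(2)]) auto
      have "sbd n k (?c n + cmod (\<i> * of_real (2 * pi * (h \<bullet> b))) * ((1 + 2 * pi * norm h) ^ n * A)) (pd b (\<lambda>x. modulation h f x - f x))"
        unfolding p by (intro sbd_add sbd_cmult Suc.IH sbd_pd[OF Suc(2) b] sbd_modulation f)
      moreover have "cmod (\<i> * of_real (2 * pi * (h \<bullet> b))) * ((1 + 2 * pi * norm h) ^ n * A)
         \<le> (2 * pi * norm h) * ((1 + 2 * pi) ^ n * A)"
        using Basis_le_norm[OF b, of h] h sbd_nonneg[OF f]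
        by (intro mult_mono power_mono) (auto simp: norm_mult abs_mult)
      ultimately show ?thesis using c by (elim sbd_mono) (auto simp: algebra_simps)
    qed
    have "?c 0 \<le> ?c (Suc n)"
      by (intro mult_right_mono[OF _ A] mult_mono power_increasing) auto
    moreover have "?c 0 = 2 * pi * (norm h * A)" by simp
    ultimately have "(1 + norm x) ^ k * cmod (modulation h f x - f x) \<le> ?c (Suc n)" for x
      using bd[OF Suc(2), of x] by linarith
    then show ?case using df pb unfolding sbd.simps by blast
  qed
qed

section \<open>Differentiation under the integral sign\<close>

text \<open>Testing the limit on sequences makes dominated convergence available. The increment of
  \<open>H w\<close> and its linear approximation are each at most
  \<open>DIM('a) * A w * norm h\<close>, so twice that function dominates the normalized
  remainder.\<close>

lemma has_derivative_integral:
  fixes H :: "'w \<Rightarrow> 'a::euclidean_space \<Rightarrow> complex"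
  assumes d: "\<And>w x. H w differentiable (at x)"
    and m: "\<And>x. (\<lambda>w. H w x) \<in> borel_measurable M"
    and i: "\<And>x. integrable M (\<lambda>w. H w x)"
    and A: "integrable M A" and b: "\<And>w x b. b \<in> Basis \<Longrightarrow> cmod (pd b (H w) x) \<le> A w"
  shows "(\<lambda>w. pd v (H w) x) \<in> borel_measurable M"
    and "((\<lambda>x. \<integral>w. H w x \<partial>M) has_derivative (\<lambda>v. \<integral>w. pd v (H w) x \<partial>M)) (at x)"
proof -
  have hd: "(H w has_derivative (\<lambda>v. pd v (H w) x)) (at x)" for w x
    by (rule differentiable_has_derivative_pd[OF d])
  have bl: "bounded_linear (\<lambda>v. pd v (H w) x)" for w x by (rule has_derivative_bounded_linear[OF hd])
  have pm: "(\<lambda>w. pd v (H w) x) \<in> borel_measurable M" for v x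
  proof (rule borel_measurable_LIMSEQ_metric)
    fix w
    show "(\<lambda>n. real (Suc n) *\<^sub>R (H w (x + (1 / real (Suc n)) *\<^sub>R v) - H w x)) \<longlonglongrightarrow> pd v (H w) x"
      by (rule difference_quotient_pd[OF d])
  qed (intro borel_measurable_scaleR borel_measurable_diff m borel_measurable_const)
  then show "(\<lambda>w. pd v (H w) x) \<in> borel_measurable M" .
  have ob: "cmod (pd v (H w) x) \<le> DIM('a) * A w * norm v" for v w x
    by (rule onorm_pd_le[OF d b])
  have ip: "integrable M (\<lambda>w. pd v (H w) x)" for v x
  proof (rule Bochner_Integration.integrable_bound[of _ "\<lambda>w. DIM('a) * A w * norm v"])
    show "AE w in M. cmod (pd v (H w) x) \<le> norm (DIM('a) * A w * norm v)"
      by (rule AE_I2) (rule order_trans[OF ob], simp)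
  qed (use A pm in auto)
  have lip: "cmod (H w (x + h) - H w x) \<le> DIM('a) * A w * norm h" for w x h
    using lipschitz_pd[of UNIV "x + h" x "H w" "A w"] d b by simp
  show "((\<lambda>x. \<integral>w. H w x \<partial>M) has_derivative (\<lambda>v. \<integral>w. pd v (H w) x \<partial>M)) (at x)"
    unfolding has_derivative_at
  proof
    show "bounded_linear (\<lambda>v. \<integral>w. pd v (H w) x \<partial>M)"
    proof (rule bounded_linear_intro)
      show "(\<integral>w. pd (u + v) (H w) x \<partial>M) = (\<integral>w. pd u (H w) x \<partial>M) + (\<integral>w. pd v (H w) x \<partial>M)" for u v
        using ip linear_simps(1)[OF bl] by simp
      show "(\<integral>w. pd (r *\<^sub>R v) (H w) x \<partial>M) = r *\<^sub>R (\<integral>w. pd v (H w) x \<partial>M)" for r v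
        using ip linear_simps(5)[OF bl] by simp
      show "norm (\<integral>w. pd v (H w) x \<partial>M) \<le> norm v * (DIM('a) * (\<integral>w. A w \<partial>M))" for v
      proof -
        have "norm (\<integral>w. pd v (H w) x \<partial>M) \<le> (\<integral>w. DIM('a) * A w * norm v \<partial>M)"
          by (rule order_trans[OF integral_norm_bound integral_mono]) (use ip A ob in auto)
        then show ?thesis by (simp add: mult_ac)
      qed
    qed
    show "(\<lambda>h. norm ((\<integral>w. H w (x + h) \<partial>M) - (\<integral>w. H w x \<partial>M) - (\<integral>w. pd h (H w) x \<partial>M)) / norm h) \<midarrow>0\<rightarrow> 0"
      unfolding tendsto_at_iff_sequentially
    proof (intro allI impI)
      fix X :: "nat \<Rightarrow> 'a" assume X: "\<forall>i. X i \<in> UNIV - {0}" "X \<longlonglongrightarrow> 0"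
      let ?q = "\<lambda>n w. (H w (x + X n) - H w x - pd (X n) (H w) x) /\<^sub>R norm (X n)"
      have "(\<lambda>n. \<integral>w. ?q n w \<partial>M) \<longlonglongrightarrow> (\<integral>w. 0 \<partial>M)"
      proof (rule integral_dominated_convergence[where w = "\<lambda>w. 2 * DIM('a) * A w"])
        show "?q n \<in> borel_measurable M" for n by (intro borel_measurable_scaleR borel_measurable_diff m pm borel_measurable_const)
        show "integrable M (\<lambda>w. 2 * DIM('a) * A w)" using A by simp
        show "AE w in M. (\<lambda>n. ?q n w) \<longlonglongrightarrow> 0"
        proof (rule AE_I2)
          fix w
          have "(\<lambda>h. norm (H w (x + h) - H w x - pd h (H w) x) / norm h) \<midarrow>0\<rightarrow> 0"
            using hd[of w x] unfolding has_derivative_at by blast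
          then have "((\<lambda>h. norm (H w (x + h) - H w x - pd h (H w) x) / norm h) \<circ> X) \<longlonglongrightarrow> 0"
            using X unfolding tendsto_at_iff_sequentially by blast
          then have "(\<lambda>n. norm (?q n w)) \<longlonglongrightarrow> 0" by (simp add: o_def divide_inverse mult.commute)
          then show "(\<lambda>n. ?q n w) \<longlonglongrightarrow> 0" by (rule tendsto_norm_zero_cancel)
        qed
        show "AE w in M. norm (?q n w) \<le> 2 * DIM('a) * A w" for n
        proof (rule AE_I2)
          fix w
          have "norm (H w (x + X n) - H w x - pd (X n) (H w) x) \<le> 2 * DIM('a) * A w * norm (X n)"
            using norm_triangle_ineq4[of "H w (x + X n) - H w x" "pd (X n) (H w) x"] lip[of w x "X n"] ob[of "X n" w x]
            by (simp add: algebra_simps)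
          moreover have "0 < norm (X n)" using X by simp
          ultimately show "norm (?q n w) \<le> 2 * DIM('a) * A w"
            by (simp add: divide_inverse[symmetric] mult.commute[of "inverse _"] pos_divide_le_eq)
        qed
      qed simp
      moreover have "(\<integral>w. ?q n w \<partial>M) = ((\<integral>w. H w (x + X n) \<partial>M) - (\<integral>w. H w x \<partial>M) - (\<integral>w. pd (X n) (H w) x \<partial>M)) /\<^sub>R norm (X n)" for n
        using i ip by (simp only: integral_scaleR_right Bochner_Integration.integral_diff Bochner_Integration.integrable_diff)
      ultimately have "(\<lambda>n. norm (((\<integral>w. H w (x + X n) \<partial>M) - (\<integral>w. H w x \<partial>M) - (\<integral>w. pd (X n) (H w) x \<partial>M)) /\<^sub>R norm (X n))) \<longlonglongrightarrow> 0"
        by (intro tendsto_norm_zero) (simp only: Bochner_Integration.integral_zero)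
      then show "((\<lambda>h. norm ((\<integral>w. H w (x + h) \<partial>M) - (\<integral>w. H w x \<partial>M) - (\<integral>w. pd h (H w) x \<partial>M)) / norm h) \<circ> X) \<longlonglongrightarrow> 0"
        by (simp add: o_def divide_inverse mult.commute)
    qed
  qed
qed


text \<open>One order is lost: differentiating under the integral needs a dominating function for
  the derivatives of the next order.\<close>

lemma sbd_integral:
  fixes H :: "'w \<Rightarrow> 'a::euclidean_space \<Rightarrow> complex"
  assumes "\<And>w. sbd (Suc n) k (A w) (H w)" and "\<And>x. (\<lambda>w. H w x) \<in> borel_measurable M"
    and A: "integrable M A"
  shows "sbd n k (\<integral>w. A w \<partial>M) (\<lambda>x. \<integral>w. H w x \<partial>M)"
  using assms(1,2)
proof (induction n arbitrary: H)
  have int: "integrable M (\<lambda>w. H w x)"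
    if "\<And>w. sbd n k (A w) (H w)" "\<And>x. (\<lambda>w. H w x) \<in> borel_measurable M" for H :: "'w \<Rightarrow> 'a \<Rightarrow> complex" and n x
  proof (rule Bochner_Integration.integrable_bound[OF A that(2)], rule AE_I2)
    fix w
    have "cmod (H w x) \<le> A w * 1"
      by (rule order_trans[OF sbd_dec[OF that(1)] mult_left_mono[OF dec_le_1 sbd_nonneg[OF that(1)]]])
    then show "cmod (H w x) \<le> norm (A w)" by simp
  qed
  have bd: "(1 + norm x) ^ k * cmod (\<integral>w. H w x \<partial>M) \<le> (\<integral>w. A w \<partial>M)"
    if "\<And>w. sbd n k (A w) (H w)" "\<And>x. (\<lambda>w. H w x) \<in> borel_measurable M" for H :: "'w \<Rightarrow> 'a \<Rightarrow> complex" and n x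
  proof -
    have "(1 + norm x) ^ k * cmod (\<integral>w. H w x \<partial>M) \<le> (1 + norm x) ^ k * (\<integral>w. cmod (H w x) \<partial>M)"
      by (intro mult_left_mono integral_norm_bound) auto
    also have "\<dots> = (\<integral>w. (1 + norm x) ^ k * cmod (H w x) \<partial>M)" by simp
    also have "\<dots> \<le> (\<integral>w. A w \<partial>M)"
      by (rule integral_mono[OF _ A]) (use int[OF that] sbd_bound[OF that(1)] in auto)
    finally show ?thesis .
  qed
  have hd: "((\<lambda>x. \<integral>w. H w x \<partial>M) has_derivative (\<lambda>v. \<integral>w. pd v (H w) x \<partial>M)) (at x)"
    "(\<lambda>w. pd v (H w) x) \<in> borel_measurable M"
    if H: "\<And>w. sbd (Suc n) k (A w) (H w)" and m: "\<And>x. (\<lambda>w. H w x) \<in> borel_measurable M" for H :: "'w \<Rightarrow> 'a \<Rightarrow> complex" and n x v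
  proof -
    have d: "H w differentiable at x" for w x
      using sbd_diff[OF H[of w]] by (simp add: differentiable_on_def)
    have b: "cmod (pd b (H w) x) \<le> A w" if "b \<in> Basis" for b w x
      using order_trans[OF sbd_dec[OF sbd_pd[OF H[of w] that]] mult_left_mono[OF dec_le_1 sbd_nonneg[OF H]]] by simp
    show "((\<lambda>x. \<integral>w. H w x \<partial>M) has_derivative (\<lambda>v. \<integral>w. pd v (H w) x \<partial>M)) (at x)"
      "(\<lambda>w. pd v (H w) x) \<in> borel_measurable M"
      by (rule has_derivative_integral[OF d m int[OF H m] A b]; assumption)+
  qed
  {
    case 0
    then show ?case using bd[OF 0] differentiable_onI_UNIV[OF hd(1)[OF 0]] by simp
  next
    case (Suc n)
    have p: "pd b (\<lambda>x. \<integral>w. H w x \<partial>M) = (\<lambda>x. \<integral>w. pd b (H w) x \<partial>M)" for b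
      by (rule ext, rule pd_eqI[OF hd(1)[OF Suc(2,3)]])
    have "sbd n k (\<integral>w. A w \<partial>M) (pd b (\<lambda>x. \<integral>w. H w x \<partial>M))" if b: "b \<in> Basis" for b
      unfolding p by (rule Suc.IH[OF sbd_pd[OF Suc(2) b] hd(2)[OF Suc(2,3)]])
    then show ?case using bd[OF Suc(2,3)] differentiable_onI_UNIV[OF hd(1)[OF Suc(2,3)]] by simp
  }
qed

section \<open>Lebesgue integrals under affine maps, and integration by parts\<close>

lemma nn_integral_lborel_affine:
  fixes f :: "'a::euclidean_space \<Rightarrow> ennreal"
  assumes [measurable]: "f \<in> borel_measurable borel" and c: "c \<noteq> 0"
  shows "(\<integral>\<^sup>+x. f (t + c *\<^sub>R x) \<partial>lborel) = ennreal (1 / \<bar>c\<bar> ^ DIM('a)) * (\<integral>\<^sup>+x. f x \<partial>lborel)"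
proof -
  have "(\<integral>\<^sup>+x. f x \<partial>lborel) = ennreal (\<bar>c\<bar> ^ DIM('a)) * (\<integral>\<^sup>+x. f (t + c *\<^sub>R x) \<partial>lborel)"
    by (subst lborel_affine[OF c, of t]) (simp add: nn_integral_density nn_integral_distr nn_integral_cmult)
  then show ?thesis using c
    by (simp add: mult.assoc[symmetric] ennreal_mult[symmetric])
qed

lemma nn_integral_lborel_translate:
  fixes f :: "'a::euclidean_space \<Rightarrow> ennreal"
  assumes "f \<in> borel_measurable borel"
  shows "(\<integral>\<^sup>+x. f (t + x) \<partial>lborel) = (\<integral>\<^sup>+x. f x \<partial>lborel)"
  using nn_integral_lborel_affine[OF assms, of 1 t] by simp

lemma nn_integral_lborel_reflect:
  fixes f :: "'a::euclidean_space \<Rightarrow> ennreal"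
  assumes "f \<in> borel_measurable borel"
  shows "(\<integral>\<^sup>+x. f (t - x) \<partial>lborel) = (\<integral>\<^sup>+x. f x \<partial>lborel)"
  using nn_integral_lborel_affine[OF assms, of "-1" t] by simp

lemma integral_lborel_affine:
  fixes f :: "'a::euclidean_space \<Rightarrow> 'b::{banach, second_countable_topology}"
  assumes [measurable]: "f \<in> borel_measurable borel" and c: "c \<noteq> 0"
  shows "(\<integral>x. f (t + c *\<^sub>R x) \<partial>lborel) = (1 / \<bar>c\<bar> ^ DIM('a)) *\<^sub>R (\<integral>x. f x \<partial>lborel)"
proof -
  have "(\<integral>x. f x \<partial>lborel) = (\<bar>c\<bar> ^ DIM('a)) *\<^sub>R (\<integral>x. f (t + c *\<^sub>R x) \<partial>lborel)"
    by (subst lborel_affine[OF c, of t]) (simp add: integral_density integral_distr)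
  then show ?thesis using c by simp
qed

lemma integral_lborel_translate:
  fixes f :: "'a::euclidean_space \<Rightarrow> 'b::{banach, second_countable_topology}"
  assumes "f \<in> borel_measurable borel"
  shows "(\<integral>x. f (t + x) \<partial>lborel) = (\<integral>x. f x \<partial>lborel)"
  using integral_lborel_affine[OF assms, of 1 t] by simp

lemma integral_lborel_reflect:
  fixes f :: "'a::euclidean_space \<Rightarrow> 'b::{banach, second_countable_topology}"
  assumes "f \<in> borel_measurable borel"
  shows "(\<integral>x. f (t - x) \<partial>lborel) = (\<integral>x. f x \<partial>lborel)"
  using integral_lborel_affine[OF assms, of "-1" t] by simp

lemma integrable_lborel_translate:
  fixes f :: "'a::euclidean_space \<Rightarrow> 'b::{banach, second_countable_topology}"
  assumes "integrable lborel f"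
  shows "integrable lborel (\<lambda>x. f (t + x))"
proof -
  have [measurable]: "f \<in> borel_measurable borel" using assms by auto
  show ?thesis
    using assms nn_integral_lborel_translate[of "\<lambda>x. ennreal (norm (f x))" t]
    by (simp add: integrable_iff_bounded)
qed

text \<open>By translation invariance the integrals of the difference quotients vanish.\<close>

lemma integral_pd_eq_0:
  fixes f :: "'a::euclidean_space \<Rightarrow> complex"
  assumes f: "sbd (Suc 0) k A f" and k: "2 * DIM('a) \<le> k" and b: "b \<in> Basis"
  shows "(\<integral>x. pd b f x \<partial>lborel) = 0"
proof -
  let ?t = "\<lambda>n. 1 / real (Suc n)"
  let ?q = "\<lambda>n x. real (Suc n) *\<^sub>R (f (x + ?t n *\<^sub>R b) - f x)"
  have [measurable]: "f \<in> borel_measurable borel" by (rule sbd_measurable[OF f])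
  have q0: "(\<integral>x. ?q n x \<partial>lborel) = 0" for n
  proof -
    have i: "integrable lborel f" by (rule sbd_integrable[OF f k])
    show ?thesis
      using i integrable_lborel_translate[OF i, of "?t n *\<^sub>R b"] integral_lborel_translate[of f "?t n *\<^sub>R b"]
      by (simp add: add.commute)
  qed
  have "(\<lambda>n. \<integral>x. ?q n x \<partial>lborel) \<longlonglongrightarrow> (\<integral>x. pd b f x \<partial>lborel)"
  proof (rule integral_dominated_convergence[where w = "\<lambda>x. (2 ^ k * (DIM('a) * A)) * dec k x"])
    show "?q n \<in> borel_measurable lborel" for n by measurable
    show "integrable lborel (\<lambda>x. 2 ^ k * (DIM('a) * A) * dec k (x::'a))"
      using integrable_dec[OF k] by simp
    have lim: "(\<lambda>n. ?q n x) \<longlonglongrightarrow> pd b f x" for x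
      using sbd_diff[OF f] by (intro difference_quotient_pd) (simp add: differentiable_on_def)
    then show "AE x in lborel. (\<lambda>n. ?q n x) \<longlonglongrightarrow> pd b f x" by simp
    have "(\<lambda>x. pd b f x) \<in> borel_measurable borel"
      by (rule borel_measurable_LIMSEQ_metric[OF _ lim]) measurable
    then show "pd b f \<in> borel_measurable lborel" by (simp add: eta_contract_eq)
    show "AE x in lborel. norm (?q n x) \<le> (2 ^ k * (DIM('a) * A)) * dec k x" for n
    proof (rule AE_I2)
      fix x
      have "cmod (f (x + ?t n *\<^sub>R b) - f x) \<le> 2 ^ k * (DIM('a) * (?t n * A)) * dec k x"
        using sbd_lipschitz[OF f, of "- (?t n *\<^sub>R b)" x] b unfolding le_dec_iff by simp
      then have "real (Suc n) * cmod (f (x + ?t n *\<^sub>R b) - f x) \<le> real (Suc n) * (2 ^ k * (DIM('a) * (?t n * A)) * dec k x)"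
        by (rule mult_left_mono) simp
      also have "\<dots> = 2 ^ k * (DIM('a) * A) * dec k x" by (simp del: of_nat_Suc)
      finally show "norm (?q n x) \<le> (2 ^ k * (DIM('a) * A)) * dec k x"
        by simp
    qed
  qed
  then show ?thesis unfolding q0 by (simp add: LIMSEQ_const_iff)
qed

section \<open>The partial Fourier transform on Schwartz functions\<close>

lemma norm_le_pair_basis:
  "norm (w::'a::euclidean_space \<times> 'a) \<le> (\<Sum>i\<in>Basis. \<bar>fst w \<bullet> i\<bar>) + (\<Sum>i\<in>Basis. \<bar>snd w \<bullet> i\<bar>)"
  using norm_Pair_le[of "fst w" "snd w"] norm_le_l1[of "fst w"] norm_le_l1[of "snd w"] by simp

lemma sbd_partial_modulation:
  fixes \<Psi> :: "'a::euclidean_space \<times> 'a \<Rightarrow> complex"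
  assumes "sbd n k A \<Psi>"
  shows "\<exists>C. sbd n k C (\<lambda>\<xi>. cis (- (2 * pi * (t \<bullet> \<xi>))) * \<Psi> (x, \<xi>))"
  using sbd_modulation[OF sbd_slice[OF assms, of x], of "- t"]
  by (auto simp: modulation_def)

lemma fourier_snd_integrable:
  fixes \<Psi> :: "'a::euclidean_space \<times> 'a \<Rightarrow> complex"
  assumes "sbd n k A \<Psi>" "2 * DIM('a) \<le> k"
  shows "integrable lborel (\<lambda>\<xi>. cis (- (2 * pi * (t \<bullet> \<xi>))) * \<Psi> (x, \<xi>))"
  using sbd_partial_modulation[OF assms(1), of t x] sbd_integrable[OF _ assms(2)] by blast

lemma sbd_dec_snd:
  fixes \<Psi> :: "'a::euclidean_space \<times> 'a \<Rightarrow> complex"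
  assumes "sbd n k A \<Psi>"
  shows "cmod (\<Psi> (x, \<xi>)) \<le> A * dec k \<xi>"
proof -
  have "dec k (x, \<xi>) \<le> dec k \<xi>"
    unfolding dec_def by (intro le_imp_inverse_le power_mono zero_less_power) (auto intro: add_pos_nonneg norm_snd_le)
  then show ?thesis
    using sbd_dec[OF assms, of "(x, \<xi>)"] mult_left_mono[OF _ sbd_nonneg[OF assms]] by (meson order_trans)
qed

definition dec_int :: "'a::euclidean_space itself \<Rightarrow> real"
  where "dec_int T = (LINT x|lborel. dec (2 * DIM('a)) (x :: 'a))"

lemma dec_int_nonneg: "0 \<le> dec_int T"
  unfolding dec_int_def by (rule integral_nonneg_AE) simp

lemma fourier_snd_bound:
  fixes \<Psi> :: "'a::euclidean_space \<times> 'a \<Rightarrow> complex"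
  assumes "sbd n (2 * DIM('a)) A \<Psi>"
  shows "cmod (fourier_snd \<Psi> w) \<le> dec_int TYPE('a) * A"
proof -
  have "cmod (fourier_snd \<Psi> w) \<le> (LINT \<xi>|lborel. cmod (cis (- (2 * pi * (snd w \<bullet> \<xi>))) * \<Psi> (fst w, \<xi>)))"
    unfolding fourier_snd_def by (simp add: case_prod_beta integral_norm_bound)
  also have "\<dots> \<le> (LINT \<xi>|lborel. A * dec (2 * DIM('a)) (\<xi>::'a))"
    by (rule integral_mono[OF integrable_norm[OF fourier_snd_integrable[OF assms]]])
      (use integrable_dec sbd_dec_snd[OF assms] in \<open>auto simp: norm_mult\<close>)
  finally show ?thesis by (simp add: dec_int_def mult.commute)
qed

text \<open>Derivatives in the first variable pass to \<open>\<Psi>\<close>, those in the second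
  bring down the factor \<open>- 2 * pi * \<i>\<close> times a coordinate of \<open>\<xi>\<close>,
  written as \<open>w \<bullet> (0, i)\<close>. The decay exponent exceeds
  \<open>2 * DIM('a)\<close> by one to pay for that coordinate.\<close>

lemma fourier_snd_has_derivative:
  fixes \<Psi> :: "'a::euclidean_space \<times> 'a \<Rightarrow> complex"
  assumes P: "sbd (Suc n) (Suc (2 * DIM('a))) A \<Psi>"
  shows "fourier_snd \<Psi> differentiable (at w)"
    and "i \<in> Basis \<Longrightarrow> pd (i, 0) (fourier_snd \<Psi>) w = fourier_snd (pd (i, 0) \<Psi>) w"
    and "i \<in> Basis \<Longrightarrow> pd (0, i) (fourier_snd \<Psi>) w = fourier_snd (\<lambda>w. (- 2 * pi * \<i>) * (of_real (w \<bullet> (0, i)) * \<Psi> w)) w"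
proof -
  let ?H = "\<lambda>\<xi> w. cis (- (2 * pi * (snd w \<bullet> \<xi>))) * \<Psi> (fst w, \<xi>)"
  let ?D = "\<lambda>\<xi> w v. cis (- (2 * pi * (snd w \<bullet> \<xi>))) * pd (fst v, 0) \<Psi> (fst w, \<xi>)
       + ((- (2 * pi * (snd v \<bullet> \<xi>))) *\<^sub>R (\<i> * cis (- (2 * pi * (snd w \<bullet> \<xi>))))) * \<Psi> (fst w, \<xi>)"
  have hd: "(?H \<xi> has_derivative ?D \<xi> w) (at w)" for \<xi> w
  proof -
    have 1: "((\<lambda>w::'a\<times>'a. - (2 * pi * (snd w \<bullet> \<xi>))) has_derivative (\<lambda>v. - (2 * pi * (snd v \<bullet> \<xi>)))) (at w)"
      by (auto intro!: derivative_eq_intros)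
    have "((\<lambda>w::'a\<times>'a. (fst w, \<xi>)) has_derivative (\<lambda>v. (fst v, 0))) (at w)"
      by (auto intro!: derivative_eq_intros)
    from diff_chain_at[OF this, of \<Psi> "\<lambda>v. pd v \<Psi> (fst w, \<xi>)"] sbd_has_derivative[OF P]
    have 2: "((\<lambda>w::'a\<times>'a. \<Psi> (fst w, \<xi>)) has_derivative (\<lambda>v. pd (fst v, 0) \<Psi> (fst w, \<xi>))) (at w)"
      by (simp add: o_def)
    show ?thesis by (rule has_derivative_mult[OF has_derivative_cis[OF 1] 2])
  qed
  have z: "pd 0 \<Psi> y = 0" for y
    using linear_0[OF has_derivative_linear[OF sbd_has_derivative[OF P]]] .
  have p1: "pd (i, 0) (?H \<xi>) w = cis (- (2 * pi * (snd w \<bullet> \<xi>))) * pd (i, 0) \<Psi> (fst w, \<xi>)" for i \<xi> w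
    by (subst pd_eqI[OF hd]) simp
  have p2: "pd (0, i) (?H \<xi>) w = cis (- (2 * pi * (snd w \<bullet> \<xi>))) * ((- 2 * pi * \<i>) * (of_real ((fst w, \<xi>) \<bullet> (0, i)) * \<Psi> (fst w, \<xi>)))" for i \<xi> w
    using z by (subst pd_eqI[OF hd]) (simp add: scaleR_conv_of_real inner_commute zero_prod_def)
  have b: "cmod (pd b (?H \<xi>) w) \<le> (1 + 2 * pi) * A * dec (2 * DIM('a)) \<xi>" if "b \<in> Basis" for b \<xi> w
  proof -
    have A0: "0 \<le> A" by (rule sbd_nonneg[OF P])
    from that consider i where "i \<in> Basis" "b = (i, 0)" | j where "j \<in> Basis" "b = (0, j)"
      by (auto simp: Basis_prod_def)
    then show ?thesis
    proof cases
      case 1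
      have "cmod (pd b (?H \<xi>) w) \<le> A * dec (Suc (2 * DIM('a))) \<xi>"
        unfolding 1 p1 using sbd_dec_snd[OF sbd_pd[OF P that]] 1 by (simp add: norm_mult)
      also have "\<dots> \<le> A * dec (2 * DIM('a)) \<xi>"
        using A0 by (intro mult_left_mono dec_antimono) auto
      also have "\<dots> \<le> (1 + 2 * pi) * (A * dec (2 * DIM('a)) \<xi>)"
        using A0 mult_right_mono[of 1 "1 + 2 * pi" "A * dec (2 * DIM('a)) \<xi>"] by simp
      finally show ?thesis by simp
    next
      case 2
      have "cmod (pd b (?H \<xi>) w) = 2 * pi * (\<bar>\<xi> \<bullet> j\<bar> * cmod (\<Psi> (fst w, \<xi>)))"
        unfolding 2 p2 by (simp add: norm_mult)
      also have "\<dots> \<le> 2 * pi * ((1 + norm \<xi>) * (A * dec (Suc (2 * DIM('a))) \<xi>))"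
        using Basis_le_norm[OF 2(1), of \<xi>] A0
        by (intro mult_left_mono mult_mono sbd_dec_snd[OF P]) auto
      also have "\<dots> = 2 * pi * A * dec (2 * DIM('a)) \<xi>"
      proof -
        have "1 + norm \<xi> \<noteq> 0" using norm_ge_zero[of \<xi>] by linarith
        then show ?thesis by (simp add: dec_def)
      qed
      also have "\<dots> \<le> (1 + 2 * pi) * A * dec (2 * DIM('a)) \<xi>"
        using A0 by (intro mult_right_mono) auto
      finally show ?thesis .
    qed
  qed
  have int: "integrable lborel (\<lambda>\<xi>. ?H \<xi> w)" for w
    by (rule fourier_snd_integrable[OF P]) simp
  have F: "fourier_snd \<Psi> = (\<lambda>w. LINT \<xi>|lborel. ?H \<xi> w)"
    by (auto simp: fourier_snd_def fun_eq_iff)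
  have D: "(fourier_snd \<Psi> has_derivative (\<lambda>v. LINT \<xi>|lborel. pd v (?H \<xi>) w)) (at w)"
    unfolding F
    by (rule has_derivative_integral(2)[where A = "\<lambda>\<xi>. (1 + 2 * pi) * A * dec (2 * DIM('a)) \<xi>"])
      (use int b integrable_dec[where 'a='a, OF order_refl] differentiableI[OF hd] in auto)
  show "fourier_snd \<Psi> differentiable (at w)" using D by (auto simp: differentiable_def)
  show "pd (i, 0) (fourier_snd \<Psi>) w = fourier_snd (pd (i, 0) \<Psi>) w"
    unfolding pd_eqI[OF D] p1 by (simp add: fourier_snd_def case_prod_beta)
  show "pd (0, i) (fourier_snd \<Psi>) w = fourier_snd (\<lambda>w. (- 2 * pi * \<i>) * (of_real (w \<bullet> (0, i)) * \<Psi> w)) w"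
    unfolding pd_eqI[OF D] p2 unfolding fourier_snd_def case_prod_beta fst_conv snd_conv ..
qed

lemma fourier_snd_inner_fst:
  "fourier_snd (\<lambda>w. of_real (w \<bullet> (i, 0)) * \<Psi> w) w = of_real (fst w \<bullet> i) * fourier_snd \<Psi> w"
  by (simp add: fourier_snd_def case_prod_beta mult.left_commute)

text \<open>Integration by parts: the derivative of the modulated slice
  \<open>modulation (- t) ?f\<close> has vanishing integral, and the product rule splits it into the
  two sides.\<close>

lemma fourier_snd_pd_snd:
  fixes \<Psi> :: "'a::euclidean_space \<times> 'a \<Rightarrow> complex"
  assumes P: "sbd (Suc n) (2 * DIM('a)) A \<Psi>" and i: "i \<in> Basis"
  shows "fourier_snd (pd (0, i) \<Psi>) w = (2 * pi * \<i>) * of_real (snd w \<bullet> i) * fourier_snd \<Psi> w"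
proof -
  obtain x t where w: "w = (x, t)" by (cases w)
  let ?f = "\<lambda>\<xi>. \<Psi> (x, \<xi>)"
  obtain B where f: "sbd (Suc n) (2 * DIM('a)) B ?f" using sbd_slice[OF P, of x] by blast
  then obtain D where m: "sbd (Suc n) (2 * DIM('a)) D (modulation (- t) ?f)" using sbd_modulation by blast
  then have m1: "sbd (Suc 0) (2 * DIM('a)) D (modulation (- t) ?f)" by (rule sbd_mono) auto
  have p: "pd i ?f \<xi> = pd (0, i) \<Psi> (x, \<xi>)" for \<xi>
  proof (rule pd_eqI)
    have "((\<lambda>\<xi>. (x, \<xi>)) has_derivative (\<lambda>v. (0, v))) (at \<xi>)" by (auto intro!: derivative_eq_intros)
    from diff_chain_at[OF this, of \<Psi> "\<lambda>v. pd v \<Psi> (x, \<xi>)"] sbd_has_derivative[OF P]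
    show "(?f has_derivative (\<lambda>v. pd (0, v) \<Psi> (x, \<xi>))) (at \<xi>)" by (simp add: o_def)
  qed
  have "0 = (LINT \<xi>|lborel. pd i (modulation (- t) ?f) \<xi>)"
    by (rule integral_pd_eq_0[OF m1 order_refl i, symmetric])
  also have "\<dots> = (LINT \<xi>|lborel. cis (- (2 * pi * (t \<bullet> \<xi>))) * pd (0, i) \<Psi> (x, \<xi>)
       - (2 * pi * \<i>) * of_real (t \<bullet> i) * (cis (- (2 * pi * (t \<bullet> \<xi>))) * \<Psi> (x, \<xi>)))"
    unfolding pd_modulation[OF f] by (simp add: modulation_def p mult_ac)
  also have "\<dots> = fourier_snd (pd (0, i) \<Psi>) w - (2 * pi * \<i>) * of_real (t \<bullet> i) * fourier_snd \<Psi> w"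
  proof -
    have "(0, i) \<in> (Basis :: ('a \<times> 'a) set)" using i by (simp add: Basis_prod_def)
    then have "sbd n (2 * DIM('a)) A (pd (0, i) \<Psi>)" by (rule sbd_pd[OF P])
    from fourier_snd_integrable[OF this] fourier_snd_integrable[OF P]
    show ?thesis by (subst Bochner_Integration.integral_diff) (auto simp: w fourier_snd_def)
  qed
  finally show ?thesis by (simp add: w)
qed

text \<open>One more power of the weight reduces, by \<open>norm_le_pair_basis\<close>, to
  multiplying the transform by coordinates. A coordinate of the first variable commutes with the
  transform; a coordinate of the second becomes a derivative of \<open>\<Psi>\<close>. So
  \<open>k\<close> counts both orders and powers of decay of \<open>\<Psi>\<close>.\<close>

lemma fourier_snd_weighted_bound:
  "\<exists>C\<ge>0. \<forall>\<Psi> :: 'a::euclidean_space \<times> 'a \<Rightarrow> complex. \<forall>A. sbd k (k + 2 * DIM('a)) A \<Psi> \<longrightarrow>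
     (\<forall>w. (1 + norm w) ^ k * cmod (fourier_snd \<Psi> w) \<le> C * A)"
proof (induction k)
  case 0
  show ?case
    by (rule exI[of _ "dec_int TYPE('a)"]) (auto simp: dec_int_nonneg intro!: fourier_snd_bound[of 0])
next
  case (Suc k)
  then obtain C where C0: "0 \<le> C" and C: "\<And>\<Psi> :: 'a \<times> 'a \<Rightarrow> complex. \<And>A w. sbd k (k + 2 * DIM('a)) A \<Psi> \<Longrightarrow>
     (1 + norm w) ^ k * cmod (fourier_snd \<Psi> w) \<le> C * A" by blast
  let ?D = "real DIM('a)"
  show ?case
  proof (rule exI[of _ "C * (1 + ?D * real (Suc k) + ?D)"], intro conjI allI impI)
    show "0 \<le> C * (1 + ?D * real (Suc k) + ?D)" using C0 by simp
    fix \<Psi> :: "'a \<times> 'a \<Rightarrow> complex" and A w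
    assume P: "sbd (Suc k) (Suc k + 2 * DIM('a)) A \<Psi>"
    have A0: "0 \<le> A" by (rule sbd_nonneg[OF P])
    let ?F = "cmod (fourier_snd \<Psi> w)" and ?p = "(1 + norm w) ^ k"
    have p0: "0 \<le> ?p" by simp
    have a: "?p * ?F \<le> C * A" by (rule C, rule sbd_mono[OF P]) auto
    have b: "?p * (\<bar>fst w \<bullet> i\<bar> * ?F) \<le> C * (real (Suc k) * A)" if i: "i \<in> Basis" for i
    proof -
      have "sbd k (Suc (k + 2 * DIM('a))) A \<Psi>" by (rule sbd_mono[OF P]) auto
      from C[OF sbd_inner_mult[OF this, of "(i, 0)"], of w] i
      show ?thesis unfolding fourier_snd_inner_fst by (simp add: norm_mult)
    qed
    have c: "?p * (\<bar>snd w \<bullet> i\<bar> * ?F) \<le> C * A" if i: "i \<in> Basis" for i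
    proof -
      have P': "sbd (Suc k) (2 * DIM('a)) A \<Psi>" by (rule sbd_mono[OF P]) auto
      have "(0, i) \<in> (Basis :: ('a \<times> 'a) set)" using i by (simp add: Basis_prod_def)
      then have "sbd k (Suc k + 2 * DIM('a)) A (pd (0, i) \<Psi>)" by (rule sbd_pd[OF P])
      then have "sbd k (k + 2 * DIM('a)) A (pd (0, i) \<Psi>)" by (rule sbd_mono) auto
      from C[OF this, of w] have "?p * (2 * pi * (\<bar>snd w \<bullet> i\<bar> * ?F)) \<le> C * A"
        \<comment> \<open>The integration by parts gives the coordinate together with
          \<open>2 * pi\<close>; as this factor exceeds 1 it is simply dropped.\<close>
        unfolding fourier_snd_pd_snd[OF P' i] by (simp add: norm_mult mult.assoc)
      moreover have "?p * (1 * (\<bar>snd w \<bullet> i\<bar> * ?F)) \<le> ?p * (2 * pi * (\<bar>snd w \<bullet> i\<bar> * ?F))"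
        using pi_gt3 by (intro mult_left_mono mult_right_mono) auto
      ultimately show ?thesis by simp
    qed
    have "(1 + norm w) * ?F \<le> (1 + (\<Sum>i\<in>Basis. \<bar>fst w \<bullet> i\<bar>) + (\<Sum>i\<in>Basis. \<bar>snd w \<bullet> i\<bar>)) * ?F"
      using norm_le_pair_basis[of w] by (intro mult_right_mono) auto
    then have "?p * ((1 + norm w) * ?F) \<le> ?p * ((1 + (\<Sum>i\<in>Basis. \<bar>fst w \<bullet> i\<bar>) + (\<Sum>i\<in>Basis. \<bar>snd w \<bullet> i\<bar>)) * ?F)"
      by (rule mult_left_mono[OF _ p0])
    also have "\<dots> = ?p * ?F + (\<Sum>i\<in>Basis. ?p * (\<bar>fst w \<bullet> i\<bar> * ?F)) + (\<Sum>i\<in>Basis. ?p * (\<bar>snd w \<bullet> i\<bar> * ?F))"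
      by (simp add: sum_distrib_right sum_distrib_left distrib_right distrib_left)
    also have "\<dots> \<le> C * A + (\<Sum>i\<in>(Basis::'a set). C * (real (Suc k) * A)) + (\<Sum>i\<in>(Basis::'a set). C * A)"
      by (intro add_mono sum_mono a b c)
    also have "\<dots> = C * (1 + ?D * real (Suc k) + ?D) * A" by (simp add: algebra_simps)
    finally show "(1 + norm w) ^ Suc k * ?F \<le> C * (1 + ?D * real (Suc k) + ?D) * A" by (simp add: mult_ac)
  qed
qed

text \<open>A derivative of the transform costs one derivative or one power of decay of
  \<open>\<Psi>\<close>, and so does a power of decay, hence \<open>n + k\<close>. The additional 1
  provides differentiability in the base case, and \<open>2 * DIM('a)\<close> provides
  integrability.\<close>

lemma sbd_fourier_snd:
  "\<exists>C\<ge>0. \<forall>\<Psi> :: 'a::euclidean_space \<times> 'a \<Rightarrow> complex. \<forall>A.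
     sbd (n + k + 1) (n + k + 1 + 2 * DIM('a)) A \<Psi> \<longrightarrow> sbd n k (C * A) (fourier_snd \<Psi>)"
proof (induction n)
  case 0
  obtain C where C: "0 \<le> C" "\<And>\<Psi> :: 'a \<times> 'a \<Rightarrow> complex. \<And>A w. sbd k (k + 2 * DIM('a)) A \<Psi> \<Longrightarrow>
     (1 + norm w) ^ k * cmod (fourier_snd \<Psi> w) \<le> C * A" using fourier_snd_weighted_bound[of k] by blast
  show ?case
  proof (rule exI[of _ C], intro conjI allI impI)
    fix \<Psi> :: "'a \<times> 'a \<Rightarrow> complex" and A
    assume P: "sbd (0 + k + 1) (0 + k + 1 + 2 * DIM('a)) A \<Psi>"
    have 1: "sbd k (k + 2 * DIM('a)) A \<Psi>" and 2: "sbd (Suc 0) (Suc (2 * DIM('a))) A \<Psi>"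
      by (rule sbd_mono[OF P]; simp)+
    show "sbd 0 k (C * A) (fourier_snd \<Psi>)"
      using C(2)[OF 1] fourier_snd_has_derivative(1)[OF 2] by (simp add: differentiable_on_def)
  qed (rule C)
next
  case (Suc n)
  then obtain C where C: "0 \<le> C" "\<And>\<Psi> :: 'a \<times> 'a \<Rightarrow> complex. \<And>A. 
     sbd (n + k + 1) (n + k + 1 + 2 * DIM('a)) A \<Psi> \<Longrightarrow> sbd n k (C * A) (fourier_snd \<Psi>)" by blast
  let ?K = "1 + 2 * pi * real (n + k + 2)"
  show ?case
  proof (rule exI[of _ "C * ?K"], intro conjI allI impI)
    show "0 \<le> C * ?K" using C by simp
    fix \<Psi> :: "'a \<times> 'a \<Rightarrow> complex" and A
    assume P: "sbd (Suc n + k + 1) (Suc n + k + 1 + 2 * DIM('a)) A \<Psi>"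
    have A0: "0 \<le> A" by (rule sbd_nonneg[OF P])
    have le: "A \<le> ?K * A" using mult_right_mono[of 1 ?K A] A0 by simp
    have P1: "sbd (Suc 0) (Suc (2 * DIM('a))) A \<Psi>"  by (rule sbd_mono[OF P]) auto
    have P2: "sbd (Suc (n + k + 1)) (n + k + 1 + 2 * DIM('a)) A \<Psi>"  by (rule sbd_mono[OF P]) auto
    have P3: "sbd (n + k + 1) (Suc (n + k + 1 + 2 * DIM('a))) A \<Psi>"  by (rule sbd_mono[OF P]) auto
    have P4: "sbd (n + k + 1) (n + k + 1 + 2 * DIM('a)) A \<Psi>"  by (rule sbd_mono[OF P]) auto
    have "sbd n k (C * ?K * A) (pd b (fourier_snd \<Psi>))" if b: "b \<in> Basis" for b
    proof -
      from b consider i where "i \<in> Basis" "b = (i, 0)" | j where "j \<in> Basis" "b = (0, j)"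
        by (auto simp: Basis_prod_def)
      then show ?thesis
      proof cases
        case 1
        have e: "pd b (fourier_snd \<Psi>) = fourier_snd (pd b \<Psi>)"
          using fourier_snd_has_derivative(2)[OF P1 1(1)] 1(2) by auto
        have "sbd n k (C * A) (pd b (fourier_snd \<Psi>))" unfolding e by (rule C(2)[OF sbd_pd[OF P2 b]])
        then show ?thesis by (rule sbd_mono) (use mult_left_mono[OF le C(1)] in \<open>auto simp: mult_ac\<close>)
      next
        case 2
        have e: "pd b (fourier_snd \<Psi>) = fourier_snd (\<lambda>w. (- 2 * pi * \<i>) * (of_real (w \<bullet> (0, j)) * \<Psi> w))"
          using fourier_snd_has_derivative(3)[OF P1 2(1)] 2(2) by auto
        have "sbd n k (C * (cmod (- 2 * pi * \<i>) * (real (Suc (n + k + 1)) * (norm (0::'a, j) * A)))) (pd b (fourier_snd \<Psi>))"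
          unfolding e by (intro C(2) sbd_cmult sbd_inner_mult P3)
        then show ?thesis
        proof (rule sbd_mono)
        have "cmod (- 2 * pi * \<i>) * (real (Suc (n + k + 1)) * (norm (0::'a, j) * A)) \<le> ?K * A"
          using 2 A0 by (simp add: norm_mult norm_Pair algebra_simps)
        from mult_left_mono[OF this C(1)]
        show "C * (cmod (- 2 * pi * \<i>) * (real (Suc (n + k + 1)) * (norm (0::'a, j) * A))) \<le> C * ?K * A"
          by (simp only: mult.assoc)
        qed auto
      qed
    qed
    moreover have "sbd 0 k (C * A) (fourier_snd \<Psi>)" by (rule sbd_mono[OF C(2)[OF P4]]) auto
    then have "sbd 0 k (C * ?K * A) (fourier_snd \<Psi>)"
      by (rule sbd_mono) (use mult_left_mono[OF le C(1)] in \<open>auto simp: mult_ac\<close>)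
    ultimately show "sbd (Suc n) k (C * ?K * A) (fourier_snd \<Psi>)" by simp
  qed
qed


section \<open>Short-time Fourier transforms and Wigner distributions of Schwartz functions\<close>

lemma stft_dist_of_fun:
  "stft g (dist_of_fun \<phi>) x \<xi> = (LINT t|lborel. cis (- (2 * pi * (\<xi> \<bullet> t))) * (\<phi> t * cnj (g (t - x))))"
  by (simp add: stft_def duality_def dist_of_fun_def modulation_def translation_def cis_cnj mult_ac)

lemma stft_fourier_snd:
  "stft g (dist_of_fun \<phi>) (fst w) (snd w) = fourier_snd (\<lambda>w. \<phi> (snd w) * cnj (g (snd w - fst w))) w"
  by (simp add: stft_dist_of_fun fourier_snd_def case_prod_beta)

lemma sbd_bilinear_change:
  fixes L :: "'a::euclidean_space \<times> 'a \<Rightarrow> 'a \<times> 'a"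
  assumes "sbd n k A f" "sbd n k B g" and L: "linear L" "\<And>x. norm (L x) \<le> K * norm x"
    "\<And>x. norm x \<le> K * norm (L x)" "1 \<le> K"
  shows "sbd n k ((real DIM('a \<times> 'a) * K) ^ n * (K ^ k * (A * B))) (\<lambda>w. f (fst (L w)) * cnj (g (snd (L w))))"
  using sbd_linear[OF sbd_tensor[OF assms(1) sbd_cnj[OF assms(2)]] L] .

text \<open>The transform is \<open>fourier_snd\<close> of a tensor product composed with the shear
  \<open>(x, t) \<mapsto> (t, t - x)\<close>, which is bounded by 3 in both directions. The bound is
  bilinear in the seminorm constants of function and window.\<close>

lemma sbd_stft:
  "\<exists>C\<ge>0. \<exists>M. \<forall>\<phi> (g :: 'a::euclidean_space \<Rightarrow> complex) A B. sbd M M A \<phi> \<longrightarrow> sbd M M B g \<longrightarrow>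
     sbd n k (C * (A * B)) (\<lambda>w. stft g (dist_of_fun \<phi>) (fst w) (snd w))"
proof -
  obtain C where C: "C \<ge> 0" "\<And>\<Psi> :: 'a \<times> 'a \<Rightarrow> complex. \<And>A. 
     sbd (n + k + 1) (n + k + 1 + 2 * DIM('a)) A \<Psi> \<Longrightarrow> sbd n k (C * A) (fourier_snd \<Psi>)"
    using sbd_fourier_snd[of n k] by blast
  let ?M = "n + k + 1 + 2 * DIM('a)"
  let ?L = "\<lambda>w::'a\<times>'a. (snd w, snd w - fst w)"
  let ?c = "(real DIM('a \<times> 'a) * 3) ^ ?M * 3 ^ ?M"
  have L: "linear ?L" by (auto intro!: linearI simp: algebra_simps)
  have L1: "norm (?L x) \<le> 3 * norm x" for x
    using norm_Pair_le[of "snd x" "snd x - fst x"] norm_triangle_ineq4[of "snd x" "fst x"]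
      norm_fst_le[of "fst x" "snd x"] norm_snd_le[of "snd x" "fst x"] by simp
  have L2: "norm x \<le> 3 * norm (?L x)" for x
    using norm_Pair_le[of "fst x" "snd x"] norm_triangle_ineq4[of "snd x" "snd x - fst x"]
      norm_fst_le[of "snd x" "snd x - fst x"] norm_snd_le[of "snd x - fst x" "snd x"] by simp
  show ?thesis
  proof (intro exI[of _ "C * ?c"] conjI exI[of _ ?M] allI impI)
    fix \<phi> g :: "'a \<Rightarrow> complex" and A B
    assume "sbd ?M ?M A \<phi>" "sbd ?M ?M B g"
    from sbd_bilinear_change[OF this L L1 L2]
    have "sbd ?M ?M (?c * (A * B)) (\<lambda>w. \<phi> (snd w) * cnj (g (snd w - fst w)))" by (simp add: mult_ac)
    then have "sbd (n + k + 1) ?M (?c * (A * B)) (\<lambda>w. \<phi> (snd w) * cnj (g (snd w - fst w)))"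
      by (rule sbd_mono) auto
    from C(2)[OF this] show "sbd n k (C * ?c * (A * B)) (\<lambda>w. stft g (dist_of_fun \<phi>) (fst w) (snd w))"
      unfolding stft_fourier_snd by (simp add: mult_ac)
  qed (use C in simp)
qed

lemma tau_wigner_fourier_snd:
  "tau_wigner \<tau> f g = fourier_snd (\<lambda>w. f (fst w + \<tau> *\<^sub>R snd w) * cnj (g (fst w - (1 - \<tau>) *\<^sub>R snd w)))"
  by (auto simp: tau_wigner_def fourier_snd_def fun_eq_iff inner_commute mult.assoc)

lemma norm_scaleR_le: "0 \<le> c \<Longrightarrow> c \<le> 1 \<Longrightarrow> norm (c *\<^sub>R x) \<le> norm x"
  by (simp add: mult_left_le_one_le)

text \<open>The origin of all uniformity in \<open>\<tau>\<close>: the inverse map is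
  \<open>x = (1 - \<tau>) a + \<tau> b\<close>, \<open>t = a - b\<close>, a convex combination and a
  difference, so both directions are bounded by an absolute constant up to the endpoints of
  \<open>[0, 1]\<close>.\<close>

lemma tau_change_bounds:
  fixes x t :: "'a::euclidean_space"
  assumes \<tau>: "0 \<le> \<tau>" "\<tau> \<le> 1"
  shows "norm (x + \<tau> *\<^sub>R t, x - (1 - \<tau>) *\<^sub>R t) \<le> 4 * norm (x, t)"
    and "norm (x, t) \<le> 4 * norm (x + \<tau> *\<^sub>R t, x - (1 - \<tau>) *\<^sub>R t)"
proof -
  have "norm (x + \<tau> *\<^sub>R t) \<le> norm x + norm t"
    using norm_triangle_ineq[of x "\<tau> *\<^sub>R t"] norm_scaleR_le[of \<tau> t] \<tau> by linarith
  moreover have "norm (x - (1 - \<tau>) *\<^sub>R t) \<le> norm x + norm t"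
    using norm_triangle_ineq4[of x "(1 - \<tau>) *\<^sub>R t"] norm_scaleR_le[of "1 - \<tau>" t] \<tau> by linarith
  ultimately show "norm (x + \<tau> *\<^sub>R t, x - (1 - \<tau>) *\<^sub>R t) \<le> 4 * norm (x, t)"
    using norm_Pair_le[of "x + \<tau> *\<^sub>R t" "x - (1 - \<tau>) *\<^sub>R t"] norm_fst_le[of x t] norm_snd_le[of t x] by linarith
next
  let ?a = "x + \<tau> *\<^sub>R t" and ?b = "x - (1 - \<tau>) *\<^sub>R t"
  have "?a - ?b = t" by (simp add: algebra_simps)
  then have t: "norm t \<le> norm ?a + norm ?b" using norm_triangle_ineq4[of ?a ?b] by simp
  have "(1 - \<tau>) *\<^sub>R ?a + \<tau> *\<^sub>R ?b = x" by (simp add: algebra_simps)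
  then have "norm x \<le> norm ?a + norm ?b"
    using norm_triangle_ineq[of "(1 - \<tau>) *\<^sub>R ?a" "\<tau> *\<^sub>R ?b"] norm_scaleR_le[of "1 - \<tau>" ?a] norm_scaleR_le[of \<tau> ?b] \<tau>
    by (smt (verit))
  then show "norm (x, t) \<le> 4 * norm (?a, ?b)"
    using norm_Pair_le[of x t] t norm_fst_le[of ?a ?b] norm_snd_le[of ?b ?a] by linarith
qed

lemma sbd_tau_wigner:
  "\<exists>C\<ge>0. \<exists>M. \<forall>\<tau>\<in>{0..1}. \<forall>h (g :: 'a::euclidean_space \<Rightarrow> complex) A B. sbd M M A h \<longrightarrow> sbd M M B g \<longrightarrow>
     sbd n k (C * (A * B)) (tau_wigner \<tau> h g)"
proof -
  obtain C where C: "C \<ge> 0" "\<And>\<Psi> :: 'a \<times> 'a \<Rightarrow> complex. \<And>A. 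
     sbd (n + k + 1) (n + k + 1 + 2 * DIM('a)) A \<Psi> \<Longrightarrow> sbd n k (C * A) (fourier_snd \<Psi>)"
    using sbd_fourier_snd[of n k] by blast
  let ?M = "n + k + 1 + 2 * DIM('a)"
  let ?c = "(real DIM('a \<times> 'a) * 4) ^ ?M * 4 ^ ?M"
  show ?thesis
  proof (intro exI[of _ "C * ?c"] conjI exI[of _ ?M] allI impI ballI)
    fix \<tau> :: real and h g :: "'a \<Rightarrow> complex" and A B
    let ?L = "\<lambda>w::'a\<times>'a. (fst w + \<tau> *\<^sub>R snd w, fst w - (1 - \<tau>) *\<^sub>R snd w)"
    assume t: "\<tau> \<in> {0..1}" and "sbd ?M ?M A h" "sbd ?M ?M B g"
    have L: "linear ?L" by (auto intro!: linearI simp: algebra_simps)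
    have L1: "norm (?L x) \<le> 4 * norm x" "norm x \<le> 4 * norm (?L x)" for x
      using tau_change_bounds[of \<tau> "fst x" "snd x"] t by auto
    from sbd_bilinear_change[OF \<open>sbd ?M ?M A h\<close> \<open>sbd ?M ?M B g\<close> L L1]
    have "sbd ?M ?M (?c * (A * B)) (\<lambda>w. h (fst w + \<tau> *\<^sub>R snd w) * cnj (g (fst w - (1 - \<tau>) *\<^sub>R snd w)))"
      by (simp add: mult_ac)
    then have "sbd (n + k + 1) ?M (?c * (A * B)) (\<lambda>w. h (fst w + \<tau> *\<^sub>R snd w) * cnj (g (fst w - (1 - \<tau>) *\<^sub>R snd w)))"
      by (rule sbd_mono) auto
    from C(2)[OF this] show "sbd n k (C * ?c * (A * B)) (tau_wigner \<tau> h g)"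
      unfolding tau_wigner_fourier_snd by (simp add: mult_ac)
  qed (use C in simp)
qed

lemma stft_tau_wigner_bound:
  assumes "\<Phi> \<in> schwartz"
  shows "\<exists>C\<ge>0. \<exists>M. \<forall>\<tau>\<in>{0..1}. \<forall>h (g :: 'a::euclidean_space \<Rightarrow> complex) A B. sbd M M A h \<longrightarrow> sbd M M B g \<longrightarrow>
     (\<forall>z \<zeta>. cmod (stft \<Phi> (dist_of_fun (tau_wigner \<tau> h g)) z \<zeta>) \<le> C * (A * B) * (dec N z * dec N \<zeta>))"
proof -
  \<comment> \<open>Decay of order \<open>N + N\<close> in the pair is requested so that it can be
    split into order \<open>N\<close> in each component.\<close>
  obtain C M where C: "C \<ge> 0" "\<And>\<phi> (g :: 'a \<times> 'a \<Rightarrow> complex) A B. sbd M M A \<phi> \<Longrightarrow> sbd M M B g \<Longrightarrow>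
     sbd 0 (N + N) (C * (A * B)) (\<lambda>w. stft g (dist_of_fun \<phi>) (fst w) (snd w))"
    using sbd_stft[of 0 "N + N"] by blast
  obtain D M' where D: "D \<ge> 0" "\<And>\<tau> h (g :: 'a \<Rightarrow> complex) A B. \<tau> \<in> {0..1} \<Longrightarrow> sbd M' M' A h \<Longrightarrow> sbd M' M' B g \<Longrightarrow>
     sbd M M (D * (A * B)) (tau_wigner \<tau> h g)"
    using sbd_tau_wigner[of M M] by blast
  obtain E where E: "sbd M M E \<Phi>" using assms schwartz_sbd by blast
  have E0: "0 \<le> E" by (rule sbd_nonneg[OF E])
  show ?thesis
  proof (intro exI[of _ "C * D * E"] conjI exI[of _ M'] allI impI ballI)
    fix \<tau> :: real and h g :: "'a \<Rightarrow> complex" and A B z \<zeta>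
    assume t: "\<tau> \<in> {0..1}" and h: "sbd M' M' A h" and g: "sbd M' M' B g"
    from sbd_dec[OF C(2)[OF D(2)[OF t h g] E], of "(z, \<zeta>)"]
    have "cmod (stft \<Phi> (dist_of_fun (tau_wigner \<tau> h g)) z \<zeta>) \<le> C * D * E * (A * B) * (dec N (z, \<zeta>) * dec N (z, \<zeta>))"
      by (simp add: dec_add mult_ac)
    also have "\<dots> \<le> C * D * E * (A * B) * (dec N z * dec N \<zeta>)"
    proof (intro mult_left_mono mult_mono)
      show "dec N (z, \<zeta>) \<le> dec N z"
        unfolding dec_def by (intro le_imp_inverse_le power_mono zero_less_power) (auto intro: add_pos_nonneg norm_fst_le)
      show "dec N (z, \<zeta>) \<le> dec N \<zeta>"
        unfolding dec_def by (intro le_imp_inverse_le power_mono zero_less_power) (auto intro: add_pos_nonneg norm_snd_le)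
    qed (use C(1) D(1) E0 sbd_nonneg[OF h] sbd_nonneg[OF g] in auto)
    finally show "cmod (stft \<Phi> (dist_of_fun (tau_wigner \<tau> h g)) z \<zeta>) \<le> C * D * E * (A * B) * (dec N z * dec N \<zeta>)" .
  qed (use C D E0 in simp)
qed

section \<open>Gaussians and Fourier inversion\<close>

lemma measurable_cis [measurable]: "cis \<in> borel_measurable borel"
  by (intro borel_measurable_continuous_onI) (auto intro!: continuous_intros)

lemma integral_lborel_prod:
  fixes F :: "'a::euclidean_space \<Rightarrow> real \<Rightarrow> complex"
  assumes F: "\<And>b. b \<in> Basis \<Longrightarrow> integrable lborel (F b)"
  shows "(LINT x|lborel. (\<Prod>b\<in>Basis. F b (x \<bullet> b))) = (\<Prod>b\<in>Basis. (LINT s|lborel. F b s))"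
proof -
  interpret product_sigma_finite "\<lambda>_::'a. lborel :: real measure" ..
  have [measurable]: "b \<in> Basis \<Longrightarrow> F b \<in> borel_measurable borel" for b
    using F[of b] by auto
  have "(LINT x|lborel. (\<Prod>b\<in>Basis. F b (x \<bullet> b)))
     = (LINT f|(\<Pi>\<^sub>M b\<in>(Basis::'a set). lborel). (\<Prod>b\<in>Basis. F b ((\<Sum>b\<in>Basis. f b *\<^sub>R b) \<bullet> b)))"
    by (subst lborel_eq, subst integral_distr) auto
  also have "\<dots> = (LINT f|(\<Pi>\<^sub>M b\<in>(Basis::'a set). lborel). (\<Prod>b\<in>Basis. F b (f b)))"
    by simp
  also have "\<dots> = (\<Prod>b\<in>Basis. (LINT s|lborel. F b s))"
    by (rule product_integral_prod) (use F in auto)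
  finally show ?thesis .
qed

lemma integrable_exp_pi_sq: "integrable lborel (\<lambda>s::real. exp (- pi * s\<^sup>2))"
proof -
  have "integrable lborel (\<lambda>s::real. std_normal_density (0 + sqrt (2 * pi) * s))"
    by (rule lborel_integrable_real_affine) (auto intro: integrable_normal_density)
  then have "integrable lborel (\<lambda>s::real. sqrt (2 * pi) * std_normal_density (0 + sqrt (2 * pi) * s))"
    by simp
  then show ?thesis
    by (simp add: std_normal_density_def power_mult_distrib)
qed

text \<open>The characteristic function of the standard normal distribution, rescaled by
  \<open>sqrt (2 * pi)\<close> to the normalization in which the Gaussian is its own Fourier
  transform.\<close>

lemma fourier_gauss_real:
  "(LINT s|lborel. cis (- (2 * pi * (\<eta> * s))) * of_real (exp (- pi * s\<^sup>2))) = complex_of_real (exp (- pi * \<eta>\<^sup>2))"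
proof -
  let ?r = "sqrt (2 * pi)"
  define f where "f = (\<lambda>x. std_normal_density x *\<^sub>R iexp ((- \<eta> * ?r) * x))"
  have [measurable]: "f \<in> borel_measurable borel" unfolding f_def by measurable
  have "(LINT x|lborel. f x) = char std_normal_distribution (- \<eta> * ?r)"
    unfolding f_def char_def by (subst integral_density) auto
  also have "\<dots> = complex_of_real (exp (- pi * \<eta>\<^sup>2))"
    unfolding char_std_normal_distribution by (simp add: power_mult_distrib)
  finally have 1: "(LINT x|lborel. f x) = complex_of_real (exp (- pi * \<eta>\<^sup>2))" .
  have "(LINT s|lborel. cis (- (2 * pi * (\<eta> * s))) * of_real (exp (- pi * s\<^sup>2))) = (LINT s|lborel. of_real ?r * f (0 + ?r *\<^sub>R s))"
  proof (rule Bochner_Integration.integral_cong[OF refl])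
    fix s :: real
    have "(- \<eta> * ?r) * (?r * s) = - (2 * pi * (\<eta> * s))" by (simp add: mult_ac)
    then have "of_real ?r * f (0 + ?r *\<^sub>R s) = of_real ?r * (of_real (std_normal_density (?r * s)) * cis (- (2 * pi * (\<eta> * s))))"
      unfolding f_def by (simp only: real_scaleR_def add_0 cis_conv_exp scaleR_conv_of_real)
    also have "\<dots> = of_real (?r * std_normal_density (?r * s)) * cis (- (2 * pi * (\<eta> * s)))" by simp
    also have "?r * std_normal_density (?r * s) = exp (- pi * s\<^sup>2)"
      by (simp add: std_normal_density_def power_mult_distrib)
    finally show "cis (- (2 * pi * (\<eta> * s))) * of_real (exp (- pi * s\<^sup>2)) = of_real ?r * f (0 + ?r *\<^sub>R s)" by (simp add: mult.commute)
  qed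
  also have "\<dots> = of_real ?r * ((1 / ?r) *\<^sub>R (LINT x|lborel. f x))"
    by (subst integral_mult_right_zero, subst integral_lborel_affine) auto
  also have "\<dots> = complex_of_real (exp (- pi * \<eta>\<^sup>2))" unfolding 1 by (simp add: scaleR_conv_of_real)
  finally show ?thesis .
qed

definition gauss :: "'a::euclidean_space \<Rightarrow> real"
  where "gauss x = exp (- pi * (norm x)\<^sup>2)"

lemma gauss_prod: "gauss x = (\<Prod>b\<in>Basis. exp (- pi * (x \<bullet> b)\<^sup>2))"
proof -
  have "(norm x)\<^sup>2 = (\<Sum>b\<in>Basis. (x \<bullet> b)\<^sup>2)"
    unfolding power2_norm_eq_inner by (subst euclidean_inner) (simp add: power2_eq_square)
  then show ?thesis by (simp add: gauss_def exp_sum[symmetric] sum_distrib_left)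
qed

lemma gauss_measurable [measurable]: "gauss \<in> borel_measurable borel"
  unfolding gauss_def by measurable

lemma fourier_gauss:
  "(LINT x|lborel. cis (- (2 * pi * (\<xi> \<bullet> x))) * of_real (gauss x)) = complex_of_real (gauss (\<xi>::'a::euclidean_space))"
proof -
  have "cis (- (2 * pi * (\<xi> \<bullet> x))) * of_real (gauss x) = (\<Prod>b\<in>Basis. cis (- (2 * pi * ((\<xi> \<bullet> b) * (x \<bullet> b)))) * of_real (exp (- pi * (x \<bullet> b)\<^sup>2)))" for x
  proof -
    have "cis (- (2 * pi * (\<xi> \<bullet> x))) = cis (\<Sum>b\<in>Basis. - (2 * pi * ((\<xi> \<bullet> b) * (x \<bullet> b))))"
      by (subst euclidean_inner) (simp add: sum_distrib_left sum_negf)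
    also have "\<dots> = (\<Prod>b\<in>Basis. cis (- (2 * pi * ((\<xi> \<bullet> b) * (x \<bullet> b)))))"
      by (simp add: cis_conv_exp sum_distrib_left exp_sum)
    finally show ?thesis by (simp add: gauss_prod prod.distrib)
  qed
  then have "(LINT x|lborel. cis (- (2 * pi * (\<xi> \<bullet> x))) * of_real (gauss x))
     = (\<Prod>b\<in>Basis. (LINT s|lborel. cis (- (2 * pi * ((\<xi> \<bullet> b) * s))) * of_real (exp (- pi * s\<^sup>2))))"
    by (simp only:) (rule integral_lborel_prod, rule Bochner_Integration.integrable_bound[OF integrable_exp_pi_sq], auto simp: norm_mult)
  then show ?thesis unfolding fourier_gauss_real by (simp add: gauss_prod)
qed

lemma gauss_pos: "0 < gauss x" and gauss_le_1: "gauss x \<le> 1"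
  by (simp_all add: gauss_def)

lemma integrable_gauss: "integrable lborel (gauss :: 'a::euclidean_space \<Rightarrow> real)"
proof -
  have fin: "(\<integral>\<^sup>+s. ennreal (exp (- pi * s\<^sup>2)) \<partial>lborel) < \<infinity>"
    using nn_integral_eq_integral[OF integrable_exp_pi_sq] by (simp add: less_top[symmetric])
  have "(\<integral>\<^sup>+x. ennreal (norm (gauss x)) \<partial>(lborel::'a measure))
    = (\<integral>\<^sup>+x. (\<Prod>b\<in>Basis. ennreal (exp (- pi * (x \<bullet> b)\<^sup>2))) \<partial>(lborel::'a measure))"
    by (simp add: gauss_prod prod_ennreal prod_nonneg)
  also have "\<dots> = (\<Prod>b\<in>(Basis::'a set). (\<integral>\<^sup>+s. ennreal (exp (- pi * s\<^sup>2)) \<partial>lborel))"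
    by (rule nn_integral_lborel_prod[where f = "\<lambda>b s. ennreal (exp (- pi * s\<^sup>2))"]) auto
  also have "\<dots> < \<infinity>" using fin by (simp add: power_less_top_ennreal)
  finally show ?thesis by (intro integrableI_bounded) auto
qed

lemma integral_gauss: "(LINT x|lborel. gauss (x::'a::euclidean_space)) = 1"
proof -
  have "complex_of_real (LINT x|lborel. gauss (x::'a)) = of_real (gauss (0::'a))"
    using fourier_gauss[of "0::'a"] by simp
  then show ?thesis by (simp add: gauss_def)
qed

text \<open>Gaussian summation. The factor \<open>gauss (e n *\<^sub>R \<xi>)\<close> makes the
  double integral absolutely convergent; since the Gaussian is its own transform, Fubini turns the
  regularized integral into an average of \<open>f\<close> around \<open>t\<close> at scale
  \<open>e n\<close>. As \<open>e n\<close> tends to 0, both sides converge dominatedly, one because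
  \<open>fh\<close> is integrable, the other because \<open>f\<close> is bounded and
  continuous.\<close>

lemma fourier_inversion:
  fixes f fh :: "'a::euclidean_space \<Rightarrow> complex"
  assumes cont: "continuous_on UNIV f" and bd: "\<And>x. cmod (f x) \<le> B" and f: "integrable lborel f"
    and fh: "\<And>\<xi>. fh \<xi> = (LINT t|lborel. cis (- (2 * pi * (\<xi> \<bullet> t))) * f t)" and ifh: "integrable lborel fh"
  shows "(LINT \<xi>|lborel. cis (2 * pi * (\<xi> \<bullet> t)) * fh \<xi>) = f t"
proof -
  have [measurable]: "f \<in> borel_measurable borel" "fh \<in> borel_measurable borel" using f ifh by auto
  define e where "e n = 1 / real (Suc n)" for n
  have e: "0 < e n" for n by (simp add: e_def)
  have e0: "e \<longlonglongrightarrow> 0" unfolding e_def by (rule LIMSEQ_Suc[OF lim_1_over_n])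
  let ?I = "\<lambda>n. LINT \<xi>|lborel. cis (2 * pi * (\<xi> \<bullet> t)) * fh \<xi> * of_real (gauss (e n *\<^sub>R \<xi>))"
  have 1: "?I \<longlonglongrightarrow> (LINT \<xi>|lborel. cis (2 * pi * (\<xi> \<bullet> t)) * fh \<xi>)"
  proof (rule integral_dominated_convergence[where w = "\<lambda>\<xi>. norm (fh \<xi>)"])
    show "AE \<xi> in lborel. (\<lambda>n. cis (2 * pi * (\<xi> \<bullet> t)) * fh \<xi> * of_real (gauss (e n *\<^sub>R \<xi>))) \<longlonglongrightarrow> cis (2 * pi * (\<xi> \<bullet> t)) * fh \<xi>"
    proof (rule AE_I2)
      fix \<xi> :: 'a
      have "(\<lambda>n. gauss (e n *\<^sub>R \<xi>)) \<longlonglongrightarrow> exp (- pi * (norm (0 *\<^sub>R \<xi>))\<^sup>2)"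
        unfolding gauss_def by (intro tendsto_intros e0)
      then show "(\<lambda>n. cis (2 * pi * (\<xi> \<bullet> t)) * fh \<xi> * of_real (gauss (e n *\<^sub>R \<xi>))) \<longlonglongrightarrow> cis (2 * pi * (\<xi> \<bullet> t)) * fh \<xi>"
        using tendsto_mult[OF tendsto_const tendsto_of_real] by fastforce
    qed
    show "AE \<xi> in lborel. norm (cis (2 * pi * (\<xi> \<bullet> t)) * fh \<xi> * of_real (gauss (e n *\<^sub>R \<xi>))) \<le> norm (fh \<xi>)" for n
      by (rule AE_I2) (simp add: norm_mult abs_of_pos[OF gauss_pos] mult_left_le[OF gauss_le_1])
  qed (use ifh in auto)
  have 2: "?I n = (LINT y|lborel. f (t + e n *\<^sub>R y) * of_real (gauss y))" for n
  proof -
    let ?G = "\<lambda>s \<xi>. cis (- (2 * pi * (\<xi> \<bullet> (s - t)))) * f s * of_real (gauss (e n *\<^sub>R \<xi>))"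
    have ig: "integrable lborel (\<lambda>\<xi>::'a. gauss (e n *\<^sub>R \<xi>))"
    proof -
      have "(\<integral>\<^sup>+x. ennreal (gauss x) \<partial>(lborel :: 'a measure)) < \<infinity>"
        using nn_integral_eq_integral[OF integrable_gauss[where 'a='a]] by (simp add: less_imp_le gauss_pos)
      then have "(\<integral>\<^sup>+\<xi>. ennreal (gauss (0 + e n *\<^sub>R \<xi>)) \<partial>(lborel :: 'a measure)) < \<infinity>"
        using nn_integral_lborel_affine[of "\<lambda>x::'a. ennreal (gauss x)" "e n" 0] e[of n]
        by (simp add: ennreal_mult_less_top)
      then show ?thesis by (intro integrableI_bounded) (auto simp: abs_of_pos[OF gauss_pos])
    qed
    have i: "integrable (lborel \<Otimes>\<^sub>M lborel) (\<lambda>(s, \<xi>). ?G s \<xi>)"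
    proof (rule lborel_pair.Fubini_integrable)
      show "integrable lborel (\<lambda>x. LINT y|lborel. norm (case (x, y) of (s, \<xi>) \<Rightarrow> ?G s \<xi>))"
        using f by (simp add: norm_mult)
      show "AE s in lborel. integrable lborel (\<lambda>y. case (s, y) of (s, \<xi>) \<Rightarrow> ?G s \<xi>)"
      proof (rule AE_I2)
        fix s
        show "integrable lborel (\<lambda>y. case (s, y) of (s, \<xi>) \<Rightarrow> ?G s \<xi>)"
          by (rule Bochner_Integration.integrable_bound[of _ "\<lambda>\<xi>. cmod (f s) * gauss (e n *\<^sub>R \<xi>)"])
            (use ig in \<open>auto simp: norm_mult\<close>)
      qed
    qed measurable
    have "?I n = (LINT \<xi>|lborel. LINT s|lborel. ?G s \<xi>)"
    proof (rule Bochner_Integration.integral_cong[OF refl])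
      fix \<xi> :: 'a
      have "cis (2 * pi * (\<xi> \<bullet> t)) * fh \<xi> * of_real (gauss (e n *\<^sub>R \<xi>))
        = (LINT s|lborel. (cis (2 * pi * (\<xi> \<bullet> t)) * of_real (gauss (e n *\<^sub>R \<xi>))) * (cis (- (2 * pi * (\<xi> \<bullet> s))) * f s))"
        unfolding fh by simp
      also have "\<dots> = (LINT s|lborel. ?G s \<xi>)"
      proof (rule Bochner_Integration.integral_cong[OF refl])
        fix s :: 'a
        have "cis (2 * pi * (\<xi> \<bullet> t)) * cis (- (2 * pi * (\<xi> \<bullet> s))) = cis (- (2 * pi * (\<xi> \<bullet> (s - t))))"
          by (simp add: cis_mult inner_diff_right right_diff_distrib)
        then have "cis (- (2 * pi * (\<xi> \<bullet> (s - t)))) = cis (2 * pi * (\<xi> \<bullet> t)) * cis (- (2 * pi * (\<xi> \<bullet> s)))" ..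
        then show "cis (2 * pi * (\<xi> \<bullet> t)) * of_real (gauss (e n *\<^sub>R \<xi>)) * (cis (- (2 * pi * (\<xi> \<bullet> s))) * f s) = ?G s \<xi>"
          by (simp only: mult_ac)
      qed
      finally show "cis (2 * pi * (\<xi> \<bullet> t)) * fh \<xi> * of_real (gauss (e n *\<^sub>R \<xi>)) = (LINT s|lborel. ?G s \<xi>)" .
    qed
    also have "\<dots> = (LINT s|lborel. LINT \<xi>|lborel. ?G s \<xi>)"
      by (rule lborel_pair.Fubini_integral[OF i])
    also have "\<dots> = (LINT s|lborel. of_real (1 / e n ^ DIM('a)) * (f s * of_real (gauss ((1 / e n) *\<^sub>R (s - t)))))"
    proof (rule Bochner_Integration.integral_cong[OF refl])
      fix s :: 'a
      let ?v = "(1 / e n) *\<^sub>R (s - t)"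
      have "(LINT \<xi>|lborel. ?G s \<xi>) = f s * (LINT \<xi>|lborel. cis (- (2 * pi * (?v \<bullet> (0 + e n *\<^sub>R \<xi>)))) * of_real (gauss (0 + e n *\<^sub>R \<xi>)))"
        using e[of n] by (simp add: inner_commute mult_ac flip: integral_mult_right_zero)
      also have "(LINT \<xi>|lborel. cis (- (2 * pi * (?v \<bullet> (0 + e n *\<^sub>R \<xi>)))) * of_real (gauss (0 + e n *\<^sub>R \<xi>))) = (1 / \<bar>e n\<bar> ^ DIM('a)) *\<^sub>R complex_of_real (gauss ?v)"
        by (subst integral_lborel_affine[of "\<lambda>x. cis (- (2 * pi * (?v \<bullet> x))) * of_real (gauss x)"]) (use e[of n] fourier_gauss[of ?v] in auto)
      finally show "(LINT \<xi>|lborel. ?G s \<xi>) = of_real (1 / e n ^ DIM('a)) * (f s * of_real (gauss ?v))"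
        using e[of n] by (simp add: scaleR_conv_of_real)
    qed
    also have "\<dots> = (1 / \<bar>e n\<bar> ^ DIM('a)) *\<^sub>R (LINT s|lborel. f s * of_real (gauss ((1 / e n) *\<^sub>R (s - t))))"
      using e[of n] by (simp add: scaleR_conv_of_real)
    also have "\<dots> = (LINT y|lborel. f (t + e n *\<^sub>R y) * of_real (gauss ((1 / e n) *\<^sub>R ((t + e n *\<^sub>R y) - t))))"
      by (rule integral_lborel_affine[symmetric]) (use e[of n] in auto)
    also have "\<dots> = (LINT y|lborel. f (t + e n *\<^sub>R y) * of_real (gauss y))"
      using e[of n] by simp
    finally show ?thesis .
  qed
  have 3: "(\<lambda>n. LINT y|lborel. f (t + e n *\<^sub>R y) * of_real (gauss y)) \<longlonglongrightarrow> (LINT y|lborel. f t * of_real (gauss (y::'a)))"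
  proof (rule integral_dominated_convergence[where w = "\<lambda>y::'a. B * gauss y"])
    show "AE y in lborel. (\<lambda>n. f (t + e n *\<^sub>R y) * of_real (gauss y)) \<longlonglongrightarrow> f t * of_real (gauss y)"
    proof (rule AE_I2)
      fix y
      have "(\<lambda>n. t + e n *\<^sub>R y) \<longlonglongrightarrow> t + 0 *\<^sub>R y" by (intro tendsto_intros e0)
      moreover have "isCont f t" using cont by (simp add: continuous_on_eq_continuous_at)
      ultimately have "(\<lambda>n. f (t + e n *\<^sub>R y)) \<longlonglongrightarrow> f t"
        using isCont_tendsto_compose[of t f] by simp
      then show "(\<lambda>n. f (t + e n *\<^sub>R y) * of_real (gauss y)) \<longlonglongrightarrow> f t * of_real (gauss y)"
        by (rule tendsto_mult_right)
    qed
    show "AE y in lborel. norm (f (t + e n *\<^sub>R y) * of_real (gauss y)) \<le> B * gauss y" for n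
      using bd by (intro AE_I2) (simp add: norm_mult abs_of_pos[OF gauss_pos] mult_right_mono less_imp_le[OF gauss_pos])
  qed (use integrable_gauss in auto)
  have "(LINT y|lborel. f t * of_real (gauss (y::'a))) = f t"
    by (simp add: integral_gauss)
  then show ?thesis using LIMSEQ_unique[OF 1[unfolded 2] 3] by simp
qed


section \<open>The inversion formula of the short-time Fourier transform\<close>

lemma dec_mult_power: "dec (k + j) w * (1 + norm w) ^ j = dec k w"
proof -
  have "(1 + norm w) ^ j \<noteq> 0" using norm_ge_zero[of w] by (metis add_nonneg_eq_0_iff power_not_zero zero_le_one zero_neq_one)
  then show ?thesis by (simp add: dec_def power_add)
qed

section \<open>Tempered functionals and the linear structure of the Schwartz space\<close>

lemma tempered_add: "u \<in> tempered \<Longrightarrow> \<phi> \<in> schwartz \<Longrightarrow> \<psi> \<in> schwartz \<Longrightarrow> u (\<lambda>x. \<phi> x + \<psi> x) = u \<phi> + u \<psi>"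
  and tempered_cmult: "u \<in> tempered \<Longrightarrow> \<phi> \<in> schwartz \<Longrightarrow> u (\<lambda>x. c * \<phi> x) = c * u \<phi>"
  by (auto simp: tempered_def)

lemma schwartz_zero: "(\<lambda>x. 0) \<in> schwartz"
  unfolding schwartz_iff_sbd using sbd_zero by blast

lemma schwartz_add: "\<phi> \<in> schwartz \<Longrightarrow> \<psi> \<in> schwartz \<Longrightarrow> (\<lambda>x. \<phi> x + \<psi> x) \<in> schwartz"
  unfolding schwartz_iff_sbd using sbd_add by blast

lemma schwartz_diff: "\<phi> \<in> schwartz \<Longrightarrow> \<psi> \<in> schwartz \<Longrightarrow> (\<lambda>x. \<phi> x - \<psi> x) \<in> schwartz"
  unfolding schwartz_iff_sbd using sbd_diff_fun by blast

lemma schwartz_cmult: "\<phi> \<in> schwartz \<Longrightarrow> (\<lambda>x. c * \<phi> x) \<in> schwartz"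
  unfolding schwartz_iff_sbd using sbd_cmult by blast

lemma schwartz_cnj: "\<phi> \<in> schwartz \<Longrightarrow> (\<lambda>x. cnj (\<phi> x)) \<in> schwartz"
  unfolding schwartz_iff_sbd using sbd_cnj by blast

lemma schwartz_sum: "finite I \<Longrightarrow> (\<And>i. i \<in> I \<Longrightarrow> f i \<in> schwartz) \<Longrightarrow> (\<lambda>x. \<Sum>i\<in>I. f i x) \<in> schwartz"
  by (induction I rule: finite_induct) (auto simp: schwartz_zero intro: schwartz_add)

lemma schwartz_iff_sbd_diag: "\<phi> \<in> schwartz \<longleftrightarrow> (\<forall>N. \<exists>C. sbd N N C \<phi>)"
  unfolding schwartz_iff_sbd
proof (intro iffI allI)
  fix n k assume "\<forall>N. \<exists>C. sbd N N C \<phi>"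
  then obtain C where "sbd (max n k) (max n k) C \<phi>" by blast
  then have "sbd n k C \<phi>" by (rule sbd_mono) auto
  then show "\<exists>C. sbd n k C \<phi>" ..
qed auto

lemma schwartz_modulation: "\<phi> \<in> schwartz \<Longrightarrow> modulation \<xi> \<phi> \<in> schwartz"
  unfolding schwartz_iff_sbd using sbd_modulation by blast

lemma schwartz_translation: "\<phi> \<in> schwartz \<Longrightarrow> translation x \<phi> \<in> schwartz"
  unfolding schwartz_iff_sbd translation_def using sbd_translate by blast

lemma tempered_diff:
  assumes "u \<in> tempered" "\<phi> \<in> schwartz" "\<psi> \<in> schwartz"
  shows "u (\<lambda>x. \<phi> x - \<psi> x) = u \<phi> - u \<psi>"
  using tempered_add[OF assms(1,2) schwartz_cmult[OF assms(3), of "-1"]] tempered_cmult[OF assms(1,3), of "-1"]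
  by simp

lemma tempered_zero: "u \<in> tempered \<Longrightarrow> u (\<lambda>x. 0) = 0"
  using tempered_cmult[OF _ schwartz_zero, of u 0] by simp

lemma tempered_sum:
  assumes "u \<in> tempered" "finite I" "\<And>i. i \<in> I \<Longrightarrow> f i \<in> schwartz"
  shows "u (\<lambda>x. \<Sum>i\<in>I. f i x) = (\<Sum>i\<in>I. u (f i))"
  using assms(2,3)
proof (induction I rule: finite_induct)
  case (insert i I)
  then show ?case
    using tempered_add[OF assms(1), of "f i" "\<lambda>x. \<Sum>i\<in>I. f i x"] schwartz_sum[of I f] by simp
qed (simp add: tempered_zero assms(1))

lemma tempered_bound:
  assumes "u \<in> tempered"
  shows "\<exists>C N. 0 \<le> C \<and> (\<forall>\<phi> A. \<phi> \<in> schwartz \<longrightarrow> sbd N N A \<phi> \<longrightarrow> cmod (u (\<phi>::'a::euclidean_space \<Rightarrow> complex)) \<le> C * A)"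
proof -
  obtain C N where C: "\<And>\<phi>. \<phi> \<in> schwartz \<Longrightarrow> cmod (u \<phi>) \<le> C * schwartz_norm N \<phi>"
    using assms unfolding tempered_def by blast
  let ?c = "real (card {bs. set bs \<subseteq> (Basis::'a set) \<and> length bs \<le> N})"
  show ?thesis
  proof (intro exI[of _ "\<bar>C\<bar> * ?c"] exI[of _ N] conjI allI impI)
    fix \<phi> :: "'a \<Rightarrow> complex" and A assume s: "\<phi> \<in> schwartz" and A: "sbd N N A \<phi>"
    have "C * schwartz_norm N \<phi> \<le> \<bar>C\<bar> * schwartz_norm N \<phi>"
      using sbd_nonneg[OF sbd_schwartz_norm[OF s, of N]] by (intro mult_right_mono) auto
    also have "\<dots> \<le> \<bar>C\<bar> * (?c * A)"
      by (rule mult_left_mono[OF schwartz_norm_le[OF A]]) simp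
    finally show "cmod (u \<phi>) \<le> \<bar>C\<bar> * ?c * A" using C[OF s] by simp
  qed simp
qed

section \<open>Riemann sums for Schwartz-valued integrals\<close>

definition grid :: "nat \<Rightarrow> 'w::euclidean_space \<Rightarrow> 'w"
  where "grid n w = (\<Sum>b\<in>Basis. (real_of_int \<lfloor>real n * (w \<bullet> b)\<rfloor> / real n) *\<^sub>R b)"

lemma grid_measurable [measurable]: "grid n \<in> borel_measurable borel"
  unfolding grid_def by measurable

lemma grid_dist:
  assumes "0 < n" shows "norm (w - grid n (w::'w::euclidean_space)) \<le> DIM('w) / n"
proof -
  have "norm (w - grid n w) \<le> (\<Sum>b\<in>Basis. \<bar>(w - grid n w) \<bullet> b\<bar>)" by (rule norm_le_l1)
  also have "\<dots> \<le> (\<Sum>b\<in>(Basis::'w set). 1 / real n)"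
  proof (rule sum_mono)
    fix b :: 'w assume b: "b \<in> Basis"
    have "(w - grid n w) \<bullet> b = (real n * (w \<bullet> b) - real_of_int \<lfloor>real n * (w \<bullet> b)\<rfloor>) / real n"
      using assms b unfolding grid_def by (simp add: inner_diff_left diff_divide_distrib)
    moreover have "0 \<le> real n * (w \<bullet> b) - real_of_int \<lfloor>real n * (w \<bullet> b)\<rfloor>" "real n * (w \<bullet> b) - real_of_int \<lfloor>real n * (w \<bullet> b)\<rfloor> \<le> 1"
      by linarith+
    ultimately show "\<bar>(w - grid n w) \<bullet> b\<bar> \<le> 1 / real n"
      using assms by (simp add: divide_right_mono)
  qed
  finally show ?thesis by simp
qed

lemma finite_grid_ball: "finite (grid n ` cball 0 r)"
proof -
  let ?k = "\<lceil>real n * r\<rceil> + 1"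
  let ?P = "\<Pi>\<^sub>E b\<in>(Basis::'a set). {- ?k..?k}"
  have "grid n ` cball 0 r \<subseteq> (\<lambda>f. \<Sum>b\<in>(Basis::'a set). (real_of_int (f b) / real n) *\<^sub>R b) ` ?P"
  proof safe
    fix w :: 'a assume w: "w \<in> cball 0 r"
    let ?f = "\<lambda>b\<in>Basis. \<lfloor>real n * (w \<bullet> b)\<rfloor>"
    have "- ?k \<le> \<lfloor>real n * (w \<bullet> b)\<rfloor> \<and> \<lfloor>real n * (w \<bullet> b)\<rfloor> \<le> ?k" if "b \<in> Basis" for b
    proof -
      have "\<bar>real n * (w \<bullet> b)\<bar> \<le> real n * r"
        using Basis_le_norm[OF that, of w] w by (auto simp: abs_mult intro!: mult_left_mono)
      then show ?thesis by linarith
    qed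
    then have "?f \<in> ?P" by auto
    then show "grid n w \<in> (\<lambda>f. \<Sum>b\<in>(Basis::'a set). (real_of_int (f b) / real n) *\<^sub>R b) ` ?P"
      by (intro image_eqI[of _ _ ?f]) (auto simp: grid_def)
  qed
  then show ?thesis by (rule finite_subset) (intro finite_imageI finite_PiE, auto)
qed

text \<open>On a ball \<open>grid n\<close> takes finitely many values, so the step function
  integrates to a finite linear combination of values of \<open>F\<close>; linearity of a functional
  can act on such sums.\<close>

lemma integral_grid:
  fixes F :: "'w::euclidean_space \<Rightarrow> complex"
  shows "(LINT w|lborel. indicator (cball 0 r) w *\<^sub>R F (grid n w))
    = (\<Sum>y\<in>grid n ` cball 0 r. of_real (measure lborel (cball 0 r \<inter> grid n -` {y})) * F y)"
proof -
  let ?B = "cball 0 r :: 'w set"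
  let ?Y = "grid n ` ?B"
  have e: "indicator ?B w *\<^sub>R F (grid n w) = (\<Sum>y\<in>?Y. indicator (?B \<inter> grid n -` {y}) w *\<^sub>R F y)" for w
  proof (cases "w \<in> ?B")
    case True
    have "(\<Sum>y\<in>?Y. indicator (?B \<inter> grid n -` {y}) w *\<^sub>R F y) = (\<Sum>y\<in>?Y. if y = grid n w then F y else 0)"
      using True by (intro sum.cong) (auto simp: indicator_def)
    also have "\<dots> = F (grid n w)"
      using True by (subst sum.delta[OF finite_grid_ball]) auto
    finally show ?thesis using True by simp
  qed simp
  have fin: "emeasure lborel (?B \<inter> grid n -` {y}) < \<infinity>" for y
    by (rule le_less_trans[OF emeasure_mono emeasure_lborel_cball_finite[of 0 r]]) auto
  have meas: "?B \<inter> grid n -` {y} \<in> sets lborel" for y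
    using measurable_sets[OF grid_measurable, of "{y}" n] by auto
  show ?thesis unfolding e
    by (subst Bochner_Integration.integral_sum) (use fin meas in \<open>auto simp: scaleR_conv_of_real\<close>)
qed

text \<open>The Riemann sums over finer and finer grids converge in every Schwartz seminorm.\<close>

lemma tempered_integral:
  fixes K :: "'w::euclidean_space \<Rightarrow> 'a::euclidean_space \<Rightarrow> complex"
  assumes u: "u \<in> tempered"
    and K1: "\<And>N. \<exists>C. \<forall>w. sbd N N (C * dec (2 * DIM('w)) w) (K w)"
    and K2: "\<And>N. \<exists>C. \<forall>w w'. norm (w - w') \<le> 1 \<longrightarrow> sbd N N (C * (norm (w - w') * dec (2 * DIM('w)) w)) (\<lambda>x. K w x - K w' x)"
    and \<phi>: "\<phi> \<in> schwartz" "\<And>x. \<phi> x = (LINT w|lborel. K w x)"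
  shows "u \<phi> = (LINT w|lborel. u (K w))"
proof -
  let ?d = "dec (2 * DIM('w)) :: 'w \<Rightarrow> real"
  have int_d: "integrable lborel ?d" by (rule integrable_dec) simp
  have KS: "K w \<in> schwartz" for w
    unfolding schwartz_iff_sbd_diag using K1 by blast
  obtain Cu N where Cu: "0 \<le> Cu" "\<And>\<phi> A. \<phi> \<in> schwartz \<Longrightarrow> sbd N N A \<phi> \<Longrightarrow> cmod (u \<phi>) \<le> Cu * A"
    using tempered_bound[OF u] by blast
  \<comment> \<open>The bounds are taken at \<open>Suc N\<close> because \<open>sbd_integral\<close>
    loses one order.\<close>
  obtain C1 where C1: "\<And>w. sbd (Suc N) (Suc N) (C1 * ?d w) (K w)" using K1 by blast
  obtain C2 where C2: "\<And>w w'. norm (w - w') \<le> 1 \<Longrightarrow> sbd (Suc N) (Suc N) (C2 * (norm (w - w') * ?d w)) (\<lambda>x. K w x - K w' x)"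
    using K2[of "Suc N"] by blast
  have C10: "0 \<le> C1" using sbd_nonneg[OF C1[of 0]] dec_pos[of "2 * DIM('w)" "0::'w"] by (simp add: zero_le_mult_iff)
  have C20: "0 \<le> C2"
  proof -
    obtain b :: 'w where b: "b \<in> Basis" using nonempty_Basis by blast
    have "0 \<le> C2 * (norm (b - 0) * ?d b)" by (rule sbd_nonneg[OF C2]) (use b in simp)
    then show ?thesis using b dec_pos[of "2 * DIM('w)" b] by (simp add: zero_le_mult_iff)
  qed
  have cont: "continuous_on UNIV (\<lambda>w. G w)"
    if G: "\<And>w w'. norm (w - w') \<le> 1 \<Longrightarrow> cmod (G w - G w') \<le> D * norm (w - w')" and D: "0 \<le> D" for G :: "'w \<Rightarrow> complex" and D
    unfolding continuous_on_iff
  proof safe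
    fix x :: 'w and e :: real assume e: "0 < e"
    show "\<exists>d>0. \<forall>x'\<in>UNIV. dist x' x < d \<longrightarrow> dist (G x') (G x) < e"
    proof (intro exI[of _ "min 1 (e / (D + 1))"] conjI ballI impI)
      fix y assume y: "dist y x < min 1 (e / (D + 1))"
      have "dist (G y) (G x) \<le> D * norm (y - x)" using G[of y x] y by (simp add: dist_norm)
      also have "\<dots> \<le> (D + 1) * norm (y - x)" by (intro mult_right_mono) auto
      also have "\<dots> < e" using y D e by (simp add: dist_norm field_simps)
      finally show "dist (G y) (G x) < e" .
    qed (use e D in auto)
  qed
  have Kc: "continuous_on UNIV (\<lambda>w. K w x)" for x
  proof (rule cont[OF _ C20])
    fix w w' :: 'w assume "norm (w - w') \<le> 1"
    then have "cmod (K w x - K w' x) \<le> C2 * (norm (w - w') * ?d w) * dec (Suc N) x"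
      using sbd_dec[OF C2[of w w']] by blast
    also have "\<dots> \<le> C2 * (norm (w - w') * 1) * 1"
      using C20 by (intro mult_mono dec_le_1) auto
    finally show "cmod (K w x - K w' x) \<le> C2 * norm (w - w')" by simp
  qed
  have Km: "(\<lambda>w. K w x) \<in> borel_measurable borel" for x
    by (rule borel_measurable_continuous_onI[OF Kc])
  have Kgm: "(\<lambda>w. K (grid n w) x) \<in> borel_measurable borel" for n x
    by (rule measurable_compose[OF grid_measurable Km])
  have [measurable]: "cball (0::'w) r \<in> sets borel" for r by simp
  have uKc: "continuous_on UNIV (\<lambda>w. u (K w))"
  proof (rule cont)
    fix w w' :: 'w assume w: "norm (w - w') \<le> 1"
    have "cmod (u (K w) - u (K w')) = cmod (u (\<lambda>x. K w x - K w' x))"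
      by (simp add: tempered_diff[OF u KS KS])
    also have "\<dots> \<le> Cu * (C2 * (norm (w - w') * ?d w))"
      by (rule Cu(2)[OF schwartz_diff[OF KS KS] sbd_mono[OF C2[OF w]]]) auto
    also have "\<dots> \<le> Cu * (C2 * (norm (w - w') * 1))"
      using C20 Cu(1) by (intro mult_left_mono dec_le_1) auto
    finally show "cmod (u (K w) - u (K w')) \<le> (Cu * C2) * norm (w - w')" by simp
  qed (use C20 Cu in simp)
  have uKm: "(\<lambda>w. u (K w)) \<in> borel_measurable borel"
    by (rule borel_measurable_continuous_onI[OF uKc])
  have uKgm: "(\<lambda>w. u (K (grid n w))) \<in> borel_measurable borel" for n
    by (rule measurable_compose[OF grid_measurable uKm])
  have Hm: "(\<lambda>w. K w x - indicator (cball 0 r) w *\<^sub>R K (grid n w) x) \<in> borel_measurable borel" for r n x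
    by (intro borel_measurable_diff borel_measurable_scaleR borel_measurable_indicator Km Kgm) simp
  \<comment> \<open>With this mesh, \<open>DIM('w) / real (m n)\<close> is at most 1, so grid points
    are close enough for the Lipschitz bound \<open>C2\<close>, and it tends to 0.\<close>
  define m where "m n = n + DIM('w) + 1" for n :: nat
  define H where "H n w = (\<lambda>x. K w x - indicator (cball 0 (real n)) w *\<^sub>R K (grid (m n) w) x)" for n w
  \<comment> \<open>Error of the Riemann sum at \<open>w\<close>: inside the ball the mesh size
    times the Lipschitz bound, outside it the whole tail of \<open>K\<close>. The factor
    \<open>?d\<close> makes both integrable.\<close>
  define A where "A n w = (C2 * (DIM('w) / real (m n)) + C1 * indicator (- cball 0 (real n)) w) * ?d w" for n w
  have m0: "0 < m n" "DIM('w) / real (m n) \<le> 1" for n by (auto simp: m_def)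
  have HA: "sbd (Suc N) (Suc N) (A n w) (H n w)" for n w
  proof (cases "w \<in> cball 0 (real n)")
    case True
    have g: "norm (w - grid (m n) w) \<le> DIM('w) / real (m n)" by (rule grid_dist[OF m0(1)])
    have e: "H n w = (\<lambda>x. K w x - K (grid (m n) w) x)" using True by (simp add: H_def)
    show ?thesis unfolding e
    proof (rule sbd_mono[OF C2])
      show "norm (w - grid (m n) w) \<le> 1" using g m0(2)[of n] by linarith
      have "C2 * (norm (w - grid (m n) w) * ?d w) \<le> C2 * (DIM('w) / real (m n) * ?d w)"
        using C20 g by (intro mult_left_mono mult_right_mono) auto
      then show "C2 * (norm (w - grid (m n) w) * ?d w) \<le> A n w" using True by (simp add: A_def)
    qed auto
  next
    case False
    then have e: "H n w = K w" by (simp add: H_def)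
    have "C1 * ?d w \<le> A n w" unfolding A_def using False C20 by (intro mult_right_mono) auto
    then show ?thesis unfolding e by (intro sbd_mono[OF C1]) auto
  qed
  have A0: "0 \<le> A n w" for n w by (rule sbd_nonneg[OF HA])
  have A_le: "A n w \<le> (C2 + C1) * ?d w" for n w
    unfolding A_def using C20 C10 m0(2)[of n] mult_left_mono[OF m0(2) C20, of n]
    by (intro mult_right_mono add_mono) (auto simp: indicator_def)
  have [measurable]: "A n \<in> borel_measurable borel" for n unfolding A_def by measurable
  have intA: "integrable lborel (A n)" for n
    by (rule Bochner_Integration.integrable_bound[of _ "\<lambda>w. (C2 + C1) * ?d w"]) (use int_d A0 A_le C20 C10 in auto)
  have A_lim: "(\<lambda>n. LINT w|lborel. A n w) \<longlonglongrightarrow> 0"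
  proof -
    have "(\<lambda>n. LINT w|lborel. A n w) \<longlonglongrightarrow> (LINT w|(lborel::'w measure). (0::real))"
    proof (rule integral_dominated_convergence[where w = "\<lambda>w. (C2 + C1) * ?d w"])
      show "AE w in lborel. (\<lambda>n. A n w) \<longlonglongrightarrow> 0"
      proof (rule AE_I2)
        fix w :: 'w
        have "(\<lambda>n. DIM('w) / real (m n)) \<longlonglongrightarrow> 0"
          unfolding m_def by real_asymp
        then have 1: "(\<lambda>n. (C2 * (DIM('w) / real (m n)) + C1 * 0) * ?d w) \<longlonglongrightarrow> (C2 * 0 + C1 * 0) * ?d w"
          by (intro tendsto_intros)
        obtain n0 where n0: "norm w \<le> real n0" using real_arch_simple by blast
        have "\<forall>\<^sub>F n in sequentially. A n w = (C2 * (DIM('w) / real (m n)) + C1 * 0) * ?d w"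
          using eventually_ge_at_top[of n0] by eventually_elim (use n0 in \<open>auto simp: A_def\<close>)
        then show "(\<lambda>n. A n w) \<longlonglongrightarrow> 0" using 1 by (simp add: tendsto_cong)
      qed
    qed (use int_d A0 A_le in auto)
    then show ?thesis by simp
  qed
  define S where "S n x = (LINT w|lborel. indicator (cball 0 (real n)) w *\<^sub>R K (grid (m n) w) x)" for n x
  let ?c = "\<lambda>n y. complex_of_real (measure lborel (cball 0 (real n) \<inter> grid (m n) -` {y}))"
  have S: "S n = (\<lambda>x. \<Sum>y\<in>grid (m n) ` cball 0 (real n). ?c n y * K y x)" for n
    unfolding S_def by (rule ext, rule integral_grid)
  have SS: "S n \<in> schwartz" for n unfolding S by (intro schwartz_sum finite_grid_ball schwartz_cmult KS)
  have uS: "u (S n) = (LINT w|lborel. indicator (cball 0 (real n)) w *\<^sub>R u (K (grid (m n) w)))" for n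
    unfolding S integral_grid[where F = "\<lambda>y. u (K y)"]
    by (subst tempered_sum[OF u finite_grid_ball]) (auto intro!: schwartz_cmult KS simp: tempered_cmult[OF u KS])
  have Hint: "integrable lborel (\<lambda>w. K w x)" "integrable lborel (\<lambda>w. indicator (cball 0 (real n)) w *\<^sub>R K (grid (m n) w) x)" for n x
  proof -
    show 1: "integrable lborel (\<lambda>w. K w x)"
    proof (rule Bochner_Integration.integrable_bound[of _ "\<lambda>w. C1 * ?d w"])
      show "AE w in lborel. norm (K w x) \<le> norm (C1 * ?d w)"
        by (rule AE_I2, rule order_trans[OF sbd_dec[OF C1]])
           (use C10 in \<open>auto simp: abs_mult intro!: mult_left_le dec_le_1\<close>)
    qed (use int_d Km in auto)
    have "integrable lborel (\<lambda>w. H n w x)"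
    proof (rule Bochner_Integration.integrable_bound[OF intA[of n]])
      show "AE w in lborel. norm (H n w x) \<le> norm (A n w)"
        by (rule AE_I2, rule order_trans[OF sbd_dec[OF HA]]) (use A0 in \<open>auto intro!: mult_left_le dec_le_1\<close>)
    qed (use Hm in \<open>simp add: H_def\<close>)
    from Bochner_Integration.integrable_diff[OF 1 this]
    show "integrable lborel (\<lambda>w. indicator (cball 0 (real n)) w *\<^sub>R K (grid (m n) w) x)"
      by (simp add: H_def)
  qed
  have diff1: "sbd N N (LINT w|lborel. A n w) (\<lambda>x. \<phi> x - S n x)" for n
  proof -
    have "sbd N (Suc N) (LINT w|lborel. A n w) (\<lambda>x. LINT w|lborel. H n w x)"
      by (rule sbd_integral[OF HA _ intA]) (use Hm in \<open>simp add: H_def\<close>)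
    then have "sbd N N (LINT w|lborel. A n w) (\<lambda>x. LINT w|lborel. H n w x)" by (rule sbd_mono) auto
    moreover have "(\<lambda>x. LINT w|lborel. H n w x) = (\<lambda>x. \<phi> x - S n x)"
      unfolding H_def S_def \<phi>(2) using Hint by auto
    ultimately show ?thesis by simp
  qed
  \<comment> \<open>The value \<open>u \<phi>\<close> and the integral of \<open>u (K w)\<close> are
    compared with the same number \<open>u (S n)\<close>, each with an error controlled by the
    integral of \<open>A n\<close>.\<close>
  have 1: "cmod (u \<phi> - u (S n)) \<le> Cu * (LINT w|lborel. A n w)" for n
    using Cu(2)[OF schwartz_diff[OF \<phi>(1) SS] diff1] by (simp add: tempered_diff[OF u \<phi>(1) SS])
  have 2: "cmod ((LINT w|lborel. u (K w)) - u (S n)) \<le> Cu * (LINT w|lborel. A n w)" for n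
  proof -
    have uH: "u (H n w) = u (K w) - indicator (cball 0 (real n)) w *\<^sub>R u (K (grid (m n) w))" for w
      unfolding H_def by (auto simp: tempered_diff[OF u KS KS] indicator_def)
    have HS: "H n w \<in> schwartz" for w
      unfolding H_def by (auto simp: indicator_def intro: KS schwartz_diff)
    have bH: "cmod (u (H n w)) \<le> Cu * A n w" for w
      by (rule Cu(2)[OF HS sbd_mono[OF HA]]) auto
    have mH: "(\<lambda>w. u (H n w)) \<in> borel_measurable borel" unfolding uH
      by (intro borel_measurable_diff borel_measurable_scaleR borel_measurable_indicator uKm uKgm) simp
    have iH: "integrable lborel (\<lambda>w. u (H n w))"
      by (rule Bochner_Integration.integrable_bound[of _ "\<lambda>w. Cu * A n w"]) (use intA bH mH Cu A0 in auto)
    have iK: "integrable lborel (\<lambda>w. u (K w))"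
    proof (rule Bochner_Integration.integrable_bound[of _ "\<lambda>w. Cu * (C1 * ?d w)"])
      show "AE w in lborel. norm (u (K w)) \<le> norm (Cu * (C1 * ?d w))"
        by (rule AE_I2, rule order_trans[OF Cu(2)[OF KS sbd_mono[OF C1]]]) auto
    qed (use int_d uKm in auto)
    have "(LINT w|lborel. u (K w)) - u (S n) = (LINT w|lborel. u (H n w))"
      using Bochner_Integration.integrable_diff[OF iK iH] iK unfolding uS uH
      by (subst Bochner_Integration.integral_diff) auto
    also have "cmod \<dots> \<le> (LINT w|lborel. Cu * A n w)"
      by (rule order_trans[OF integral_norm_bound integral_mono]) (use iH intA bH in auto)
    finally show ?thesis by simp
  qed
  have "cmod (u \<phi> - (LINT w|lborel. u (K w))) \<le> 2 * (Cu * (LINT w|lborel. A n w))" for n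
    using norm_triangle_ineq4[of "u \<phi> - u (S n)" "(LINT w|lborel. u (K w)) - u (S n)"] 1[of n] 2[of n] by simp
  moreover have "(\<lambda>n. 2 * (Cu * (LINT w|lborel. A n w))) \<longlonglongrightarrow> 2 * (Cu * 0)"
    by (intro tendsto_intros A_lim)
  ultimately have "cmod (u \<phi> - (LINT w|lborel. u (K w))) \<le> 2 * (Cu * 0)"
    by (intro tendsto_lowerbound[where f = "\<lambda>n. 2 * (Cu * (LINT w|lborel. A n w))" and F = sequentially]) auto
  then show ?thesis by simp
qed

section \<open>Time-frequency shifts and the transform of a tempered functional\<close>

definition tfshift :: "'a::euclidean_space \<times> 'a \<Rightarrow> ('a \<Rightarrow> complex) \<Rightarrow> 'a \<Rightarrow> complex"
  where "tfshift w g = modulation (snd w) (translation (fst w) g)"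

lemma stft_tfshift: "stft g u x \<xi> = u (\<lambda>t. cnj (tfshift (x, \<xi>) g t))"
  by (simp add: stft_def duality_def tfshift_def)

lemma schwartz_tfshift: "g \<in> schwartz \<Longrightarrow> tfshift w g \<in> schwartz"
  by (simp add: tfshift_def schwartz_modulation schwartz_translation)

lemma norm_fst_snd_le: "norm (fst w) \<le> norm w" "norm (snd w) \<le> norm w"
  using norm_fst_le[of "fst w" "snd w"] norm_snd_le[of "snd w" "fst w"] by simp_all

lemma sbd_tfshift:
  fixes g :: "'a::euclidean_space \<Rightarrow> complex"
  assumes "sbd n k A g"
  shows "sbd n k ((1 + 2 * pi) ^ n * DIM('a) ^ n * A * (1 + norm w) ^ (n + k)) (tfshift w g)"
  unfolding tfshift_def translation_def
proof (rule sbd_mono[OF sbd_modulation[OF sbd_translate[OF assms]]])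
  have A: "0 \<le> A" by (rule sbd_nonneg[OF assms])
  have 1: "1 + 2 * pi * norm (snd w) \<le> (1 + 2 * pi) * (1 + norm w)"
  proof -
    have "2 * pi * norm (snd w) \<le> 2 * pi * norm w" using norm_fst_snd_le[of w] by (intro mult_left_mono) auto
    moreover have "(1 + 2 * pi) * (1 + norm w) = 1 + 2 * pi * norm w + (2 * pi + norm w)" by (simp add: algebra_simps)
    moreover have "0 \<le> 2 * pi + norm w" by simp
    ultimately show ?thesis by linarith
  qed
  have "(1 + 2 * pi * norm (snd w)) ^ n * (DIM('a) ^ n * ((1 + norm (fst w)) ^ k * A))
    \<le> ((1 + 2 * pi) * (1 + norm w)) ^ n * (DIM('a) ^ n * ((1 + norm w) ^ k * A))"
    using norm_fst_snd_le[of w] A 1 by (intro mult_mono power_mono mult_left_mono mult_right_mono) auto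
  also have "\<dots> = (1 + 2 * pi) ^ n * DIM('a) ^ n * A * (1 + norm w) ^ (n + k)"
    by (simp add: power_mult_distrib power_add mult_ac)
  finally show "(1 + 2 * pi * norm (snd w)) ^ n * (DIM('a) ^ n * ((1 + norm (fst w)) ^ k * A))
    \<le> (1 + 2 * pi) ^ n * DIM('a) ^ n * A * (1 + norm w) ^ (n + k)" .
qed auto

text \<open>Split into a change of frequency and a change of position: \<open>M_\<xi>' (M_(\<xi> -
  \<xi>') - 1) T_x g + M_\<xi>' T_x' (T_(x - x') - 1) g\<close>. Both inner differences gain
  \<open>norm (w - w')\<close>; the outer shifts and the decay spent on the modulation cost at most
  \<open>2 * N + 1\<close> powers of \<open>1 + norm w\<close>.\<close>

lemma sbd_tfshift_diff:
  fixes g :: "'a::euclidean_space \<Rightarrow> complex"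
  assumes g: "g \<in> schwartz"
  shows "\<exists>C\<ge>0. \<forall>w w'. norm (w - w') \<le> 1 \<longrightarrow>
     sbd N N (C * (norm (w - w') * (1 + norm w) ^ (2 * N + 1))) (\<lambda>t. tfshift w g t - tfshift w' g t)"
proof -
  obtain A where A: "sbd (Suc N) (Suc N) A g" using schwartz_sbd[OF g] by blast
  have A0: "0 \<le> A" by (rule sbd_nonneg[OF A])
  let ?D = "real DIM('a)" and ?p = "2 * (1 + 2 * pi)"
  let ?c1 = "real (Suc N) * (2 * pi) * (1 + 2 * pi) ^ N"
  let ?C = "?p ^ N * (?c1 * ?D ^ N * A) + ?p ^ N * (?D ^ N * (2 ^ N * (2 ^ N * ?D * A)))"
  have "sbd N N (?C * (norm (w - w') * (1 + norm w) ^ (2 * N + 1))) (\<lambda>t. tfshift w g t - tfshift w' g t)"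
    if w: "norm (w - w') \<le> 1" for w w' :: "'a \<times> 'a"
  proof -
    obtain x \<xi> x' \<xi>' where ww: "w = (x, \<xi>)" "w' = (x', \<xi>')" by (cases w, cases w')
    let ?n = "norm (w - w')" and ?W = "1 + norm w"
    have nx: "norm (x - x') \<le> ?n" and n\<xi>: "norm (\<xi> - \<xi>') \<le> ?n"
      using norm_fst_snd_le[of "w - w'"] by (auto simp: ww)
    have nw: "norm w' \<le> norm w + 1" using norm_triangle_ineq4[of w "w - w'"] w by simp
    have W1: "1 \<le> ?W" by simp
    have fx: "1 + norm x \<le> ?W" using norm_fst_snd_le[of w] by (simp add: ww)
    have fx': "1 + norm x' \<le> 2 * ?W" 
    proof -
      have "norm x' \<le> norm w'" using norm_fst_snd_le(1)[of w'] by (simp add: ww)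
      then show ?thesis using nw norm_ge_zero[of w] by argo
    qed
    have f\<xi>': "1 + 2 * pi * norm \<xi>' \<le> ?p * ?W"
    proof -
      have "norm \<xi>' \<le> norm w'" using norm_fst_snd_le(2)[of w'] by (simp add: ww)
      then have "norm \<xi>' \<le> 2 * ?W" using nw norm_ge_zero[of w] by argo
      then have "2 * pi * norm \<xi>' \<le> 2 * pi * (2 * ?W)" by (intro mult_left_mono) auto
      then have "1 + 2 * pi * norm \<xi>' \<le> 2 * ?W + 2 * pi * (2 * ?W)"
        by (rule add_mono[rotated]) (use norm_ge_zero[of w] in argo)
      also have "\<dots> = ?p * ?W" by (simp add: algebra_simps)
      finally show ?thesis .
    qed
    have 1: "sbd N N (?p ^ N * (?c1 * ?D ^ N * A) * (?n * ?W ^ (2 * N + 1)))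
      (modulation \<xi>' (\<lambda>t. modulation (\<xi> - \<xi>') (translation x g) t - translation x g t))"
    proof -
      have t: "sbd N (Suc N) (?D ^ N * ((1 + norm x) ^ Suc N * A)) (translation x g)"
      proof -
        have "sbd N (Suc N) A g" by (rule sbd_mono[OF A]) auto
        from sbd_translate[OF this, of x] show ?thesis by (simp add: translation_def)
      qed
      have "norm (\<xi> - \<xi>') \<le> 1" using n\<xi> w by linarith
      from sbd_modulation[OF sbd_modulation_diff[OF t this], of \<xi>']
      show ?thesis
      proof (rule sbd_mono)
        have "(1 + 2 * pi * norm \<xi>') ^ N * (?c1 * (norm (\<xi> - \<xi>') * (?D ^ N * ((1 + norm x) ^ Suc N * A))))
           \<le> (?p * ?W) ^ N * (?c1 * (?n * (?D ^ N * (?W ^ Suc N * A))))"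
          using A0 n\<xi> f\<xi>' fx by (intro mult_mono power_mono mult_nonneg_nonneg) auto
        also have "\<dots> = ?p ^ N * (?c1 * ?D ^ N * A) * (?n * (?W ^ N * ?W ^ Suc N))"
          by (simp only: power_mult_distrib mult_ac)
        also have "?W ^ N * ?W ^ Suc N = ?W ^ (2 * N + 1)" by (simp add: power_add[symmetric] mult_2)
        finally show "(1 + 2 * pi * norm \<xi>') ^ N * (?c1 * (norm (\<xi> - \<xi>') * (?D ^ N * ((1 + norm x) ^ Suc N * A))))
           \<le> ?p ^ N * (?c1 * ?D ^ N * A) * (?n * ?W ^ (2 * N + 1))" .
      qed auto
    qed
    have 2: "sbd N N (?p ^ N * (?D ^ N * (2 ^ N * (2 ^ N * ?D * A))) * (?n * ?W ^ (2 * N + 1)))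
      (modulation \<xi>' (translation x' (\<lambda>t. g (t - (x - x')) - g t)))"
    proof -
      have "norm (x - x') \<le> 1" using nx w by linarith
      moreover have "sbd (Suc N) N A g" by (rule sbd_mono[OF A]) auto
      ultimately have t: "sbd N N (2 ^ N * (?D * (norm (x - x') * A))) (\<lambda>t. g (t - (x - x')) - g t)"
        by (intro sbd_translate_diff)
      show ?thesis unfolding translation_def
      proof (rule sbd_mono[OF sbd_modulation[OF sbd_translate[OF t]]])
        have "(1 + 2 * pi * norm \<xi>') ^ N * (?D ^ N * ((1 + norm x') ^ N * (2 ^ N * (?D * (norm (x - x') * A)))))
          \<le> (?p * ?W) ^ N * (?D ^ N * ((2 * ?W) ^ N * (2 ^ N * (?D * (?n * A)))))"
          using A0 nx f\<xi>' fx' by (intro mult_mono power_mono mult_nonneg_nonneg) auto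
        also have "\<dots> = ?p ^ N * (?D ^ N * (2 ^ N * (2 ^ N * ?D * A))) * (?n * (?W ^ N * ?W ^ N))"
          by (simp only: power_mult_distrib mult_ac)
        also have "\<dots> \<le> ?p ^ N * (?D ^ N * (2 ^ N * (2 ^ N * ?D * A))) * (?n * ?W ^ (2 * N + 1))"
        proof -
          have "?W ^ N * ?W ^ N = ?W ^ (2 * N)" by (simp add: power_add[symmetric] mult_2)
          also have "\<dots> \<le> ?W ^ (2 * N + 1)" by (rule power_increasing) auto
          finally show ?thesis using A0 by (intro mult_left_mono) auto
        qed
        finally show "(1 + 2 * pi * norm \<xi>') ^ N * (real (DIM('a) ^ N) * ((1 + norm x') ^ N * (2 ^ N * (?D * (norm (x - x') * A)))))
          \<le> ?p ^ N * (?D ^ N * (2 ^ N * (2 ^ N * ?D * A))) * (?n * ?W ^ (2 * N + 1))" by simp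
      qed auto
    qed
    have "(\<lambda>t. tfshift w g t - tfshift w' g t) = (\<lambda>t. modulation \<xi>' (\<lambda>t. modulation (\<xi> - \<xi>') (translation x g) t - translation x g t) t
       + modulation \<xi>' (translation x' (\<lambda>t. g (t - (x - x')) - g t)) t)"
    proof
      fix t
      have "cis (2 * pi * (\<xi>' \<bullet> t)) * cis (2 * pi * ((\<xi> - \<xi>') \<bullet> t)) = cis (2 * pi * (\<xi> \<bullet> t))"
        by (simp add: cis_mult inner_diff_left right_diff_distrib)
      moreover have "t - x' - (x - x') = t - x" by simp
      ultimately show "tfshift w g t - tfshift w' g t = modulation \<xi>' (\<lambda>t. modulation (\<xi> - \<xi>') (translation x g) t - translation x g t) t
       + modulation \<xi>' (translation x' (\<lambda>t. g (t - (x - x')) - g t)) t"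
        by (simp only: tfshift_def ww modulation_def translation_def right_diff_distrib mult.assoc[symmetric] fst_conv snd_conv) simp
    qed
    then show ?thesis using sbd_add[OF 1 2] by (simp add: distrib_right)
  qed
  moreover have "0 \<le> ?C" using A0 by simp
  ultimately show ?thesis by blast
qed

lemma sbd_tfshift_bound:
  fixes g :: "'a::euclidean_space \<Rightarrow> complex"
  assumes g: "g \<in> schwartz"
  shows "\<exists>C\<ge>0. \<forall>w. sbd N N (C * (1 + norm w) ^ (2 * N)) (tfshift w g)"
proof -
  obtain A where A: "sbd N N A g" using schwartz_sbd[OF g] by blast
  show ?thesis
  proof (intro exI[of _ "(1 + 2 * pi) ^ N * DIM('a) ^ N * A"] conjI allI)
    show "0 \<le> (1 + 2 * pi) ^ N * DIM('a) ^ N * A" using sbd_nonneg[OF A] by simp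
    show "sbd N N ((1 + 2 * pi) ^ N * DIM('a) ^ N * A * (1 + norm w) ^ (2 * N)) (tfshift w g)" for w
      using sbd_tfshift[OF A, of w] by (simp only: mult_2)
  qed
qed

lemma stft_poly_growth:
  fixes g :: "'a::euclidean_space \<Rightarrow> complex"
  assumes u: "u \<in> tempered" and g: "g \<in> schwartz"
  shows "\<exists>C\<ge>0. \<exists>N. \<forall>w. cmod (stft g u (fst w) (snd w)) \<le> C * (1 + norm w) ^ N"
proof -
  obtain Cu N where Cu: "0 \<le> Cu" "\<And>\<phi> A. \<phi> \<in> schwartz \<Longrightarrow> sbd N N A \<phi> \<Longrightarrow> cmod (u \<phi>) \<le> Cu * A"
    using tempered_bound[OF u] by blast
  obtain C where C: "0 \<le> C" "\<And>w. sbd N N (C * (1 + norm w) ^ (2 * N)) (tfshift w g)"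
    using sbd_tfshift_bound[OF g] by blast
  have "cmod (stft g u (fst w) (snd w)) \<le> Cu * C * (1 + norm w) ^ (2 * N)" for w
    using Cu(2)[OF schwartz_cnj[OF schwartz_tfshift[OF g, of w]] sbd_cnj[OF C(2)]]
    by (simp add: stft_tfshift mult.assoc)
  then show ?thesis using Cu C by (intro exI[of _ "Cu * C"] conjI exI[of _ "2 * N"]) auto
qed

text \<open>The map \<open>w \<mapsto> tfshift w g\<close> is locally Lipschitz in every Schwartz
  seminorm, and \<open>u\<close> is bounded by one of them. Continuity supplies the joint
  measurability that all later Tonelli arguments rest on.\<close>

lemma stft_continuous:
  fixes g :: "'a::euclidean_space \<Rightarrow> complex"
  assumes u: "u \<in> tempered" and g: "g \<in> schwartz"
  shows "continuous_on UNIV (\<lambda>w. stft g u (fst w) (snd w))"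
  unfolding continuous_on_iff
proof safe
  fix a b :: 'a and e :: real assume e: "0 < e"
  obtain Cu N where Cu: "0 \<le> Cu" "\<And>\<phi> A. \<phi> \<in> schwartz \<Longrightarrow> sbd N N A \<phi> \<Longrightarrow> cmod (u \<phi>) \<le> Cu * A"
    using tempered_bound[OF u] by blast
  obtain C where C: "0 \<le> C" "\<And>w w'. norm (w - w') \<le> 1 \<Longrightarrow>
     sbd N N (C * (norm (w - w') * (1 + norm w) ^ (2 * N + 1))) (\<lambda>t. tfshift w g t - tfshift w' g t)"
    using sbd_tfshift_diff[OF g, of N] by blast
  let ?w = "(a, b)"
  let ?K = "Cu * (C * (1 + norm ?w) ^ (2 * N + 1))"
  have K0: "0 \<le> ?K" using Cu C by simp
  show "\<exists>d>0. \<forall>x'\<in>UNIV. dist x' ?w < d \<longrightarrow> dist (stft g u (fst x') (snd x')) (stft g u (fst ?w) (snd ?w)) < e"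
  proof (intro exI[of _ "min 1 (e / (?K + 1))"] conjI ballI impI)
    fix w' assume y: "dist w' ?w < min 1 (e / (?K + 1))"
    then have n: "norm (?w - w') \<le> 1" by (simp add: dist_norm norm_minus_commute)
    have "dist (stft g u (fst w') (snd w')) (stft g u (fst ?w) (snd ?w)) = cmod (u (\<lambda>t. cnj (tfshift ?w g t - tfshift w' g t)))"
      by (simp add: stft_tfshift dist_norm norm_minus_commute tempered_diff[OF u schwartz_cnj[OF schwartz_tfshift[OF g]] schwartz_cnj[OF schwartz_tfshift[OF g]]])
    also have "\<dots> \<le> Cu * (C * (norm (?w - w') * (1 + norm ?w) ^ (2 * N + 1)))"
      by (rule Cu(2)[OF schwartz_cnj[OF schwartz_diff] sbd_cnj[OF C(2)[OF n]]]) (intro schwartz_tfshift g)+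
    also have "\<dots> \<le> (?K + 1) * norm (?w - w')" by (simp add: algebra_simps)
    also have "\<dots> < (?K + 1) * (e / (?K + 1))"
      using y K0 by (intro mult_strict_left_mono) (auto simp: dist_norm norm_minus_commute)
    also have "\<dots> = e" using K0 by simp
    finally show "dist (stft g u (fst w') (snd w')) (stft g u (fst ?w) (snd ?w)) < e" .
  qed (use e K0 in auto)
qed

lemma stft_measurable:
  fixes g :: "'a::euclidean_space \<Rightarrow> complex"
  assumes "u \<in> tempered" "g \<in> schwartz"
  shows "(\<lambda>w. stft g u (fst w) (snd w)) \<in> borel_measurable borel"
  by (rule borel_measurable_continuous_onI[OF stft_continuous[OF assms]])

lemma schwartz_stft:
  assumes "\<phi> \<in> schwartz" "g \<in> schwartz"
  shows "(\<lambda>w. stft g (dist_of_fun \<phi>) (fst w) (snd w)) \<in> schwartz"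
  unfolding schwartz_iff_sbd
proof (intro allI)
  fix n k
  obtain C M where C: "\<And>\<phi> g A B. sbd M M A \<phi> \<Longrightarrow> sbd M M B g \<Longrightarrow>
     sbd n k (C * (A * B)) (\<lambda>w. stft (g :: 'a \<Rightarrow> complex) (dist_of_fun \<phi>) (fst w) (snd w))"
    using sbd_stft[of n k, where 'a='a] by blast
  obtain A B where "sbd M M A \<phi>" "sbd M M B g" using assms schwartz_sbd by blast
  from C[OF this] show "\<exists>C. sbd n k C (\<lambda>w. stft g (dist_of_fun \<phi>) (fst w) (snd w))" ..
qed

text \<open>For fixed \<open>x\<close>, Fourier inversion in \<open>\<xi>\<close> recovers
  \<open>\<phi> t * cnj (g (t - x))\<close>; the remaining factor \<open>g (t - x)\<close> completes
  the square, and integrating over \<open>x\<close> gives the energy of the window.\<close>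

lemma stft_fun_inversion:
  fixes \<phi> g :: "'a::euclidean_space \<Rightarrow> complex"
  assumes \<phi>: "\<phi> \<in> schwartz" and g: "g \<in> schwartz"
  shows "(LINT w|lborel. stft g (dist_of_fun \<phi>) (fst w) (snd w) * tfshift w g t)
    = \<phi> t * of_real (LINT z|lborel. (cmod (g z))\<^sup>2)"
proof -
  let ?V = "\<lambda>w. stft g (dist_of_fun \<phi>) (fst w) (snd w)"
  obtain B where B: "sbd 0 (2 * DIM('a)) B g" using schwartz_sbd[OF g] by blast
  obtain A where A: "sbd 0 (2 * DIM('a \<times> 'a)) A ?V" using schwartz_sbd[OF schwartz_stft[OF \<phi> g]] by blast
  have [measurable]: "g \<in> borel_measurable borel" "?V \<in> borel_measurable borel"
    by (rule sbd_measurable[OF B], rule sbd_measurable[OF A])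
  have gB: "cmod (g x) \<le> B" for x
    using order_trans[OF sbd_dec[OF B] mult_left_mono[OF dec_le_1 sbd_nonneg[OF B]]] by simp
  have tm: "(\<lambda>w. tfshift w g t) \<in> borel_measurable borel"
    unfolding tfshift_def modulation_def translation_def
    by (intro borel_measurable_continuous_onI continuous_intros continuous_on_compose2[OF sbd_continuous[OF B]]) auto
  have i: "integrable lborel (\<lambda>w. ?V w * tfshift w g t)"
  proof (rule Bochner_Integration.integrable_bound[of _ "\<lambda>w. B * cmod (?V w)"])
    show "integrable lborel (\<lambda>w. B * cmod (?V w))"
      using sbd_integrable[OF A order_refl] by simp
    show "AE w in lborel. norm (?V w * tfshift w g t) \<le> norm (B * cmod (?V w))"
      using gB sbd_nonneg[OF B]
      by (intro AE_I2) (simp add: norm_mult tfshift_def modulation_def translation_def mult.commute[of _ "cmod (g _)"] mult_right_mono)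
  qed (use tm in measurable)
  have inner: "(LINT \<xi>|lborel. ?V (x, \<xi>) * tfshift (x, \<xi>) g t) = \<phi> t * of_real ((cmod (g (t - x)))\<^sup>2)" for x
  proof -
    let ?f = "\<lambda>s. \<phi> s * cnj (g (s - x))"
    obtain A1 where A1: "sbd 0 (2 * DIM('a)) A1 \<phi>" using schwartz_sbd[OF \<phi>] by blast
    have f0: "sbd 0 (2 * DIM('a) + 2 * DIM('a)) (2 ^ 0 * (A1 * (DIM('a) ^ 0 * ((1 + norm x) ^ (2 * DIM('a)) * B)))) ?f"
      by (rule sbd_mult[OF A1 sbd_cnj[OF sbd_translate[OF B]]])
    then obtain D where f: "sbd 0 (2 * DIM('a)) D ?f" using sbd_mono[OF f0 order_refl le_add1 order_refl] by blast
    have "(LINT \<xi>|lborel. cis (2 * pi * (\<xi> \<bullet> t)) * ?V (x, \<xi>)) = ?f t"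
    proof (rule fourier_inversion[OF sbd_continuous[OF f]])
      show "cmod (?f s) \<le> D" for s
        using order_trans[OF sbd_dec[OF f] mult_left_mono[OF dec_le_1 sbd_nonneg[OF f]]] by simp
      show "integrable lborel ?f" by (rule sbd_integrable[OF f order_refl])
      show "?V (x, \<xi>) = (LINT t|lborel. cis (- (2 * pi * (\<xi> \<bullet> t))) * ?f t)" for \<xi>
        by (simp add: stft_dist_of_fun)
      show "integrable lborel (\<lambda>\<xi>. ?V (x, \<xi>))"
        by (rule sbd_integrable[OF sbd_slice[OF A]]) simp
    qed
    moreover have "(LINT \<xi>|lborel. ?V (x, \<xi>) * tfshift (x, \<xi>) g t) = g (t - x) * (LINT \<xi>|lborel. cis (2 * pi * (\<xi> \<bullet> t)) * ?V (x, \<xi>))"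
      by (simp add: tfshift_def modulation_def translation_def mult_ac flip: integral_mult_right_zero)
    ultimately have "(LINT \<xi>|lborel. ?V (x, \<xi>) * tfshift (x, \<xi>) g t) = \<phi> t * (g (t - x) * cnj (g (t - x)))"
      by (simp only: mult_ac)
    then show ?thesis by (simp only: complex_norm_square)
  qed
  have "(LINT w|lborel. ?V w * tfshift w g t) = (LINT x|lborel. LINT \<xi>|lborel. ?V (x, \<xi>) * tfshift (x, \<xi>) g t)"
    using lborel_pair.integral_fst'[of "\<lambda>w. ?V w * tfshift w g t"] i unfolding lborel_prod by simp
  also have "\<dots> = (LINT x|lborel. \<phi> t * of_real ((cmod (g (t - x)))\<^sup>2))"
    by (simp only: inner)
  also have "\<dots> = \<phi> t * of_real (LINT x|lborel. (cmod (g (t - x)))\<^sup>2)"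
    by (simp only: integral_mult_right_zero integral_complex_of_real)
  also have "(LINT x|lborel. (cmod (g (t - x)))\<^sup>2) = (LINT z|lborel. (cmod (g z))\<^sup>2)"
    by (rule integral_lborel_reflect) measurable
  finally show ?thesis .
qed

text \<open>\<open>tempered_integral\<close> applied to \<open>K w\<close>, whose integral over
  \<open>w\<close> is a multiple of \<open>\<phi>\<close> by \<open>stft_fun_inversion\<close>; the
  decay of \<open>V\<close> beats the polynomial growth of the seminorms of
  \<open>tfshift w g\<close>. The conjugates arise because functionals act linearly on
  \<open>\<phi>\<close>, while \<open>stft\<close> pairs antilinearly. At
  \<open>\<phi> = cnj b\<close> this is Moyal's identity between a functional and a Schwartz
  function.\<close>

theorem stft_inversion:
  fixes \<phi> g :: "'a::euclidean_space \<Rightarrow> complex"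
  assumes u: "u \<in> tempered" and \<phi>: "\<phi> \<in> schwartz" and g: "g \<in> schwartz"
  shows "u \<phi> * of_real (LINT z|lborel. (cmod (g z))\<^sup>2)
    = (LINT w|lborel. stft g u (fst w) (snd w) * cnj (stft g (dist_of_fun (\<lambda>x. cnj (\<phi> x))) (fst w) (snd w)))"
proof -
  let ?\<chi> = "\<lambda>x. cnj (\<phi> x)"
  let ?n = "complex_of_real (LINT z|lborel. (cmod (g z))\<^sup>2)"
  let ?M = "2 * DIM('a \<times> 'a)"
  define V where "V w = stft g (dist_of_fun ?\<chi>) (fst w) (snd w)" for w
  define K where "K w = (\<lambda>t. cnj (V w * tfshift w g t))" for w
  have V: "V \<in> schwartz" unfolding V_def by (intro schwartz_stft schwartz_cnj \<phi> g)
  have KS: "(\<lambda>t. V w * tfshift w g t) \<in> schwartz" for w by (intro schwartz_cmult schwartz_tfshift g)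
  have "u (\<lambda>t. ?n * \<phi> t) = (LINT w|lborel. u (K w))"
  proof (rule tempered_integral[OF u])
    fix N
    obtain C where C: "0 \<le> C" "\<And>w. sbd N N (C * (1 + norm w) ^ (2 * N)) (tfshift w g)"
      using sbd_tfshift_bound[OF g] by blast
    obtain D where D: "0 \<le> D" "\<And>w w'. norm (w - w') \<le> 1 \<Longrightarrow>
       sbd N N (D * (norm (w - w') * (1 + norm w) ^ (2 * N + 1))) (\<lambda>t. tfshift w g t - tfshift w' g t)"
      using sbd_tfshift_diff[OF g, of N] by blast
    \<comment> \<open>Order 1 serves the Lipschitz estimate of \<open>V\<close>; of the decay,
      \<open>?M\<close> secures integrability over \<open>w\<close> and \<open>2 * N + 1\<close>
      absorbs the growth of the shifted windows.\<close>
    obtain A where A: "sbd (Suc 0) (?M + (2 * N + 1)) A V" using schwartz_sbd[OF V] by blast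
    have A0: "0 \<le> A" by (rule sbd_nonneg[OF A])
    have VA: "cmod (V w) * (1 + norm w) ^ j \<le> A * dec ?M w" if "j \<le> 2 * N + 1" for w j
    proof -
      have "cmod (V w) * (1 + norm w) ^ j \<le> (A * dec (?M + (2 * N + 1)) w) * (1 + norm w) ^ (2 * N + 1)"
        using that by (intro mult_mono sbd_dec[OF A] power_increasing) (auto simp: A0)
      also have "\<dots> = A * dec ?M w" by (simp only: mult.assoc dec_mult_power)
      finally show ?thesis .
    qed
    show "\<exists>C. \<forall>w. sbd N N (C * dec ?M w) (K w)"
    proof (intro exI allI)
      fix w
      show "sbd N N (A * C * dec ?M w) (K w)" unfolding K_def
      proof (rule sbd_mono[OF sbd_cnj[OF sbd_cmult[OF C(2)]]])
        show "cmod (V w) * (C * (1 + norm w) ^ (2 * N)) \<le> A * C * dec ?M w"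
          using mult_left_mono[OF VA[of "2 * N" w] C(1)] by (simp add: mult_ac)
      qed auto
    qed
    let ?E = "DIM('a \<times> 'a) * 2 ^ (?M + (2 * N + 1))"
    show "\<exists>C. \<forall>w w'. norm (w - w') \<le> 1 \<longrightarrow> sbd N N (C * (norm (w - w') * dec ?M w)) (\<lambda>t. K w t - K w' t)"
    proof (intro exI allI impI)
      fix w w' :: "'a \<times> 'a" assume n: "norm (w - w') \<le> 1"
      have nw: "1 + norm w' \<le> 2 * (1 + norm w)" using norm_triangle_ineq4[of w "w - w'"] n norm_ge_zero[of w]
        unfolding diff_diff_eq2 add_diff_cancel_left' by argo
      \<comment> \<open>Discrete product rule: either the shifted window or the coefficient
        \<open>V\<close> varies. The second part uses \<open>?E\<close>, which is the Lipschitz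
        factor of \<open>V\<close> from \<open>sbd_lipschitz\<close>.\<close>
      have e: "(\<lambda>t. K w t - K w' t) = (\<lambda>t. cnj (V w * (tfshift w g t - tfshift w' g t) + (V w - V w') * tfshift w' g t))"
        by (rule ext) (simp add: K_def algebra_simps)
      have "cmod (V w) * (D * (norm (w - w') * (1 + norm w) ^ (2 * N + 1))) + cmod (V w - V w') * (C * (1 + norm w') ^ (2 * N))
        \<le> A * D * (norm (w - w') * dec ?M w) + (?E * A * 2 ^ (2 * N) * C) * (norm (w - w') * dec ?M w)"
      proof (rule add_mono)
        show "cmod (V w) * (D * (norm (w - w') * (1 + norm w) ^ (2 * N + 1))) \<le> A * D * (norm (w - w') * dec ?M w)"
          using mult_left_mono[OF VA[of "2 * N + 1" w], of "D * norm (w - w')"] D(1) by (simp add: mult_ac)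
        have "cmod (V w' - V w) \<le> 2 ^ (?M + (2 * N + 1)) * (DIM('a \<times> 'a) * (norm (w - w') * A)) * dec (?M + (2 * N + 1)) w"
          using sbd_lipschitz[OF A n, of w] unfolding le_dec_iff by simp
        then have "cmod (V w - V w') * (C * (1 + norm w') ^ (2 * N))
           \<le> (2 ^ (?M + (2 * N + 1)) * (DIM('a \<times> 'a) * (norm (w - w') * A)) * dec (?M + (2 * N + 1)) w) * (C * (2 * (1 + norm w)) ^ (2 * N))"
          using nw C(1) A0 by (intro mult_mono power_mono) (auto simp: norm_minus_commute)
        also have "\<dots> \<le> (2 ^ (?M + (2 * N + 1)) * (DIM('a \<times> 'a) * (norm (w - w') * A)) * dec (?M + 2 * N) w) * (C * (2 * (1 + norm w)) ^ (2 * N))"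
          using C(1) A0 by (intro mult_right_mono mult_left_mono dec_antimono) auto
        also have "\<dots> = (?E * A * 2 ^ (2 * N) * C) * (norm (w - w') * (dec (?M + 2 * N) w * (1 + norm w) ^ (2 * N)))"
          by (simp only: power_mult_distrib mult_ac of_nat_mult of_nat_power of_nat_numeral)
        finally show "cmod (V w - V w') * (C * (1 + norm w') ^ (2 * N)) \<le> (?E * A * 2 ^ (2 * N) * C) * (norm (w - w') * dec ?M w)"
          unfolding dec_mult_power .
      qed
      then show "sbd N N ((A * D + ?E * A * 2 ^ (2 * N) * C) * (norm (w - w') * dec ?M w)) (\<lambda>t. K w t - K w' t)"
        unfolding e distrib_right
        by (intro sbd_mono[OF sbd_cnj[OF sbd_add[OF sbd_cmult[OF D(2)[OF n]] sbd_cmult[OF C(2)]]]]) auto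
    qed
  next
    show "(\<lambda>t. ?n * \<phi> t) \<in> schwartz" by (intro schwartz_cmult \<phi>)
    fix t
    have "cnj (LINT w|lborel. V w * tfshift w g t) = cnj (cnj (\<phi> t) * ?n)"
      unfolding V_def by (simp only: stft_fun_inversion[OF schwartz_cnj[OF \<phi>] g])
    then show "?n * \<phi> t = (LINT w|lborel. K w t)"
      unfolding K_def Bochner_Integration.integral_cnj by (simp only: complex_cnj_mult complex_cnj_cnj complex_cnj_complex_of_real mult.commute)
  qed
  moreover have "u (K w) = stft g u (fst w) (snd w) * cnj (V w)" for w
    unfolding K_def using tempered_cmult[OF u schwartz_cnj[OF schwartz_tfshift[OF g, of w]], of "cnj (V w)"]
    by (simp add: stft_tfshift mult.commute)
  ultimately show ?thesis
    using tempered_cmult[OF u \<phi>, of ?n] by (simp add: V_def mult.commute)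
qed

section \<open>Powers in the extended nonnegative reals and Hoelder's inequality\<close>

text \<open>Unlike \<^const>\<open>epowr\<close>, the power with exponent \<open>0\<close> is \<open>1\<close> also at \<open>0\<close> and \<open>\<infinity>\<close>.\<close>

definition pw :: "ennreal \<Rightarrow> real \<Rightarrow> ennreal"
  where "pw x s = (if s = 0 then 1 else epowr x s)"

lemma pw_0 [simp]: "pw x 0 = 1"
  by (simp add: pw_def)

lemma pw_ennreal: "s \<noteq> 0 \<Longrightarrow> 0 \<le> r \<Longrightarrow> pw (ennreal r) s = ennreal (r powr s)"
  by (simp add: pw_def epowr_def)

lemma pw_top [simp]: "s \<noteq> 0 \<Longrightarrow> pw top s = top"
  by (simp add: pw_def epowr_def)

lemma pw_zero [simp]: "s \<noteq> 0 \<Longrightarrow> pw 0 s = 0"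
  by (simp add: pw_def epowr_def)

lemma pw_1 [simp]: "pw x 1 = x"
  by (cases x) (auto simp: pw_ennreal)

lemma pw_one [simp]: "pw 1 s = 1"
  by (cases "s = 0") (auto simp: pw_def epowr_def)

lemma pw_mono:
  assumes "x \<le> y" "0 \<le> s" shows "pw x s \<le> pw y s"
proof (cases "s = 0 \<or> y = top")
  case False
  then obtain a b where "x = ennreal a" "0 \<le> a" "y = ennreal b" "0 \<le> b"
    using assms by (metis ennreal_cases top.extremum_unique)
  then show ?thesis using False assms by (simp add: pw_ennreal powr_mono2 ennreal_leI)
qed (cases "s = 0"; auto)

lemma pw_mult: "0 \<le> s \<Longrightarrow> pw (x * y) s = pw x s * pw y s"
proof (cases "s = 0")
  case False
  assume "0 \<le> s"
  have t: "pw (top * y) s = top * pw y s" for y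
  proof (cases "y = 0")
    case True then show ?thesis using False by simp
  next
    case y: False
    then have "pw y s \<noteq> 0" using False by (cases y) (auto simp: pw_ennreal ennreal_eq_0_iff)
    then show ?thesis using y False by (simp add: ennreal_top_mult)
  qed
  show ?thesis
  proof (cases "x = top \<or> y = top")
    case True then show ?thesis using t[of x] t[of y] False by (auto simp: mult.commute)
  next
    case F: False
    then obtain a b where "x = ennreal a" "0 \<le> a" "y = ennreal b" "0 \<le> b"
      by (metis ennreal_cases)
    then show ?thesis using False by (simp add: pw_ennreal ennreal_mult[symmetric] powr_mult)
  qed
qed simp

lemma pw_add: "0 \<le> s \<Longrightarrow> 0 \<le> t \<Longrightarrow> pw x (s + t) = pw x s * pw x t"
proof (cases "s = 0 \<or> t = 0")
  case False
  assume "0 \<le> s" "0 \<le> t"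
  then show ?thesis using False
    by (cases x) (auto simp: pw_ennreal powr_add ennreal_mult[symmetric] add_nonneg_eq_0_iff)
qed auto

lemma pw_pw: "pw (pw x s) t = pw x (s * t)"
proof (cases "s = 0 \<or> t = 0")
  case False
  then show ?thesis by (cases x) (auto simp: pw_ennreal powr_powr)
qed auto

lemma pw_eq_0_iff: "s \<noteq> 0 \<Longrightarrow> pw x s = 0 \<longleftrightarrow> x = 0"
  by (cases x) (auto simp: pw_ennreal ennreal_eq_0_iff)

lemma pw_eq_top_iff: "s \<noteq> 0 \<Longrightarrow> pw x s = top \<longleftrightarrow> x = top"
  by (cases x) (auto simp: pw_ennreal)

lemma pw_measurable [measurable]:
  assumes [measurable]: "f \<in> borel_measurable M"
  shows "(\<lambda>x. pw (f x) s) \<in> borel_measurable M"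
  unfolding pw_def epowr_def by measurable

lemma pw_cancel: "0 < s \<Longrightarrow> pw x s \<le> pw y s \<longleftrightarrow> x \<le> y"
  using pw_mono[of x y s] pw_mono[of "pw x s" "pw y s" "1 / s"] by (auto simp: pw_pw)

lemma pw_le_iff: "0 < s \<Longrightarrow> pw x (1 / s) \<le> y \<longleftrightarrow> x \<le> pw y s"
  using pw_cancel[of s "pw x (1/s)" y] by (simp add: pw_pw)

lemma pw_prod: "finite I \<Longrightarrow> 0 \<le> s \<Longrightarrow> pw (\<Prod>i\<in>I. f i) s = (\<Prod>i\<in>I. pw (f i) s)"
  by (induction I rule: finite_induct) (auto simp: pw_mult)

lemma young_pw:
  assumes "0 \<le> \<theta>" "\<theta> \<le> 1"
  shows "pw a \<theta> * pw b (1 - \<theta>) \<le> ennreal \<theta> * a + ennreal (1 - \<theta>) * b"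
proof (cases "\<theta> = 0 \<or> \<theta> = 1")
  case False
  then have \<theta>: "0 < \<theta>" "0 < 1 - \<theta>" using assms by auto
  show ?thesis
  proof (cases "a = top \<or> b = top")
    case True
    then have "ennreal \<theta> * a + ennreal (1 - \<theta>) * b = top"
      using \<theta> by (auto simp: ennreal_mult_top)
    then show ?thesis by (simp only: top_greatest)
  next
    case F: False
    then obtain x y where xy: "a = ennreal x" "0 \<le> x" "b = ennreal y" "0 \<le> y"
      by (metis ennreal_cases)
    show ?thesis
    proof (cases "x = 0 \<or> y = 0")
      case True then show ?thesis using xy \<theta> by auto
    next
      case G: False
      have "x powr \<theta> * y powr (1 - \<theta>) \<le> \<theta> * x + (1 - \<theta>) * y"
        by (rule Youngs_inequality_0) (use \<theta> G xy in auto)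
      then show ?thesis using xy \<theta>
        by (simp add: pw_ennreal ennreal_mult[symmetric] ennreal_plus[symmetric] ennreal_leI del: ennreal_plus)
    qed
  qed
qed auto

text \<open>Young's inequality integrated, after both integrals have been normalized to 1. Vanishing
  and infinite integrals are treated apart because the normalization divides by them. The endpoint
  weights 0 and 1 are included, with \<open>pw x 0 = 1\<close>.\<close>

lemma hoelder2:
  assumes [measurable]: "f \<in> borel_measurable M" "g \<in> borel_measurable M"
    and \<theta>: "0 \<le> \<theta>" "\<theta> \<le> 1"
  shows "(\<integral>\<^sup>+x. pw (f x) \<theta> * pw (g x) (1 - \<theta>) \<partial>M) \<le> pw (\<integral>\<^sup>+x. f x \<partial>M) \<theta> * pw (\<integral>\<^sup>+x. g x \<partial>M) (1 - \<theta>)"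
proof (cases "\<theta> = 0 \<or> \<theta> = 1")
  case False
  then have \<theta>': "0 < \<theta>" "0 < 1 - \<theta>" using \<theta> by auto
  let ?F = "\<integral>\<^sup>+x. f x \<partial>M" and ?G = "\<integral>\<^sup>+x. g x \<partial>M"
  consider "?F = 0" | "?G = 0" | "?F \<noteq> 0" "?G \<noteq> 0" "?F = top \<or> ?G = top" | "?F \<noteq> 0" "?G \<noteq> 0" "?F \<noteq> top" "?G \<noteq> top"
    by blast
  then show ?thesis
  proof cases
    case 1
    then have "AE x in M. f x = 0" by (simp add: nn_integral_0_iff_AE)
    then have "AE x in M. pw (f x) \<theta> * pw (g x) (1 - \<theta>) = 0" by eventually_elim (use \<theta>' in simp)
    then have "(\<integral>\<^sup>+x. pw (f x) \<theta> * pw (g x) (1 - \<theta>) \<partial>M) = 0" by (subst nn_integral_0_iff_AE) auto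
    then show ?thesis by simp
  next
    case 2
    then have "AE x in M. g x = 0" by (simp add: nn_integral_0_iff_AE)
    then have "AE x in M. pw (f x) \<theta> * pw (g x) (1 - \<theta>) = 0" by eventually_elim (use \<theta>' in simp)
    then have "(\<integral>\<^sup>+x. pw (f x) \<theta> * pw (g x) (1 - \<theta>) \<partial>M) = 0" by (subst nn_integral_0_iff_AE) auto
    then show ?thesis by simp
  next
    case 3
    then have "pw ?F \<theta> * pw ?G (1 - \<theta>) = top"
      using \<theta>' pw_eq_0_iff[of \<theta> ?F] pw_eq_0_iff[of "1 - \<theta>" ?G] by (auto simp: ennreal_mult_eq_top_iff)
    then show ?thesis by simp
  next
    case 4
    have Ff: "?F * (f x / ?F) = f x" and Gg: "?G * (g x / ?G) = g x" for x
      using 4 by (metis ennreal_mult_divide_eq ennreal_times_divide mult.commute)+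
    have "pw (f x) \<theta> * pw (g x) (1 - \<theta>) = (pw ?F \<theta> * pw ?G (1 - \<theta>)) * (pw (f x / ?F) \<theta> * pw (g x / ?G) (1 - \<theta>))" for x
    proof -
      have "pw (f x) \<theta> * pw (g x) (1 - \<theta>) = pw (?F * (f x / ?F)) \<theta> * pw (?G * (g x / ?G)) (1 - \<theta>)"
        by (simp only: Ff Gg)
      then show ?thesis using \<theta> by (simp only: pw_mult diff_ge_0_iff_ge mult_ac)
    qed
    then have "(\<integral>\<^sup>+x. pw (f x) \<theta> * pw (g x) (1 - \<theta>) \<partial>M)
       = (pw ?F \<theta> * pw ?G (1 - \<theta>)) * (\<integral>\<^sup>+x. pw (f x / ?F) \<theta> * pw (g x / ?G) (1 - \<theta>) \<partial>M)"
      by (simp add: nn_integral_cmult)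
    also have "\<dots> \<le> (pw ?F \<theta> * pw ?G (1 - \<theta>)) * (\<integral>\<^sup>+x. ennreal \<theta> * (f x / ?F) + ennreal (1 - \<theta>) * (g x / ?G) \<partial>M)"
      using \<theta> by (intro mult_left_mono nn_integral_mono young_pw) auto
    also have "(\<integral>\<^sup>+x. ennreal \<theta> * (f x / ?F) + ennreal (1 - \<theta>) * (g x / ?G) \<partial>M)
       = ennreal \<theta> * (?F / ?F) + ennreal (1 - \<theta>) * (?G / ?G)"
      by (simp add: nn_integral_add nn_integral_cmult nn_integral_divide)
    also have "\<dots> = 1"
    proof -
      have "?F / ?F = 1" "?G / ?G = 1" using 4 by (auto intro!: ennreal_divide_self simp: less_top)
      then show ?thesis using \<theta> by (simp add: ennreal_plus[symmetric] del: ennreal_plus)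
    qed
    finally show ?thesis by simp
  qed
qed auto

text \<open>Induction by splitting off one factor with \<open>hoelder2\<close>; the remaining
  weights are rescaled by \<open>1 - \<theta> i\<close> to have sum 1 again. If
  \<open>\<theta> i = 1\<close>, all others vanish.\<close>

lemma hoelder:
  assumes "finite I" "\<And>i. i \<in> I \<Longrightarrow> f i \<in> borel_measurable M" "\<And>i. i \<in> I \<Longrightarrow> 0 \<le> \<theta> i" "(\<Sum>i\<in>I. \<theta> i) = 1"
  shows "(\<integral>\<^sup>+x. (\<Prod>i\<in>I. pw (f i x) (\<theta> i)) \<partial>M) \<le> (\<Prod>i\<in>I. pw (\<integral>\<^sup>+x. f i x \<partial>M) (\<theta> i))"
  using assms
proof (induction I arbitrary: \<theta> rule: finite_induct)
  case (insert i I)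
  have [measurable]: "f i \<in> borel_measurable M" "\<And>j. j \<in> I \<Longrightarrow> f j \<in> borel_measurable M" using insert by auto
  have s: "(\<Sum>j\<in>I. \<theta> j) = 1 - \<theta> i" using insert by simp
  have s0: "0 \<le> (\<Sum>j\<in>I. \<theta> j)" using insert by (intro sum_nonneg) auto
  show ?case
  proof (cases "\<theta> i = 1")
    case True
    then have "\<theta> j = 0" if "j \<in> I" for j
      using s insert that sum_nonneg_eq_0_iff[of I \<theta>] by auto
    then show ?thesis using insert True by simp
  next
    case False
    let ?r = "1 - \<theta> i"
    have r: "0 < ?r" using False s s0 by linarith
    let ?g = "\<lambda>x. \<Prod>j\<in>I. pw (f j x) (\<theta> j / ?r)"
    have e: "(\<Prod>j\<in>I. pw (a j) (\<theta> j)) = pw (\<Prod>j\<in>I. pw (a j) (\<theta> j / ?r)) ?r" for a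
      using r insert by (simp add: pw_prod pw_pw)
    have "(\<integral>\<^sup>+x. (\<Prod>j\<in>insert i I. pw (f j x) (\<theta> j)) \<partial>M) = (\<integral>\<^sup>+x. pw (f i x) (\<theta> i) * pw (?g x) ?r \<partial>M)"
      using insert by (simp add: e)
    also have "\<dots> \<le> pw (\<integral>\<^sup>+x. f i x \<partial>M) (\<theta> i) * pw (\<integral>\<^sup>+x. ?g x \<partial>M) ?r"
      by (rule hoelder2) (use insert r in auto)
    also have "\<dots> \<le> pw (\<integral>\<^sup>+x. f i x \<partial>M) (\<theta> i) * pw (\<Prod>j\<in>I. pw (\<integral>\<^sup>+x. f j x \<partial>M) (\<theta> j / ?r)) ?r"
    proof (intro mult_left_mono pw_mono insert.IH)
      show "(\<Sum>j\<in>I. \<theta> j / ?r) = 1" using s r by (simp add: sum_divide_distrib[symmetric])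
    qed (use insert r in auto)
    also have "\<dots> = (\<Prod>j\<in>insert i I. pw (\<integral>\<^sup>+x. f j x \<partial>M) (\<theta> j))"
      using insert by (simp add: e)
    finally show ?thesis .
  qed
qed simp

section \<open>Mixed Lebesgue norms\<close>

lemma Lnorm_finite:
  assumes "0 < p" shows "Lnorm (ennreal p) F = pw (\<integral>\<^sup>+x. pw (F x) p \<partial>lborel) (1 / p)"
  using assms by (simp add: Lnorm_def pw_def)

text \<open>Identifies the limes superior with the essential supremum: the strict bounds by
  \<open>a + 1 / (n + 1)\<close> hold almost everywhere for all \<open>n\<close>
  simultaneously.\<close>

lemma Lnorm_top_le_iff: "Lnorm top F \<le> c \<longleftrightarrow> (AE x in lborel. F x \<le> c)"
proof
  assume "Lnorm top F \<le> c"
  then have *: "y > c \<Longrightarrow> AE x in lborel. F x < y" for y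
    by (simp add: Lnorm_def Limsup_le_iff)
  show "AE x in lborel. F x \<le> c"
  proof (cases "c = top")
    case False
    then obtain a where a: "c = ennreal a" "0 \<le> a" by (metis ennreal_cases)
    have "AE x in lborel. F x < ennreal (a + 1 / real (Suc n))" for n
      by (rule *) (use a in \<open>simp add: ennreal_less_iff\<close>)
    then have "AE x in lborel. \<forall>n. F x < ennreal (a + 1 / real (Suc n))"
      unfolding AE_all_countable by blast
    then show ?thesis
    proof eventually_elim
      case (elim x)
      show ?case
      proof (rule ennreal_le_epsilon)
        fix e :: real assume e: "0 < e"
        then obtain n where n: "inverse (real (Suc n)) < e" using reals_Archimedean by blast
        have "F x \<le> ennreal (a + 1 / real (Suc n))" using elim by (simp add: less_imp_le)
        also have "\<dots> \<le> ennreal (a + e)" using n by (intro ennreal_leI) (simp add: inverse_eq_divide)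
        finally show "F x \<le> c + ennreal e" using a e by simp
      qed
    qed
  qed simp
next
  assume "AE x in lborel. F x \<le> c"
  then show "Lnorm top F \<le> c" unfolding Lnorm_def by (auto intro: Limsup_bounded)
qed

lemma AE_le_Lnorm_top: "AE x in lborel. F x \<le> Lnorm top F"
  using Lnorm_top_le_iff[of F "Lnorm top F"] by simp

lemma ennreal_exp_cases:
  assumes "1 \<le> p" obtains "p = top" | r where "p = ennreal r" "1 \<le> r"
  using assms by (cases p) auto

lemma Lnorm_mono_AE:
  assumes "1 \<le> p" "AE x in lborel. F x \<le> G x" shows "Lnorm p F \<le> Lnorm p G"
  using assms(1)
proof (cases rule: ennreal_exp_cases)
  case 1
  have "AE x in lborel. F x \<le> Lnorm top G"
    using assms(2) AE_le_Lnorm_top[of G] by eventually_elim auto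
  then show ?thesis by (simp add: 1 Lnorm_top_le_iff)
next
  case (2 r)
  then have r: "0 < r" by simp
  have "AE x in lborel. pw (F x) r \<le> pw (G x) r"
    using assms(2) by eventually_elim (use r in \<open>auto intro: pw_mono\<close>)
  then show ?thesis unfolding 2 Lnorm_finite[OF r]
    using r by (intro pw_mono nn_integral_mono_AE) auto
qed

lemma Lnorm_mono: "1 \<le> p \<Longrightarrow> (\<And>x. F x \<le> G x) \<Longrightarrow> Lnorm p F \<le> Lnorm p G"
  by (rule Lnorm_mono_AE) auto

text \<open>Measurability is not needed for finite constants: \<^const>\<open>nn_integral\<close> is the lower integral
  on nonmeasurable functions.\<close>

lemma nn_integral_cmult_le:
  assumes "0 < c" "c < \<infinity>"
  shows "(\<integral>\<^sup>+x. c * f x \<partial>M) \<le> c * (\<integral>\<^sup>+x. f x \<partial>M)"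
  unfolding nn_integral_def[of M "\<lambda>x. c * f x"]
proof (rule SUP_least, safe)
  fix g assume g: "simple_function M g" "g \<le> (\<lambda>x. c * f x)"
  have [measurable]: "g \<in> borel_measurable M" using g(1) by (rule borel_measurable_simple_function)
  have le: "g x / c \<le> f x" for x
    using g(2) assms by (auto simp: le_fun_def divide_le_posI_ennreal mult.commute)
  have "integral\<^sup>S M g = (\<integral>\<^sup>+x. g x \<partial>M)" by (rule nn_integral_eq_simple_integral[OF g(1), symmetric])
  also have "\<dots> = (\<integral>\<^sup>+x. c * (g x / c) \<partial>M)"
    using assms by (intro nn_integral_cong) (metis ennreal_mult_divide_eq ennreal_times_divide mult.commute not_gr_zero top.not_eq_extremum infinity_ennreal_def)
  also have "\<dots> = c * (\<integral>\<^sup>+x. g x / c \<partial>M)" by (rule nn_integral_cmult) measurable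
  also have "\<dots> \<le> c * (\<integral>\<^sup>+x. f x \<partial>M)" by (intro mult_left_mono nn_integral_mono le) auto
  finally show "integral\<^sup>S M g \<le> c * (\<integral>\<^sup>+x. f x \<partial>M)" .
qed

lemma Lnorm_cmult_le:
  assumes p: "1 \<le> p" and c: "0 < c" "c < \<infinity>"
  shows "Lnorm p (\<lambda>x. c * F x) \<le> c * Lnorm p F"
  using p
proof (cases rule: ennreal_exp_cases)
  case 1
  have "AE x in lborel. c * F x \<le> c * Lnorm top F"
    using AE_le_Lnorm_top[of F] by eventually_elim (auto intro: mult_left_mono)
  then show ?thesis by (simp add: 1 Lnorm_top_le_iff)
next
  case (2 r)
  then have r: "0 < r" by simp
  have pc: "0 < pw c r" "pw c r < \<infinity>"
    using c r pw_eq_0_iff[of r c] pw_eq_top_iff[of r c] by (auto simp: less_top[symmetric] zero_less_iff_neq_zero)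
  have "(\<integral>\<^sup>+x. pw (c * F x) r \<partial>lborel) \<le> pw c r * (\<integral>\<^sup>+x. pw (F x) r \<partial>lborel)"
    using nn_integral_cmult_le[OF pc, of lborel "\<lambda>x. pw (F x) r"] r by (simp add: pw_mult)
  then have "Lnorm p (\<lambda>x. c * F x) \<le> pw (pw c r * (\<integral>\<^sup>+x. pw (F x) r \<partial>lborel)) (1 / r)"
    unfolding 2 Lnorm_finite[OF r] using r by (intro pw_mono) auto
  also have "\<dots> = c * Lnorm p F" unfolding 2 Lnorm_finite[OF r] using r by (simp add: pw_mult pw_pw)
  finally show ?thesis .
qed

text \<open>For finite \<open>p\<close> this is the Jacobian raised to \<open>1 / p\<close>. For
  \<open>p = top\<close> the exponent of \<open>c\<close> is 0, since
  \<open>inverse top = 0\<close>, and the content is that affine preimages of null sets are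
  null.\<close>

lemma Lnorm_affine:
  fixes F :: "'a::euclidean_space \<Rightarrow> ennreal"
  assumes p: "1 \<le> p" and [measurable]: "F \<in> borel_measurable borel" and c: "c \<noteq> 0"
  shows "Lnorm p (\<lambda>x. F (t + c *\<^sub>R x)) \<le> ennreal (\<bar>c\<bar> powr (- (DIM('a) * enn2real (inverse p)))) * Lnorm p F"
  using p
proof (cases rule: ennreal_exp_cases)
  case 1
  have "AE x in lborel. F x \<le> Lnorm top F" by (rule AE_le_Lnorm_top)
  then have "AE x in lborel. indicator {x. \<not> F x \<le> Lnorm top F} x = (0 :: ennreal)" by eventually_elim simp
  then have "(\<integral>\<^sup>+x. indicator {x. \<not> F x \<le> Lnorm top F} x \<partial>lborel) = 0" by (subst nn_integral_0_iff_AE) auto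
  then have "(\<integral>\<^sup>+x. indicator {x. \<not> F x \<le> Lnorm top F} (t + c *\<^sub>R x) \<partial>lborel) = 0"
    by (subst nn_integral_lborel_affine[OF _ c]) auto
  then have "AE x in lborel. indicator {x. \<not> F x \<le> Lnorm top F} (t + c *\<^sub>R x) = (0 :: ennreal)"
    by (subst (asm) nn_integral_0_iff_AE) auto
  then have "AE x in lborel. F (t + c *\<^sub>R x) \<le> Lnorm top F"
    by eventually_elim (auto simp: indicator_def split: if_splits)
  then show ?thesis using c by (simp add: 1 Lnorm_top_le_iff)
next
  case (2 r)
  then have r: "0 < r" by simp
  have "Lnorm p (\<lambda>x. F (t + c *\<^sub>R x)) = pw (ennreal (1 / \<bar>c\<bar> ^ DIM('a)) * (\<integral>\<^sup>+x. pw (F x) r \<partial>lborel)) (1 / r)"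
    unfolding 2 Lnorm_finite[OF r] by (subst nn_integral_lborel_affine[OF _ c, of "\<lambda>x. pw (F x) r"]) auto
  also have "\<dots> = pw (ennreal (1 / \<bar>c\<bar> ^ DIM('a))) (1 / r) * Lnorm p F"
    unfolding 2 Lnorm_finite[OF r] using r by (simp add: pw_mult)
  also have "pw (ennreal (1 / \<bar>c\<bar> ^ DIM('a))) (1 / r) = ennreal (\<bar>c\<bar> powr (- (DIM('a) * enn2real (inverse p))))"
  proof -
    have "(1 / \<bar>c\<bar> ^ DIM('a)) powr (1 / r) = \<bar>c\<bar> powr (- (DIM('a) * (1 / r)))"
      using c by (simp add: powr_realpow[symmetric] powr_minus_divide[symmetric] powr_powr)
    then show ?thesis using r by (simp add: pw_ennreal 2 inverse_ennreal inverse_eq_divide)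
  qed
  finally show ?thesis by simp
qed

section \<open>Tonelli's theorem and measurability of norms of slices\<close>

lemma measurable_borel_prod: "borel_measurable (lborel \<Otimes>\<^sub>M lborel) = borel_measurable (borel :: ('a::euclidean_space \<times> 'b::euclidean_space) measure)"
  by (simp add: lborel_prod)

lemma borel_measurable_fst_borel [measurable]: "fst \<in> borel_measurable (borel :: ('a::euclidean_space \<times> 'b::euclidean_space) measure)"
  by (intro borel_measurable_continuous_onI continuous_intros)

lemma borel_measurable_snd_borel [measurable]: "snd \<in> borel_measurable (borel :: ('a::euclidean_space \<times> 'b::euclidean_space) measure)"
  by (intro borel_measurable_continuous_onI continuous_intros)

lemma tonelli_swap:
  fixes f :: "'a::euclidean_space \<Rightarrow> 'b::euclidean_space \<Rightarrow> ennreal"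
  assumes "(\<lambda>w. f (fst w) (snd w)) \<in> borel_measurable borel"
  shows "(\<integral>\<^sup>+x. \<integral>\<^sup>+y. f x y \<partial>lborel \<partial>lborel) = (\<integral>\<^sup>+y. \<integral>\<^sup>+x. f x y \<partial>lborel \<partial>lborel)"
  by (rule lborel_pair.Fubini'[symmetric]) (use assms in \<open>simp add: measurable_borel_prod case_prod_beta'\<close>)

lemma nn_integral_lborel_pair:
  fixes g :: "'a::euclidean_space \<times> 'b::euclidean_space \<Rightarrow> ennreal"
  assumes "g \<in> borel_measurable borel"
  shows "(\<integral>\<^sup>+w. g w \<partial>lborel) = (\<integral>\<^sup>+x. \<integral>\<^sup>+y. g (x, y) \<partial>lborel \<partial>lborel)"
  using lborel.nn_integral_fst[of g lborel] assms by (simp add: measurable_borel_prod lborel_prod)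

lemma nn_integral_measurable:
  fixes f :: "'a::euclidean_space \<Rightarrow> 'b::euclidean_space \<Rightarrow> ennreal"
  assumes "(\<lambda>w. f (fst w) (snd w)) \<in> borel_measurable borel"
  shows "(\<lambda>x. \<integral>\<^sup>+y. f x y \<partial>lborel) \<in> borel_measurable borel"
proof -
  have "(\<lambda>x. \<integral>\<^sup>+y. f x y \<partial>lborel) \<in> borel_measurable lborel"
    by (rule lborel.borel_measurable_nn_integral) (use assms in \<open>simp add: measurable_borel_prod case_prod_beta'\<close>)
  then show ?thesis by simp
qed

lemma measurable_slice:
  fixes f :: "'a::euclidean_space \<Rightarrow> 'b::euclidean_space \<Rightarrow> 'c::topological_space"
  assumes "(\<lambda>w. f (fst w) (snd w)) \<in> borel_measurable borel"
  shows "f x \<in> borel_measurable borel" "(\<lambda>x. f x y) \<in> borel_measurable borel"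
  using measurable_compose[OF _ assms, of "\<lambda>y. (x, y)" borel] measurable_compose[OF _ assms, of "\<lambda>x. (x, y)" borel]
  by simp_all

text \<open>For \<open>p = top\<close>, the essential supremum of a slice exceeds \<open>a\<close>
  exactly when the set where the slice exceeds \<open>a\<close> has nonzero measure, and this
  measure depends measurably on the parameter.\<close>

lemma Lnorm_measurable:
  fixes f :: "'a::euclidean_space \<Rightarrow> 'b::euclidean_space \<Rightarrow> ennreal"
  assumes p: "1 \<le> p" and f: "(\<lambda>w. f (fst w) (snd w)) \<in> borel_measurable borel"
  shows "(\<lambda>x. Lnorm p (f x)) \<in> borel_measurable borel"
  using p
proof (cases rule: ennreal_exp_cases)
  case 1
  show ?thesis
  proof (rule borel_measurableI_greater)
    fix a
    have fx[measurable]: "f x \<in> borel_measurable borel" for x by (rule measurable_slice[OF f])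
    have "a < Lnorm p (f x) \<longleftrightarrow> (\<integral>\<^sup>+y. indicator {a<..} (f x y) \<partial>lborel) \<noteq> 0" for x
    proof -
      have "Lnorm p (f x) \<le> a \<longleftrightarrow> (AE y in lborel. indicator {a<..} (f x y) = (0 :: ennreal))"
        unfolding 1 Lnorm_top_le_iff by (intro AE_cong) (auto simp: indicator_def not_less)
      also have "\<dots> \<longleftrightarrow> (\<integral>\<^sup>+y. indicator {a<..} (f x y) \<partial>lborel) = 0"
        by (subst nn_integral_0_iff_AE) auto
      finally show ?thesis by (auto simp: not_le[symmetric])
    qed
    moreover have "(\<lambda>x. \<integral>\<^sup>+y. indicator {a<..} (f x y) \<partial>lborel) \<in> borel_measurable borel"
      by (rule nn_integral_measurable) (use f in measurable)
    ultimately show "{x \<in> space borel. a < Lnorm p (f x)} \<in> sets borel"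
      by simp
  qed
next
  case (2 r)
  then have r: "0 < r" by simp
  have "(\<lambda>x. \<integral>\<^sup>+y. pw (f x y) r \<partial>lborel) \<in> borel_measurable borel"
    by (rule nn_integral_measurable) (use f in measurable)
  then show ?thesis unfolding 2 Lnorm_finite[OF r] by measurable
qed

section \<open>Minkowski's integral inequality\<close>

text \<open>Write \<open>G ^ r\<close> as \<open>G * G ^ (r - 1)\<close>, exchange the integrals,
  apply Hoelder in \<open>x\<close>, and divide by the power \<open>1 - 1 / r\<close> of the left
  side. The division is legitimate only for a finite left side, so the argument runs on truncations
  of \<open>G\<close> followed by monotone convergence.\<close>

lemma minkowski_finite:
  fixes f :: "'a::euclidean_space \<Rightarrow> 'b::euclidean_space \<Rightarrow> ennreal"
  assumes r: "1 < r" and f: "(\<lambda>w. f (fst w) (snd w)) \<in> borel_measurable borel"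
  shows "(\<integral>\<^sup>+x. pw (\<integral>\<^sup>+y. f x y \<partial>lborel) r \<partial>lborel) \<le> pw (\<integral>\<^sup>+y. pw (\<integral>\<^sup>+x. pw (f x y) r \<partial>lborel) (1 / r) \<partial>lborel) r"
    (is "_ \<le> pw ?R r")
proof -
  define G where "G x = (\<integral>\<^sup>+y. f x y \<partial>lborel)" for x
  have [measurable]: "G \<in> borel_measurable borel"
    unfolding G_def by (rule nn_integral_measurable[OF f])
  \<comment> \<open>Cut off in height and in space, so that its \<open>r\<close>-th power has finite
    integral even where \<open>G\<close> is infinite.\<close>
  define Gn where "Gn n x = min (G x) (of_nat n) * indicator (ball 0 (real n)) x" for n x
  have [measurable]: "ball (0::'a) t \<in> sets borel" for t by simp
  have [measurable]: "Gn n \<in> borel_measurable borel" for n unfolding Gn_def by measurable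
  have Gn_le: "Gn n x \<le> G x" for n x unfolding Gn_def by (auto simp: indicator_def)
  let ?I = "\<lambda>n. \<integral>\<^sup>+x. pw (Gn n x) r \<partial>lborel"
  have In: "?I n \<le> pw ?R r" for n
  proof -
    have "?I n \<le> (\<integral>\<^sup>+x. pw (of_nat n) r * indicator (ball 0 (real n)) x \<partial>(lborel :: 'a measure))"
      using r by (intro nn_integral_mono) (auto simp: Gn_def indicator_def intro: pw_mono)
    also have "\<dots> = pw (of_nat n) r * emeasure lborel (ball (0::'a) (real n))" by (simp add: nn_integral_cmult)
    also have "\<dots> < top"
      using r emeasure_lborel_ball_finite[of "0::'a" "real n"] 
      by (simp add: ennreal_mult_less_top pw_ennreal ennreal_of_nat_eq_real_of_nat)
    finally have fin: "?I n \<noteq> top" by simp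
    have "?I n = (\<integral>\<^sup>+x. Gn n x * pw (Gn n x) (r - 1) \<partial>lborel)"
      using r pw_add[of 1 "r - 1"] by simp
    also have "\<dots> \<le> (\<integral>\<^sup>+x. G x * pw (Gn n x) (r - 1) \<partial>lborel)"
      by (intro nn_integral_mono mult_right_mono Gn_le) auto
    also have "\<dots> = (\<integral>\<^sup>+x. \<integral>\<^sup>+y. f x y * pw (Gn n x) (r - 1) \<partial>lborel \<partial>lborel)"
      unfolding G_def using measurable_slice(1)[OF f] by (intro nn_integral_cong) (simp add: nn_integral_multc)
    also have "\<dots> = (\<integral>\<^sup>+y. \<integral>\<^sup>+x. f x y * pw (Gn n x) (r - 1) \<partial>lborel \<partial>lborel)"
      by (rule tonelli_swap) (use f in measurable)
    also have "\<dots> \<le> (\<integral>\<^sup>+y. pw (\<integral>\<^sup>+x. pw (f x y) r \<partial>lborel) (1 / r) * pw (?I n) (1 - 1 / r) \<partial>lborel)"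
    proof (rule nn_integral_mono)
      fix y
      have "(\<integral>\<^sup>+x. f x y * pw (Gn n x) (r - 1) \<partial>lborel) = (\<integral>\<^sup>+x. pw (pw (f x y) r) (1 / r) * pw (pw (Gn n x) r) (1 - 1 / r) \<partial>lborel)"
        using r by (simp add: pw_pw right_diff_distrib)
      also have "\<dots> \<le> pw (\<integral>\<^sup>+x. pw (f x y) r \<partial>lborel) (1 / r) * pw (?I n) (1 - 1 / r)"
        by (rule hoelder2) (use r measurable_slice(2)[OF f] in auto)
      finally show "(\<integral>\<^sup>+x. f x y * pw (Gn n x) (r - 1) \<partial>lborel) \<le> pw (\<integral>\<^sup>+x. pw (f x y) r \<partial>lborel) (1 / r) * pw (?I n) (1 - 1 / r)" .
    qed
    also have "\<dots> = ?R * pw (?I n) (1 - 1 / r)"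
    proof (rule nn_integral_multc)
      have "(\<lambda>w. pw (f (snd w) (fst w)) r) \<in> borel_measurable (borel :: ('b \<times> 'a) measure)"
        using measurable_compose[OF _ f, of "\<lambda>w. (snd w, fst w)" "borel :: ('b \<times> 'a) measure"] by simp
      then have "(\<lambda>y. \<integral>\<^sup>+x. pw (f x y) r \<partial>lborel) \<in> borel_measurable borel"
        by (rule nn_integral_measurable)
      then show "(\<lambda>y. pw (\<integral>\<^sup>+x. pw (f x y) r \<partial>lborel) (1 / r)) \<in> borel_measurable lborel" by simp
    qed
    finally have main: "?I n \<le> ?R * pw (?I n) (1 - 1 / r)" .
    show ?thesis
    proof (cases "?I n = 0")
      case False
      have "?I n = pw (?I n) (1 / r) * pw (?I n) (1 - 1 / r)"
        using r by (subst pw_add[symmetric]) auto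
      with main have "pw (?I n) (1 - 1 / r) * pw (?I n) (1 / r) \<le> pw (?I n) (1 - 1 / r) * ?R"
        by (simp only: mult.commute[of "pw (?I n) (1 - 1 / r)"])
      moreover have "pw (?I n) (1 - 1 / r) \<noteq> 0" "pw (?I n) (1 - 1 / r) \<noteq> top"
        using False fin r pw_eq_0_iff[of "1 - 1 / r" "?I n"] pw_eq_top_iff[of "1 - 1 / r" "?I n"] by auto
      ultimately have "pw (?I n) (1 / r) \<le> ?R"
        by (rule ennreal_mult_le_mult_iff[THEN iffD1, rotated 2])
      then show ?thesis using r by (simp add: pw_le_iff)
    qed simp
  qed
  have sup: "(SUP n. pw (Gn n x) r) = pw (G x) r" for x
  proof (rule antisym)
    show "(SUP n. pw (Gn n x) r) \<le> pw (G x) r" using r Gn_le by (intro SUP_least pw_mono) auto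
    obtain n0 where n0: "norm x < real n0" using reals_Archimedean2 by blast
    show "pw (G x) r \<le> (SUP n. pw (Gn n x) r)"
    proof (cases "G x = top")
      case False
      then obtain g where g: "G x = ennreal g" "0 \<le> g" by (metis ennreal_cases)
      obtain n1 where "g \<le> real n1" using real_arch_simple by blast
      then have "G x \<le> of_nat (max n0 n1)" using g by (simp add: ennreal_of_nat_eq_real_of_nat ennreal_leI)
      then have "Gn (max n0 n1) x = G x" using n0 by (simp add: Gn_def min_def)
      then show ?thesis by (intro SUP_upper2[of "max n0 n1"]) auto
    next
      case True
      have "of_nat n \<le> (SUP n. pw (Gn n x) r)" for n
      proof (rule SUP_upper2[of "max n0 (Suc n)"])
        have "of_nat n \<le> (ennreal (real (max n0 (Suc n))))" by (simp add: ennreal_of_nat_eq_real_of_nat ennreal_leI)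
        also have "\<dots> \<le> ennreal (real (max n0 (Suc n)) powr r)"
        proof (rule ennreal_leI)
          have "1 \<le> real (max n0 (Suc n))" by linarith
          from powr_mono[OF _ this, of 1 r] r this
          show "real (max n0 (Suc n)) \<le> real (max n0 (Suc n)) powr r" by (simp del: of_nat_max)
        qed
        also have "\<dots> = pw (Gn (max n0 (Suc n)) x) r"
          using True n0 r by (simp add: Gn_def pw_ennreal ennreal_of_nat_eq_real_of_nat del: of_nat_Suc of_nat_max)
        finally show "of_nat n \<le> pw (Gn (max n0 (Suc n)) x) r" .
      qed simp
      then have "(SUP n. of_nat n) \<le> (SUP n. pw (Gn n x) r)" by (rule SUP_least)
      from order_trans[OF top_greatest this[unfolded ennreal_SUP_of_nat_eq_top]] show ?thesis .
    qed
  qed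
  have "(\<integral>\<^sup>+x. pw (G x) r \<partial>lborel) = (\<integral>\<^sup>+x. (SUP n. pw (Gn n x) r) \<partial>lborel)" by (simp add: sup)
  also have "\<dots> = (SUP n. ?I n)"
  proof (rule nn_integral_monotone_convergence_SUP)
    show "incseq (\<lambda>n x. pw (Gn n x) r)"
    proof (intro incseq_SucI le_funI pw_mono)
      show "Gn n x \<le> Gn (Suc n) x" for n x
        unfolding Gn_def by (intro mult_mono min.mono) (auto simp: indicator_def)
    qed (use r in auto)
  qed measurable
  also have "\<dots> \<le> pw ?R r" by (intro SUP_least In)
  finally show ?thesis by (simp add: G_def)
qed

text \<open>At \<open>p = top\<close> the statement amounts to exchanging two almost-everywhere
  quantifiers, which requires joint measurability of the exceptional set.\<close>

theorem minkowski:
  fixes f :: "'a::euclidean_space \<Rightarrow> 'b::euclidean_space \<Rightarrow> ennreal"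
  assumes p: "1 \<le> p" and f: "(\<lambda>w. f (fst w) (snd w)) \<in> borel_measurable borel"
  shows "Lnorm p (\<lambda>x. \<integral>\<^sup>+y. f x y \<partial>lborel) \<le> (\<integral>\<^sup>+y. Lnorm p (\<lambda>x. f x y) \<partial>lborel)"
  using p
proof (cases rule: ennreal_exp_cases)
  case 1
  have f': "(\<lambda>w. f (snd w) (fst w)) \<in> borel_measurable (borel :: ('b \<times> 'a) measure)"
    using measurable_compose[OF _ f, of "\<lambda>w. (snd w, fst w)" "borel :: ('b \<times> 'a) measure"] by simp
  have L[measurable]: "(\<lambda>y. Lnorm top (\<lambda>x. f x y)) \<in> borel_measurable borel"
    by (rule Lnorm_measurable[OF _ f']) simp
  have "AE y in lborel. AE x in lborel. f x y \<le> Lnorm top (\<lambda>x. f x y)"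
    by (rule AE_I2) (rule AE_le_Lnorm_top)
  then have "AE x in lborel. AE y in lborel. f x y \<le> Lnorm top (\<lambda>x. f x y)"
  proof (subst lborel_pair.AE_commute)
    have "{w \<in> space borel. f (fst w) (snd w) \<le> Lnorm top (\<lambda>x. f x (snd w))} \<in> sets (borel :: ('a \<times> 'b) measure)"
      using f by measurable
    then show "{w \<in> space (lborel \<Otimes>\<^sub>M lborel). f (fst w) (snd w) \<le> Lnorm top (\<lambda>x. f x (snd w))} \<in> sets (lborel \<Otimes>\<^sub>M lborel)"
      unfolding lborel_prod by simp
  qed
  then have "AE x in lborel. (\<integral>\<^sup>+y. f x y \<partial>lborel) \<le> (\<integral>\<^sup>+y. Lnorm top (\<lambda>x. f x y) \<partial>lborel)"
    by eventually_elim (rule nn_integral_mono_AE)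
  then show ?thesis by (simp add: 1 Lnorm_top_le_iff)
next
  case (2 r)
  show ?thesis
  proof (cases "r = 1")
    case True
    then show ?thesis using tonelli_swap[OF f] by (simp add: 2 Lnorm_finite[of 1, simplified])
  next
    case False
    then have r: "1 < r" using 2 by simp
    then have "Lnorm p (\<lambda>x. \<integral>\<^sup>+y. f x y \<partial>lborel) \<le> pw (pw (\<integral>\<^sup>+y. pw (\<integral>\<^sup>+x. pw (f x y) r \<partial>lborel) (1 / r) \<partial>lborel) r) (1 / r)"
      unfolding 2 Lnorm_finite[OF order.strict_trans[OF zero_less_one r]] by (intro pw_mono minkowski_finite f) auto
    also have "\<dots> = (\<integral>\<^sup>+y. Lnorm p (\<lambda>x. f x y) \<partial>lborel)"
      unfolding 2 Lnorm_finite[OF order.strict_trans[OF zero_less_one r]] using r by (simp add: pw_pw)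
    finally show ?thesis .
  qed
qed

section \<open>Integral operators with a kernel in the variables of the \<tau>-Wigner distribution\<close>

lemma measurable_comp_continuous:
  assumes "f \<in> borel_measurable borel" "continuous_on UNIV L"
  shows "(\<lambda>x. f (L x)) \<in> borel_measurable borel"
  using measurable_compose[OF borel_measurable_continuous_onI[OF assms(2)] assms(1)] .

text \<open>Here \<open>c\<close> may be \<open>0\<close> or \<open>top\<close>, as happens for
  values of a kernel; for measurable \<open>F\<close> such constants still leave the
  integral.\<close>

lemma Lnorm_cmult_le_measurable:
  assumes p: "1 \<le> p" and F: "F \<in> borel_measurable borel"
  shows "Lnorm p (\<lambda>x. c * F x) \<le> c * Lnorm p F"
  using p
proof (cases rule: ennreal_exp_cases)
  case 1
  have "AE x in lborel. c * F x \<le> c * Lnorm top F"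
    using AE_le_Lnorm_top[of F] by eventually_elim (auto intro: mult_left_mono)
  then show ?thesis by (simp add: 1 Lnorm_top_le_iff)
next
  case (2 r)
  then have r: "0 < r" by simp
  show ?thesis unfolding 2 Lnorm_finite[OF r] using r F by (simp add: pw_mult nn_integral_cmult pw_pw)
qed

text \<open>The map \<open>(x, y) \<mapsto> ((1 - \<tau>) x + \<tau> y, x - y)\<close> preserves
  volume for every \<open>\<tau>\<close>: a reflection in \<open>y\<close> at fixed
  \<open>x\<close>, then a translation in \<open>x\<close> at fixed \<open>\<zeta>\<close>. Powers
  of \<open>\<tau>\<close> and \<open>1 - \<tau>\<close> thus come only from integrations over one
  variable.\<close>

lemma nn_integral_tau_change:
  fixes H :: "'a::euclidean_space \<times> 'a \<Rightarrow> ennreal"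
  assumes H: "H \<in> borel_measurable borel"
  shows "(\<integral>\<^sup>+x. \<integral>\<^sup>+y. H ((1 - \<tau>) *\<^sub>R x + \<tau> *\<^sub>R y, x - y) \<partial>lborel \<partial>lborel) = (\<integral>\<^sup>+z. \<integral>\<^sup>+\<zeta>. H (z, \<zeta>) \<partial>lborel \<partial>lborel)"
proof -
  have "(\<integral>\<^sup>+y. H ((1 - \<tau>) *\<^sub>R x + \<tau> *\<^sub>R y, x - y) \<partial>lborel) = (\<integral>\<^sup>+\<zeta>. H (- (\<tau> *\<^sub>R \<zeta>) + x, \<zeta>) \<partial>lborel)" for x
  proof -
    have "(\<lambda>y. H ((1 - \<tau>) *\<^sub>R x + \<tau> *\<^sub>R y, x - y)) \<in> borel_measurable borel"
      by (rule measurable_comp_continuous[OF H]) (intro continuous_intros)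
    from nn_integral_lborel_reflect[OF this, of x] show ?thesis
      by (simp add: algebra_simps)
  qed
  then have "(\<integral>\<^sup>+x. \<integral>\<^sup>+y. H ((1 - \<tau>) *\<^sub>R x + \<tau> *\<^sub>R y, x - y) \<partial>lborel \<partial>lborel) = (\<integral>\<^sup>+x. \<integral>\<^sup>+\<zeta>. H (- (\<tau> *\<^sub>R \<zeta>) + x, \<zeta>) \<partial>lborel \<partial>lborel)"
    by simp
  also have "\<dots> = (\<integral>\<^sup>+\<zeta>. \<integral>\<^sup>+x. H (- (\<tau> *\<^sub>R \<zeta>) + x, \<zeta>) \<partial>lborel \<partial>lborel)"
    by (rule tonelli_swap, rule measurable_comp_continuous[OF H]) (intro continuous_intros)
  also have "\<dots> = (\<integral>\<^sup>+\<zeta>. \<integral>\<^sup>+z. H (z, \<zeta>) \<partial>lborel \<partial>lborel)"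
  proof (rule nn_integral_cong)
    fix \<zeta> :: 'a
    have "(\<lambda>z. H (z, \<zeta>)) \<in> borel_measurable borel"
      by (rule measurable_comp_continuous[OF H]) (intro continuous_intros)
    from nn_integral_lborel_translate[OF this] show "(\<integral>\<^sup>+x. H (- (\<tau> *\<^sub>R \<zeta>) + x, \<zeta>) \<partial>lborel) = (\<integral>\<^sup>+z. H (z, \<zeta>) \<partial>lborel)" .
  qed
  also have "\<dots> = (\<integral>\<^sup>+z. \<integral>\<^sup>+\<zeta>. H (z, \<zeta>) \<partial>lborel \<partial>lborel)"
    by (rule tonelli_swap[symmetric]) (use H in simp)
  finally show ?thesis .
qed

lemma hoelder4:
  assumes [measurable]: "f1 \<in> borel_measurable M" "f2 \<in> borel_measurable M" "f3 \<in> borel_measurable M" "f4 \<in> borel_measurable M"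
    and "0 \<le> a" "0 \<le> b" "0 \<le> c" "0 \<le> d" "a + b + c + d = 1"
  shows "(\<integral>\<^sup>+x. pw (f1 x) a * pw (f2 x) b * pw (f3 x) c * pw (f4 x) d \<partial>M)
    \<le> pw (\<integral>\<^sup>+x. f1 x \<partial>M) a * pw (\<integral>\<^sup>+x. f2 x \<partial>M) b * pw (\<integral>\<^sup>+x. f3 x \<partial>M) c * pw (\<integral>\<^sup>+x. f4 x \<partial>M) d"
proof -
  let ?f = "\<lambda>i::nat. if i = 0 then f1 else if i = 1 then f2 else if i = 2 then f3 else f4"
  let ?t = "\<lambda>i::nat. if i = 0 then a else if i = 1 then b else if i = 2 then c else d"
  have "(\<integral>\<^sup>+x. (\<Prod>i<4. pw (?f i x) (?t i)) \<partial>M) \<le> (\<Prod>i<4. pw (\<integral>\<^sup>+x. ?f i x \<partial>M) (?t i))"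
    by (rule hoelder) (use assms in \<open>auto simp: eval_nat_numeral\<close>)
  then show ?thesis by (simp add: eval_nat_numeral)
qed

text \<open>With \<open>\<beta>(z) = \<parallel>b(z, \<cdot>)\<parallel>\<^sub>P\<close> and \<open>b = \<beta> c\<close>, Hoelder's inequality in \<open>y\<close> is applied to the factorization
  \<open>b F = (\<beta>\<^sup>S c\<^sup>P)\<^bsup>1/P\<^esup> (F\<^sup>R)\<^bsup>1/P\<^esup> (\<beta>\<^sup>S F\<^sup>R)\<^bsup>1/R-1/P\<^esup> (\<beta>\<^sup>S)\<^bsup>1/S-1/R\<^esup>\<close>.\<close>

lemma kernel_bound:
  fixes b :: "'a::euclidean_space \<times> 'a \<Rightarrow> ennreal" and F :: "'a \<Rightarrow> ennreal"
  assumes \<tau>: "0 < \<tau>" "\<tau> < 1" and PS: "0 < P" "0 < S" "1 / P + 1 / S = 1" and R: "S \<le> R" "R \<le> P"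
    and b: "b \<in> borel_measurable borel" and F[measurable]: "F \<in> borel_measurable borel"
  shows "pw (\<integral>\<^sup>+x. pw (\<integral>\<^sup>+y. b ((1 - \<tau>) *\<^sub>R x + \<tau> *\<^sub>R y, x - y) * F y \<partial>lborel) R \<partial>lborel) (1 / R)
    \<le> ennreal (\<tau> powr (- (DIM('a) * (1 - 1 / R))) * (1 - \<tau>) powr (- (DIM('a) * (1 / R))))
       * (pw (\<integral>\<^sup>+z. pw (pw (\<integral>\<^sup>+\<zeta>. pw (b (z, \<zeta>)) P \<partial>lborel) (1 / P)) S \<partial>lborel) (1 / S)
       * pw (\<integral>\<^sup>+y. pw (F y) R \<partial>lborel) (1 / R))"
proof -
  have R0: "0 < R" using R PS by linarith
  define J where "J z = (\<integral>\<^sup>+\<zeta>. pw (b (z, \<zeta>)) P \<partial>lborel)" for z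
  define \<beta> where "\<beta> z = pw (J z) (1 / P)" for z
  define B where "B = (\<integral>\<^sup>+z. pw (\<beta> z) S \<partial>lborel)"
  define NF where "NF = (\<integral>\<^sup>+y. pw (F y) R \<partial>lborel)"
  let ?\<theta>3 = "1 / R - 1 / P" and ?\<theta>4 = "1 / S - 1 / R"
  have \<theta>: "0 \<le> 1 / P" "0 \<le> ?\<theta>3" "0 \<le> ?\<theta>4" "1 / P + 1 / P + ?\<theta>3 + ?\<theta>4 = 1"
    using PS R R0 by (auto simp: frac_le)
  have [measurable]: "J \<in> borel_measurable borel"
    unfolding J_def by (rule nn_integral_measurable) (use b in simp)
  have \<beta>m[measurable]: "\<beta> \<in> borel_measurable borel" unfolding \<beta>_def by measurable
  note [measurable] = b
  let ?z = "\<lambda>x y. (1 - \<tau>) *\<^sub>R x + \<tau> *\<^sub>R y"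
  let ?C = "\<tau> powr (- (DIM('a) * (1 - 1 / R))) * (1 - \<tau>) powr (- (DIM('a) * (1 / R)))"
  have C0: "0 < ?C" using \<tau> by simp
  let ?T = "\<lambda>x. \<integral>\<^sup>+y. b (?z x y, x - y) * F y \<partial>lborel"
  show ?thesis unfolding J_def[symmetric] \<beta>_def[symmetric] B_def[symmetric] NF_def[symmetric]
  proof -
    \<comment> \<open>The order of the cases matters: for \<open>NF = 0\<close> the right side may
      read \<open>top * 0 = 0\<close>, so the vanishing of the left side is shown first; otherwise
      \<open>B = top\<close> makes the right side infinite.\<close>
    consider "NF = 0" | "NF \<noteq> 0" "B = top" | "B \<noteq> top" by blast
    then show "pw (\<integral>\<^sup>+x. pw (?T x) R \<partial>lborel) (1 / R) \<le> ennreal ?C * (pw B (1 / S) * pw NF (1 / R))"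
    proof cases
      case 1
      then have "AE y in lborel. F y = 0"
        using R0 pw_eq_0_iff[of R] unfolding NF_def by (simp add: nn_integral_0_iff_AE)
      then have "AE y in lborel. b (?z x y, x - y) * F y = 0" for x by eventually_elim simp
      then have "?T x = 0" for x using nn_integral_cong_AE[of "\<lambda>y. b (?z x y, x - y) * F y" "\<lambda>_. 0" lborel] by simp
      then show ?thesis using R0 by simp
    next
      case 2
      then have "ennreal ?C * (pw B (1 / S) * pw NF (1 / R)) = top"
        using C0 PS R0 \<tau> pw_eq_0_iff[of "1 / R" NF] by (simp add: ennreal_mult_eq_top_iff ennreal_top_mult)
      then show ?thesis by (simp only: top_greatest)
    next
      case 3
      \<comment> \<open>The normalized kernel. It satisfies \<open>b = \<beta> c\<close> off a null
        set: finiteness of \<open>B\<close> excludes \<open>\<beta> z = top\<close> almost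
        everywhere, and where \<open>\<beta> z = 0\<close> the slice of \<open>b\<close> vanishes
        almost everywhere.\<close>
      define c where "c w = b w * inverse (\<beta> (fst w))" for w
      have [measurable]: "c \<in> borel_measurable borel" unfolding c_def by measurable
      define N where "N = {w. b w \<noteq> \<beta> (fst w) * c w}"
      have [measurable]: "N \<in> sets borel" unfolding N_def by measurable
      have "AE z in lborel. pw (\<beta> z) S \<noteq> top"
        using nn_integral_PInf_AE[of "\<lambda>z. pw (\<beta> z) S" lborel] 3 unfolding B_def by auto
      then have "AE z in lborel. (\<integral>\<^sup>+\<zeta>. indicator N (z, \<zeta>) \<partial>lborel) = 0"
      proof eventually_elim
        case (elim z)
        then have bt: "\<beta> z \<noteq> top" using PS by (auto simp: pw_eq_top_iff)
        show ?case
        proof (cases "\<beta> z = 0")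
          case True
          then have "J z = 0" using PS by (auto simp: \<beta>_def pw_eq_0_iff)
          then have "AE \<zeta> in lborel. b (z, \<zeta>) = 0"
            using PS pw_eq_0_iff[of P] unfolding J_def by (subst (asm) nn_integral_0_iff_AE) auto
          then have "AE \<zeta> in lborel. indicator N (z, \<zeta>) = (0::ennreal)"
            by eventually_elim (simp add: N_def c_def)
          then show ?thesis by (subst nn_integral_0_iff_AE) auto
        next
          case False
          then have "b (z, \<zeta>) = \<beta> z * c (z, \<zeta>)" for \<zeta>
            using bt unfolding c_def fst_conv
            by (metis divide_ennreal_def ennreal_mult_divide_eq ennreal_times_divide mult.commute)
          then show ?thesis by (simp add: N_def)
        qed
      qed
      then have "(\<integral>\<^sup>+z. \<integral>\<^sup>+\<zeta>. indicator N (z, \<zeta>) \<partial>lborel \<partial>lborel) = (0::ennreal)"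
        using nn_integral_cong_AE[of "\<lambda>z. \<integral>\<^sup>+\<zeta>. indicator N (z, \<zeta>) \<partial>lborel" "\<lambda>_. 0" lborel] by simp
      \<comment> \<open>The exceptional set \<open>N\<close> is null in the variables
        \<open>(z, \<zeta>)\<close>; volume preservation carries this over to
        \<open>(x, y)\<close>.\<close>
      then have "(\<integral>\<^sup>+x. \<integral>\<^sup>+y. indicator N (?z x y, x - y) \<partial>lborel \<partial>lborel) = (0::ennreal)"
        by (subst nn_integral_tau_change) auto
      moreover have mN: "(\<lambda>w. indicator N (?z (fst w) (snd w), fst w - snd w)) \<in> borel_measurable borel"
        by measurable
      ultimately have "AE x in lborel. (\<integral>\<^sup>+y. indicator N (?z x y, x - y) \<partial>lborel) = (0::ennreal)"
        using nn_integral_measurable[OF mN] by (subst (asm) nn_integral_0_iff_AE) auto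
      then have AEb: "AE x in lborel. AE y in lborel. b (?z x y, x - y) = \<beta> (?z x y) * c (?z x y, x - y)"
      proof eventually_elim
        case (elim x)
        then have "AE y in lborel. indicator N (?z x y, x - y) = (0::ennreal)"
          by (subst (asm) nn_integral_0_iff_AE) auto
        then show ?case by eventually_elim (auto simp: N_def indicator_def split: if_splits)
      qed
      let ?X = "\<lambda>w. pw (\<beta> (fst w)) S * pw (c w) P"
      define Px where "Px x = (\<integral>\<^sup>+y. ?X (?z x y, x - y) \<partial>lborel)" for x
      define Qx where "Qx x = (\<integral>\<^sup>+y. pw (\<beta> (?z x y)) S * pw (F y) R \<partial>lborel)" for x
      have [measurable]: "Px \<in> borel_measurable borel" "Qx \<in> borel_measurable borel"
        unfolding Px_def Qx_def by (rule nn_integral_measurable, measurable)+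
      \<comment> \<open>The one-variable Jacobians: at fixed \<open>x\<close> the map
        \<open>y \<mapsto> z\<close> contributes the inverse \<open>d\<close>-th power of
        \<open>\<tau>\<close>, at fixed \<open>y\<close> the map \<open>x \<mapsto> z\<close> that
        of \<open>1 - \<tau>\<close>.\<close>
      let ?D = "ennreal (1 / \<tau> ^ DIM('a)) * B" and ?E = "ennreal (1 / (1 - \<tau>) ^ DIM('a)) * B"
      have T_le: "AE x in lborel. ?T x \<le> pw (Px x) (1 / P) * pw NF (1 / P) * pw (Qx x) ?\<theta>3 * pw ?D ?\<theta>4"
        using AEb
      proof eventually_elim
        case (elim x)
        have "?T x = (\<integral>\<^sup>+y. \<beta> (?z x y) * c (?z x y, x - y) * F y \<partial>lborel)"
          by (rule nn_integral_cong_AE) (use elim in eventually_elim, simp)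
        also have "\<dots> = (\<integral>\<^sup>+y. pw (?X (?z x y, x - y)) (1 / P) * pw (pw (F y) R) (1 / P)
            * pw (pw (\<beta> (?z x y)) S * pw (F y) R) ?\<theta>3 * pw (pw (\<beta> (?z x y)) S) ?\<theta>4 \<partial>lborel)"
        proof (rule nn_integral_cong)
          fix y
          let ?b = "\<beta> (?z x y)" and ?c = "c (?z x y, x - y)"
          \<comment> \<open>Bookkeeping of the four weights: the powers of \<open>\<beta>\<close>
            sum to \<open>S * (1 / S) = 1\<close>, and below those of \<open>F\<close> to
            \<open>R * (1 / R) = 1\<close>.\<close>
          have e1: "S * (1 / P) + (S * ?\<theta>3 + S * ?\<theta>4) = 1"
          proof -
            have "S * (1 / P) + (S * ?\<theta>3 + S * ?\<theta>4) = S * (1 / S)" by (simp only: right_diff_distrib)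
            then show ?thesis using PS by simp
          qed
          have e2: "R * (1 / P) + R * ?\<theta>3 = 1" using R0 PS by (simp add: field_simps)
          have "?b = pw ?b (S * (1 / P)) * (pw ?b (S * ?\<theta>3) * pw ?b (S * ?\<theta>4))"
            using PS \<theta> e1 by (simp only: pw_add[symmetric] mult_nonneg_nonneg less_imp_le add_nonneg_nonneg) simp
          moreover have "F y = pw (F y) (R * (1 / P)) * pw (F y) (R * ?\<theta>3)"
            using R0 \<theta> e2 by (simp only: pw_add[symmetric] mult_nonneg_nonneg less_imp_le) simp
          moreover have "?c = pw ?c (P * (1 / P))" using PS by simp
          ultimately have "?b * ?c * F y = (pw ?b (S * (1 / P)) * (pw ?b (S * ?\<theta>3) * pw ?b (S * ?\<theta>4)))
             * pw ?c (P * (1 / P)) * (pw (F y) (R * (1 / P)) * pw (F y) (R * ?\<theta>3))"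
            by metis
          then show "?b * ?c * F y = pw (?X (?z x y, x - y)) (1 / P) * pw (pw (F y) R) (1 / P)
            * pw (pw ?b S * pw (F y) R) ?\<theta>3 * pw (pw ?b S) ?\<theta>4"
            using \<theta> by (simp only: pw_mult pw_pw fst_conv mult_ac)
        qed
        also have "\<dots> \<le> pw (Px x) (1 / P) * pw NF (1 / P) * pw (Qx x) ?\<theta>3 * pw (\<integral>\<^sup>+y. pw (\<beta> (?z x y)) S \<partial>lborel) ?\<theta>4"
          unfolding Px_def NF_def Qx_def by (rule hoelder4) (use \<theta> in \<open>auto intro: \<beta>m\<close>)
        also have "(\<integral>\<^sup>+y. pw (\<beta> (?z x y)) S \<partial>lborel) = ?D"
          unfolding B_def using nn_integral_lborel_affine[of "\<lambda>z. pw (\<beta> z) S" \<tau> "(1 - \<tau>) *\<^sub>R x"] \<tau> by simp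
        finally show ?case .
      qed
      have IP: "(\<integral>\<^sup>+x. Px x \<partial>lborel) \<le> B"
      proof -
        have "(\<integral>\<^sup>+x. Px x \<partial>lborel) = (\<integral>\<^sup>+z. \<integral>\<^sup>+\<zeta>. ?X (z, \<zeta>) \<partial>lborel \<partial>lborel)"
          unfolding Px_def by (rule nn_integral_tau_change) measurable
        also have "\<dots> \<le> (\<integral>\<^sup>+z. pw (\<beta> z) S \<partial>lborel)"
        proof (rule nn_integral_mono)
          fix z
          have bz: "(\<lambda>\<zeta>. pw (b (z, \<zeta>)) P) \<in> borel_measurable borel" by measurable
          have "(\<integral>\<^sup>+\<zeta>. ?X (z, \<zeta>) \<partial>lborel) = (\<integral>\<^sup>+\<zeta>. (pw (\<beta> z) S * pw (inverse (\<beta> z)) P) * pw (b (z, \<zeta>)) P \<partial>lborel)"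
            using PS by (simp add: c_def pw_mult mult_ac)
          also have "\<dots> = (pw (\<beta> z) S * pw (inverse (\<beta> z)) P) * J z"
            unfolding J_def using bz by (intro nn_integral_cmult) simp
          also have "J z = pw (\<beta> z) P" using PS by (simp add: \<beta>_def pw_pw)
          also have "(pw (\<beta> z) S * pw (inverse (\<beta> z)) P) * pw (\<beta> z) P = pw (\<beta> z) S * pw (\<beta> z * inverse (\<beta> z)) P"
            using PS by (simp add: pw_mult mult_ac)
          \<comment> \<open>Only an inequality: \<open>x * inverse x\<close> is 0, not 1, at
            \<open>0\<close> and at \<open>top\<close>.\<close>
          also have "\<dots> \<le> pw (\<beta> z) S * pw 1 P"
          proof -
            have "x * inverse x \<le> (1::ennreal)" for x
              by (cases x; cases "x = 0") (auto simp: inverse_ennreal ennreal_mult[symmetric])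
            then show ?thesis using PS by (intro mult_left_mono pw_mono) auto
          qed
          finally show "(\<integral>\<^sup>+\<zeta>. ?X (z, \<zeta>) \<partial>lborel) \<le> pw (\<beta> z) S" by simp
        qed
        finally show ?thesis by (simp add: B_def)
      qed
      have IQ: "(\<integral>\<^sup>+x. Qx x \<partial>lborel) = ?E * NF"
      proof -
        have "(\<integral>\<^sup>+x. Qx x \<partial>lborel) = (\<integral>\<^sup>+y. \<integral>\<^sup>+x. pw (\<beta> (?z x y)) S * pw (F y) R \<partial>lborel \<partial>lborel)"
          unfolding Qx_def by (rule tonelli_swap) measurable
        also have "\<dots> = (\<integral>\<^sup>+y. ?E * pw (F y) R \<partial>lborel)"
        proof (rule nn_integral_cong)
          fix y
          have "(\<integral>\<^sup>+x. pw (\<beta> (?z x y)) S * pw (F y) R \<partial>lborel) = (\<integral>\<^sup>+x. pw (\<beta> (\<tau> *\<^sub>R y + (1 - \<tau>) *\<^sub>R x)) S \<partial>lborel) * pw (F y) R"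
            by (subst nn_integral_multc) (simp_all add: add.commute)
          also have "(\<integral>\<^sup>+x. pw (\<beta> (\<tau> *\<^sub>R y + (1 - \<tau>) *\<^sub>R x)) S \<partial>lborel) = ?E"
            unfolding B_def using nn_integral_lborel_affine[of "\<lambda>z. pw (\<beta> z) S" "1 - \<tau>" "\<tau> *\<^sub>R y"] \<tau> by simp
          finally show "(\<integral>\<^sup>+x. pw (\<beta> (?z x y)) S * pw (F y) R \<partial>lborel) = ?E * pw (F y) R" .
        qed
        also have "\<dots> = ?E * NF" unfolding NF_def by (rule nn_integral_cmult) measurable
        finally show ?thesis .
      qed
      let ?K = "pw NF (R * (1 / P)) * pw ?D (R * ?\<theta>4)"
      \<comment> \<open>A second use of Hoelder, now in \<open>x\<close>: after raising to the power
        \<open>R\<close>, the factors \<open>Px\<close> and \<open>Qx\<close> carry the weights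
        \<open>R / P\<close> and \<open>R * ?\<theta>3 = 1 - R / P\<close>, which sum to 1.\<close>
      have RP: "R * (1 / P) \<le> 1" using R PS by simp
      have R\<theta>3: "R * ?\<theta>3 = 1 - R * (1 / P)" using R0 by (simp add: right_diff_distrib)
      have "(\<integral>\<^sup>+x. pw (?T x) R \<partial>lborel) \<le> (\<integral>\<^sup>+x. pw (pw (Px x) (1 / P) * pw NF (1 / P) * pw (Qx x) ?\<theta>3 * pw ?D ?\<theta>4) R \<partial>lborel)"
        by (rule nn_integral_mono_AE) (use T_le in \<open>eventually_elim\<close>, use R0 in \<open>auto intro: pw_mono\<close>)
      also have "\<dots> = (\<integral>\<^sup>+x. ?K * (pw (Px x) (R * (1 / P)) * pw (Qx x) (1 - R * (1 / P))) \<partial>lborel)"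
        using R0 unfolding R\<theta>3[symmetric] by (simp only: pw_mult pw_pw less_imp_le mult_ac)
      also have "\<dots> = ?K * (\<integral>\<^sup>+x. pw (Px x) (R * (1 / P)) * pw (Qx x) (1 - R * (1 / P)) \<partial>lborel)"
        by (rule nn_integral_cmult) measurable
      also have "\<dots> \<le> ?K * (pw (\<integral>\<^sup>+x. Px x \<partial>lborel) (R * (1 / P)) * pw (\<integral>\<^sup>+x. Qx x \<partial>lborel) (1 - R * (1 / P)))"
        by (intro mult_left_mono hoelder2) (use RP R0 PS in auto)
      also have "\<dots> \<le> ?K * (pw B (R * (1 / P)) * pw (?E * NF) (R * ?\<theta>3))"
        unfolding IQ R\<theta>3[symmetric] using R0 PS by (intro mult_left_mono mult_right_mono pw_mono IP) auto
      finally have "pw (\<integral>\<^sup>+x. pw (?T x) R \<partial>lborel) (1 / R) \<le> pw (?K * (pw B (R * (1 / P)) * pw (?E * NF) (R * ?\<theta>3))) (1 / R)"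
        using R0 by (intro pw_mono) auto
      also have "\<dots> = pw NF (1 / P) * pw ?D ?\<theta>4 * (pw B (1 / P) * pw (?E * NF) ?\<theta>3)"
        using R0 by (simp add: pw_mult pw_pw)
      also have "\<dots> = (pw (ennreal (1 / \<tau> ^ DIM('a))) ?\<theta>4 * pw (ennreal (1 / (1 - \<tau>) ^ DIM('a))) ?\<theta>3)
          * ((pw B (1 / P) * (pw B ?\<theta>3 * pw B ?\<theta>4)) * (pw NF (1 / P) * pw NF ?\<theta>3))"
        using \<theta> by (simp only: pw_mult mult_ac)
      also have "pw B (1 / P) * (pw B ?\<theta>3 * pw B ?\<theta>4) = pw B (1 / S)"
        using \<theta> by (simp add: pw_add[symmetric] del: pw_add)
      also have "pw NF (1 / P) * pw NF ?\<theta>3 = pw NF (1 / R)"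
        using \<theta> by (simp add: pw_add[symmetric] del: pw_add)
      \<comment> \<open>The exponents \<open>?\<theta>4\<close> and \<open>?\<theta>3\<close> are
        enlarged to \<open>1 - 1 / R\<close> and \<open>1 / R\<close>, which is allowed since
        \<open>\<tau>\<close> and \<open>1 - \<tau>\<close> lie below 1. The result no longer
        depends on \<open>P\<close> and has the form met at \<open>p = top\<close>.\<close>
      also have "pw (ennreal (1 / \<tau> ^ DIM('a))) ?\<theta>4 * pw (ennreal (1 / (1 - \<tau>) ^ DIM('a))) ?\<theta>3 \<le> ennreal ?C"
      proof -
        have pe: "pw (ennreal (1 / t ^ DIM('a))) s \<le> ennreal (t powr (- (DIM('a) * s')))"
          if t: "0 < t" "t < 1" and s: "0 \<le> s" "s \<le> s'" for t s s' :: real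
        proof -
          have "pw (ennreal (1 / t ^ DIM('a))) s = ennreal (t powr (- (DIM('a) * s)))"
          proof (cases "s = 0")
            case False
            have "(1 / t ^ DIM('a)) powr s = t powr (- (DIM('a) * s))"
              using t by (simp add: powr_realpow[symmetric] powr_minus_divide[symmetric] powr_powr)
            then show ?thesis using False t by (simp add: pw_ennreal)
          qed (use t in simp)
          also have "\<dots> \<le> ennreal (t powr (- (DIM('a) * s')))"
            using t s by (intro ennreal_leI powr_mono') (auto intro: mult_left_mono)
          finally show ?thesis .
        qed
        have s4: "?\<theta>4 \<le> 1 - 1 / R" using PS \<theta>(1) by linarith
        have s3: "?\<theta>3 \<le> 1 / R" using \<theta>(1) by linarith
        have "pw (ennreal (1 / \<tau> ^ DIM('a))) ?\<theta>4 * pw (ennreal (1 / (1 - \<tau>) ^ DIM('a))) ?\<theta>3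
          \<le> ennreal (\<tau> powr (- (DIM('a) * (1 - 1 / R)))) * ennreal ((1 - \<tau>) powr (- (DIM('a) * (1 / R))))"
          by (rule mult_mono[OF pe[OF \<tau> \<theta>(3) s4] pe[OF _ _ \<theta>(2) s3]]) (use \<tau> in auto)
        then show ?thesis by (simp add: ennreal_mult[symmetric])
      qed
      finally show ?thesis by (simp add: mult_right_mono)
    qed
  qed
qed


text \<open>With frequencies frozen, \<open>kernel_bound\<close> in position leaves the kernel
  \<open>k\<close>, an \<open>L^S\<close> norm in \<open>z1\<close> of an \<open>L^P\<close> norm in
  \<open>\<zeta>2\<close>. Minkowski's inequality takes the integral over \<open>\<xi>'\<close> out
  of the \<open>R1\<close> norm, and \<open>kernel_bound\<close> applies again in frequency. The
  norm of \<open>b\<close> then runs, from inside out, over \<open>\<zeta>2\<close>,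
  \<open>z1\<close>, \<open>\<zeta>1\<close>, \<open>z2\<close>. Because \<open>S \<le> P\<close>,
  Minkowski's inequality with exponent \<open>P / S\<close> exchanges \<open>z1\<close> and
  \<open>\<zeta>1\<close>, which gives the required \<open>L^S\<close> norm in \<open>Z\<close> of
  an \<open>L^P\<close> norm in \<open>Y\<close>; for \<open>P = S\<close> Tonelli suffices.\<close>

lemma kernel_bound_mixed_finite:
  fixes b :: "('a::euclidean_space \<times> 'a) \<times> ('a \<times> 'a) \<Rightarrow> ennreal" and F :: "'a \<times> 'a \<Rightarrow> ennreal"
  assumes \<tau>: "0 < \<tau>" "\<tau> < 1" and PS: "0 < P" "0 < S" "1 / P + 1 / S = 1" and SP: "S \<le> P"
    and R1: "S \<le> R1" "R1 \<le> P" and R2: "S \<le> R2" "R2 \<le> P"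
    and b: "b \<in> borel_measurable borel" and F: "F \<in> borel_measurable borel"
  shows "pw (\<integral>\<^sup>+\<xi>. pw (pw (\<integral>\<^sup>+x. pw (\<integral>\<^sup>+\<xi>'. \<integral>\<^sup>+x'.
            b (((1 - \<tau>) *\<^sub>R x + \<tau> *\<^sub>R x', \<tau> *\<^sub>R \<xi> + (1 - \<tau>) *\<^sub>R \<xi>'), (\<xi> - \<xi>', - (x - x'))) * F (x', \<xi>')
              \<partial>lborel \<partial>lborel) R1 \<partial>lborel) (1 / R1)) R2 \<partial>lborel) (1 / R2)
    \<le> ennreal (\<tau> powr (- (DIM('a) * (1 - 1 / R1 + 1 / R2))) * (1 - \<tau>) powr (- (DIM('a) * (1 / R1 + (1 - 1 / R2)))))
       * (pw (\<integral>\<^sup>+Z. pw (pw (\<integral>\<^sup>+Y. pw (b (Z, Y)) P \<partial>lborel) (1 / P)) S \<partial>lborel) (1 / S)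
       * pw (\<integral>\<^sup>+\<xi>'. pw (pw (\<integral>\<^sup>+x'. pw (F (x', \<xi>')) R1 \<partial>lborel) (1 / R1)) R2 \<partial>lborel) (1 / R2))"
proof -
  have P1: "1 < P" and S1: "1 < S"
    using PS zero_less_divide_1_iff[of P] zero_less_divide_1_iff[of S] less_divide_eq_1_pos[of P 1] less_divide_eq_1_pos[of S 1]
    by (smt (verit) divide_less_eq_1_pos)+
  have R0: "0 < R1" "0 < R2" "1 < R1" "1 < R2" using R1 R2 S1 by linarith+
  let ?n = "real DIM('a)"
  define N where "N \<xi>' = pw (\<integral>\<^sup>+x'. pw (F (x', \<xi>')) R1 \<partial>lborel) (1 / R1)" for \<xi>'
  define \<beta> where "\<beta> z2 \<zeta>1 z1 = pw (\<integral>\<^sup>+\<zeta>2. pw (b ((z1, z2), (\<zeta>1, - \<zeta>2))) P \<partial>lborel) (1 / P)" for z2 \<zeta>1 z1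
  define k where "k w = pw (\<integral>\<^sup>+z1. pw (\<beta> (fst w) (snd w) z1) S \<partial>lborel) (1 / S)" for w
  note cont = continuous_intros
  have Nm[measurable]: "N \<in> borel_measurable borel"
    unfolding N_def by (intro pw_measurable nn_integral_measurable measurable_comp_continuous[OF F] cont)
  have \<beta>m: "(\<lambda>w. \<beta> (fst (fst w)) (snd (fst w)) (snd w)) \<in> borel_measurable borel"
    unfolding \<beta>_def by (intro pw_measurable nn_integral_measurable measurable_comp_continuous[OF b] cont)
  have km[measurable]: "k \<in> borel_measurable borel"
    unfolding k_def by (intro pw_measurable nn_integral_measurable \<beta>m)
  define c1 where "c1 = \<tau> powr (- (?n * (1 - 1 / R1))) * (1 - \<tau>) powr (- (?n * (1 / R1)))"
  define c2 where "c2 = (1 - \<tau>) powr (- (?n * (1 - 1 / R2))) * \<tau> powr (- (?n * (1 / R2)))"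
  have c0: "0 \<le> c1" "0 \<le> c2" unfolding c1_def c2_def using \<tau> by simp_all
  let ?K = "\<lambda>x \<xi> x' \<xi>'. b (((1 - \<tau>) *\<^sub>R x + \<tau> *\<^sub>R x', \<tau> *\<^sub>R \<xi> + (1 - \<tau>) *\<^sub>R \<xi>'), (\<xi> - \<xi>', - (x - x')))"
  have step1: "pw (\<integral>\<^sup>+x. pw (\<integral>\<^sup>+x'. ?K x \<xi> x' \<xi>' * F (x', \<xi>') \<partial>lborel) R1 \<partial>lborel) (1 / R1)
     \<le> ennreal c1 * (k (\<tau> *\<^sub>R \<xi> + (1 - \<tau>) *\<^sub>R \<xi>', \<xi> - \<xi>') * N \<xi>')" for \<xi> \<xi>'
  proof -
    have "(\<lambda>w. b ((fst w, \<tau> *\<^sub>R \<xi> + (1 - \<tau>) *\<^sub>R \<xi>'), (\<xi> - \<xi>', - snd w))) \<in> borel_measurable borel"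
      "(\<lambda>x'. F (x', \<xi>')) \<in> borel_measurable borel"
      by (intro measurable_comp_continuous[OF b] measurable_comp_continuous[OF F] cont)+
    from kernel_bound[OF \<tau> PS R1 this]
    show ?thesis unfolding fst_conv snd_conv c1_def k_def N_def \<beta>_def .
  qed
  have inner: "pw (\<integral>\<^sup>+x. pw (\<integral>\<^sup>+\<xi>'. \<integral>\<^sup>+x'. ?K x \<xi> x' \<xi>' * F (x', \<xi>') \<partial>lborel \<partial>lborel) R1 \<partial>lborel) (1 / R1)
     \<le> ennreal c1 * (\<integral>\<^sup>+\<xi>'. k (\<tau> *\<^sub>R \<xi> + (1 - \<tau>) *\<^sub>R \<xi>', \<xi> - \<xi>') * N \<xi>' \<partial>lborel)" for \<xi>
  proof -
    have m: "(\<lambda>w. \<integral>\<^sup>+x'. ?K (fst w) \<xi> x' (snd w) * F (x', snd w) \<partial>lborel) \<in> borel_measurable borel"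
      by (intro nn_integral_measurable borel_measurable_times_ennreal measurable_comp_continuous[OF b] measurable_comp_continuous[OF F] cont)
    have "pw (\<integral>\<^sup>+x. pw (\<integral>\<^sup>+\<xi>'. \<integral>\<^sup>+x'. ?K x \<xi> x' \<xi>' * F (x', \<xi>') \<partial>lborel \<partial>lborel) R1 \<partial>lborel) (1 / R1)
       \<le> (\<integral>\<^sup>+\<xi>'. pw (\<integral>\<^sup>+x. pw (\<integral>\<^sup>+x'. ?K x \<xi> x' \<xi>' * F (x', \<xi>') \<partial>lborel) R1 \<partial>lborel) (1 / R1) \<partial>lborel)"
      using minkowski_finite[OF R0(3) m] R0 by (simp add: pw_le_iff)
    also have "\<dots> \<le> (\<integral>\<^sup>+\<xi>'. ennreal c1 * (k (\<tau> *\<^sub>R \<xi> + (1 - \<tau>) *\<^sub>R \<xi>', \<xi> - \<xi>') * N \<xi>') \<partial>lborel)"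
      by (intro nn_integral_mono step1)
    also have "\<dots> = ennreal c1 * (\<integral>\<^sup>+\<xi>'. k (\<tau> *\<^sub>R \<xi> + (1 - \<tau>) *\<^sub>R \<xi>', \<xi> - \<xi>') * N \<xi>' \<partial>lborel)"
      by (rule nn_integral_cmult) measurable
    finally show ?thesis .
  qed
  have \<tau>': "0 < 1 - \<tau>" "1 - \<tau> < 1" using \<tau> by auto
  \<comment> \<open>Here \<open>\<tau>\<close> and \<open>1 - \<tau>\<close> change roles, as the
    frequency component of the kernel point is \<open>\<tau> \<xi> + (1 - \<tau>) \<xi>'\<close>.
    Hence the exchanged bases in \<open>c2\<close>.\<close>
  have outer: "pw (\<integral>\<^sup>+\<xi>. pw (\<integral>\<^sup>+\<xi>'. k (\<tau> *\<^sub>R \<xi> + (1 - \<tau>) *\<^sub>R \<xi>', \<xi> - \<xi>') * N \<xi>' \<partial>lborel) R2 \<partial>lborel) (1 / R2)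
     \<le> ennreal c2 * (pw (\<integral>\<^sup>+z2. pw (pw (\<integral>\<^sup>+\<zeta>1. pw (k (z2, \<zeta>1)) P \<partial>lborel) (1 / P)) S \<partial>lborel) (1 / S) * pw (\<integral>\<^sup>+\<xi>'. pw (N \<xi>') R2 \<partial>lborel) (1 / R2))"
    using kernel_bound[OF \<tau>' PS R2 km Nm] by (simp add: c2_def)
  have swap: "(\<integral>\<^sup>+z2. pw (pw (\<integral>\<^sup>+\<zeta>1. pw (k (z2, \<zeta>1)) P \<partial>lborel) (1 / P)) S \<partial>lborel)
     \<le> (\<integral>\<^sup>+Z. pw (pw (\<integral>\<^sup>+Y. pw (b (Z, Y)) P \<partial>lborel) (1 / P)) S \<partial>lborel)"
  proof -
    have Jm: "(\<lambda>Z. \<integral>\<^sup>+Y. pw (b (Z, Y)) P \<partial>lborel) \<in> borel_measurable borel"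
      by (intro pw_measurable nn_integral_measurable) (use b in simp)
    have J: "(\<integral>\<^sup>+\<zeta>1. pw (\<beta> z2 \<zeta>1 z1) P \<partial>lborel) = (\<integral>\<^sup>+Y. pw (b ((z1, z2), Y)) P \<partial>lborel)" for z1 z2
    proof -
      have "(\<lambda>Y. pw (b ((z1, z2), Y)) P) \<in> borel_measurable borel"
        by (intro pw_measurable measurable_comp_continuous[OF b] cont)
      then have "(\<integral>\<^sup>+Y. pw (b ((z1, z2), Y)) P \<partial>lborel) = (\<integral>\<^sup>+\<zeta>1. \<integral>\<^sup>+\<zeta>2. pw (b ((z1, z2), (\<zeta>1, \<zeta>2))) P \<partial>lborel \<partial>lborel)"
        by (rule nn_integral_lborel_pair)
      also have "\<dots> = (\<integral>\<^sup>+\<zeta>1. \<integral>\<^sup>+\<zeta>2. pw (b ((z1, z2), (\<zeta>1, 0 - \<zeta>2))) P \<partial>lborel \<partial>lborel)"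
        by (intro nn_integral_cong nn_integral_lborel_reflect[symmetric] pw_measurable measurable_comp_continuous[OF b] cont)
      finally show ?thesis using PS by (simp add: \<beta>_def pw_pw)
    qed
    have in1: "pw (pw (\<integral>\<^sup>+\<zeta>1. pw (k (z2, \<zeta>1)) P \<partial>lborel) (1 / P)) S
       \<le> (\<integral>\<^sup>+z1. pw (pw (\<integral>\<^sup>+Y. pw (b ((z1, z2), Y)) P \<partial>lborel) (1 / P)) S \<partial>lborel)" for z2
    proof (cases "P = S")
      case True
      have "pw (pw (\<integral>\<^sup>+\<zeta>1. pw (k (z2, \<zeta>1)) P \<partial>lborel) (1 / P)) S = (\<integral>\<^sup>+\<zeta>1. \<integral>\<^sup>+z1. pw (\<beta> z2 \<zeta>1 z1) S \<partial>lborel \<partial>lborel)"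
        using PS by (simp add: k_def pw_pw True)
      also have "\<dots> = (\<integral>\<^sup>+z1. \<integral>\<^sup>+\<zeta>1. pw (\<beta> z2 \<zeta>1 z1) S \<partial>lborel \<partial>lborel)"
        by (intro tonelli_swap pw_measurable, rule measurable_comp_continuous[OF \<beta>m, of "\<lambda>w. ((z2, fst w), snd w)", simplified]) (intro cont)
      finally show ?thesis using PS J by (simp add: True pw_pw)
    next
      case False
      then have r: "1 < P / S" using SP PS by simp
      have m: "(\<lambda>w. pw (\<beta> z2 (fst w) (snd w)) S) \<in> borel_measurable borel"
        by (intro pw_measurable, rule measurable_comp_continuous[OF \<beta>m, of "\<lambda>w. ((z2, fst w), snd w)", simplified]) (intro cont)
      have "pw (pw (\<integral>\<^sup>+\<zeta>1. pw (k (z2, \<zeta>1)) P \<partial>lborel) (1 / P)) S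
          = pw (\<integral>\<^sup>+\<zeta>1. pw (\<integral>\<^sup>+z1. pw (\<beta> z2 \<zeta>1 z1) S \<partial>lborel) (P / S) \<partial>lborel) (1 / (P / S))"
        using PS by (simp add: k_def pw_pw)
      also have "\<dots> \<le> (\<integral>\<^sup>+z1. pw (\<integral>\<^sup>+\<zeta>1. pw (pw (\<beta> z2 \<zeta>1 z1) S) (P / S) \<partial>lborel) (1 / (P / S)) \<partial>lborel)"
        using minkowski_finite[OF r m] r PS by (subst pw_le_iff) auto
      also have "\<dots> = (\<integral>\<^sup>+z1. pw (pw (\<integral>\<^sup>+Y. pw (b ((z1, z2), Y)) P \<partial>lborel) (1 / P)) S \<partial>lborel)"
        using PS J by (simp add: pw_pw)
      finally show ?thesis .
    qed
    have "(\<integral>\<^sup>+z2. pw (pw (\<integral>\<^sup>+\<zeta>1. pw (k (z2, \<zeta>1)) P \<partial>lborel) (1 / P)) S \<partial>lborel)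
       \<le> (\<integral>\<^sup>+z2. \<integral>\<^sup>+z1. pw (pw (\<integral>\<^sup>+Y. pw (b ((z1, z2), Y)) P \<partial>lborel) (1 / P)) S \<partial>lborel \<partial>lborel)"
      by (intro nn_integral_mono in1)
    also have "\<dots> = (\<integral>\<^sup>+z1. \<integral>\<^sup>+z2. pw (pw (\<integral>\<^sup>+Y. pw (b ((z1, z2), Y)) P \<partial>lborel) (1 / P)) S \<partial>lborel \<partial>lborel)"
      by (rule tonelli_swap) (intro pw_measurable measurable_comp_continuous[OF Jm] cont)
    also have "\<dots> = (\<integral>\<^sup>+Z. pw (pw (\<integral>\<^sup>+Y. pw (b (Z, Y)) P \<partial>lborel) (1 / P)) S \<partial>lborel)"
      by (rule nn_integral_lborel_pair[symmetric]) (intro pw_measurable Jm)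
    finally show ?thesis .
  qed
  let ?NF = "pw (\<integral>\<^sup>+\<xi>'. pw (N \<xi>') R2 \<partial>lborel) (1 / R2)"
  let ?T = "\<lambda>\<xi>. \<integral>\<^sup>+\<xi>'. k (\<tau> *\<^sub>R \<xi> + (1 - \<tau>) *\<^sub>R \<xi>', \<xi> - \<xi>') * N \<xi>' \<partial>lborel"
  have Tm: "?T \<in> borel_measurable borel" by (rule nn_integral_measurable) measurable
  have "pw (\<integral>\<^sup>+\<xi>. pw (pw (\<integral>\<^sup>+x. pw (\<integral>\<^sup>+\<xi>'. \<integral>\<^sup>+x'. ?K x \<xi> x' \<xi>' * F (x', \<xi>') \<partial>lborel \<partial>lborel) R1 \<partial>lborel) (1 / R1)) R2 \<partial>lborel) (1 / R2)
     \<le> pw (\<integral>\<^sup>+\<xi>. pw (ennreal c1 * ?T \<xi>) R2 \<partial>lborel) (1 / R2)"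
    using R0 by (intro pw_mono nn_integral_mono inner) auto
  also have "(\<integral>\<^sup>+\<xi>. pw (ennreal c1 * ?T \<xi>) R2 \<partial>lborel) = pw (ennreal c1) R2 * (\<integral>\<^sup>+\<xi>. pw (?T \<xi>) R2 \<partial>lborel)"
    using R0 Tm by (simp add: pw_mult nn_integral_cmult)
  also have "pw \<dots> (1 / R2) = ennreal c1 * pw (\<integral>\<^sup>+\<xi>. pw (?T \<xi>) R2 \<partial>lborel) (1 / R2)"
    using R0 by (simp add: pw_mult pw_pw)
  also have "\<dots> \<le> ennreal c1 * (ennreal c2 * (pw (\<integral>\<^sup>+Z. pw (pw (\<integral>\<^sup>+Y. pw (b (Z, Y)) P \<partial>lborel) (1 / P)) S \<partial>lborel) (1 / S) * ?NF))"
    using PS by (intro mult_left_mono order_trans[OF outer] mult_right_mono pw_mono swap) auto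
  also have "\<dots> = ennreal (c1 * c2) * (pw (\<integral>\<^sup>+Z. pw (pw (\<integral>\<^sup>+Y. pw (b (Z, Y)) P \<partial>lborel) (1 / P)) S \<partial>lborel) (1 / S) * ?NF)"
    using c0 by (simp add: ennreal_mult mult.assoc)
  also have "c1 * c2 = \<tau> powr (- (?n * (1 - 1 / R1 + 1 / R2))) * (1 - \<tau>) powr (- (?n * (1 / R1 + (1 - 1 / R2))))"
  proof -
    have "c1 * c2 = (\<tau> powr (- (?n * (1 - 1 / R1))) * \<tau> powr (- (?n * (1 / R2)))) * ((1 - \<tau>) powr (- (?n * (1 / R1))) * (1 - \<tau>) powr (- (?n * (1 - 1 / R2))))"
      unfolding c1_def c2_def by (simp only: mult_ac)
    also have "\<dots> = \<tau> powr (- (?n * (1 - 1 / R1)) + - (?n * (1 / R2))) * (1 - \<tau>) powr (- (?n * (1 / R1)) + - (?n * (1 - 1 / R2)))"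
      by (simp only: powr_add)
    also have "\<dots> = \<tau> powr (- (?n * (1 - 1 / R1 + 1 / R2))) * (1 - \<tau>) powr (- (?n * (1 / R1 + (1 - 1 / R2))))"
      by (simp only: distrib_left minus_add_distrib)
    finally show ?thesis .
  qed
  finally show ?thesis unfolding N_def .
qed

text \<open>The endpoint \<open>p = top\<close>, \<open>q = 1\<close>: the kernel is majorized by a
  function of the first variable alone. Taking that variable as the variable of integration exhibits
  the operator as a superposition of affine pullbacks of \<open>F\<close>, and Minkowski's
  inequality bounds it by the sum of their norms. The Jacobians together with the scaling of the two
  norms give exactly the exponents of \<open>alpha_tau\<close>.\<close>

lemma kernel_bound_mixed_top:
  fixes \<beta> F :: "'a::euclidean_space \<times> 'a \<Rightarrow> ennreal"
  assumes \<tau>: "0 < \<tau>" "\<tau> < 1" and r: "1 \<le> r1" "1 \<le> r2"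
    and \<beta>: "\<beta> \<in> borel_measurable borel" and F: "F \<in> borel_measurable borel"
  shows "Lnorm r2 (\<lambda>\<xi>. Lnorm r1 (\<lambda>x. \<integral>\<^sup>+\<xi>'. \<integral>\<^sup>+x'. \<beta> ((1 - \<tau>) *\<^sub>R x + \<tau> *\<^sub>R x', \<tau> *\<^sub>R \<xi> + (1 - \<tau>) *\<^sub>R \<xi>') * F (x', \<xi>') \<partial>lborel \<partial>lborel))
    \<le> ennreal (\<tau> powr (- (DIM('a) * (1 - enn2real (inverse r1) + enn2real (inverse r2)))) * (1 - \<tau>) powr (- (DIM('a) * (enn2real (inverse r1) + (1 - enn2real (inverse r2))))))
       * ((\<integral>\<^sup>+Z. \<beta> Z \<partial>lborel) * Lnorm r2 (\<lambda>\<xi>'. Lnorm r1 (\<lambda>x'. F (x', \<xi>'))))"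
proof -
  let ?n = "real DIM('a)" and ?e1 = "enn2real (inverse r1)" and ?e2 = "enn2real (inverse r2)"
  note cont = continuous_intros
  \<comment> \<open>Solving for the old variables gives \<open>x' = fst Z / \<tau> - c x\<close> and
    \<open>\<xi>' = snd Z / (1 - \<tau>) - \<xi> / c\<close>; the slopes \<open>c\<close> and
    \<open>1 / c\<close> determine how the \<open>r1\<close> and \<open>r2\<close> norms scale,
    while \<open>k\<close> is the Jacobian of the substitution.\<close>
  define c where "c = (1 - \<tau>) / \<tau>"
  have c: "0 < c" using \<tau> by (simp add: c_def)
  define k where "k = (1 / \<tau> ^ DIM('a)) * (1 / (1 - \<tau>) ^ DIM('a))"
  have k: "0 < k" using \<tau> by (simp add: k_def)
  define N where "N \<xi>' = Lnorm r1 (\<lambda>x'. F (x', \<xi>'))" for \<xi>'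
  have F': "(\<lambda>x'. F (x', \<xi>')) \<in> borel_measurable borel" for \<xi>'
    by (intro measurable_comp_continuous[OF F] cont)
  have Nm: "N \<in> borel_measurable borel"
    unfolding N_def by (intro Lnorm_measurable r measurable_comp_continuous[OF F] cont)
  have sub: "(\<integral>\<^sup>+\<xi>'. \<integral>\<^sup>+x'. \<beta> ((1 - \<tau>) *\<^sub>R x + \<tau> *\<^sub>R x', \<tau> *\<^sub>R \<xi> + (1 - \<tau>) *\<^sub>R \<xi>') * F (x', \<xi>') \<partial>lborel \<partial>lborel)
    = ennreal k * (\<integral>\<^sup>+Z. \<beta> Z * F ((1 / \<tau>) *\<^sub>R fst Z + (- c) *\<^sub>R x, (1 / (1 - \<tau>)) *\<^sub>R snd Z + (- (1 / c)) *\<^sub>R \<xi>) \<partial>lborel)" for x \<xi>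
  proof -
    let ?G = "\<lambda>z1 z2. \<beta> (z1, z2) * F ((1 / \<tau>) *\<^sub>R z1 + (- c) *\<^sub>R x, (1 / (1 - \<tau>)) *\<^sub>R z2 + (- (1 / c)) *\<^sub>R \<xi>)"
    have gm: "(\<lambda>w. ?G (fst w) (snd w)) \<in> borel_measurable borel"
      by (intro borel_measurable_times_ennreal measurable_comp_continuous[OF \<beta>] measurable_comp_continuous[OF F] cont)
    have e: "\<beta> ((1 - \<tau>) *\<^sub>R x + \<tau> *\<^sub>R x', \<tau> *\<^sub>R \<xi> + (1 - \<tau>) *\<^sub>R \<xi>') * F (x', \<xi>')
       = ?G ((1 - \<tau>) *\<^sub>R x + \<tau> *\<^sub>R x') (\<tau> *\<^sub>R \<xi> + (1 - \<tau>) *\<^sub>R \<xi>')" for x' \<xi>'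
    proof -
      have "(1 / \<tau>) *\<^sub>R ((1 - \<tau>) *\<^sub>R x + \<tau> *\<^sub>R x') + (- c) *\<^sub>R x = x'"
        using \<tau> by (simp add: scaleR_add_right c_def)
      moreover have "(1 / (1 - \<tau>)) *\<^sub>R (\<tau> *\<^sub>R \<xi> + (1 - \<tau>) *\<^sub>R \<xi>') + (- (1 / c)) *\<^sub>R \<xi> = \<xi>'"
        using \<tau> by (simp add: scaleR_add_right c_def)
      ultimately show ?thesis by simp
    qed
    have "(\<integral>\<^sup>+\<xi>'. \<integral>\<^sup>+x'. ?G ((1 - \<tau>) *\<^sub>R x + \<tau> *\<^sub>R x') (\<tau> *\<^sub>R \<xi> + (1 - \<tau>) *\<^sub>R \<xi>') \<partial>lborel \<partial>lborel)
       = (\<integral>\<^sup>+\<xi>'. ennreal (1 / \<tau> ^ DIM('a)) * (\<integral>\<^sup>+z1. ?G z1 (\<tau> *\<^sub>R \<xi> + (1 - \<tau>) *\<^sub>R \<xi>') \<partial>lborel) \<partial>lborel)"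
    proof (rule nn_integral_cong)
      fix \<xi>'
      have "(\<lambda>z1. ?G z1 (\<tau> *\<^sub>R \<xi> + (1 - \<tau>) *\<^sub>R \<xi>')) \<in> borel_measurable borel" by (rule measurable_slice(2)[OF gm])
      from nn_integral_lborel_affine[OF this, of \<tau> "(1 - \<tau>) *\<^sub>R x"] \<tau>
      show "(\<integral>\<^sup>+x'. ?G ((1 - \<tau>) *\<^sub>R x + \<tau> *\<^sub>R x') (\<tau> *\<^sub>R \<xi> + (1 - \<tau>) *\<^sub>R \<xi>') \<partial>lborel) = ennreal (1 / \<tau> ^ DIM('a)) * (\<integral>\<^sup>+z1. ?G z1 (\<tau> *\<^sub>R \<xi> + (1 - \<tau>) *\<^sub>R \<xi>') \<partial>lborel)"
        by simp
    qed
    also have "\<dots> = ennreal (1 / \<bar>1 - \<tau>\<bar> ^ DIM('a)) * (\<integral>\<^sup>+z2. ennreal (1 / \<tau> ^ DIM('a)) * (\<integral>\<^sup>+z1. ?G z1 z2 \<partial>lborel) \<partial>lborel)"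
    proof (rule nn_integral_lborel_affine)
      have "(\<lambda>w. ?G (snd w) (fst w)) \<in> borel_measurable borel"
        by (intro borel_measurable_times_ennreal measurable_comp_continuous[OF \<beta>] measurable_comp_continuous[OF F] cont)
      then have "(\<lambda>z2. \<integral>\<^sup>+z1. ?G z1 z2 \<partial>lborel) \<in> borel_measurable borel" by (rule nn_integral_measurable)
      then show "(\<lambda>z2. ennreal (1 / \<tau> ^ DIM('a)) * (\<integral>\<^sup>+z1. ?G z1 z2 \<partial>lborel)) \<in> borel_measurable borel"
        by measurable
    qed (use \<tau> in simp)
    also have "\<dots> = ennreal (1 / \<bar>1 - \<tau>\<bar> ^ DIM('a)) * (ennreal (1 / \<tau> ^ DIM('a)) * (\<integral>\<^sup>+z2. \<integral>\<^sup>+z1. ?G z1 z2 \<partial>lborel \<partial>lborel))"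
    proof (subst nn_integral_cmult)
      have "(\<lambda>w. ?G (snd w) (fst w)) \<in> borel_measurable borel"
        by (intro borel_measurable_times_ennreal measurable_comp_continuous[OF \<beta>] measurable_comp_continuous[OF F] cont)
      from nn_integral_measurable[OF this] show "(\<lambda>z2. \<integral>\<^sup>+z1. ?G z1 z2 \<partial>lborel) \<in> borel_measurable lborel" by simp
    qed simp
    also have "(\<integral>\<^sup>+z2. \<integral>\<^sup>+z1. ?G z1 z2 \<partial>lborel \<partial>lborel) = (\<integral>\<^sup>+Z. ?G (fst Z) (snd Z) \<partial>lborel)"
      using tonelli_swap[OF gm] nn_integral_lborel_pair[OF gm] by simp
    also have "ennreal (1 / \<bar>1 - \<tau>\<bar> ^ DIM('a)) * (ennreal (1 / \<tau> ^ DIM('a)) * (\<integral>\<^sup>+Z. ?G (fst Z) (snd Z) \<partial>lborel))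
      = ennreal k * (\<integral>\<^sup>+Z. ?G (fst Z) (snd Z) \<partial>lborel)"
      using \<tau> by (simp add: k_def ennreal_mult[symmetric] mult.assoc[symmetric] mult.commute)
    finally show ?thesis unfolding e by simp
  qed
  let ?d1 = "ennreal (c powr (- (?n * ?e1)))" and ?d2 = "ennreal ((1 / c) powr (- (?n * ?e2)))"
  have pos: "0 < ennreal k" "ennreal k < \<infinity>" "0 < ?d1" "?d1 < \<infinity>" "0 < ?d2" "?d2 < \<infinity>" using k c by auto
  let ?I = "\<lambda>x \<xi> (Z :: 'a \<times> 'a). \<beta> Z * F ((1 / \<tau>) *\<^sub>R fst Z + (- c) *\<^sub>R x, (1 / (1 - \<tau>)) *\<^sub>R snd Z + (- (1 / c)) *\<^sub>R \<xi>)"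
  let ?n1 = "\<lambda>\<xi> (Z :: 'a \<times> 'a). N ((1 / (1 - \<tau>)) *\<^sub>R snd Z + (- (1 / c)) *\<^sub>R \<xi>)"
  have Im: "(\<lambda>w. ?I (fst w) \<xi> (snd w)) \<in> borel_measurable borel" for \<xi>
    by (intro borel_measurable_times_ennreal measurable_comp_continuous[OF \<beta>] measurable_comp_continuous[OF F] cont)
  have nm: "(\<lambda>w. \<beta> (snd w) * ?n1 (fst w) (snd w)) \<in> borel_measurable borel"
    by (intro borel_measurable_times_ennreal measurable_comp_continuous[OF \<beta>] measurable_comp_continuous[OF Nm] cont)
  have nm': "(\<lambda>Z. \<beta> Z * ?n1 \<xi> Z) \<in> borel_measurable borel" for \<xi> by (rule measurable_slice(1)[OF nm])
  have inner: "Lnorm r1 (\<lambda>x. ennreal k * (\<integral>\<^sup>+Z. ?I x \<xi> Z \<partial>lborel)) \<le> ennreal k * ?d1 * (\<integral>\<^sup>+Z. \<beta> Z * ?n1 \<xi> Z \<partial>lborel)" for \<xi>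
  proof -
    have "Lnorm r1 (\<lambda>x. ennreal k * (\<integral>\<^sup>+Z. ?I x \<xi> Z \<partial>lborel)) \<le> ennreal k * Lnorm r1 (\<lambda>x. \<integral>\<^sup>+Z. ?I x \<xi> Z \<partial>lborel)"
      by (rule Lnorm_cmult_le[OF r(1) pos(1,2)])
    also have "\<dots> \<le> ennreal k * (\<integral>\<^sup>+Z. Lnorm r1 (\<lambda>x. ?I x \<xi> Z) \<partial>lborel)"
      by (intro mult_left_mono minkowski r Im) simp
    also have "\<dots> \<le> ennreal k * (\<integral>\<^sup>+Z. ?d1 * (\<beta> Z * ?n1 \<xi> Z) \<partial>lborel)"
    proof (intro mult_left_mono nn_integral_mono)
      fix Z :: "'a \<times> 'a"
      let ?t = "(1 / (1 - \<tau>)) *\<^sub>R snd Z + (- (1 / c)) *\<^sub>R \<xi>"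
      have "Lnorm r1 (\<lambda>x. ?I x \<xi> Z) \<le> \<beta> Z * Lnorm r1 (\<lambda>x. F ((1 / \<tau>) *\<^sub>R fst Z + (- c) *\<^sub>R x, ?t))"
        by (intro Lnorm_cmult_le_measurable r measurable_comp_continuous[OF F] cont)
      also have "\<dots> \<le> \<beta> Z * (?d1 * N ?t)"
        using Lnorm_affine[OF r(1) F', of "- c" "(1 / \<tau>) *\<^sub>R fst Z" ?t] c
        by (intro mult_left_mono) (simp_all add: N_def)
      finally show "Lnorm r1 (\<lambda>x. ?I x \<xi> Z) \<le> ?d1 * (\<beta> Z * N ?t)" by (simp add: mult_ac)
    qed simp
    also have "\<dots> = ennreal k * (?d1 * (\<integral>\<^sup>+Z. \<beta> Z * ?n1 \<xi> Z \<partial>lborel))"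
      by (subst nn_integral_cmult) (use nm' in auto)
    finally show ?thesis by (simp add: mult.assoc)
  qed
  have kd: "0 < ennreal k * ?d1" "ennreal k * ?d1 < \<infinity>"
    using pos by (auto simp: ennreal_zero_less_mult_iff ennreal_mult_less_top)
  have "Lnorm r2 (\<lambda>\<xi>. Lnorm r1 (\<lambda>x. ennreal k * (\<integral>\<^sup>+Z. ?I x \<xi> Z \<partial>lborel)))
     \<le> Lnorm r2 (\<lambda>\<xi>. (ennreal k * ?d1) * (\<integral>\<^sup>+Z. \<beta> Z * ?n1 \<xi> Z \<partial>lborel))"
    by (intro Lnorm_mono r inner)
  also have "\<dots> \<le> (ennreal k * ?d1) * Lnorm r2 (\<lambda>\<xi>. \<integral>\<^sup>+Z. \<beta> Z * ?n1 \<xi> Z \<partial>lborel)"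
    by (rule Lnorm_cmult_le[OF r(2) kd])
  also have "\<dots> \<le> (ennreal k * ?d1) * (\<integral>\<^sup>+Z. Lnorm r2 (\<lambda>\<xi>. \<beta> Z * ?n1 \<xi> Z) \<partial>lborel)"
    by (intro mult_left_mono minkowski r nm) simp
  also have "\<dots> \<le> (ennreal k * ?d1) * (\<integral>\<^sup>+Z. (?d2 * Lnorm r2 N) * \<beta> Z \<partial>lborel)"
  proof (intro mult_left_mono nn_integral_mono)
    fix Z :: "'a \<times> 'a"
    have "Lnorm r2 (\<lambda>\<xi>. \<beta> Z * ?n1 \<xi> Z) \<le> \<beta> Z * Lnorm r2 (\<lambda>\<xi>. ?n1 \<xi> Z)"
      by (intro Lnorm_cmult_le_measurable r measurable_comp_continuous[OF Nm] cont)
    also have "\<dots> \<le> \<beta> Z * (?d2 * Lnorm r2 N)"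
      using Lnorm_affine[OF r(2) Nm, of "- (1 / c)" "(1 / (1 - \<tau>)) *\<^sub>R snd Z"] c
      by (intro mult_left_mono) (simp_all)
    finally show "Lnorm r2 (\<lambda>\<xi>. \<beta> Z * ?n1 \<xi> Z) \<le> (?d2 * Lnorm r2 N) * \<beta> Z" by (simp add: mult_ac)
  qed simp
  also have "\<dots> = (ennreal k * ?d1) * ((?d2 * Lnorm r2 N) * (\<integral>\<^sup>+Z. \<beta> Z \<partial>lborel))"
    using \<beta> by (simp add: nn_integral_cmult)
  also have "\<dots> = (ennreal k * ?d1 * ?d2) * ((\<integral>\<^sup>+Z. \<beta> Z \<partial>lborel) * Lnorm r2 N)"
    by (simp only: mult_ac)
  also have "ennreal k * ?d1 * ?d2 = ennreal (\<tau> powr (- (?n * (1 - ?e1 + ?e2))) * (1 - \<tau>) powr (- (?n * (?e1 + (1 - ?e2)))))"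
  proof -
    have "k = \<tau> powr (- ?n) * (1 - \<tau>) powr (- ?n)"
      using \<tau> by (simp add: k_def powr_minus_divide powr_realpow)
    moreover have "c powr (- (?n * ?e1)) = \<tau> powr (?n * ?e1) * (1 - \<tau>) powr (- (?n * ?e1))"
      using \<tau> by (simp add: c_def powr_divide powr_minus divide_simps)
    moreover have "(1 / c) powr (- (?n * ?e2)) = \<tau> powr (- (?n * ?e2)) * (1 - \<tau>) powr (?n * ?e2)"
      using \<tau> by (simp add: c_def powr_divide powr_minus divide_simps)
    ultimately have "k * c powr (- (?n * ?e1)) * (1 / c) powr (- (?n * ?e2))
       = (\<tau> powr (- ?n) * \<tau> powr (?n * ?e1) * \<tau> powr (- (?n * ?e2))) * ((1 - \<tau>) powr (- ?n) * (1 - \<tau>) powr (- (?n * ?e1)) * (1 - \<tau>) powr (?n * ?e2))"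
      by (simp only: mult_ac)
    also have "\<dots> = \<tau> powr (- (?n * (1 - ?e1 + ?e2))) * (1 - \<tau>) powr (- (?n * (?e1 + (1 - ?e2))))"
      by (simp add: powr_add[symmetric] algebra_simps)
    finally show ?thesis using k c by (simp add: ennreal_mult[symmetric])
  qed
  finally show ?thesis unfolding sub N_def .
qed

section \<open>Convolution with rapidly decaying functions\<close>

text \<open>Convolution of \<open>a\<close> with \<open>dec N\<close> in both variables,
  \<open>dec N\<close> being even. Integrating the symbol against a function concentrated around a
  point \<open>W\<close> becomes a kernel evaluated at \<open>W\<close>, and the averaging is what
  makes exponents larger than \<open>q\<close> accessible in the first variable.\<close>

definition smear :: "nat \<Rightarrow> ('w::euclidean_space \<times> 'w \<Rightarrow> ennreal) \<Rightarrow> 'w \<times> 'w \<Rightarrow> ennreal"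
  where "smear N a W = (\<integral>\<^sup>+z. \<integral>\<^sup>+\<zeta>. a (z, \<zeta>) * (ennreal (dec N (z - fst W)) * ennreal (dec N (\<zeta> - snd W))) \<partial>lborel \<partial>lborel)"

definition dec_nn :: "nat \<Rightarrow> 'w::euclidean_space itself \<Rightarrow> ennreal"
  where "dec_nn N T = (\<integral>\<^sup>+z. ennreal (dec N (z :: 'w)) \<partial>lborel)"

lemma dec_nn_finite: "2 * DIM('w::euclidean_space) \<le> N \<Longrightarrow> dec_nn N TYPE('w) < \<infinity>"
  unfolding dec_nn_def using nn_integral_eq_integral[OF integrable_dec[of N, where 'a='w]]
  by (simp add: less_top[symmetric])

lemma dec_nn_shift:
  fixes z Z :: "'w::euclidean_space"
  shows "(\<integral>\<^sup>+z. ennreal (dec N (z - Z)) \<partial>lborel) = dec_nn N TYPE('w)"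
    and "(\<integral>\<^sup>+Z. ennreal (dec N (z - Z)) \<partial>lborel) = dec_nn N TYPE('w)"
proof -
  have m: "(\<lambda>z::'w. ennreal (dec N z)) \<in> borel_measurable borel" by measurable
  show "(\<integral>\<^sup>+z. ennreal (dec N (z - Z)) \<partial>lborel) = dec_nn N TYPE('w)"
    unfolding dec_nn_def using nn_integral_lborel_translate[OF m, of "- Z"] by simp
  show "(\<integral>\<^sup>+Z. ennreal (dec N (z - Z)) \<partial>lborel) = dec_nn N TYPE('w)"
    unfolding dec_nn_def by (rule nn_integral_lborel_reflect[OF m])
qed

lemma dec_measurable_cont:
  assumes "continuous_on UNIV L"
  shows "(\<lambda>x. ennreal (dec N (L x :: 'w::euclidean_space))) \<in> borel_measurable borel"
proof -
  have "(\<lambda>z::'w. ennreal (dec N z)) \<in> borel_measurable borel" by measurable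
  from measurable_comp_continuous[OF this assms] show ?thesis .
qed

lemma smear_measurable:
  assumes a: "a \<in> borel_measurable borel"
  shows "smear N a \<in> borel_measurable borel"
  unfolding smear_def
  by (intro nn_integral_measurable borel_measurable_times_ennreal measurable_comp_continuous[OF a] dec_measurable_cont continuous_intros)

text \<open>After a translation, \<open>Y\<close> occurs only as a shift of the slice
  \<open>a (z, \<cdot>)\<close>, which does not change its norm. Minkowski's inequality then leaves
  a convolution in \<open>z\<close> alone.\<close>

lemma Lnorm_smear:
  fixes a :: "'w::euclidean_space \<times> 'w \<Rightarrow> ennreal"
  assumes p: "1 \<le> p" and a: "a \<in> borel_measurable borel"
  shows "Lnorm p (\<lambda>Y. smear N a (Z, Y)) \<le> dec_nn N TYPE('w) * (\<integral>\<^sup>+z. Lnorm p (\<lambda>\<zeta>. a (z, \<zeta>)) * ennreal (dec N (z - Z)) \<partial>lborel)"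
proof -
  note cont = continuous_intros
  have am: "(\<lambda>\<zeta>. a (z, \<zeta>)) \<in> borel_measurable borel" for z by (intro measurable_comp_continuous[OF a] cont)
  let ?A = "\<lambda>z. Lnorm p (\<lambda>\<zeta>. a (z, \<zeta>))"
  have Am: "?A \<in> borel_measurable borel" by (rule Lnorm_measurable[OF p]) (use a in simp)
  let ?h = "\<lambda>Y w. a (fst w, snd w + Y) * (ennreal (dec N (fst w - Z)) * ennreal (dec N (snd w)))"
  have e: "smear N a (Z, Y) = (\<integral>\<^sup>+w. ?h Y w \<partial>lborel)" for Y
  proof -
    have "smear N a (Z, Y) = (\<integral>\<^sup>+z. \<integral>\<^sup>+\<eta>. a (z, \<eta> + Y) * (ennreal (dec N (z - Z)) * ennreal (dec N \<eta>)) \<partial>lborel \<partial>lborel)"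
      unfolding smear_def
    proof (rule nn_integral_cong)
      fix z
      have "(\<lambda>\<zeta>. a (z, \<zeta>) * (ennreal (dec N (z - fst (Z, Y))) * ennreal (dec N (\<zeta> - snd (Z, Y))))) \<in> borel_measurable borel"
        by (intro borel_measurable_times_ennreal am dec_measurable_cont cont)
      from nn_integral_lborel_translate[OF this, of Y]
      show "(\<integral>\<^sup>+\<zeta>. a (z, \<zeta>) * (ennreal (dec N (z - fst (Z, Y))) * ennreal (dec N (\<zeta> - snd (Z, Y)))) \<partial>lborel)
        = (\<integral>\<^sup>+\<eta>. a (z, \<eta> + Y) * (ennreal (dec N (z - Z)) * ennreal (dec N \<eta>)) \<partial>lborel)"
        by (simp add: add.commute)
    qed
    also have "\<dots> = (\<integral>\<^sup>+w. ?h Y w \<partial>lborel)"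
      by (subst nn_integral_lborel_pair) (auto intro!: borel_measurable_times_ennreal measurable_comp_continuous[OF a] dec_measurable_cont cont)
    finally show ?thesis .
  qed
  have "Lnorm p (\<lambda>Y. smear N a (Z, Y)) \<le> (\<integral>\<^sup>+w. Lnorm p (\<lambda>Y. ?h Y w) \<partial>lborel)"
    unfolding e by (intro minkowski p borel_measurable_times_ennreal measurable_comp_continuous[OF a] dec_measurable_cont cont)
  also have "\<dots> \<le> (\<integral>\<^sup>+w. (?A (fst w) * ennreal (dec N (fst w - Z))) * ennreal (dec N (snd w)) \<partial>(lborel :: ('w \<times> 'w) measure))"
  proof (rule nn_integral_mono)
    fix w :: "'w \<times> 'w"
    let ?e = "ennreal (dec N (fst w - Z)) * ennreal (dec N (snd w))"
    have "Lnorm p (\<lambda>Y. ?h Y w) = Lnorm p (\<lambda>Y. ?e * a (fst w, snd w + 1 *\<^sub>R Y))" by (simp add: mult_ac)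
    also have "\<dots> \<le> ?e * Lnorm p (\<lambda>Y. a (fst w, snd w + 1 *\<^sub>R Y))"
      by (intro Lnorm_cmult_le_measurable p measurable_comp_continuous[OF a] cont)
    also have "\<dots> \<le> ?e * ?A (fst w)"
      using Lnorm_affine[OF p am, of 1 "fst w" "snd w"] by (intro mult_left_mono) auto
    finally show "Lnorm p (\<lambda>Y. ?h Y w) \<le> (?A (fst w) * ennreal (dec N (fst w - Z))) * ennreal (dec N (snd w))" by (simp add: mult_ac)
  qed
  also have "\<dots> = (\<integral>\<^sup>+z. (?A z * ennreal (dec N (z - Z))) * dec_nn N TYPE('w) \<partial>lborel)"
    by (subst nn_integral_lborel_pair)
      (auto intro!: borel_measurable_times_ennreal measurable_comp_continuous[OF Am] dec_measurable_cont cont simp: nn_integral_cmult dec_nn_def)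
  also have "\<dots> = dec_nn N TYPE('w) * (\<integral>\<^sup>+z. ?A z * ennreal (dec N (z - Z)) \<partial>lborel)"
    by (subst nn_integral_multc)
      (auto intro!: borel_measurable_times_ennreal Am dec_measurable_cont cont simp: mult.commute)
  finally show ?thesis .
qed

text \<open>Interpolation between the \<open>L\<^sup>q\<close> bound and the pointwise bound given by Hoelder's inequality.\<close>

lemma dec_convolution_bound:
  fixes A :: "'w::euclidean_space \<Rightarrow> ennreal"
  assumes q: "1 \<le> q" "q \<le> s" and A[measurable]: "A \<in> borel_measurable borel"
  shows "pw (\<integral>\<^sup>+Z. pw (\<integral>\<^sup>+z. A z * ennreal (dec N (z - Z)) \<partial>lborel) s \<partial>lborel) (1 / s)
    \<le> pw (dec_nn N TYPE('w)) ((1 - 1 / q) * (s - q) / s + q / s) * pw (\<integral>\<^sup>+z. pw (A z) q \<partial>lborel) (1 / q)"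
proof -
  note cont = continuous_intros
  let ?I = "dec_nn N TYPE('w)"
  let ?D = "\<lambda>Z. \<integral>\<^sup>+z. A z * ennreal (dec N (z - Z)) \<partial>lborel"
  let ?G = "\<lambda>Z. \<integral>\<^sup>+z. pw (A z) q * ennreal (dec N (z - Z)) \<partial>lborel"
  let ?n = "\<integral>\<^sup>+z. pw (A z) q \<partial>lborel"
  have q0: "0 < q" "0 < s" "0 \<le> 1 - 1 / q" "0 \<le> s - q" using q by auto
  have dm: "(\<lambda>z. ennreal (dec N (z - Z))) \<in> borel_measurable borel" for Z :: 'w by (intro dec_measurable_cont cont)
  \<comment> \<open>Hoelder's inequality with the weight \<open>dec N (z - Z)\<close> distributed as
    its powers \<open>1 / q\<close> and \<open>1 - 1 / q\<close>.\<close>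
  have D: "?D Z \<le> pw (?G Z) (1 / q) * pw ?I (1 - 1 / q)" for Z
  proof -
    have "?D Z = (\<integral>\<^sup>+z. pw (pw (A z) q * ennreal (dec N (z - Z))) (1 / q) * pw (ennreal (dec N (z - Z))) (1 - 1 / q) \<partial>lborel)"
    proof (rule nn_integral_cong)
      fix z
      let ?e = "ennreal (dec N (z - Z))"
      have "pw ?e (1 / q) * pw ?e (1 - 1 / q) = ?e" using q0 by (subst pw_add[symmetric]) auto
      moreover have "pw (pw (A z) q * ?e) (1 / q) = A z * pw ?e (1 / q)" using q0 by (simp add: pw_mult pw_pw)
      ultimately show "A z * ?e = pw (pw (A z) q * ?e) (1 / q) * pw ?e (1 - 1 / q)" by (simp add: mult.assoc)
    qed
    also have "\<dots> \<le> pw (?G Z) (1 / q) * pw (\<integral>\<^sup>+z. ennreal (dec N (z - Z)) \<partial>lborel) (1 - 1 / q)"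
      by (rule hoelder2) (use q0 q dm in auto)
    finally show ?thesis by (simp add: dec_nn_shift)
  qed
  have G1: "?G Z \<le> ?n" for Z
    by (intro nn_integral_mono) (simp add: dec_le_1 mult_left_le)
  have Gm: "?G \<in> borel_measurable borel"
    by (intro nn_integral_measurable borel_measurable_times_ennreal dec_measurable_cont cont pw_measurable measurable_comp_continuous[OF A])
  have GI: "(\<integral>\<^sup>+Z. ?G Z \<partial>lborel) = ?n * ?I"
  proof -
    have "(\<integral>\<^sup>+Z. ?G Z \<partial>lborel) = (\<integral>\<^sup>+z. \<integral>\<^sup>+Z. pw (A z) q * ennreal (dec N (z - Z)) \<partial>lborel \<partial>lborel)"
      by (intro tonelli_swap borel_measurable_times_ennreal dec_measurable_cont cont pw_measurable measurable_comp_continuous[OF A])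
    also have "\<dots> = (\<integral>\<^sup>+z. pw (A z) q * ?I \<partial>lborel)"
      by (subst nn_integral_cmult) (auto intro!: dec_measurable_cont cont simp: dec_nn_shift)
    finally show ?thesis by (simp add: nn_integral_multc)
  qed
  \<comment> \<open>The power \<open>s\<close> is split as \<open>s - q\<close> and
    \<open>q\<close>: in the first factor \<open>?G Z\<close> is replaced by its uniform bound
    \<open>?n\<close>, in the second it is kept, to be integrated over \<open>Z\<close> by
    \<open>GI\<close>.\<close>
  have Ds: "pw (?D Z) s \<le> (pw (pw ?n (1 / q) * pw ?I (1 - 1 / q)) (s - q) * pw ?I (q - 1)) * ?G Z" for Z
  proof -
    have "pw (?D Z) s = pw (?D Z) (s - q) * pw (?D Z) q"
      using q0 by (subst pw_add[symmetric]) auto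
    also have "\<dots> \<le> pw (pw ?n (1 / q) * pw ?I (1 - 1 / q)) (s - q) * pw (pw (?G Z) (1 / q) * pw ?I (1 - 1 / q)) q"
      using q0 by (intro mult_mono pw_mono order_trans[OF D] mult_right_mono G1 order_refl) auto
    also have "pw (pw (?G Z) (1 / q) * pw ?I (1 - 1 / q)) q = ?G Z * pw ?I (q - 1)"
      using q0 by (simp add: pw_mult pw_pw left_diff_distrib)
    finally show ?thesis by (simp add: mult_ac)
  qed
  have "(\<integral>\<^sup>+Z. pw (?D Z) s \<partial>lborel) \<le> (\<integral>\<^sup>+Z. (pw (pw ?n (1 / q) * pw ?I (1 - 1 / q)) (s - q) * pw ?I (q - 1)) * ?G Z \<partial>lborel)"
    by (intro nn_integral_mono Ds)
  also have "\<dots> = (pw (pw ?n (1 / q) * pw ?I (1 - 1 / q)) (s - q) * pw ?I (q - 1)) * (?n * ?I)"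
    using Gm GI by (simp add: nn_integral_cmult)
  finally have "pw (\<integral>\<^sup>+Z. pw (?D Z) s \<partial>lborel) (1 / s) \<le> pw ((pw (pw ?n (1 / q) * pw ?I (1 - 1 / q)) (s - q) * pw ?I (q - 1)) * (?n * ?I)) (1 / s)"
    using q0 by (intro pw_mono) auto
  also have "\<dots> = (pw ?n ((s - q) / (q * s)) * pw ?n (1 / s)) * (pw ?I ((1 - 1 / q) * (s - q) / s) * (pw ?I ((q - 1) / s) * pw ?I (1 / s)))"
    using q0 by (simp add: pw_mult pw_pw mult_ac)
  also have "pw ?n ((s - q) / (q * s)) * pw ?n (1 / s) = pw ?n (1 / q)"
    using q0 by (subst pw_add[symmetric]) (auto simp: field_simps)
  also have "pw ?I ((q - 1) / s) * pw ?I (1 / s) = pw ?I (q / s)"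
    using q0 q by (subst pw_add[symmetric]) (auto simp: add_divide_distrib[symmetric])
  also have "pw ?I ((1 - 1 / q) * (s - q) / s) * pw ?I (q / s) = pw ?I ((1 - 1 / q) * (s - q) / s + q / s)"
    using q0 by (subst pw_add) auto
  finally show ?thesis by (simp add: mult.commute)
qed

section \<open>Arithmetic of conjugate exponents\<close>

lemma ennreal_inverse_antimono: "x \<le> y \<Longrightarrow> inverse y \<le> inverse (x :: ennreal)"
proof (cases "x = 0 \<or> y = top")
  case False
  assume "x \<le> y"
  moreover obtain a b where "x = ennreal a" "0 < a" "y = ennreal b" "0 \<le> b"
    using False \<open>x \<le> y\<close> by (metis ennreal_0 ennreal_cases order_le_less top_unique)
  ultimately show ?thesis by (simp add: inverse_ennreal ennreal_leI le_imp_inverse_le)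
qed auto

lemma enn2real_inverse_conj_exp:
  assumes "1 \<le> r"
  shows "inverse r = ennreal (enn2real (inverse r))" "enn2real (inverse r) \<le> 1"
    "enn2real (inverse (conj_exp r)) = 1 - enn2real (inverse r)"
    "inverse (conj_exp r) = ennreal (1 - enn2real (inverse r))"
proof -
  have i: "inverse r \<le> 1"
    using assms by (cases r)
      (auto simp: inverse_ennreal ennreal_le_1 ennreal_1[symmetric] inverse_le_1_iff simp del: ennreal_1)
  then have fin: "inverse r < top" using ennreal_one_less_top le_less_trans by blast
  show 1: "inverse r = ennreal (enn2real (inverse r))" using fin by simp
  show le: "enn2real (inverse r) \<le> 1" using i 1 by (metis ennreal_le_1 enn2real_nonneg)
  have "inverse (inverse x) = x" for x :: ennreal
    by (cases x; cases "x = 0") (auto simp: inverse_ennreal)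
  then have "inverse (conj_exp r) = 1 - inverse r" by (simp add: conj_exp_def)
  also have "\<dots> = ennreal (1 - enn2real (inverse r))"
    by (subst 1) (simp add: ennreal_1[symmetric] ennreal_minus del: ennreal_1)
  finally show 4: "inverse (conj_exp r) = ennreal (1 - enn2real (inverse r))" .
  show "enn2real (inverse (conj_exp r)) = 1 - enn2real (inverse r)" unfolding 4 using le by simp
qed

lemma alpha_tau_eq:
  assumes r: "1 \<le> r1" "1 \<le> r2" and \<tau>: "0 < \<tau>" "\<tau> < 1"
  shows "alpha_tau d r1 r2 \<tau> = \<tau> powr (- (d * (1 - enn2real (inverse r1) + enn2real (inverse r2))))
     * (1 - \<tau>) powr (- (d * (enn2real (inverse r1) + (1 - enn2real (inverse r2)))))"
proof -
  have 1: "enn2real (inverse (conj_exp r1) + inverse r2) = 1 - enn2real (inverse r1) + enn2real (inverse r2)"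
    unfolding enn2real_inverse_conj_exp(4)[OF r(1)] 
    by (subst enn2real_inverse_conj_exp(1)[OF r(2)]) (use enn2real_inverse_conj_exp(2)[OF r(1)] in \<open>simp add: ennreal_plus[symmetric] del: ennreal_plus\<close>)
  have 2: "enn2real (inverse r1 + inverse (conj_exp r2)) = enn2real (inverse r1) + (1 - enn2real (inverse r2))"
    unfolding enn2real_inverse_conj_exp(4)[OF r(2)] 
    by (subst enn2real_inverse_conj_exp(1)[OF r(1)]) (use enn2real_inverse_conj_exp(2)[OF r(2)] in \<open>simp add: ennreal_plus[symmetric] del: ennreal_plus\<close>)
  show ?thesis unfolding alpha_tau_def 1 2 using \<tau> by (simp add: powr_minus divide_simps)
qed

text \<open>Passing to inverses, \<open>conj_exp r \<le> p\<close> says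
  \<open>1 / P \<le> 1 - 1 / R\<close>, that is \<open>S \<le> R\<close>. Since
  \<open>r \<le> p\<close> is finite, \<open>1 / R > 0\<close>; hence \<open>1 / P < 1\<close>, and
  the conjugate exponent \<open>S\<close> is finite.\<close>

lemma finite_exponents:
  assumes p: "1 \<le> p" "p \<noteq> top" and r: "1 \<le> r" "r \<le> p" "conj_exp r \<le> p"
  obtains P R S where "p = ennreal P" "r = ennreal R" "0 < P" "0 < S" "0 < R" "1 / P + 1 / S = 1" "S \<le> R" "R \<le> P" "S \<le> P" "conj_exp p = ennreal S"
proof -
  obtain P where P: "p = ennreal P" "1 \<le> P" using p by (metis ennreal_exp_cases)
  have "r \<noteq> top" using r p by (auto simp: top_unique)
  then obtain R where R: "r = ennreal R" "1 \<le> R" using r by (metis ennreal_exp_cases)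
  have RP: "R \<le> P" using r P R by simp
  have iP: "inverse p = ennreal (1 / P)" using P by (simp add: inverse_ennreal inverse_eq_divide)
  have iR: "enn2real (inverse r) = 1 / R" using R by (simp add: inverse_ennreal inverse_eq_divide)
  have "inverse p \<le> inverse (conj_exp r)" using r(3) by (simp add: ennreal_inverse_antimono)
  then have "ennreal (1 / P) \<le> ennreal (1 - 1 / R)"
    unfolding iP enn2real_inverse_conj_exp(4)[OF r(1)] iR .
  then have le: "1 / P \<le> 1 - 1 / R" using R P by (subst (asm) ennreal_le_iff) auto
  have i: "1 / P \<le> 1 / R" using RP R by (simp add: frac_le)
  have p1: "1 / P < 1"
  proof (rule ccontr)
    assume "\<not> 1 / P < 1"
    then have "1 / R \<le> 0" using le by linarith
    then show False using R by simp
  qed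
  define S where "S = 1 / (1 - 1 / P)"
  have S: "0 < S" "1 / S = 1 - 1 / P" using p1 by (auto simp: S_def)
  have "1 / R \<le> 1 / S" using le S by linarith
  then have SR: "S \<le> R" using inverse_le_imp_le[of R S] R by (simp add: inverse_eq_divide)
  have c: "conj_exp p = ennreal S"
  proof -
    have "conj_exp p = inverse (ennreal (1 - 1 / P))"
      unfolding conj_exp_def iP using P by (simp add: ennreal_1[symmetric] ennreal_minus del: ennreal_1)
    then show ?thesis using p1 by (simp add: inverse_ennreal S_def inverse_eq_divide)
  qed
  show ?thesis
    by (rule that[of P R S]) (use P R S SR RP c in auto)
qed

lemma ennreal_const_pos:
  assumes "c < (\<infinity>::ennreal)" obtains C where "0 < C" "c \<le> ennreal C"
proof -
  obtain x where "c = ennreal x" "0 \<le> x" using assms by (cases c) auto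
  then show ?thesis by (intro that[of "x + 1"]) (auto intro: ennreal_leI)
qed

section \<open>The majorizing integral operator\<close>

definition tau_pt :: "real \<Rightarrow> 'a::euclidean_space \<times> 'a \<Rightarrow> 'a \<times> 'a \<Rightarrow> 'a \<times> 'a"
  where "tau_pt \<tau> w w' = ((1 - \<tau>) *\<^sub>R fst w + \<tau> *\<^sub>R fst w', \<tau> *\<^sub>R snd w + (1 - \<tau>) *\<^sub>R snd w')"

text \<open>The operator that remains once all phases are discarded and the weights are moved into
  \<open>a\<close> and \<open>F\<close>. The kernel point is where the Wigner distribution of two
  atoms shifted by \<open>w\<close> and \<open>w'\<close> is concentrated.\<close>

definition out_op :: "nat \<Rightarrow> real \<Rightarrow> (('a::euclidean_space \<times> 'a) \<times> ('a \<times> 'a) \<Rightarrow> ennreal) \<Rightarrow> ('a \<times> 'a \<Rightarrow> ennreal) \<Rightarrow> 'a \<times> 'a \<Rightarrow> ennreal"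
  where "out_op N \<tau> a F w = (\<integral>\<^sup>+w'. smear N a (tau_pt \<tau> w w', symplectic_J (w - w')) * F w' \<partial>lborel)"

text \<open>The constant is built from integrals of \<open>dec N\<close> only, so
  \<open>\<tau>\<close> enters through \<open>alpha_tau\<close> alone. At \<open>p = top\<close> the
  condition on \<open>q\<close> forces \<open>q = 1\<close>, and \<open>r1\<close>,
  \<open>r2\<close> may be 1 or infinite; for finite \<open>p\<close> all exponents become real and
  the convolution bound raises \<open>q\<close> to the conjugate exponent \<open>S\<close>.\<close>

theorem out_op_bound:
  fixes T :: "'a::euclidean_space itself"
  assumes p: "1 \<le> p" and q: "1 \<le> q" and r: "1 \<le> r1" "1 \<le> r2" and qp: "q \<le> conj_exp p"
    and rp: "r1 \<le> p" "r2 \<le> p" "conj_exp r1 \<le> p" "conj_exp r2 \<le> p" and N: "2 * DIM('a \<times> 'a) \<le> N"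
  shows "\<exists>C>0. \<forall>\<tau> (a :: ('a \<times> 'a) \<times> ('a \<times> 'a) \<Rightarrow> ennreal) F. 0 < \<tau> \<longrightarrow> \<tau> < 1 \<longrightarrow> a \<in> borel_measurable borel \<longrightarrow> F \<in> borel_measurable borel \<longrightarrow>
    Lnorm r2 (\<lambda>\<xi>. Lnorm r1 (\<lambda>x. out_op N \<tau> a F (x, \<xi>)))
      \<le> ennreal (C * alpha_tau DIM('a) r1 r2 \<tau>) * (Lnorm q (\<lambda>z. Lnorm p (\<lambda>\<zeta>. a (z, \<zeta>))) * Lnorm r2 (\<lambda>\<xi>. Lnorm r1 (\<lambda>x. F (x, \<xi>))))"
proof -
  note cont = continuous_intros
  let ?I = "dec_nn N TYPE('a \<times> 'a)"
  have I: "?I < \<infinity>" by (rule dec_nn_finite[OF N])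
  have out: "out_op N \<tau> a F (x, \<xi>) = (\<integral>\<^sup>+\<xi>'. \<integral>\<^sup>+x'. smear N a (((1 - \<tau>) *\<^sub>R x + \<tau> *\<^sub>R x', \<tau> *\<^sub>R \<xi> + (1 - \<tau>) *\<^sub>R \<xi>'), (\<xi> - \<xi>', - (x - x'))) * F (x', \<xi>') \<partial>lborel \<partial>lborel)"
    if a: "a \<in> borel_measurable borel" and F: "F \<in> borel_measurable borel" for \<tau> x \<xi> and a :: "('a \<times> 'a) \<times> ('a \<times> 'a) \<Rightarrow> ennreal" and F
  proof -
    have m: "(\<lambda>w'. smear N a (((1 - \<tau>) *\<^sub>R x + \<tau> *\<^sub>R fst w', \<tau> *\<^sub>R \<xi> + (1 - \<tau>) *\<^sub>R snd w'), (\<xi> - snd w', - (x - fst w'))) * F w') \<in> borel_measurable borel"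
      by (intro borel_measurable_times_ennreal measurable_comp_continuous[OF smear_measurable[OF a]] F cont)
    have "out_op N \<tau> a F (x, \<xi>) = (\<integral>\<^sup>+w'. smear N a (((1 - \<tau>) *\<^sub>R x + \<tau> *\<^sub>R fst w', \<tau> *\<^sub>R \<xi> + (1 - \<tau>) *\<^sub>R snd w'), (\<xi> - snd w', - (x - fst w'))) * F w' \<partial>lborel)"
      by (simp add: out_op_def tau_pt_def symplectic_J_def)
    also have "\<dots> = (\<integral>\<^sup>+x'. \<integral>\<^sup>+\<xi>'. smear N a (((1 - \<tau>) *\<^sub>R x + \<tau> *\<^sub>R x', \<tau> *\<^sub>R \<xi> + (1 - \<tau>) *\<^sub>R \<xi>'), (\<xi> - \<xi>', - (x - x'))) * F (x', \<xi>') \<partial>lborel \<partial>lborel)"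
      using nn_integral_lborel_pair[OF m] by simp
    also have "\<dots> = (\<integral>\<^sup>+\<xi>'. \<integral>\<^sup>+x'. smear N a (((1 - \<tau>) *\<^sub>R x + \<tau> *\<^sub>R x', \<tau> *\<^sub>R \<xi> + (1 - \<tau>) *\<^sub>R \<xi>'), (\<xi> - \<xi>', - (x - x'))) * F (x', \<xi>') \<partial>lborel \<partial>lborel)"
      by (rule tonelli_swap) (use m in simp)
    finally show ?thesis .
  qed
  have Am: "(\<lambda>z. Lnorm p (\<lambda>\<zeta>. a (z, \<zeta>))) \<in> borel_measurable borel" if "a \<in> borel_measurable borel" for a :: "('a \<times> 'a) \<times> ('a \<times> 'a) \<Rightarrow> ennreal"
    by (rule Lnorm_measurable[OF p]) (use that in simp)
  have "\<exists>c. c < (\<infinity>::ennreal) \<and> (\<forall>\<tau> (a :: ('a \<times> 'a) \<times> ('a \<times> 'a) \<Rightarrow> ennreal) F. 0 < \<tau> \<longrightarrow> \<tau> < 1 \<longrightarrow> a \<in> borel_measurable borel \<longrightarrow> F \<in> borel_measurable borel \<longrightarrow>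
    Lnorm r2 (\<lambda>\<xi>. Lnorm r1 (\<lambda>x. out_op N \<tau> a F (x, \<xi>)))
      \<le> ennreal (alpha_tau DIM('a) r1 r2 \<tau>) * ((c * Lnorm q (\<lambda>z. Lnorm p (\<lambda>\<zeta>. a (z, \<zeta>)))) * Lnorm r2 (\<lambda>\<xi>. Lnorm r1 (\<lambda>x. F (x, \<xi>)))))"
  proof (cases "p = top")
    case True
    have "conj_exp p = 1" by (simp add: True conj_exp_def)
    then have q1: "q = 1" using q qp by (simp add: antisym)
    show ?thesis
    proof (intro exI conjI allI impI)
      show "?I * ?I < \<infinity>" using I by (simp add: ennreal_mult_less_top)
      fix \<tau> :: real and a :: "('a \<times> 'a) \<times> ('a \<times> 'a) \<Rightarrow> ennreal" and F :: "'a \<times> 'a \<Rightarrow> ennreal"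
      assume \<tau>: "0 < \<tau>" "\<tau> < 1" and a: "a \<in> borel_measurable borel" and F: "F \<in> borel_measurable borel"
      let ?A = "\<lambda>z. Lnorm p (\<lambda>\<zeta>. a (z, \<zeta>))"
      define \<beta> where "\<beta> Z = (\<integral>\<^sup>+z. ?A z * ennreal (dec N (z - Z)) \<partial>lborel) * ?I" for Z
      have \<beta>m: "\<beta> \<in> borel_measurable borel"
      proof -
        have "(\<lambda>Z. \<integral>\<^sup>+z. ?A z * ennreal (dec N (z - Z)) \<partial>lborel) \<in> borel_measurable borel"
          by (intro nn_integral_measurable borel_measurable_times_ennreal measurable_comp_continuous[OF Am[OF a]] dec_measurable_cont cont)
        then show ?thesis unfolding \<beta>_def by measurable
      qed
      have b: "smear N a W \<le> \<beta> (fst W)" for W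
      proof -
        have "smear N a W \<le> (\<integral>\<^sup>+z. \<integral>\<^sup>+\<zeta>. (?A z * ennreal (dec N (z - fst W))) * ennreal (dec N (\<zeta> - snd W)) \<partial>lborel \<partial>lborel)"
          unfolding smear_def
        proof (rule nn_integral_mono, rule nn_integral_mono_AE)
          fix z
          show "AE \<zeta> in lborel. a (z, \<zeta>) * (ennreal (dec N (z - fst W)) * ennreal (dec N (\<zeta> - snd W))) \<le> (?A z * ennreal (dec N (z - fst W))) * ennreal (dec N (\<zeta> - snd W))"
            using AE_le_Lnorm_top[of "\<lambda>\<zeta>. a (z, \<zeta>)"] unfolding True
            by eventually_elim (simp add: mult.assoc mult_right_mono)
        qed
        also have "\<dots> = (\<integral>\<^sup>+z. (?A z * ennreal (dec N (z - fst W))) * ?I \<partial>lborel)"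
          by (subst nn_integral_cmult) (auto intro!: dec_measurable_cont cont simp: dec_nn_shift)
        also have "\<dots> = \<beta> (fst W)" unfolding \<beta>_def
          by (rule nn_integral_multc) (auto intro!: borel_measurable_times_ennreal Am[OF a] dec_measurable_cont cont)
        finally show ?thesis .
      qed
      have I\<beta>: "(\<integral>\<^sup>+Z. \<beta> Z \<partial>lborel) = (?I * ?I) * Lnorm q ?A"
      proof -
        have "(\<integral>\<^sup>+Z. \<beta> Z \<partial>lborel) = (\<integral>\<^sup>+Z. \<integral>\<^sup>+z. ?A z * ennreal (dec N (z - Z)) \<partial>lborel \<partial>lborel) * ?I"
          unfolding \<beta>_def
          by (rule nn_integral_multc) (simp, intro nn_integral_measurable borel_measurable_times_ennreal measurable_comp_continuous[OF Am[OF a]] dec_measurable_cont cont)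
        also have "(\<integral>\<^sup>+Z. \<integral>\<^sup>+z. ?A z * ennreal (dec N (z - Z)) \<partial>lborel \<partial>lborel) = (\<integral>\<^sup>+z. \<integral>\<^sup>+Z. ?A z * ennreal (dec N (z - Z)) \<partial>lborel \<partial>lborel)"
          by (intro tonelli_swap borel_measurable_times_ennreal measurable_comp_continuous[OF Am[OF a]] dec_measurable_cont cont)
        also have "\<dots> = (\<integral>\<^sup>+z. ?A z * ?I \<partial>lborel)"
          by (subst nn_integral_cmult) (auto intro!: dec_measurable_cont cont simp: dec_nn_shift)
        also have "\<dots> = (\<integral>\<^sup>+z. ?A z \<partial>lborel) * ?I"
          by (rule nn_integral_multc) (use Am[OF a] in simp)
        also have "(\<integral>\<^sup>+z. ?A z \<partial>lborel) = Lnorm q ?A"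
          unfolding q1 by (simp add: Lnorm_finite[of 1, simplified])
        finally show ?thesis by (simp add: mult_ac)
      qed
      have "Lnorm r2 (\<lambda>\<xi>. Lnorm r1 (\<lambda>x. out_op N \<tau> a F (x, \<xi>)))
        \<le> Lnorm r2 (\<lambda>\<xi>. Lnorm r1 (\<lambda>x. \<integral>\<^sup>+\<xi>'. \<integral>\<^sup>+x'. \<beta> ((1 - \<tau>) *\<^sub>R x + \<tau> *\<^sub>R x', \<tau> *\<^sub>R \<xi> + (1 - \<tau>) *\<^sub>R \<xi>') * F (x', \<xi>') \<partial>lborel \<partial>lborel))"
        unfolding out[OF a F]
        by (intro Lnorm_mono r nn_integral_mono mult_right_mono order_trans[OF b]) auto
      also have "\<dots> \<le> ennreal (alpha_tau DIM('a) r1 r2 \<tau>) * ((\<integral>\<^sup>+Z. \<beta> Z \<partial>lborel) * Lnorm r2 (\<lambda>\<xi>. Lnorm r1 (\<lambda>x. F (x, \<xi>))))"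
        unfolding alpha_tau_eq[OF r \<tau>] by (rule kernel_bound_mixed_top[OF \<tau> r \<beta>m F])
      finally show "Lnorm r2 (\<lambda>\<xi>. Lnorm r1 (\<lambda>x. out_op N \<tau> a F (x, \<xi>)))
        \<le> ennreal (alpha_tau DIM('a) r1 r2 \<tau>) * (((?I * ?I) * Lnorm q ?A) * Lnorm r2 (\<lambda>\<xi>. Lnorm r1 (\<lambda>x. F (x, \<xi>))))"
        unfolding I\<beta> .
    qed
  next
    case False
    obtain P R1 S where 1: "p = ennreal P" "r1 = ennreal R1" "0 < P" "0 < S" "0 < R1" "1 / P + 1 / S = 1" "S \<le> R1" "R1 \<le> P" "S \<le> P" "conj_exp p = ennreal S"
      using finite_exponents[OF p False r(1) rp(1) rp(3)] by blast
    obtain P' R2 S' where 2: "p = ennreal P'" "r2 = ennreal R2" "0 < P'" "0 < S'" "0 < R2" "S' \<le> R2" "R2 \<le> P'" "conj_exp p = ennreal S'"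
      using finite_exponents[OF p False r(2) rp(2) rp(4)] by blast
    have [simp]: "P' = P" "S' = S" using 1 2 by auto
    have "q \<noteq> top" using qp 1(10) by (auto simp: top_unique)
    then obtain Q where Q: "q = ennreal Q" "1 \<le> Q" using q by (metis ennreal_exp_cases)
    have QS: "Q \<le> S" using qp 1(4) unfolding Q(1) 1(10) by (simp add: ennreal_le_iff)
    \<comment> \<open>The power of the mass of \<open>dec N\<close> produced by
      \<open>dec_convolution_bound\<close> when passing from \<open>Q\<close> to
      \<open>S\<close>.\<close>
    let ?e = "(1 - 1 / Q) * (S - Q) / S + Q / S"
    show ?thesis
    proof (intro exI conjI allI impI)
      show "?I * pw ?I ?e < \<infinity>"
        using I by (cases "?e = 0") (auto simp: ennreal_mult_less_top less_top[symmetric] pw_eq_top_iff ennreal_mult_eq_top_iff)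
      fix \<tau> :: real and a :: "('a \<times> 'a) \<times> ('a \<times> 'a) \<Rightarrow> ennreal" and F :: "'a \<times> 'a \<Rightarrow> ennreal"
      assume \<tau>: "0 < \<tau>" "\<tau> < 1" and a: "a \<in> borel_measurable borel" and F: "F \<in> borel_measurable borel"
      let ?A = "\<lambda>z. Lnorm p (\<lambda>\<zeta>. a (z, \<zeta>))"
      let ?D = "\<lambda>Z. \<integral>\<^sup>+z. ?A z * ennreal (dec N (z - Z)) \<partial>lborel"
      have i1: "enn2real (inverse r1) = 1 / R1" "enn2real (inverse r2) = 1 / R2"
        using 1 2 by (simp_all add: inverse_ennreal inverse_eq_divide)
      have Dm: "?D \<in> borel_measurable borel"
        by (intro nn_integral_measurable borel_measurable_times_ennreal measurable_comp_continuous[OF Am[OF a]] dec_measurable_cont cont)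
      have "Lnorm r2 (\<lambda>\<xi>. Lnorm r1 (\<lambda>x. out_op N \<tau> a F (x, \<xi>)))
        \<le> ennreal (alpha_tau DIM('a) r1 r2 \<tau>)
         * (pw (\<integral>\<^sup>+Z. pw (pw (\<integral>\<^sup>+Y. pw (smear N a (Z, Y)) P \<partial>lborel) (1 / P)) S \<partial>lborel) (1 / S)
         * Lnorm r2 (\<lambda>\<xi>. Lnorm r1 (\<lambda>x. F (x, \<xi>))))"
        unfolding alpha_tau_eq[OF r \<tau>] i1 out[OF a F] unfolding 1(2) 2(2) Lnorm_finite[OF 1(5)] Lnorm_finite[OF 2(5)]
        by (rule kernel_bound_mixed_finite[OF \<tau> 1(3,4,6,9) 1(7,8) _ _ smear_measurable[OF a] F]) (use 2 in auto)
      also have "pw (\<integral>\<^sup>+Z. pw (pw (\<integral>\<^sup>+Y. pw (smear N a (Z, Y)) P \<partial>lborel) (1 / P)) S \<partial>lborel) (1 / S)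
         \<le> pw (\<integral>\<^sup>+Z. pw (?I * ?D Z) S \<partial>lborel) (1 / S)"
      proof (intro pw_mono nn_integral_mono)
        fix Z
        show "pw (\<integral>\<^sup>+Y. pw (smear N a (Z, Y)) P \<partial>lborel) (1 / P) \<le> ?I * ?D Z"
          using Lnorm_smear[OF p a, of N Z] unfolding 1(1) Lnorm_finite[OF 1(3)] .
      qed (use 1 in auto)
      also have "\<dots> = ?I * pw (\<integral>\<^sup>+Z. pw (?D Z) S \<partial>lborel) (1 / S)"
        using 1(4) Dm by (simp add: pw_mult nn_integral_cmult pw_pw)
      also have "\<dots> \<le> ?I * (pw ?I ?e * pw (\<integral>\<^sup>+z. pw (?A z) Q \<partial>lborel) (1 / Q))"
        by (intro mult_left_mono dec_convolution_bound Q QS Am a) simp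
      also have "pw (\<integral>\<^sup>+z. pw (?A z) Q \<partial>lborel) (1 / Q) = Lnorm q ?A"
        unfolding Q(1) by (rule Lnorm_finite[symmetric]) (use Q in simp)
      finally show "Lnorm r2 (\<lambda>\<xi>. Lnorm r1 (\<lambda>x. out_op N \<tau> a F (x, \<xi>)))
        \<le> ennreal (alpha_tau DIM('a) r1 r2 \<tau>) * (((?I * pw ?I ?e) * Lnorm q ?A) * Lnorm r2 (\<lambda>\<xi>. Lnorm r1 (\<lambda>x. F (x, \<xi>))))"
        by (simp add: mult.assoc mult_left_mono mult_right_mono)
    qed
  qed
  then obtain c where c: "c < (\<infinity>::ennreal)" and le: "\<And>\<tau> (a :: ('a \<times> 'a) \<times> ('a \<times> 'a) \<Rightarrow> ennreal) F. 0 < \<tau> \<Longrightarrow> \<tau> < 1 \<Longrightarrow> a \<in> borel_measurable borel \<Longrightarrow> F \<in> borel_measurable borel \<Longrightarrow>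
    Lnorm r2 (\<lambda>\<xi>. Lnorm r1 (\<lambda>x. out_op N \<tau> a F (x, \<xi>)))
      \<le> ennreal (alpha_tau DIM('a) r1 r2 \<tau>) * ((c * Lnorm q (\<lambda>z. Lnorm p (\<lambda>\<zeta>. a (z, \<zeta>)))) * Lnorm r2 (\<lambda>\<xi>. Lnorm r1 (\<lambda>x. F (x, \<xi>))))"
    by blast
  obtain C where C: "0 < C" "c \<le> ennreal C" using ennreal_const_pos[OF c] by blast
  show ?thesis
  proof (intro exI conjI allI impI)
    show "0 < C" by (rule C)
    fix \<tau> :: real and a :: "('a \<times> 'a) \<times> ('a \<times> 'a) \<Rightarrow> ennreal" and F :: "'a \<times> 'a \<Rightarrow> ennreal"
    assume \<tau>: "0 < \<tau>" "\<tau> < 1" and a: "a \<in> borel_measurable borel" and F: "F \<in> borel_measurable borel"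
    let ?X = "Lnorm q (\<lambda>z. Lnorm p (\<lambda>\<zeta>. a (z, \<zeta>)))" and ?Y = "Lnorm r2 (\<lambda>\<xi>. Lnorm r1 (\<lambda>x. F (x, \<xi>)))"
    have al: "0 \<le> alpha_tau DIM('a) r1 r2 \<tau>" unfolding alpha_tau_eq[OF r \<tau>] by simp
    have "ennreal (alpha_tau DIM('a) r1 r2 \<tau>) * ((c * ?X) * ?Y) \<le> ennreal (alpha_tau DIM('a) r1 r2 \<tau>) * ((ennreal C * ?X) * ?Y)"
      by (intro mult_left_mono mult_right_mono C) auto
    also have "\<dots> = ennreal (C * alpha_tau DIM('a) r1 r2 \<tau>) * (?X * ?Y)"
      using al C by (simp add: ennreal_mult mult_ac)
    finally show "Lnorm r2 (\<lambda>\<xi>. Lnorm r1 (\<lambda>x. out_op N \<tau> a F (x, \<xi>))) \<le> ennreal (C * alpha_tau DIM('a) r1 r2 \<tau>) * (?X * ?Y)"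
      using le[OF \<tau> a F] by (rule order_trans[rotated])
  qed
qed

section \<open>The \<tau>-Wigner distribution\<close>

lemma schwartz_mult: "f \<in> schwartz \<Longrightarrow> g \<in> schwartz \<Longrightarrow> (\<lambda>x. f x * g x) \<in> schwartz"
  unfolding schwartz_iff_sbd
proof (intro allI)
  fix n k assume "\<forall>n k. \<exists>C. sbd n k C f" "\<forall>n k. \<exists>C. sbd n k C g"
  then obtain A B where "sbd n k A f" "sbd n 0 B g" by blast
  from sbd_mult[OF this] show "\<exists>C. sbd n k C (\<lambda>x. f x * g x)" by auto
qed

lemma schwartz_linear:
  fixes f :: "'b::euclidean_space \<Rightarrow> complex" and L :: "'a::euclidean_space \<Rightarrow> 'b"
  assumes "f \<in> schwartz" "linear L" "\<And>x. norm (L x) \<le> K * norm x" "\<And>x. norm x \<le> K * norm (L x)" "1 \<le> K"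
  shows "(\<lambda>x. f (L x)) \<in> schwartz"
  unfolding schwartz_iff_sbd
proof (intro allI)
  fix n k
  obtain A where "sbd n k A f" using schwartz_sbd[OF assms(1)] by blast
  from sbd_linear[OF this assms(2-5)] show "\<exists>C. sbd n k C (\<lambda>x. f (L x))" ..
qed

lemma schwartz_tensor:
  "f \<in> schwartz \<Longrightarrow> g \<in> schwartz \<Longrightarrow> (\<lambda>w. f (fst w) * g (snd w)) \<in> schwartz"
  unfolding schwartz_iff_sbd
proof (intro allI)
  fix n k assume "\<forall>n k. \<exists>C. sbd n k C f" "\<forall>n k. \<exists>C. sbd n k C g"
  then obtain A B where "sbd n k A f" "sbd n k B g" by blast
  from sbd_tensor[OF this] show "\<exists>C. sbd n k C (\<lambda>w. f (fst w) * g (snd w))" ..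
qed

lemma schwartz_slice: "f \<in> schwartz \<Longrightarrow> (\<lambda>y. f (x, y)) \<in> schwartz"
  unfolding schwartz_iff_sbd using sbd_slice by blast

lemma schwartz_fourier_snd:
  assumes "\<Psi> \<in> schwartz" shows "fourier_snd (\<Psi> :: 'a::euclidean_space \<times> 'a \<Rightarrow> complex) \<in> schwartz"
  unfolding schwartz_iff_sbd
proof (intro allI)
  fix n k
  obtain C where C: "\<And>\<Psi> :: 'a \<times> 'a \<Rightarrow> complex. \<And>A. sbd (n + k + 1) (n + k + 1 + 2 * DIM('a)) A \<Psi> \<Longrightarrow> sbd n k (C * A) (fourier_snd \<Psi>)"
    using sbd_fourier_snd[of n k, where 'a='a] by blast
  obtain A where "sbd (n + k + 1) (n + k + 1 + 2 * DIM('a)) A \<Psi>" using schwartz_sbd[OF assms] by blast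
  from C[OF this] show "\<exists>C. sbd n k C (fourier_snd \<Psi>)" ..
qed

lemma schwartz_tau_change:
  assumes "H \<in> schwartz" "0 \<le> \<tau>" "\<tau> \<le> 1"
  shows "(\<lambda>w :: 'a::euclidean_space \<times> 'a. H (fst w + \<tau> *\<^sub>R snd w, fst w - (1 - \<tau>) *\<^sub>R snd w)) \<in> schwartz"
  by (rule schwartz_linear[OF assms(1), where K = 4])
    (use tau_change_bounds[OF assms(2,3)] in \<open>auto intro!: linearI simp: algebra_simps\<close>)

lemma schwartz_tau_change_inv:
  assumes "H \<in> schwartz" "0 \<le> \<tau>" "\<tau> \<le> 1"
  shows "(\<lambda>w :: 'a::euclidean_space \<times> 'a. H ((1 - \<tau>) *\<^sub>R fst w + \<tau> *\<^sub>R snd w, fst w - snd w)) \<in> schwartz"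
proof (rule schwartz_linear[OF assms(1), where K = 4])
  fix w :: "'a \<times> 'a"
  let ?x = "(1 - \<tau>) *\<^sub>R fst w + \<tau> *\<^sub>R snd w" and ?t = "fst w - snd w"
  have "?x + \<tau> *\<^sub>R ?t = fst w" "?x - (1 - \<tau>) *\<^sub>R ?t = snd w" by (simp_all add: algebra_simps)
  then show "norm (?x, ?t) \<le> 4 * norm w" "norm w \<le> 4 * norm (?x, ?t)"
    using tau_change_bounds[OF assms(2,3), of ?x ?t] by simp_all
qed (auto intro!: linearI simp: algebra_simps)

lemma schwartz_tau_wigner:
  assumes "h \<in> schwartz" "g \<in> schwartz" "0 \<le> \<tau>" "\<tau> \<le> 1"
  shows "tau_wigner \<tau> h g \<in> schwartz"
  unfolding tau_wigner_fourier_snd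
  using schwartz_tau_change[OF schwartz_tensor[OF assms(1) schwartz_cnj[OF assms(2)]] assms(3,4)]
  by (intro schwartz_fourier_snd) simp

lemma schwartz_measurable: "f \<in> schwartz \<Longrightarrow> f \<in> borel_measurable borel"
  using schwartz_sbd[of f 0 0] sbd_measurable by blast

lemma schwartz_continuous: "f \<in> schwartz \<Longrightarrow> continuous_on UNIV f"
  using schwartz_sbd[of f 0 0] sbd_continuous by blast

lemma schwartz_integrable:
  fixes f :: "'a::euclidean_space \<Rightarrow> complex"
  shows "f \<in> schwartz \<Longrightarrow> integrable lborel f"
  using schwartz_sbd[of f 0 "2 * DIM('a)"] sbd_integrable[OF _ order_refl] by blast

lemma integral_lborel_pair:
  fixes f :: "'a::euclidean_space \<times> 'b::euclidean_space \<Rightarrow> complex"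
  assumes "integrable lborel f"
  shows "(LINT w|lborel. f w) = (LINT x|lborel. LINT y|lborel. f (x, y))"
    and "(LINT w|lborel. f w) = (LINT y|lborel. LINT x|lborel. f (x, y))"
proof -
  have i: "integrable (lborel \<Otimes>\<^sub>M lborel) f" "integrable (lborel \<Otimes>\<^sub>M lborel) (\<lambda>(x, y). f (x, y))"
    using assms by (simp_all add: lborel_prod)
  show 1: "(LINT w|lborel. f w) = (LINT x|lborel. LINT y|lborel. f (x, y))"
    using lborel_pair.integral_fst'[OF i(1)] by (simp add: lborel_prod)
  show "(LINT w|lborel. f w) = (LINT y|lborel. LINT x|lborel. f (x, y))"
    using lborel_pair.Fubini_integral[OF i(2)] 1 by simp
qed

lemma integral_measurable:
  fixes f :: "'a::euclidean_space \<Rightarrow> 'b::euclidean_space \<Rightarrow> complex"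
  assumes "(\<lambda>w. f (fst w) (snd w)) \<in> borel_measurable borel"
  shows "(\<lambda>x. LINT y|lborel. f x y) \<in> borel_measurable borel"
proof -
  have "(\<lambda>x. LINT y|lborel. f x y) \<in> borel_measurable lborel"
    by (rule lborel.borel_measurable_lebesgue_integral) (use assms in \<open>simp add: measurable_borel_prod case_prod_beta'\<close>)
  then show ?thesis by simp
qed

text \<open>Moves the partial Fourier transform from \<open>\<Psi>\<close> back to the tensor
  product, so that \<open>tau_wigner_dist\<close> agrees with \<open>tau_wigner\<close> on
  functions. The substitution is done in two volume-preserving steps: \<open>s = u - t\<close> at
  fixed \<open>u\<close>, then \<open>u = x + \<tau> t\<close> at fixed \<open>t\<close>.\<close>

lemma tau_wigner_parseval:
  fixes h g :: "'a::euclidean_space \<Rightarrow> complex"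
  assumes h: "h \<in> schwartz" and g: "g \<in> schwartz" and P: "\<Psi> \<in> schwartz" and \<tau>: "0 \<le> \<tau>" "\<tau> \<le> 1"
  shows "(LINT u|lborel. LINT s|lborel. h u * cnj (g s) * fourier_snd \<Psi> ((1 - \<tau>) *\<^sub>R u + \<tau> *\<^sub>R s, u - s))
    = (LINT y|lborel. tau_wigner \<tau> h g y * \<Psi> y)"
proof -
  let ?F = "fourier_snd \<Psi>"
  define H where "H w = h (fst w) * cnj (g (snd w)) * ?F ((1 - \<tau>) *\<^sub>R fst w + \<tau> *\<^sub>R snd w, fst w - snd w)" for w
  have H: "H \<in> schwartz"
    unfolding H_def
    by (intro schwartz_mult schwartz_tensor h schwartz_cnj g schwartz_tau_change_inv schwartz_fourier_snd P \<tau>)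
  let ?G = "\<lambda>w. H (fst w + \<tau> *\<^sub>R snd w, fst w - (1 - \<tau>) *\<^sub>R snd w)"
  have G: "?G \<in> schwartz" by (rule schwartz_tau_change[OF H \<tau>])
  have G1: "(\<lambda>w :: 'a \<times> 'a. H (fst w, fst w - snd w)) \<in> schwartz"
  proof (rule schwartz_linear[OF H, where K = 3])
    show "norm (fst x, fst x - snd x) \<le> 3 * norm x" for x :: "'a \<times> 'a"
      using norm_Pair_le[of "fst x" "fst x - snd x"] norm_triangle_ineq4[of "fst x" "snd x"] norm_fst_snd_le[of x] by simp
    show "norm x \<le> 3 * norm (fst x, fst x - snd x)" for x :: "'a \<times> 'a"
      using norm_Pair_le[of "fst x" "snd x"] norm_triangle_ineq4[of "fst x" "fst x - snd x"] norm_fst_snd_le[of "(fst x, fst x - snd x)"] by simp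
  qed (auto intro!: linearI simp: algebra_simps)
  have Hm: "H \<in> borel_measurable borel" by (rule schwartz_measurable[OF H])
  have "(LINT u|lborel. LINT s|lborel. H (u, s)) = (LINT u|lborel. LINT t|lborel. H (u, u - t))"
  proof (rule Bochner_Integration.integral_cong[OF refl])
    fix u
    have "(\<lambda>s. H (u, s)) \<in> borel_measurable borel" by (rule schwartz_measurable[OF schwartz_slice[OF H]])
    from integral_lborel_reflect[OF this, of u] show "(LINT s|lborel. H (u, s)) = (LINT t|lborel. H (u, u - t))" by simp
  qed
  also have "\<dots> = (LINT t|lborel. LINT u|lborel. H (u, u - t))"
    using integral_lborel_pair[OF schwartz_integrable[OF G1]] by simp
  also have "\<dots> = (LINT t|lborel. LINT x|lborel. ?G (x, t))"
  proof (rule Bochner_Integration.integral_cong[OF refl])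
    fix t
    have "(\<lambda>u. H (u, u - t)) \<in> borel_measurable borel"
      by (rule measurable_comp_continuous[OF Hm]) (intro continuous_intros)
    from integral_lborel_translate[OF this, of "\<tau> *\<^sub>R t"]
    show "(LINT u|lborel. H (u, u - t)) = (LINT x|lborel. ?G (x, t))" by (simp add: algebra_simps)
  qed
  also have "\<dots> = (LINT x|lborel. LINT t|lborel. ?G (x, t))"
    using integral_lborel_pair[OF schwartz_integrable[OF G]] by simp
  also have "\<dots> = (LINT x|lborel. LINT \<xi>|lborel. tau_wigner \<tau> h g (x, \<xi>) * \<Psi> (x, \<xi>))"
  proof (rule Bochner_Integration.integral_cong[OF refl])
    fix x
    let ?c = "\<lambda>t. h (x + \<tau> *\<^sub>R t) * cnj (g (x - (1 - \<tau>) *\<^sub>R t))"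
    have cS: "?c \<in> schwartz"
      using schwartz_slice[OF schwartz_tau_change[OF schwartz_tensor[OF h schwartz_cnj[OF g]] \<tau>], of x] by simp
    have PS: "(\<lambda>\<xi>. \<Psi> (x, \<xi>)) \<in> schwartz" by (rule schwartz_slice[OF P])
    let ?E = "\<lambda>w. cis (- (2 * pi * (fst w \<bullet> snd w))) * (?c (fst w) * \<Psi> (x, snd w))"
    have i: "integrable lborel ?E"
    proof (rule Bochner_Integration.integrable_bound)
      show "integrable lborel (\<lambda>w. ?c (fst w) * \<Psi> (x, snd w))"
        by (rule schwartz_integrable[OF schwartz_tensor[OF cS PS]])
      have "continuous_on UNIV ?E"
        by (intro continuous_intros continuous_on_compose2[OF schwartz_continuous[OF h]]
          continuous_on_compose2[OF schwartz_continuous[OF g]] continuous_on_compose2[OF schwartz_continuous[OF P]]) auto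
      then show "?E \<in> borel_measurable lborel" using borel_measurable_continuous_onI by simp
    qed (simp add: norm_mult)
    have "(LINT t|lborel. ?G (x, t)) = (LINT t|lborel. LINT \<xi>|lborel. ?E (t, \<xi>))"
    proof (rule Bochner_Integration.integral_cong[OF refl])
      fix t
      have "(1 - \<tau>) *\<^sub>R (x + \<tau> *\<^sub>R t) + \<tau> *\<^sub>R (x - (1 - \<tau>) *\<^sub>R t) = x" by (simp add: algebra_simps)
      moreover have "(x + \<tau> *\<^sub>R t) - (x - (1 - \<tau>) *\<^sub>R t) = t" by (simp add: algebra_simps)
      ultimately have "?G (x, t) = ?c t * (LINT \<xi>|lborel. cis (- (2 * pi * (t \<bullet> \<xi>))) * \<Psi> (x, \<xi>))"
        by (simp add: H_def fourier_snd_def)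
      also have "\<dots> = (LINT \<xi>|lborel. ?E (t, \<xi>))"
        unfolding integral_mult_right_zero[symmetric] fst_conv snd_conv by (simp only: mult_ac)
      finally show "?G (x, t) = (LINT \<xi>|lborel. ?E (t, \<xi>))" .
    qed
    also have "\<dots> = (LINT \<xi>|lborel. LINT t|lborel. ?E (t, \<xi>))"
      using integral_lborel_pair[OF i] by simp
    also have "\<dots> = (LINT \<xi>|lborel. tau_wigner \<tau> h g (x, \<xi>) * \<Psi> (x, \<xi>))"
      by (rule Bochner_Integration.integral_cong[OF refl]) (simp add: tau_wigner_def mult.assoc flip: integral_mult_left_zero)
    finally show "(LINT t|lborel. ?G (x, t)) = (LINT \<xi>|lborel. tau_wigner \<tau> h g (x, \<xi>) * \<Psi> (x, \<xi>))" .
  qed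
  also have "\<dots> = (LINT y|lborel. tau_wigner \<tau> h g y * \<Psi> y)"
    by (rule integral_lborel_pair(1)[symmetric, OF schwartz_integrable[OF schwartz_mult[OF schwartz_tau_wigner[OF h g \<tau>] P]]])
  finally show ?thesis by (simp add: H_def)
qed

section \<open>Covariance under time-frequency shifts\<close>

text \<open>Translating \<open>t\<close> by the difference of the positions of \<open>w\<close> and
  \<open>w'\<close> recentres both factors at the position component of \<open>tau_pt\<close>. The
  phases then separate into a constant \<open>c\<close>, a modulation in \<open>y\<close> by
  \<open>symplectic_J (w - w')\<close>, and a shift of the frequency variable.\<close>

lemma tau_wigner_shift:
  fixes h g :: "'a::euclidean_space \<Rightarrow> complex"
  assumes h: "h \<in> schwartz" and g: "g \<in> schwartz"
  shows "\<exists>c. cmod c = 1 \<and> tau_wigner \<tau> (tfshift w h) (tfshift w' g)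
    = (\<lambda>y. c * tfshift (tau_pt \<tau> w w', symplectic_J (w - w')) (tau_wigner \<tau> h g) y)"
proof (intro exI conjI ext)
  let ?\<Delta> = "fst w - fst w'" and ?z = "tau_pt \<tau> w w'"
  let ?c = "cis (2 * pi * (?\<Delta> \<bullet> snd ?z))"
  show "cmod ?c = 1" by simp
  fix y :: "'a \<times> 'a"
  obtain x \<xi> where y: "y = (x, \<xi>)" by (cases y)
  let ?f = "\<lambda>t. cis (- (2 * pi * (t \<bullet> \<xi>))) * tfshift w h (x + \<tau> *\<^sub>R t) * cnj (tfshift w' g (x - (1 - \<tau>) *\<^sub>R t))"
  have fm: "?f \<in> borel_measurable borel"
    by (intro borel_measurable_continuous_onI continuous_intros continuous_on_compose2[OF schwartz_continuous[OF schwartz_tfshift[OF h]]]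
          continuous_on_compose2[OF schwartz_continuous[OF schwartz_tfshift[OF g]]]) auto
  have "tau_wigner \<tau> (tfshift w h) (tfshift w' g) y = (LINT t|lborel. ?f (?\<Delta> + t))"
    unfolding integral_lborel_translate[OF fm] by (simp add: tau_wigner_def y)
  also have "\<dots> = (LINT t|lborel. (?c * cis (2 * pi * (symplectic_J (w - w') \<bullet> y))) *
     (cis (- (2 * pi * (t \<bullet> (\<xi> - snd ?z)))) * h ((x - fst ?z) + \<tau> *\<^sub>R t) * cnj (g ((x - fst ?z) - (1 - \<tau>) *\<^sub>R t))))"
  proof (rule Bochner_Integration.integral_cong[OF refl])
    fix t
    have 1: "x + \<tau> *\<^sub>R (?\<Delta> + t) - fst w = (x - fst ?z) + \<tau> *\<^sub>R t"
      and 2: "x - (1 - \<tau>) *\<^sub>R (?\<Delta> + t) - fst w' = (x - fst ?z) - (1 - \<tau>) *\<^sub>R t"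
      by (simp_all add: tau_pt_def algebra_simps)
    \<comment> \<open>The terms linear in \<open>t\<close> combine to the frequency shift, those
      containing \<open>x\<close> or \<open>\<xi>\<close> but not \<open>t\<close> to the
      modulation, and the rest is independent of \<open>y\<close> and \<open>t\<close>.\<close>
    have 3: "- (2 * pi * ((?\<Delta> + t) \<bullet> \<xi>)) + 2 * pi * (snd w \<bullet> (x + \<tau> *\<^sub>R (?\<Delta> + t))) + - (2 * pi * (snd w' \<bullet> (x - (1 - \<tau>) *\<^sub>R (?\<Delta> + t))))
      = 2 * pi * (?\<Delta> \<bullet> snd ?z) + 2 * pi * (symplectic_J (w - w') \<bullet> y) + - (2 * pi * (t \<bullet> (\<xi> - snd ?z)))"
      by (simp add: tau_pt_def symplectic_J_def y inner_simps inner_commute algebra_simps)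
    have "?f (?\<Delta> + t) = cis (- (2 * pi * ((?\<Delta> + t) \<bullet> \<xi>))) * cis (2 * pi * (snd w \<bullet> (x + \<tau> *\<^sub>R (?\<Delta> + t)))) * cis (- (2 * pi * (snd w' \<bullet> (x - (1 - \<tau>) *\<^sub>R (?\<Delta> + t)))))
       * (h ((x - fst ?z) + \<tau> *\<^sub>R t) * cnj (g ((x - fst ?z) - (1 - \<tau>) *\<^sub>R t)))"
      unfolding tfshift_def modulation_def translation_def 1 2 complex_cnj_mult cis_cnj by (simp only: mult_ac)
    also have "cis (- (2 * pi * ((?\<Delta> + t) \<bullet> \<xi>))) * cis (2 * pi * (snd w \<bullet> (x + \<tau> *\<^sub>R (?\<Delta> + t)))) * cis (- (2 * pi * (snd w' \<bullet> (x - (1 - \<tau>) *\<^sub>R (?\<Delta> + t)))))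
       = ?c * cis (2 * pi * (symplectic_J (w - w') \<bullet> y)) * cis (- (2 * pi * (t \<bullet> (\<xi> - snd ?z))))"
      unfolding cis_mult 3 ..
    finally show "?f (?\<Delta> + t) = (?c * cis (2 * pi * (symplectic_J (w - w') \<bullet> y))) *
     (cis (- (2 * pi * (t \<bullet> (\<xi> - snd ?z)))) * h ((x - fst ?z) + \<tau> *\<^sub>R t) * cnj (g ((x - fst ?z) - (1 - \<tau>) *\<^sub>R t)))"
      by (simp only: mult_ac)
  qed
  also have "\<dots> = ?c * tfshift (tau_pt \<tau> w w', symplectic_J (w - w')) (tau_wigner \<tau> h g) y"
    unfolding integral_mult_right_zero
    by (simp add: tfshift_def modulation_def translation_def tau_wigner_def case_prod_beta y mult.assoc)
  finally show "tau_wigner \<tau> (tfshift w h) (tfshift w' g) y = ?c * tfshift (tau_pt \<tau> w w', symplectic_J (w - w')) (tau_wigner \<tau> h g) y" .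
qed

text \<open>A time-frequency shift translates the transform up to a phase, and the phase disappears
  in the modulus.\<close>

lemma cmod_stft_tfshift:
  fixes W \<Phi> :: "'a::euclidean_space \<Rightarrow> complex"
  assumes W: "W \<in> schwartz" and P: "\<Phi> \<in> schwartz" and c: "cmod c = 1"
  shows "cmod (stft \<Phi> (dist_of_fun (\<lambda>y. c * tfshift (z0, \<eta>) W y)) z \<zeta>) = cmod (stft \<Phi> (dist_of_fun W) (z - z0) (\<zeta> - \<eta>))"
proof -
  let ?f = "\<lambda>t. cis (- (2 * pi * (\<zeta> \<bullet> t))) * ((c * tfshift (z0, \<eta>) W t) * cnj (\<Phi> (t - z)))"
  have fm: "?f \<in> borel_measurable borel"
    by (intro borel_measurable_continuous_onI continuous_intros continuous_on_compose2[OF schwartz_continuous[OF schwartz_tfshift[OF W]]]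
          continuous_on_compose2[OF schwartz_continuous[OF P]]) auto
  have "stft \<Phi> (dist_of_fun (\<lambda>y. c * tfshift (z0, \<eta>) W y)) z \<zeta> = (LINT t|lborel. ?f (z0 + t))"
    unfolding integral_lborel_translate[OF fm] by (simp add: stft_dist_of_fun)
  also have "\<dots> = (LINT t|lborel. (c * cis (2 * pi * ((\<eta> - \<zeta>) \<bullet> z0))) * (cis (- (2 * pi * ((\<zeta> - \<eta>) \<bullet> t))) * (W t * cnj (\<Phi> (t - (z - z0))))))"
  proof (rule Bochner_Integration.integral_cong[OF refl])
    fix t
    have 1: "z0 + t - z = t - (z - z0)" "z0 + t - z0 = t" by simp_all
    have 2: "- (2 * pi * (\<zeta> \<bullet> (z0 + t))) + 2 * pi * (\<eta> \<bullet> (z0 + t)) = 2 * pi * ((\<eta> - \<zeta>) \<bullet> z0) + - (2 * pi * ((\<zeta> - \<eta>) \<bullet> t))"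
      by (simp add: inner_simps algebra_simps)
    have "?f (z0 + t) = (cis (- (2 * pi * (\<zeta> \<bullet> (z0 + t)))) * cis (2 * pi * (\<eta> \<bullet> (z0 + t)))) * (c * (W t * cnj (\<Phi> (t - (z - z0)))))"
      unfolding tfshift_def modulation_def translation_def fst_conv snd_conv 1 by (simp only: mult_ac)
    also have "cis (- (2 * pi * (\<zeta> \<bullet> (z0 + t)))) * cis (2 * pi * (\<eta> \<bullet> (z0 + t))) = cis (2 * pi * ((\<eta> - \<zeta>) \<bullet> z0)) * cis (- (2 * pi * ((\<zeta> - \<eta>) \<bullet> t)))"
      unfolding cis_mult 2 ..
    finally show "?f (z0 + t) = (c * cis (2 * pi * ((\<eta> - \<zeta>) \<bullet> z0))) * (cis (- (2 * pi * ((\<zeta> - \<eta>) \<bullet> t))) * (W t * cnj (\<Phi> (t - (z - z0)))))"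
      by (simp only: mult_ac)
  qed
  finally show ?thesis unfolding integral_mult_right_zero using c by (simp add: norm_mult stft_dist_of_fun)
qed

lemma stft_tau_wigner_shift_bound:
  assumes P: "\<Phi> \<in> schwartz"
  shows "\<exists>C\<ge>0. \<exists>M. \<forall>\<tau>\<in>{0..1}. \<forall>h (g :: 'a::euclidean_space \<Rightarrow> complex) A B. h \<in> schwartz \<longrightarrow> g \<in> schwartz \<longrightarrow> sbd M M A h \<longrightarrow> sbd M M B g \<longrightarrow>
     (\<forall>w w' z \<zeta>. cmod (stft \<Phi> (dist_of_fun (tau_wigner \<tau> (tfshift w h) (tfshift w' g))) z \<zeta>)
        \<le> C * (A * B) * (dec N (z - tau_pt \<tau> w w') * dec N (\<zeta> - symplectic_J (w - w'))))"
proof -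
  obtain C M where C: "C \<ge> 0" "\<And>\<tau> h (g :: 'a \<Rightarrow> complex) A B z \<zeta>. \<tau> \<in> {0..1} \<Longrightarrow> sbd M M A h \<Longrightarrow> sbd M M B g \<Longrightarrow>
     cmod (stft \<Phi> (dist_of_fun (tau_wigner \<tau> h g)) z \<zeta>) \<le> C * (A * B) * (dec N z * dec N \<zeta>)"
    using stft_tau_wigner_bound[OF P, of N] by blast
  show ?thesis
  proof (intro exI[of _ C] conjI exI[of _ M] ballI allI impI)
    fix \<tau> :: real and h g :: "'a \<Rightarrow> complex" and A B w w' z \<zeta>
    assume \<tau>: "\<tau> \<in> {0..1}" and h: "h \<in> schwartz" "sbd M M A h" and g: "g \<in> schwartz" "sbd M M B g"
    obtain c where c: "cmod c = 1" "tau_wigner \<tau> (tfshift w h) (tfshift w' g)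
      = (\<lambda>y. c * tfshift (tau_pt \<tau> w w', symplectic_J (w - w')) (tau_wigner \<tau> h g) y)"
      using tau_wigner_shift[OF h(1) g(1)] by blast
    have W: "tau_wigner \<tau> h g \<in> schwartz" using schwartz_tau_wigner[OF h(1) g(1)] \<tau> by simp
    show "cmod (stft \<Phi> (dist_of_fun (tau_wigner \<tau> (tfshift w h) (tfshift w' g))) z \<zeta>)
        \<le> C * (A * B) * (dec N (z - tau_pt \<tau> w w') * dec N (\<zeta> - symplectic_J (w - w')))"
      unfolding c(2) cmod_stft_tfshift[OF W P c(1)] by (rule C(2)[OF \<tau> h(2) g(2)])
  qed (rule C)
qed

section \<open>The Wigner distribution of a Schwartz function and a tempered functional\<close>

lemma tau_wigner_dist_fun:
  "tau_wigner_dist \<tau> (dist_of_fun h) f \<Psi> = (LINT u|lborel. h u * cnj (f (\<lambda>s. cnj (fourier_snd \<Psi> ((1 - \<tau>) *\<^sub>R u + \<tau> *\<^sub>R s, u - s)))))"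
  by (simp add: tau_wigner_dist_def dist_of_fun_def duality_def)

lemma integrable_tensor:
  fixes f :: "'a::euclidean_space \<Rightarrow> complex" and g :: "'b::euclidean_space \<Rightarrow> complex"
  assumes "integrable lborel f" "integrable lborel g"
  shows "integrable lborel (\<lambda>w. f (fst w) * g (snd w))"
proof (rule integrableI_bounded)
  have [measurable]: "f \<in> borel_measurable borel" "g \<in> borel_measurable borel" using assms by auto
  show "(\<lambda>w. f (fst w) * g (snd w)) \<in> borel_measurable lborel" by simp
  have "(\<integral>\<^sup>+w. ennreal (norm (f (fst w) * g (snd w))) \<partial>lborel) = (\<integral>\<^sup>+x. ennreal (norm (f x)) \<partial>lborel) * (\<integral>\<^sup>+y. ennreal (norm (g y)) \<partial>lborel)"
    by (subst nn_integral_lborel_pair) (simp_all add: norm_mult ennreal_mult nn_integral_cmult nn_integral_multc)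
  also have "\<dots> < \<infinity>" using assms by (simp add: integrable_iff_bounded ennreal_mult_less_top)
  finally show "(\<integral>\<^sup>+w. ennreal (norm (f (fst w) * g (snd w))) \<partial>lborel) < \<infinity>" .
qed

text \<open>Where a nonzero continuous function does not vanish is a nonempty open set, hence not
  negligible.\<close>

lemma window_norm_pos:
  fixes g :: "'a::euclidean_space \<Rightarrow> complex"
  assumes g: "g \<in> schwartz" "g \<noteq> (\<lambda>_. 0)"
  shows "0 < (LINT z|lborel. (cmod (g z))\<^sup>2)"
proof (rule ccontr)
  let ?U = "{x. g x \<noteq> 0}"
  have [measurable]: "g \<in> borel_measurable borel" by (rule schwartz_measurable[OF g(1)])
  have "(\<lambda>x. g x * cnj (g x)) \<in> schwartz" by (intro schwartz_mult schwartz_cnj g)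
  from integrable_norm[OF schwartz_integrable[OF this]]
  have i: "integrable lborel (\<lambda>z. (cmod (g z))\<^sup>2)" by (simp add: norm_mult power2_eq_square)
  assume "\<not> 0 < (LINT z|lborel. (cmod (g z))\<^sup>2)"
  moreover have "0 \<le> (LINT z|lborel. (cmod (g z))\<^sup>2)" by (rule integral_nonneg_AE) simp
  ultimately have "(LINT z|lborel. (cmod (g z))\<^sup>2) = 0" by simp
  then have "AE z in lborel. (cmod (g z))\<^sup>2 = 0" by (subst (asm) integral_nonneg_eq_0_iff_AE[OF i]) auto
  then have "AE z in lborel. z \<notin> ?U" by eventually_elim simp
  moreover have "?U \<in> sets lborel" by simp
  ultimately have "?U \<in> null_sets lborel" by (simp add: AE_iff_null_sets)
  then have "negligible ?U" by (simp add: negligible_iff_null_sets null_sets_completionI)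
  moreover have "open ?U"
    using open_Collect_neq[OF schwartz_continuous[OF g(1)] continuous_on_const] .
  ultimately have "?U = {}" using open_not_negligible by blast
  then show False using g(2) by auto
qed

text \<open>Inserts the inversion formula for \<open>f\<close>: the distribution becomes a
  superposition of Wigner distributions of \<open>h\<close> with the atoms
  \<open>tfshift w g\<close>, with conjugated coefficients by antilinearity in \<open>f\<close>.
  Fubini rests on the decay of \<open>Sg u w\<close> in \<open>w\<close>, uniform in
  \<open>u\<close>, against the polynomial growth of \<open>V\<close>. The second claim makes the
  integral over \<open>u\<close> in \<open>tau_wigner_dist\<close> additive.\<close>

lemma stft_tau_wigner_dist:
  fixes h g :: "'a::euclidean_space \<Rightarrow> complex" and f
  assumes h: "h \<in> schwartz" and g: "g \<in> schwartz" "g \<noteq> (\<lambda>_. 0)" and f: "f \<in> tempered" and P: "\<Psi> \<in> schwartz" and \<tau>: "0 \<le> \<tau>" "\<tau> \<le> 1"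
  shows "tau_wigner_dist \<tau> (dist_of_fun h) f \<Psi> * of_real (LINT z|lborel. (cmod (g z))\<^sup>2)
     = (LINT w|lborel. cnj (stft g f (fst w) (snd w)) * (LINT y|lborel. tau_wigner \<tau> h (tfshift w g) y * \<Psi> y))"
    and "integrable lborel (\<lambda>u. h u * cnj (f (\<lambda>s. cnj (fourier_snd \<Psi> ((1 - \<tau>) *\<^sub>R u + \<tau> *\<^sub>R s, u - s)))))"
proof -
  let ?n = "complex_of_real (LINT z|lborel. (cmod (g z))\<^sup>2)"
  have n0: "?n \<noteq> 0" using window_norm_pos[OF g] by simp
  let ?M0 = "2 * DIM('a \<times> 'a)"
  define K where "K w = fourier_snd \<Psi> ((1 - \<tau>) *\<^sub>R fst w + \<tau> *\<^sub>R snd w, fst w - snd w)" for w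
  have KS: "K \<in> schwartz" unfolding K_def by (intro schwartz_tau_change_inv schwartz_fourier_snd P \<tau>)
  have kS: "(\<lambda>s. K (u, s)) \<in> schwartz" for u by (rule schwartz_slice[OF KS])
  define V where "V w = stft g f (fst w) (snd w)" for w
  define Sg where "Sg u w = stft g (dist_of_fun (\<lambda>s. K (u, s))) (fst w) (snd w)" for u w
  define G where "G p = h (fst p) * (cnj (V (snd p)) * Sg (fst p) (snd p))" for p
  have inv: "cnj (f (\<lambda>s. cnj (K (u, s)))) * ?n = (LINT w|lborel. cnj (V w) * Sg u w)" for u
  proof -
    have "cnj (f (\<lambda>s. cnj (K (u, s))) * ?n) = cnj (LINT w|lborel. V w * cnj (Sg u w))"
      using stft_inversion[OF f schwartz_cnj[OF kS] g(1), of u] by (simp add: V_def Sg_def)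
    also have "\<dots> = (LINT w|lborel. cnj (V w) * Sg u w)"
      by (simp add: Bochner_Integration.integral_cnj[symmetric] del: Bochner_Integration.integral_cnj)
    finally show ?thesis by simp
  qed
  obtain C1 M where C1: "0 \<le> C1" "\<And>w. cmod (V w) \<le> C1 * (1 + norm w) ^ M"
    using stft_poly_growth[OF f g(1)] unfolding V_def by blast
  obtain C2 M' where C2: "0 \<le> C2" "\<And>\<phi> (g :: 'a \<Rightarrow> complex) A B. sbd M' M' A \<phi> \<Longrightarrow> sbd M' M' B g \<Longrightarrow>
     sbd 0 (?M0 + M) (C2 * (A * B)) (\<lambda>w. stft g (dist_of_fun \<phi>) (fst w) (snd w))"
    using sbd_stft[of 0 "?M0 + M", where 'a='a] by blast
  obtain A where A: "sbd M' M' A K" using schwartz_sbd[OF KS] by blast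
  obtain B where B: "sbd M' M' B g" using schwartz_sbd[OF g(1)] by blast
  \<comment> \<open>Independent of \<open>u\<close> because the constant of \<open>sbd_slice\<close>
    is.\<close>
  define D where "D = C2 * ((real (DIM('a) + DIM('a)) ^ M' * A) * B)"
  have D0: "0 \<le> D" unfolding D_def using C2(1) sbd_nonneg[OF A] sbd_nonneg[OF B] by simp
  have SgD: "cmod (Sg u w) \<le> D * dec (?M0 + M) w" for u w
    unfolding Sg_def D_def by (rule sbd_dec[OF C2(2)[OF sbd_slice[OF A] B]])
  have VS: "cmod (cnj (V w) * Sg u w) \<le> C1 * D * dec ?M0 w" for u w
  proof -
    have "cmod (cnj (V w) * Sg u w) = cmod (V w) * cmod (Sg u w)" by (simp add: norm_mult)
    also have "\<dots> \<le> (C1 * (1 + norm w) ^ M) * (D * dec (?M0 + M) w)"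
      by (intro mult_mono C1(2) SgD) (use C1 D0 in auto)
    also have "\<dots> = C1 * D * (dec (?M0 + M) w * (1 + norm w) ^ M)" by (simp only: mult_ac)
    finally show ?thesis unfolding dec_mult_power .
  qed
  have Vm: "V \<in> borel_measurable borel" unfolding V_def by (rule stft_measurable[OF f g(1)])
  have cVm: "(\<lambda>w. cnj (V w)) \<in> borel_measurable borel"
    by (rule measurable_compose[OF Vm]) (intro borel_measurable_continuous_onI continuous_intros)
  have Sm: "(\<lambda>p. Sg (fst p) (snd p)) \<in> borel_measurable borel"
    unfolding Sg_def stft_dist_of_fun
    by (intro integral_measurable borel_measurable_continuous_onI continuous_intros
      continuous_on_compose2[OF schwartz_continuous[OF KS]] continuous_on_compose2[OF schwartz_continuous[OF g(1)]]) auto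
  have Gm: "G \<in> borel_measurable borel"
    unfolding G_def by (intro borel_measurable_times measurable_comp_continuous[OF schwartz_measurable[OF h]]
      measurable_comp_continuous[OF cVm] Sm continuous_intros)
  have iG: "integrable lborel G"
  proof (rule Bochner_Integration.integrable_bound)
    show "integrable lborel (\<lambda>p. h (fst p) * complex_of_real (C1 * D * dec ?M0 (snd p :: 'a \<times> 'a)))"
    proof (rule integrable_tensor[OF schwartz_integrable[OF h]])
      have "integrable lborel (\<lambda>w :: 'a \<times> 'a. C1 * D * dec ?M0 w)" using integrable_dec[OF order_refl, where 'a="'a \<times> 'a"] by simp
      then show "integrable lborel (\<lambda>w :: 'a \<times> 'a. complex_of_real (C1 * D * dec ?M0 w))" by (rule integrable_of_real)
    qed
    show "G \<in> borel_measurable lborel" using Gm by simp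
    show "AE p in lborel. norm (G p) \<le> norm (h (fst p) * complex_of_real (C1 * D * dec ?M0 (snd p)))"
    proof (rule AE_I2)
      fix p
      have "cmod (G p) \<le> cmod (h (fst p)) * (C1 * D * dec ?M0 (snd p))"
        unfolding G_def norm_mult[of "h (fst p)"] by (intro mult_left_mono VS) auto
      also have "\<dots> = norm (h (fst p) * complex_of_real (C1 * D * dec ?M0 (snd p)))"
        using C1 D0 by (simp add: norm_mult)
      finally show "norm (G p) \<le> norm (h (fst p) * complex_of_real (C1 * D * dec ?M0 (snd p)))" .
    qed
  qed
  have Gu: "(LINT w|lborel. G (u, w)) = (h u * cnj (f (\<lambda>s. cnj (K (u, s))))) * ?n" for u
    by (simp add: G_def mult.assoc inv)
  have cancel: "inverse ?n * (x * ?n) = x" for x using n0 by simp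
  have Kk: "K (u, s) = fourier_snd \<Psi> ((1 - \<tau>) *\<^sub>R u + \<tau> *\<^sub>R s, u - s)" for u s by (simp add: K_def)
  \<comment> \<open>By Fubini the inner integrals of \<open>G\<close> are integrable in
    \<open>u\<close>; by \<open>inv\<close> they equal the wanted function times \<open>?n\<close>,
    which is nonzero.\<close>
  have "integrable (lborel \<Otimes>\<^sub>M lborel) G" using iG by (simp add: lborel_prod)
  from lborel_pair.integrable_fst'[OF this]
  have "integrable lborel (\<lambda>u. (h u * cnj (f (\<lambda>s. cnj (K (u, s))))) * ?n)" unfolding Gu .
  then have "integrable lborel (\<lambda>u. inverse ?n * ((h u * cnj (f (\<lambda>s. cnj (K (u, s))))) * ?n))"
    by (rule integrable_mult_right)
  then show "integrable lborel (\<lambda>u. h u * cnj (f (\<lambda>s. cnj (fourier_snd \<Psi> ((1 - \<tau>) *\<^sub>R u + \<tau> *\<^sub>R s, u - s)))))"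
    by (simp only: cancel Kk)
  have "tau_wigner_dist \<tau> (dist_of_fun h) f \<Psi> * ?n = (LINT u|lborel. (h u * cnj (f (\<lambda>s. cnj (K (u, s))))) * ?n)"
    by (simp add: tau_wigner_dist_fun Kk)
  also have "\<dots> = (LINT u|lborel. LINT w|lborel. G (u, w))" by (simp only: Gu)
  also have "\<dots> = (LINT w|lborel. LINT u|lborel. G (u, w))"
    using integral_lborel_pair[OF iG] by simp
  also have "\<dots> = (LINT w|lborel. cnj (V w) * (LINT y|lborel. tau_wigner \<tau> h (tfshift w g) y * \<Psi> y))"
  proof (rule Bochner_Integration.integral_cong[OF refl])
    fix w :: "'a \<times> 'a"
    have "(LINT u|lborel. G (u, w)) = (LINT u|lborel. cnj (V w) * (h u * Sg u w))"
      by (simp add: G_def mult.left_commute)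
    also have "\<dots> = cnj (V w) * (LINT u|lborel. h u * Sg u w)" by simp
    also have "(LINT u|lborel. h u * Sg u w) = (LINT u|lborel. LINT s|lborel. h u * cnj (tfshift w g s) * fourier_snd \<Psi> ((1 - \<tau>) *\<^sub>R u + \<tau> *\<^sub>R s, u - s))"
    proof (rule Bochner_Integration.integral_cong[OF refl])
      fix u
      have "h u * Sg u w = (LINT s|lborel. h u * (cis (- (2 * pi * (snd w \<bullet> s))) * (K (u, s) * cnj (g (s - fst w)))))"
        unfolding Sg_def stft_dist_of_fun by simp
      also have "\<dots> = (LINT s|lborel. h u * cnj (tfshift w g s) * K (u, s))"
        by (simp add: tfshift_def modulation_def translation_def cis_cnj mult_ac)
      finally show "h u * Sg u w = (LINT s|lborel. h u * cnj (tfshift w g s) * fourier_snd \<Psi> ((1 - \<tau>) *\<^sub>R u + \<tau> *\<^sub>R s, u - s))"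
        unfolding Kk .
    qed
    also have "\<dots> = (LINT y|lborel. tau_wigner \<tau> h (tfshift w g) y * \<Psi> y)"
      by (rule tau_wigner_parseval[OF h schwartz_tfshift[OF g(1)] P \<tau>])
    finally show "(LINT u|lborel. G (u, w)) = cnj (V w) * (LINT y|lborel. tau_wigner \<tau> h (tfshift w g) y * \<Psi> y)" .
  qed
  finally show "tau_wigner_dist \<tau> (dist_of_fun h) f \<Psi> * ?n
     = (LINT w|lborel. cnj (stft g f (fst w) (snd w)) * (LINT y|lborel. tau_wigner \<tau> h (tfshift w g) y * \<Psi> y))"
    unfolding V_def .
qed

lemma tau_wigner_dist_functions:
  fixes h f :: "'a::euclidean_space \<Rightarrow> complex"
  assumes h: "h \<in> schwartz" and f: "f \<in> schwartz" and P: "\<Psi> \<in> schwartz" and \<tau>: "0 \<le> \<tau>" "\<tau> \<le> 1"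
  shows "tau_wigner_dist \<tau> (dist_of_fun h) (dist_of_fun f) \<Psi> = dist_of_fun (tau_wigner \<tau> h f) \<Psi>"
proof -
  have "tau_wigner_dist \<tau> (dist_of_fun h) (dist_of_fun f) \<Psi>
     = (LINT u|lborel. LINT s|lborel. h u * cnj (f s) * fourier_snd \<Psi> ((1 - \<tau>) *\<^sub>R u + \<tau> *\<^sub>R s, u - s))"
    unfolding tau_wigner_dist_fun unfolding dist_of_fun_def
    by (rule Bochner_Integration.integral_cong[OF refl])
      (simp add: Bochner_Integration.integral_cnj[symmetric] mult.assoc del: Bochner_Integration.integral_cnj)
  then show ?thesis unfolding tau_wigner_parseval[OF h f P \<tau>] by (simp add: dist_of_fun_def)
qed

section \<open>Boundedness of \<tau>-pseudodifferential operators\<close>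

text \<open>A moderate weight need not be measurable; it is replaced by the equivalent continuous weight
  \<open>z \<mapsto> inf\<^sub>w v(z - w) m(w)\<close>.\<close>

lemma moderate_weight_regularization:
  assumes v: "submult_weight v" and m: "m \<in> moderate_weights v"
  obtains \<mu> C where "0 < C" "continuous_on UNIV \<mu>" "\<And>z. 0 < \<mu> z" "\<And>z. \<mu> z \<le> m z" "\<And>z. m z \<le> C * \<mu> z"
    "\<And>z y. \<mu> (z + y) \<le> v y * \<mu> z"
proof -
  obtain C where C: "0 < C" "\<And>z w. m (z + w) \<le> C * v z * m w" and m0: "\<And>z. 0 < m z"
    using m unfolding moderate_weights_def by blast
  have v0: "\<And>z. 0 < v z" "v 0 = 1" and vm: "\<And>z w. v (z + w) \<le> v z * v w" and ve: "\<And>z. v (- z) = v z" and vc: "continuous_on UNIV v"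
    using v unfolding submult_weight_def by auto
  define \<mu> where "\<mu> z = (INF w. v (z - w) * m w)" for z
  have bb: "bdd_below (range (\<lambda>w. v (z - w) * m w))" for z
    using v0 m0 by (intro bdd_belowI2[of _ 0]) (simp add: less_imp_le)
  have le: "\<mu> z \<le> v (z - w) * m w" for z w
    unfolding \<mu>_def by (rule cINF_lower[OF bb]) simp
  have 1: "\<mu> z \<le> m z" for z using le[of z z] v0 by simp
  have "m z / C \<le> \<mu> z" for z
    unfolding \<mu>_def
  proof (rule cINF_greatest)
    fix w show "m z / C \<le> v (z - w) * m w" using C(2)[of "z - w" w] C(1) by (simp add: pos_divide_le_eq mult_ac)
  qed simp
  then have 2: "m z \<le> C * \<mu> z" for z using C(1) by (simp add: pos_divide_le_eq mult_ac)
  have 3: "0 < \<mu> z" for z using 2[of z] m0[of z] C(1) by (smt (verit) zero_less_mult_pos)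
  have 4: "\<mu> (z + y) \<le> v y * \<mu> z" for z y
  proof -
    have "\<mu> (z + y) / v y \<le> \<mu> z"
      unfolding \<mu>_def[of z]
    proof (rule cINF_greatest)
      fix w
      have "\<mu> (z + y) \<le> v (y + (z - w)) * m w" using le[of "z + y" w] by (simp add: algebra_simps)
      also have "\<dots> \<le> (v y * v (z - w)) * m w" using vm m0[of w] by (intro mult_right_mono) auto
      finally show "\<mu> (z + y) / v y \<le> v (z - w) * m w" using v0(1)[of y] by (simp add: pos_divide_le_eq mult_ac)
    qed simp
    then show ?thesis using v0(1)[of y] by (simp add: pos_divide_le_eq mult_ac)
  qed
  have vl: "v \<midarrow>0\<rightarrow> 1" using vc v0(2) by (metis UNIV_I continuous_on_def)
  \<comment> \<open>Moderateness with constant exactly 1 traps \<open>\<mu> (z + y)\<close> between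
    \<open>\<mu> z / v y\<close> and \<open>v y * \<mu> z\<close>, and \<open>v y\<close> tends to
    \<open>v 0 = 1\<close>.\<close>
  have "isCont \<mu> z" for z
    unfolding isCont_iff
  proof (rule tendsto_sandwich)
    show "((\<lambda>y. \<mu> z / v y) \<longlongrightarrow> \<mu> z) (at 0)" using tendsto_divide[OF tendsto_const vl, of "\<mu> z"] by simp
    show "((\<lambda>y. v y * \<mu> z) \<longlongrightarrow> \<mu> z) (at 0)" using tendsto_mult[OF vl tendsto_const, of "\<mu> z"] by simp
    show "\<forall>\<^sub>F y in at 0. \<mu> (z + y) \<le> v y * \<mu> z" using 4 by simp
    have "\<mu> z / v y \<le> \<mu> (z + y)" for y
      using 4[of "z + y" "- y"] v0(1)[of y] by (simp add: ve pos_divide_le_eq mult_ac)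
    then show "\<forall>\<^sub>F y in at 0. \<mu> z / v y \<le> \<mu> (z + y)" by simp
  qed
  then have "continuous_on UNIV \<mu>" by (simp add: continuous_on_eq_continuous_at)
  from that[OF C(1) this 3 1 2 4] show thesis .
qed

section \<open>Pointwise estimate of the pairing by the majorant\<close>

text \<open>A nonintegrable function has Bochner integral 0 by convention, so the inequality also
  covers divergent integrals.\<close>

lemma ennreal_cmod_integral_le: "ennreal (cmod (LINT w|M. F w)) \<le> (\<integral>\<^sup>+w. ennreal (cmod (F w)) \<partial>M)"
  using integral_norm_bound_ennreal[of M F] by (cases "integrable M F") (simp_all add: not_integrable_integral_eq)

lemma stft_tau_wigner_dist_integral:
  fixes h g :: "'a::euclidean_space \<Rightarrow> complex" and f
  assumes "h \<in> schwartz" and "g \<in> schwartz" "g \<noteq> (\<lambda>_. 0)" and "f \<in> tempered" and P: "\<Phi> \<in> schwartz" and "0 \<le> \<tau>" "\<tau> \<le> 1"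
  shows "stft \<Phi> (tau_wigner_dist \<tau> (dist_of_fun h) f) z \<zeta> * of_real (LINT z|lborel. (cmod (g z))\<^sup>2)
     = (LINT w|lborel. cnj (stft g f (fst w) (snd w)) * stft \<Phi> (dist_of_fun (tau_wigner \<tau> h (tfshift w g))) z \<zeta>)"
  using stft_tau_wigner_dist(1)[OF assms(1-4) schwartz_cnj[OF schwartz_tfshift[OF P]] assms(6,7), of "(z, \<zeta>)"]
  by (simp only: stft_tfshift[of \<Phi>]) (simp add: dist_of_fun_def)

text \<open>Read off from the representation as an iterated parameter integral of continuous
  functions, where the functional \<open>f\<close> enters only through its continuous
  transform.\<close>

lemma stft_tau_wigner_dist_measurable:
  fixes h g :: "'a::euclidean_space \<Rightarrow> complex" and f
  assumes h: "h \<in> schwartz" and g: "g \<in> schwartz" "g \<noteq> (\<lambda>_. 0)" and f: "f \<in> tempered" and P: "\<Phi> \<in> schwartz" and \<tau>: "0 \<le> \<tau>" "\<tau> \<le> 1"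
  shows "(\<lambda>W. stft \<Phi> (tau_wigner_dist \<tau> (dist_of_fun h) f) (fst W) (snd W)) \<in> borel_measurable borel"
proof -
  let ?n = "complex_of_real (LINT z|lborel. (cmod (g z))\<^sup>2)"
  have n0: "?n \<noteq> 0" using window_norm_pos[OF g] by simp
  have e: "stft \<Phi> (tau_wigner_dist \<tau> (dist_of_fun h) f) z \<zeta>
     = (LINT w|lborel. cnj (stft g f (fst w) (snd w)) * stft \<Phi> (dist_of_fun (tau_wigner \<tau> h (tfshift w g))) z \<zeta>) * inverse ?n" for z \<zeta>
    using stft_tau_wigner_dist_integral[OF h g f P \<tau>, of z \<zeta>, symmetric] n0 by simp
  have cV: "continuous_on UNIV (\<lambda>w. cnj (stft g f (fst w) (snd w)))"
    by (intro continuous_intros stft_continuous[OF f g(1)])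
  note cg = continuous_on_compose2[OF schwartz_continuous[OF h]] continuous_on_compose2[OF schwartz_continuous[OF g(1)]]
    continuous_on_compose2[OF schwartz_continuous[OF P]]
  show ?thesis
    unfolding e stft_dist_of_fun tau_wigner_def case_prod_beta tfshift_def modulation_def translation_def
    by (intro borel_measurable_times integral_measurable borel_measurable_const
        borel_measurable_continuous_onI[OF continuous_on_compose2[OF cV]]
        borel_measurable_continuous_onI continuous_intros cg) auto
qed

lemma norm_symplectic_J [simp]: "norm (symplectic_J z) = norm z"
  by (simp add: symplectic_J_def norm_prod_def add.commute)

lemma symplectic_J_diff: "symplectic_J (x - y) = symplectic_J x - symplectic_J y"
  by (simp add: symplectic_J_def)

lemma symplectic_J_J: "symplectic_J (symplectic_J x) = - x"
  by (simp add: symplectic_J_def prod_eq_iff)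

text \<open>Since \<open>J (J x) = - x\<close> and \<open>v\<close> is even,
  \<open>v (w - w')\<close> equals \<open>v (J (J (w - w')))\<close>, and \<open>J (w - w')\<close>
  is near \<open>\<zeta>\<close> where the kernel is concentrated. This is why the symbol carries
  the weight composed with \<open>J\<close>; the distance from \<open>\<zeta>\<close> costs a
  polynomial factor.\<close>

lemma weight_J_bound:
  assumes v: "submult_weight v" and gr: "\<And>z. v z \<le> C * (1 + norm z) ^ N"
  shows "v (w - w') \<le> v (symplectic_J \<zeta>) * (C * (1 + norm (\<zeta> - symplectic_J (w - w'))) ^ N)"
proof -
  have v0: "\<And>z. 0 < v z" and vm: "\<And>z w. v (z + w) \<le> v z * v w" and ve: "\<And>z. v (- z) = v z"
    using v unfolding submult_weight_def by auto
  let ?y = "\<zeta> - symplectic_J (w - w')"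
  have "v (w - w') = v (symplectic_J \<zeta> + - symplectic_J ?y)"
    by (simp add: symplectic_J_diff[of \<zeta>] symplectic_J_J) (metis ve minus_diff_eq)
  also have "\<dots> \<le> v (symplectic_J \<zeta>) * v (symplectic_J ?y)" using vm[of "symplectic_J \<zeta>" "- symplectic_J ?y"] by (simp only: ve)
  also have "\<dots> \<le> v (symplectic_J \<zeta>) * (C * (1 + norm ?y) ^ N)"
    using gr[of "symplectic_J ?y"] v0[of "symplectic_J \<zeta>"] by (intro mult_left_mono) auto
  finally show ?thesis .
qed


text \<open>The modulus stands inside the integral on the left, so one estimate yields both absolute
  convergence of the pairing and its size. An arbitrary \<open>h\<close> in place of the window
  makes it reach every test function; \<open>K\<close> and \<open>M\<close> do not depend on
  \<open>\<tau>\<close>, \<open>a\<close>, \<open>f\<close>, \<open>h\<close> or \<open>w\<close>,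
  and the seminorm constant \<open>A\<close> enters linearly.\<close>

lemma op_tau_integrand_bound:
  fixes v \<mu> :: "'a::euclidean_space \<times> 'a \<Rightarrow> real" and g :: "'a \<Rightarrow> complex"
  assumes v: "submult_weight v" "polynomial_growth v"
    and \<mu>: "continuous_on UNIV \<mu>" "\<And>z. 0 < \<mu> z" "\<And>z y. \<mu> (z + y) \<le> v y * \<mu> z"
    and g: "g \<in> schwartz" "g \<noteq> (\<lambda>_. 0)" and P: "\<Phi> \<in> schwartz"
  shows "\<exists>K\<ge>0. \<exists>M. \<forall>\<tau>\<in>{0..1}. \<forall>a\<in>tempered. \<forall>f\<in>tempered. \<forall>h\<in>schwartz. \<forall>w A. sbd M M A h \<longrightarrow>
    (\<integral>\<^sup>+W. ennreal (cmod (stft \<Phi> a (fst W) (snd W) * cnj (stft \<Phi> (tau_wigner_dist \<tau> (dist_of_fun (tfshift w h)) f) (fst W) (snd W)))) \<partial>lborel) * ennreal (\<mu> w)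
     \<le> ennreal (K * A) * out_op N \<tau> (\<lambda>W. ennreal (cmod (stft \<Phi> a (fst W) (snd W)) * v (symplectic_J (snd W))))
          (\<lambda>w'. ennreal (cmod (stft g f (fst w') (snd w')) * \<mu> w')) w"
proof -
  have v0: "\<And>z. 0 < v z" "v 0 = 1" and vc: "continuous_on UNIV v"
    using v(1) unfolding submult_weight_def by auto
  obtain Cv N0 where gr: "\<And>z. v z \<le> Cv * (1 + norm z) ^ N0" using v(2) unfolding polynomial_growth_def by blast
  have Cv: "1 \<le> Cv" using gr[of 0] v0 by simp
  \<comment> \<open>The additional order \<open>N0\<close> of decay will absorb the polynomial
    factor of \<open>weight_J_bound\<close>, leaving order \<open>N\<close>.\<close>
  obtain C M where C: "0 \<le> C" "\<And>\<tau> h (g :: 'a \<Rightarrow> complex) A B w w' z \<zeta>. \<tau> \<in> {0..1} \<Longrightarrow> h \<in> schwartz \<Longrightarrow> g \<in> schwartz \<Longrightarrow> sbd M M A h \<Longrightarrow> sbd M M B g \<Longrightarrow>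
     cmod (stft \<Phi> (dist_of_fun (tau_wigner \<tau> (tfshift w h) (tfshift w' g))) z \<zeta>)
        \<le> C * (A * B) * (dec (N + N0) (z - tau_pt \<tau> w w') * dec (N + N0) (\<zeta> - symplectic_J (w - w')))"
    using stft_tau_wigner_shift_bound[OF P, of "N + N0"] by blast
  obtain B where B: "sbd M M B g" using schwartz_sbd[OF g(1)] by blast
  have B0: "0 \<le> B" by (rule sbd_nonneg[OF B])
  let ?n = "LINT z|lborel. (cmod (g z))\<^sup>2"
  have n0: "0 < ?n" by (rule window_norm_pos[OF g])
  \<comment> \<open>\<open>C\<close> and \<open>B\<close> bound the Wigner term, \<open>Cv\<close>
    is the growth constant of \<open>v\<close>, and the energy of \<open>g\<close> normalizes the
    inversion formula.\<close>
  define K where "K = C * B * Cv / ?n"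
  have K0: "0 \<le> K" using C(1) B0 Cv n0 by (simp add: K_def)
  show ?thesis
  proof (intro exI[of _ K] conjI K0 exI[of _ M] ballI allI impI)
    fix \<tau> :: real and a :: "('a \<times> 'a \<Rightarrow> complex) \<Rightarrow> complex" and f :: "('a \<Rightarrow> complex) \<Rightarrow> complex" and h :: "'a \<Rightarrow> complex" and w :: "'a \<times> 'a" and A
    assume \<tau>: "\<tau> \<in> {0..1}" and a: "a \<in> tempered" and f: "f \<in> tempered" and h: "h \<in> schwartz" "sbd M M A h"
    have \<tau>': "0 \<le> \<tau>" "\<tau> \<le> 1" using \<tau> by auto
    have A0: "0 \<le> A" by (rule sbd_nonneg[OF h(2)])
    have hw: "tfshift w h \<in> schwartz" by (rule schwartz_tfshift[OF h(1)])
    define Va where "Va W = stft \<Phi> a (fst W) (snd W)" for W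
    define Vf where "Vf w' = stft g f (fst w') (snd w')" for w'
    define X where "X W = stft \<Phi> (tau_wigner_dist \<tau> (dist_of_fun (tfshift w h)) f) (fst W) (snd W)" for W
    define E where "E W w' = dec N (fst W - tau_pt \<tau> w w') * dec N (snd W - symplectic_J (w - w'))" for W w'
    let ?a = "\<lambda>W. ennreal (cmod (Va W) * v (symplectic_J (snd W)))"
    let ?F = "\<lambda>w'. ennreal (cmod (Vf w') * \<mu> w')"
    have am: "?a \<in> borel_measurable borel"
      unfolding Va_def symplectic_J_def
      by (intro measurable_compose[OF _ measurable_ennreal] borel_measurable_continuous_onI continuous_intros stft_continuous[OF a P]
          continuous_on_compose2[OF vc]) auto
    have Fm: "?F \<in> borel_measurable borel"
      unfolding Vf_def
      by (intro measurable_compose[OF _ measurable_ennreal] borel_measurable_continuous_onI continuous_intros stft_continuous[OF f g(1)] \<mu>(1))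
    have Xb: "ennreal (cmod (X W)) \<le> (\<integral>\<^sup>+w'. ennreal (C * (A * B) / ?n * cmod (Vf w') *
        (dec (N + N0) (fst W - tau_pt \<tau> w w') * dec (N + N0) (snd W - symplectic_J (w - w')))) \<partial>lborel)" for W
    proof -
      have "X W = inverse (of_real ?n) * (LINT w'|lborel. cnj (Vf w') * stft \<Phi> (dist_of_fun (tau_wigner \<tau> (tfshift w h) (tfshift w' g))) (fst W) (snd W))"
        unfolding Vf_def using stft_tau_wigner_dist_integral[OF hw g f P \<tau>', of "fst W" "snd W", symmetric] n0 by (simp add: X_def)
      also have "\<dots> = (LINT w'|lborel. inverse (of_real ?n) * (cnj (Vf w') * stft \<Phi> (dist_of_fun (tau_wigner \<tau> (tfshift w h) (tfshift w' g))) (fst W) (snd W)))"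
        by simp
      finally have "ennreal (cmod (X W)) \<le> (\<integral>\<^sup>+w'. ennreal (cmod (inverse (of_real ?n) * (cnj (Vf w') * stft \<Phi> (dist_of_fun (tau_wigner \<tau> (tfshift w h) (tfshift w' g))) (fst W) (snd W)))) \<partial>lborel)"
        by (simp only: ennreal_cmod_integral_le)
      also have "\<dots> \<le> (\<integral>\<^sup>+w'. ennreal (C * (A * B) / ?n * cmod (Vf w') *
        (dec (N + N0) (fst W - tau_pt \<tau> w w') * dec (N + N0) (snd W - symplectic_J (w - w')))) \<partial>lborel)"
      proof (intro nn_integral_mono ennreal_leI)
        fix w'
        let ?S = "stft \<Phi> (dist_of_fun (tau_wigner \<tau> (tfshift w h) (tfshift w' g))) (fst W) (snd W)"
        have "cmod (inverse (of_real ?n) * (cnj (Vf w') * ?S)) = cmod (Vf w') / ?n * cmod ?S"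
          using n0 by (simp add: norm_mult norm_inverse divide_inverse)
        also have "\<dots> \<le> cmod (Vf w') / ?n * (C * (A * B) * (dec (N + N0) (fst W - tau_pt \<tau> w w') * dec (N + N0) (snd W - symplectic_J (w - w'))))"
          by (intro mult_left_mono C(2)[OF \<tau> h(1) g(1) h(2) B]) (use n0 in simp)
        finally show "cmod (inverse (of_real ?n) * (cnj (Vf w') * ?S)) \<le> C * (A * B) / ?n * cmod (Vf w') *
            (dec (N + N0) (fst W - tau_pt \<tau> w w') * dec (N + N0) (snd W - symplectic_J (w - w')))"
          by (simp add: mult_ac)
      qed
      finally show ?thesis .
    qed
    have pt: "cmod (Va W) * \<mu> w * (C * (A * B) / ?n * cmod (Vf w') *
        (dec (N + N0) (fst W - tau_pt \<tau> w w') * dec (N + N0) (snd W - symplectic_J (w - w'))))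
      \<le> K * A * ((cmod (Va W) * v (symplectic_J (snd W))) * E W w' * (cmod (Vf w') * \<mu> w'))" for W w'
    proof -
      let ?y = "snd W - symplectic_J (w - w')" and ?x = "fst W - tau_pt \<tau> w w'"
      have "\<mu> w \<le> v (w - w') * \<mu> w'" using \<mu>(3)[of w' "w - w'"] by simp
      also have "\<dots> \<le> (v (symplectic_J (snd W)) * (Cv * (1 + norm ?y) ^ N0)) * \<mu> w'"
        using weight_J_bound[OF v(1) gr] \<mu>(2)[of w'] by (intro mult_right_mono) auto
      finally have 1: "\<mu> w \<le> v (symplectic_J (snd W)) * (Cv * (1 + norm ?y) ^ N0) * \<mu> w'" .
      have 2: "dec (N + N0) ?x * dec (N + N0) ?y \<le> dec N ?x * dec (N + N0) ?y"
        by (intro mult_right_mono dec_antimono) auto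
      have 3: "\<mu> w * (dec (N + N0) ?x * dec (N + N0) ?y) \<le> v (symplectic_J (snd W)) * (Cv * (1 + norm ?y) ^ N0) * \<mu> w' * (dec N ?x * dec (N + N0) ?y)"
        by (rule mult_mono[OF 1 2]) (use v0 Cv \<mu>(2) in \<open>simp_all add: less_imp_le\<close>)
      also have "\<dots> = v (symplectic_J (snd W)) * Cv * \<mu> w' * (dec N ?x * (dec (N + N0) ?y * (1 + norm ?y) ^ N0))" by (simp only: mult_ac)
      finally have 4: "\<mu> w * (dec (N + N0) ?x * dec (N + N0) ?y) \<le> v (symplectic_J (snd W)) * Cv * \<mu> w' * E W w'"
        unfolding dec_mult_power E_def .
      have "cmod (Va W) * \<mu> w * (C * (A * B) / ?n * cmod (Vf w') * (dec (N + N0) ?x * dec (N + N0) ?y))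
         = (cmod (Va W) * (C * (A * B) / ?n * cmod (Vf w'))) * (\<mu> w * (dec (N + N0) ?x * dec (N + N0) ?y))" by (simp only: mult_ac)
      also have "\<dots> \<le> (cmod (Va W) * (C * (A * B) / ?n * cmod (Vf w'))) * (v (symplectic_J (snd W)) * Cv * \<mu> w' * E W w')"
        by (intro mult_left_mono 4) (use C(1) A0 B0 n0 in simp)
      also have "\<dots> = K * A * ((cmod (Va W) * v (symplectic_J (snd W))) * E W w' * (cmod (Vf w') * \<mu> w'))"
        by (simp add: K_def mult_ac)
      finally show ?thesis .
    qed
    have E0: "0 \<le> E W w'" for W w' by (simp add: E_def)
    have EE: "ennreal (E W w') = ennreal (dec N (fst W - tau_pt \<tau> w w')) * ennreal (dec N (snd W - symplectic_J (w - w')))" for W w'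
      by (simp add: E_def ennreal_mult)
    have Em: "(\<lambda>p. ennreal (E (fst p) (snd p))) \<in> borel_measurable borel"
      unfolding EE tau_pt_def symplectic_J_def
      by (intro borel_measurable_times_ennreal dec_measurable_cont continuous_intros)
    have "(\<integral>\<^sup>+W. ennreal (cmod (Va W * cnj (X W))) \<partial>lborel) * ennreal (\<mu> w)
        \<le> (\<integral>\<^sup>+W. ennreal (cmod (Va W) * \<mu> w) * ennreal (cmod (X W)) \<partial>lborel)"
    proof -
      have Vm: "Va \<in> borel_measurable borel" and Xm: "X \<in> borel_measurable borel"
        unfolding Va_def X_def by (rule stft_measurable[OF a P], rule stft_tau_wigner_dist_measurable[OF hw g f P \<tau>'])
      show ?thesis
        using \<mu>(2)[of w] Vm Xm
        by (subst nn_integral_multc[symmetric]) (simp_all add: norm_mult ennreal_mult'' ennreal_mult mult_ac)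
    qed
    also have "\<dots> \<le> (\<integral>\<^sup>+W. \<integral>\<^sup>+w'. ennreal (K * A) * (?a W * ennreal (E W w') * ?F w') \<partial>lborel \<partial>lborel)"
    proof (rule nn_integral_mono)
      fix W
      let ?G = "\<lambda>w'. C * (A * B) / ?n * cmod (Vf w') *
        (dec (N + N0) (fst W - tau_pt \<tau> w w') * dec (N + N0) (snd W - symplectic_J (w - w')))"
      have c: "0 \<le> cmod (Va W) * \<mu> w" using \<mu>(2)[of w] by simp
      have "continuous_on UNIV ?G"
        unfolding Vf_def tau_pt_def symplectic_J_def
        by (intro continuous_intros stft_continuous[OF f g(1)] continuous_on_compose2[OF continuous_dec]) auto
      then have "?G \<in> borel_measurable borel" by (rule borel_measurable_continuous_onI)
      then have Gm: "(\<lambda>w'. ennreal (?G w')) \<in> borel_measurable lborel" by simp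
      have "ennreal (cmod (Va W) * \<mu> w) * ennreal (cmod (X W)) \<le> ennreal (cmod (Va W) * \<mu> w) * (\<integral>\<^sup>+w'. ennreal (?G w') \<partial>lborel)"
        by (intro mult_left_mono Xb) simp
      also have "\<dots> = (\<integral>\<^sup>+w'. ennreal (cmod (Va W) * \<mu> w) * ennreal (?G w') \<partial>lborel)"
        by (rule nn_integral_cmult[symmetric, OF Gm])
      also have "\<dots> \<le> (\<integral>\<^sup>+w'. ennreal (K * A) * (?a W * ennreal (E W w') * ?F w') \<partial>lborel)"
      proof (rule nn_integral_mono)
        fix w'
        have "ennreal (cmod (Va W) * \<mu> w) * ennreal (?G w') = ennreal (cmod (Va W) * \<mu> w * ?G w')"
          by (rule ennreal_mult'[symmetric, OF c])
        also have "\<dots> \<le> ennreal (K * A * ((cmod (Va W) * v (symplectic_J (snd W))) * E W w' * (cmod (Vf w') * \<mu> w')))"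
          by (intro ennreal_leI pt)
        also have "\<dots> = ennreal (K * A) * (?a W * ennreal (E W w') * ?F w')"
          using K0 A0 E0 v0 \<mu>(2) by (simp add: ennreal_mult less_imp_le)
        finally show "ennreal (cmod (Va W) * \<mu> w) * ennreal (?G w') \<le> ennreal (K * A) * (?a W * ennreal (E W w') * ?F w')" .
      qed
      finally show "ennreal (cmod (Va W) * \<mu> w) * ennreal (cmod (X W)) \<le> (\<integral>\<^sup>+w'. ennreal (K * A) * (?a W * ennreal (E W w') * ?F w') \<partial>lborel)" .
    qed
    also have "\<dots> = (\<integral>\<^sup>+w'. \<integral>\<^sup>+W. ennreal (K * A) * (?a W * ennreal (E W w') * ?F w') \<partial>lborel \<partial>lborel)"
      by (rule tonelli_swap)
        (intro borel_measurable_times_ennreal borel_measurable_const Em measurable_comp_continuous[OF am] measurable_comp_continuous[OF Fm] continuous_intros)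
    also have "\<dots> = (\<integral>\<^sup>+w'. ennreal (K * A) * (smear N ?a (tau_pt \<tau> w w', symplectic_J (w - w')) * ?F w') \<partial>lborel)"
    proof (rule nn_integral_cong)
      fix w'
      have Ewm: "(\<lambda>W. ennreal (E W w')) \<in> borel_measurable borel"
        unfolding EE by (intro borel_measurable_times_ennreal dec_measurable_cont continuous_intros)
      have m: "(\<lambda>W. ?a W * ennreal (E W w')) \<in> borel_measurable borel" by (rule borel_measurable_times_ennreal[OF am Ewm])
      have "(\<integral>\<^sup>+W. ennreal (K * A) * (?a W * ennreal (E W w') * ?F w') \<partial>lborel) = ennreal (K * A) * ((\<integral>\<^sup>+W. ?a W * ennreal (E W w') \<partial>lborel) * ?F w')"
        using m by (subst nn_integral_cmult, simp, subst nn_integral_multc) simp_all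
      also have "(\<integral>\<^sup>+W. ?a W * ennreal (E W w') \<partial>lborel) = smear N ?a (tau_pt \<tau> w w', symplectic_J (w - w'))"
        by (subst nn_integral_lborel_pair[OF m]) (simp add: smear_def EE)
      finally show "(\<integral>\<^sup>+W. ennreal (K * A) * (?a W * ennreal (E W w') * ?F w') \<partial>lborel)
         = ennreal (K * A) * (smear N ?a (tau_pt \<tau> w w', symplectic_J (w - w')) * ?F w')" .
    qed
    also have "\<dots> = ennreal (K * A) * out_op N \<tau> ?a ?F w"
      unfolding out_op_def
    proof (rule nn_integral_cmult)
      have "continuous_on UNIV (\<lambda>w'. (tau_pt \<tau> w w', symplectic_J (w - w')))"
        unfolding tau_pt_def symplectic_J_def by (intro continuous_intros)
      from measurable_comp_continuous[OF smear_measurable[OF am] this]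
      have "(\<lambda>w'. smear N ?a (tau_pt \<tau> w w', symplectic_J (w - w'))) \<in> borel_measurable borel" .
      then show "(\<lambda>w'. smear N ?a (tau_pt \<tau> w w', symplectic_J (w - w')) * ?F w') \<in> borel_measurable lborel"
        using Fm by simp
    qed
    finally show "(\<integral>\<^sup>+W. ennreal (cmod (stft \<Phi> a (fst W) (snd W) * cnj (stft \<Phi> (tau_wigner_dist \<tau> (dist_of_fun (tfshift w h)) f) (fst W) (snd W)))) \<partial>lborel) * ennreal (\<mu> w)
       \<le> ennreal (K * A) * out_op N \<tau> (\<lambda>W. ennreal (cmod (stft \<Phi> a (fst W) (snd W)) * v (symplectic_J (snd W))))
          (\<lambda>w'. ennreal (cmod (stft g f (fst w') (snd w')) * \<mu> w')) w"
      unfolding Va_def Vf_def X_def .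
  qed
qed

section \<open>Convergence, linearity and temperedness of the operator\<close>

text \<open>Used in contrapositive form: a function with finite mixed norm is finite at some
  point.\<close>

lemma Lnorm_top_function:
  assumes "1 \<le> p" shows "Lnorm p (\<lambda>x :: 'a::euclidean_space. top) = top"
  using assms
proof (cases rule: ennreal_exp_cases)
  case 1
  have "AE x :: 'a in lborel. (top :: ennreal) \<le> Lnorm top (\<lambda>x :: 'a. top)" using AE_le_Lnorm_top[of "\<lambda>x :: 'a. top"] .
  moreover have "ae_filter (lborel :: 'a measure) \<noteq> bot" by (simp add: ae_filter_eq_bot_iff)
  ultimately show ?thesis using 1 by (simp add: eventually_const top_unique)
next
  case (2 r)
  then show ?thesis by (simp add: Lnorm_finite pw_eq_top_iff)
qed

lemma tau_wigner_dist_add_left: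
  fixes g h1 h2 :: "'a::euclidean_space \<Rightarrow> complex"
  assumes "h1 \<in> schwartz" "h2 \<in> schwartz" "f \<in> tempered" "\<Psi> \<in> schwartz" "0 \<le> \<tau>" "\<tau> \<le> 1"
    and g: "g \<in> schwartz" "g \<noteq> (\<lambda>_. 0)"
  shows "tau_wigner_dist \<tau> (dist_of_fun (\<lambda>x. h1 x + h2 x)) f \<Psi> = tau_wigner_dist \<tau> (dist_of_fun h1) f \<Psi> + tau_wigner_dist \<tau> (dist_of_fun h2) f \<Psi>"
  unfolding tau_wigner_dist_fun distrib_right
  by (intro Bochner_Integration.integral_add stft_tau_wigner_dist(2)[OF _ g] assms)

lemma tau_wigner_dist_cmult_left:
  "tau_wigner_dist \<tau> (dist_of_fun (\<lambda>x. c * h x)) f \<Psi> = c * tau_wigner_dist \<tau> (dist_of_fun h) f \<Psi>"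
  unfolding tau_wigner_dist_fun by (simp add: mult.assoc)

lemma tau_wigner_dist_linear_right:
  fixes g h :: "'a::euclidean_space \<Rightarrow> complex"
  assumes "h \<in> schwartz" "f1 \<in> tempered" "f2 \<in> tempered" "\<Psi> \<in> schwartz" "0 \<le> \<tau>" "\<tau> \<le> 1"
    and g: "g \<in> schwartz" "g \<noteq> (\<lambda>_. 0)"
  shows "tau_wigner_dist \<tau> (dist_of_fun h) (\<lambda>\<phi>. f1 \<phi> + c * f2 \<phi>) \<Psi> = tau_wigner_dist \<tau> (dist_of_fun h) f1 \<Psi> + cnj c * tau_wigner_dist \<tau> (dist_of_fun h) f2 \<Psi>"
proof -
  let ?I = "\<lambda>f u. h u * cnj (f (\<lambda>s. cnj (fourier_snd \<Psi> ((1 - \<tau>) *\<^sub>R u + \<tau> *\<^sub>R s, u - s))))"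
  have i: "integrable lborel (?I f1)" "integrable lborel (?I f2)"
    by (intro stft_tau_wigner_dist(2)[OF _ g] assms)+
  have "(LINT u|lborel. ?I f1 u + cnj c * ?I f2 u) = (LINT u|lborel. ?I f1 u) + (LINT u|lborel. cnj c * ?I f2 u)"
    by (intro Bochner_Integration.integral_add integrable_mult_right i)
  then show ?thesis unfolding tau_wigner_dist_fun integral_mult_right_zero by (simp add: distrib_left mult.left_commute)
qed

text \<open>Every function is a shift by \<open>w\<close> of another one, so a bound at a single
  \<open>w\<close> reaches all test functions.\<close>

lemma tfshift_inverse: "tfshift w (translation (- fst w) (modulation (- snd w) h)) = h"
proof
  fix t
  have "cis (2 * pi * (snd w \<bullet> t)) * cis (2 * pi * (- snd w \<bullet> t)) = 1" by (simp add: cis_mult)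
  then show "tfshift w (translation (- fst w) (modulation (- snd w) h)) t = h t"
    by (simp add: tfshift_def translation_def modulation_def flip: mult.assoc)
qed

lemma op_tau_linear:
  fixes g :: "'a::euclidean_space \<Rightarrow> complex" and \<Phi> :: "'a \<times> 'a \<Rightarrow> complex"
  assumes g: "g \<in> schwartz" "g \<noteq> (\<lambda>_. 0)" and P: "\<Phi> \<in> schwartz" and \<tau>: "0 \<le> \<tau>" "\<tau> \<le> 1"
    and f: "f1 \<in> tempered" "f2 \<in> tempered" and \<psi>: "\<psi> \<in> schwartz"
    and i1: "integrable lborel (\<lambda>W. stft \<Phi> a (fst W) (snd W) * cnj (stft \<Phi> (tau_wigner_dist \<tau> (dist_of_fun (\<lambda>x. cnj (\<psi> x))) f1) (fst W) (snd W)))"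
    and i2: "integrable lborel (\<lambda>W. stft \<Phi> a (fst W) (snd W) * cnj (stft \<Phi> (tau_wigner_dist \<tau> (dist_of_fun (\<lambda>x. cnj (\<psi> x))) f2) (fst W) (snd W)))"
  shows "op_tau \<tau> \<Phi> a (\<lambda>\<phi>. f1 \<phi> + c * f2 \<phi>) \<psi> = op_tau \<tau> \<Phi> a f1 \<psi> + c * op_tau \<tau> \<Phi> a f2 \<psi>"
proof -
  let ?V = "\<lambda>W. stft \<Phi> a (fst W) (snd W)" and ?X = "\<lambda>f W. stft \<Phi> (tau_wigner_dist \<tau> (dist_of_fun (\<lambda>x. cnj (\<psi> x))) f) (fst W) (snd W)"
  have "?X (\<lambda>\<phi>. f1 \<phi> + c * f2 \<phi>) W = ?X f1 W + cnj c * ?X f2 W" for W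
    unfolding stft_tfshift
    by (rule tau_wigner_dist_linear_right[OF schwartz_cnj[OF \<psi>] f schwartz_cnj[OF schwartz_tfshift[OF P]] \<tau> g])
  then have "(LINT W|lborel. ?V W * cnj (?X (\<lambda>\<phi>. f1 \<phi> + c * f2 \<phi>) W)) = (LINT W|lborel. ?V W * cnj (?X f1 W) + c * (?V W * cnj (?X f2 W)))"
    by (simp add: distrib_left mult.left_commute)
  also have "\<dots> = (LINT W|lborel. ?V W * cnj (?X f1 W)) + c * (LINT W|lborel. ?V W * cnj (?X f2 W))"
    using Bochner_Integration.integral_add[OF i1 integrable_mult_right[OF i2, of c]] by simp
  finally show ?thesis unfolding op_tau_def ext_duality_def by (simp add: add_divide_distrib)
qed

text \<open>Finiteness of the majorant at the one point \<open>w0\<close> suffices. A test function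
  is written as a shift by \<open>w0\<close>, whose unshifted form has seminorms larger by a fixed
  factor; this gives integrability of the pairing and continuity in a single Schwartz
  seminorm.\<close>

lemma op_tau_tempered:
  fixes g :: "'a::euclidean_space \<Rightarrow> complex" and R :: "'a \<times> 'a \<Rightarrow> ennreal"
  assumes g: "g \<in> schwartz" "g \<noteq> (\<lambda>_. 0)" and P: "\<Phi> \<in> schwartz" "\<Phi> \<noteq> (\<lambda>_. 0)" and \<tau>: "0 \<le> \<tau>" "\<tau> \<le> 1"
    and a: "a \<in> tempered" and f: "f \<in> tempered" and \<mu>: "\<And>w. 0 < \<mu> w" and K: "0 \<le> K"
    and bound: "\<And>h w A. h \<in> schwartz \<Longrightarrow> sbd M M A h \<Longrightarrow>
      (\<integral>\<^sup>+W. ennreal (cmod (stft \<Phi> a (fst W) (snd W) * cnj (stft \<Phi> (tau_wigner_dist \<tau> (dist_of_fun (tfshift w h)) f) (fst W) (snd W)))) \<partial>lborel) * ennreal (\<mu> w)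
      \<le> ennreal (K * A) * R w"
    and w0: "R w0 < \<infinity>"
  shows "\<And>h. h \<in> schwartz \<Longrightarrow> integrable lborel (\<lambda>W. stft \<Phi> a (fst W) (snd W) * cnj (stft \<Phi> (tau_wigner_dist \<tau> (dist_of_fun h) f) (fst W) (snd W)))"
    and "op_tau \<tau> \<Phi> a f \<in> tempered"
    and "\<And>h w A. h \<in> schwartz \<Longrightarrow> sbd M M A h \<Longrightarrow>
      ennreal (cmod (op_tau \<tau> \<Phi> a f (\<lambda>x. cnj (tfshift w h x))) * \<mu> w) \<le> ennreal (K * A / (LINT z|lborel. (cmod (\<Phi> z))\<^sup>2)) * R w"
proof -
  let ?n = "LINT z|lborel. (cmod (\<Phi> z))\<^sup>2"
  have n0: "0 < ?n" by (rule window_norm_pos[OF P])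
  let ?V = "\<lambda>W. stft \<Phi> a (fst W) (snd W)"
  let ?X = "\<lambda>h W. stft \<Phi> (tau_wigner_dist \<tau> (dist_of_fun h) f) (fst W) (snd W)"
  let ?h = "\<lambda>h. translation (- fst w0) (modulation (- snd w0) h)"
  \<comment> \<open>The factor depends on the fixed \<open>w0\<close> and \<open>M\<close> only, so
    it can enter the continuity constant.\<close>
  have shift: "\<exists>c\<ge>0. \<forall>h A. sbd M M A h \<longrightarrow> sbd M M (c * A) (?h h)"
  proof (intro exI[of _ "real DIM('a) ^ M * ((1 + norm (- fst w0)) ^ M * (1 + 2 * pi * norm (- snd w0)) ^ M)"] conjI allI impI)
    fix h :: "'a \<Rightarrow> complex" and A assume "sbd M M A h"
    from sbd_translate[OF sbd_modulation[OF this, of "- snd w0"], of "- fst w0"]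
    show "sbd M M (real DIM('a) ^ M * ((1 + norm (- fst w0)) ^ M * (1 + 2 * pi * norm (- snd w0)) ^ M) * A) (?h h)"
      unfolding translation_def by (simp only: mult.assoc of_nat_power)
  qed simp
  then obtain c where c: "0 \<le> c" "\<And>h A. sbd M M A h \<Longrightarrow> sbd M M (c * A) (?h h)" by blast
  have hS: "?h h \<in> schwartz" if "h \<in> schwartz" for h by (intro schwartz_translation schwartz_modulation that)
  show i: "integrable lborel (\<lambda>W. ?V W * cnj (?X h W))" if h: "h \<in> schwartz" for h
  proof (rule integrableI_bounded)
    have "?X h \<in> borel_measurable borel" by (rule stft_tau_wigner_dist_measurable[OF h g f P(1) \<tau>])
    then have "(\<lambda>W. cnj (?X h W)) \<in> borel_measurable borel"
      by (rule measurable_compose) (intro borel_measurable_continuous_onI continuous_intros)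
    then show "(\<lambda>W. ?V W * cnj (?X h W)) \<in> borel_measurable lborel" using stft_measurable[OF a P(1)] by simp
    obtain A where A: "sbd M M A h" using schwartz_sbd[OF h] by blast
    have "(\<integral>\<^sup>+W. ennreal (cmod (?V W * cnj (?X h W))) \<partial>lborel) * ennreal (\<mu> w0) \<le> ennreal (K * (c * A)) * R w0"
      using bound[OF hS[OF h] c(2)[OF A], of w0] unfolding tfshift_inverse .
    also have "\<dots> < \<infinity>" using w0 by (simp add: ennreal_mult_less_top)
    finally show "(\<integral>\<^sup>+W. ennreal (norm (?V W * cnj (?X h W))) \<partial>lborel) < \<infinity>"
      using \<mu>[of w0] by (auto simp: ennreal_mult_less_top)
  qed
  show b: "ennreal (cmod (op_tau \<tau> \<Phi> a f (\<lambda>x. cnj (tfshift w h x))) * \<mu> w) \<le> ennreal (K * A / ?n) * R w"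
    if h: "h \<in> schwartz" "sbd M M A h" for h w A
  proof -
    have A0: "0 \<le> A" by (rule sbd_nonneg[OF h(2)])
    have "ennreal (cmod (op_tau \<tau> \<Phi> a f (\<lambda>x. cnj (tfshift w h x))) * \<mu> w)
       = ennreal (inverse ?n) * (ennreal (cmod (LINT W|lborel. ?V W * cnj (?X (tfshift w h) W))) * ennreal (\<mu> w))"
      using n0 \<mu>[of w] unfolding op_tau_def ext_duality_def
      by (simp add: norm_mult norm_inverse divide_inverse ennreal_mult[symmetric] mult_ac)
    also have "\<dots> \<le> ennreal (inverse ?n) * (ennreal (K * A) * R w)"
      by (intro mult_left_mono order_trans[OF mult_right_mono[OF ennreal_cmod_integral_le] bound[OF h]]) simp_all
    also have "\<dots> = ennreal (K * A / ?n) * R w"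
      using n0 K A0 by (simp add: divide_inverse ennreal_mult mult_ac)
    finally show ?thesis .
  qed
  show "op_tau \<tau> \<Phi> a f \<in> tempered"
    unfolding tempered_def mem_Collect_eq
  proof (intro conjI ballI allI)
    fix \<phi> \<psi> :: "'a \<Rightarrow> complex" assume s: "\<phi> \<in> schwartz" "\<psi> \<in> schwartz"
    have "?X (\<lambda>x. cnj (\<phi> x + \<psi> x)) W = ?X (\<lambda>x. cnj (\<phi> x)) W + ?X (\<lambda>x. cnj (\<psi> x)) W" for W
      unfolding stft_tfshift complex_cnj_add
      by (rule tau_wigner_dist_add_left[OF schwartz_cnj[OF s(1)] schwartz_cnj[OF s(2)] f schwartz_cnj[OF schwartz_tfshift[OF P(1)]] \<tau> g])
    then have "(LINT W|lborel. ?V W * cnj (?X (\<lambda>x. cnj (\<phi> x + \<psi> x)) W))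
      = (LINT W|lborel. ?V W * cnj (?X (\<lambda>x. cnj (\<phi> x)) W) + ?V W * cnj (?X (\<lambda>x. cnj (\<psi> x)) W))"
      by (simp add: distrib_left)
    also have "\<dots> = (LINT W|lborel. ?V W * cnj (?X (\<lambda>x. cnj (\<phi> x)) W)) + (LINT W|lborel. ?V W * cnj (?X (\<lambda>x. cnj (\<psi> x)) W))"
      by (intro Bochner_Integration.integral_add i schwartz_cnj s)
    finally show "op_tau \<tau> \<Phi> a f (\<lambda>x. \<phi> x + \<psi> x) = op_tau \<tau> \<Phi> a f \<phi> + op_tau \<tau> \<Phi> a f \<psi>"
      unfolding op_tau_def ext_duality_def by (simp add: add_divide_distrib)
  next
    fix d and \<phi> :: "'a \<Rightarrow> complex" assume s: "\<phi> \<in> schwartz"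
    have "?X (\<lambda>x. cnj (d * \<phi> x)) W = cnj d * ?X (\<lambda>x. cnj (\<phi> x)) W" for W
      unfolding stft_tfshift complex_cnj_mult by (rule tau_wigner_dist_cmult_left)
    then have "(LINT W|lborel. ?V W * cnj (?X (\<lambda>x. cnj (d * \<phi> x)) W)) = (LINT W|lborel. d * (?V W * cnj (?X (\<lambda>x. cnj (\<phi> x)) W)))"
      by (simp add: mult.left_commute)
    also have "\<dots> = d * (LINT W|lborel. ?V W * cnj (?X (\<lambda>x. cnj (\<phi> x)) W))" by (rule integral_mult_right_zero)
    finally show "op_tau \<tau> \<Phi> a f (\<lambda>x. d * \<phi> x) = d * op_tau \<tau> \<Phi> a f \<phi>"
      unfolding op_tau_def ext_duality_def by simp
  next
    obtain R0 where R0: "0 \<le> R0" "R w0 = ennreal R0" using w0 by (cases "R w0") auto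
    show "\<exists>C N. \<forall>\<phi>\<in>schwartz. cmod (op_tau \<tau> \<Phi> a f \<phi>) \<le> C * schwartz_norm N \<phi>"
    proof (intro exI[of _ "K * c / ?n * R0 / \<mu> w0"] exI[of _ M] ballI)
      fix \<phi> :: "'a \<Rightarrow> complex" assume s: "\<phi> \<in> schwartz"
      have A: "sbd M M (schwartz_norm M \<phi>) (\<lambda>x. cnj (\<phi> x))" by (rule sbd_cnj[OF sbd_schwartz_norm[OF s]])
      have A0: "0 \<le> schwartz_norm M \<phi>" by (rule sbd_nonneg[OF A])
      have "ennreal (cmod (op_tau \<tau> \<Phi> a f \<phi>) * \<mu> w0) \<le> ennreal (K * (c * schwartz_norm M \<phi>) / ?n) * R w0"
        using b[OF hS[OF schwartz_cnj[OF s]] c(2)[OF A], of w0] unfolding tfshift_inverse by simp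
      also have "\<dots> = ennreal (K * (c * schwartz_norm M \<phi>) / ?n * R0)"
        using R0 K c(1) n0 A0 by (simp only: R0(2)) (rule ennreal_mult[symmetric], simp_all)
      finally have "cmod (op_tau \<tau> \<Phi> a f \<phi>) * \<mu> w0 \<le> K * (c * schwartz_norm M \<phi>) / ?n * R0"
        using R0 K c(1) n0 A0 by (simp add: ennreal_le_iff)
      then have "cmod (op_tau \<tau> \<Phi> a f \<phi>) \<le> K * (c * schwartz_norm M \<phi>) / ?n * R0 / \<mu> w0"
        by (simp only: pos_le_divide_eq[OF \<mu>])
      then show "cmod (op_tau \<tau> \<Phi> a f \<phi>) \<le> K * c / ?n * R0 / \<mu> w0 * schwartz_norm M \<phi>" by (simp add: mult_ac)
    qed
  qed
qed

text \<open>For Schwartz \<open>f\<close> the pairing in \<open>op_tau\<close> is Moyal's identity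
  for \<open>a\<close> and the Schwartz function \<open>tau_wigner \<tau> h f\<close>, and
  \<open>\<Phi>\<close> drops out through its energy.\<close>

lemma op_tau_duality:
  fixes f h :: "'a::euclidean_space \<Rightarrow> complex"
  assumes f: "f \<in> schwartz" and h: "h \<in> schwartz" and P: "\<Phi> \<in> schwartz" "\<Phi> \<noteq> (\<lambda>_. 0)" and \<tau>: "0 \<le> \<tau>" "\<tau> \<le> 1"
    and a: "a \<in> tempered"
  shows "duality (op_tau \<tau> \<Phi> a (dist_of_fun f)) h = duality a (tau_wigner \<tau> h f)"
proof -
  let ?n = "LINT z|lborel. (cmod (\<Phi> z))\<^sup>2"
  have n0: "0 < ?n" by (rule window_norm_pos[OF P])
  have W: "tau_wigner \<tau> h f \<in> schwartz" by (rule schwartz_tau_wigner[OF h f \<tau>])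
  have "stft \<Phi> (tau_wigner_dist \<tau> (dist_of_fun h) (dist_of_fun f)) z \<zeta> = stft \<Phi> (dist_of_fun (tau_wigner \<tau> h f)) z \<zeta>" for z \<zeta>
    unfolding stft_tfshift by (rule tau_wigner_dist_functions[OF h f schwartz_cnj[OF schwartz_tfshift[OF P(1)]] \<tau>])
  moreover have "a (\<lambda>y. cnj (tau_wigner \<tau> h f y)) * of_real ?n = (LINT w|lborel. stft \<Phi> a (fst w) (snd w) * cnj (stft \<Phi> (dist_of_fun (tau_wigner \<tau> h f)) (fst w) (snd w)))"
    using stft_inversion[OF a schwartz_cnj[OF W] P(1)] by simp
  ultimately have "duality (op_tau \<tau> \<Phi> a (dist_of_fun f)) h = a (\<lambda>y. cnj (tau_wigner \<tau> h f y)) * of_real ?n / of_real ?n"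
    by (simp add: duality_def op_tau_def ext_duality_def)
  then show ?thesis using n0 by (simp add: duality_def)
qed

theorem theorem4p3:
  fixes v m :: "(real ^ 'd) \<times> (real ^ 'd) \<Rightarrow> real"
    and g :: "real ^ 'd \<Rightarrow> complex"
    and \<Phi> :: "(real ^ 'd) \<times> (real ^ 'd) \<Rightarrow> complex"
    and p q r1 r2 :: ennreal
  assumes "submult_weight v" and "polynomial_growth v"
    and "m \<in> moderate_weights v"
    and "g \<in> schwartz" and "g \<noteq> (\<lambda>_. 0)"
    and "\<Phi> \<in> schwartz" and "\<Phi> \<noteq> (\<lambda>_. 0)"
    and "1 \<le> p" and "1 \<le> q" and "1 \<le> r1" and "1 \<le> r2"
    and "q \<le> conj_exp p"
    and "Max {r1, r2, conj_exp r1, conj_exp r2} \<le> p"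
  shows "\<exists>C>0. \<forall>\<tau>\<in>{0<..<1}. \<forall>a\<in>wiener_space \<Phi> p (v \<circ> symplectic_J) q.
    (\<forall>f\<in>schwartz. \<forall>h\<in>schwartz.
       duality (op_tau \<tau> \<Phi> a (dist_of_fun f)) h = duality a (tau_wigner \<tau> h f)) \<and>
    (\<forall>f1\<in>modulation_space g r1 r2 m. \<forall>f2\<in>modulation_space g r1 r2 m. \<forall>c. \<forall>\<psi>\<in>schwartz.
       op_tau \<tau> \<Phi> a (\<lambda>\<phi>. f1 \<phi> + c * f2 \<phi>) \<psi> = op_tau \<tau> \<Phi> a f1 \<psi> + c * op_tau \<tau> \<Phi> a f2 \<psi>) \<and>
    (\<forall>f\<in>modulation_space g r1 r2 m.
       op_tau \<tau> \<Phi> a f \<in> modulation_space g r1 r2 m \<and>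
       modulation_norm g r1 r2 m (op_tau \<tau> \<Phi> a f)
         \<le> ennreal (C * alpha_tau CARD('d) r1 r2 \<tau>)
            * wiener_norm \<Phi> p (v \<circ> symplectic_J) q a
            * modulation_norm g r1 r2 m f)"
proof -
  let ?N = "2 * DIM((real ^ 'd) \<times> (real ^ 'd))"
  note v = assms(1,2) and g = assms(4,5) and P = assms(6,7) and e = assms(8-11) and qp = assms(12)
  have rp: "r1 \<le> p" "r2 \<le> p" "conj_exp r1 \<le> p" "conj_exp r2 \<le> p" using assms(13) by auto
  obtain \<mu> Cm where Cm: "0 < Cm" and \<mu>: "continuous_on UNIV \<mu>" "\<And>z. 0 < \<mu> z" "\<And>z y. \<mu> (z + y) \<le> v y * \<mu> z"
    and \<mu>m: "\<And>z. \<mu> z \<le> m z" "\<And>z. m z \<le> Cm * \<mu> z"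
    by (rule moderate_weight_regularization[OF v(1) assms(3)]) blast
  have v0: "\<And>z. 0 < v z" and vc: "continuous_on UNIV v" using v(1) unfolding submult_weight_def by auto
  define aa where "aa a W = ennreal (cmod (stft \<Phi> a (fst W) (snd W)) * v (symplectic_J (snd W)))" for a W
  define F where "F f w = ennreal (cmod (stft g f (fst w) (snd w)) * \<mu> w)" for f w
  obtain K M where K: "0 \<le> K" "\<And>\<tau> a f h w A. \<tau> \<in> {0..1} \<Longrightarrow> a \<in> tempered \<Longrightarrow> f \<in> tempered \<Longrightarrow> h \<in> schwartz \<Longrightarrow> sbd M M A h \<Longrightarrow>
    (\<integral>\<^sup>+W. ennreal (cmod (stft \<Phi> a (fst W) (snd W) * cnj (stft \<Phi> (tau_wigner_dist \<tau> (dist_of_fun (tfshift w h)) f) (fst W) (snd W)))) \<partial>lborel) * ennreal (\<mu> w)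
     \<le> ennreal (K * A) * out_op ?N \<tau> (aa a) (F f) w"
    using op_tau_integrand_bound[OF v \<mu> g P(1), of ?N] unfolding aa_def[abs_def] F_def[abs_def] by blast
  obtain C1 where C1: "0 < C1" "\<And>\<tau> (a :: ((real ^ 'd) \<times> (real ^ 'd)) \<times> ((real ^ 'd) \<times> (real ^ 'd)) \<Rightarrow> ennreal) F. 0 < \<tau> \<Longrightarrow> \<tau> < 1 \<Longrightarrow> a \<in> borel_measurable borel \<Longrightarrow> F \<in> borel_measurable borel \<Longrightarrow>
    Lnorm r2 (\<lambda>\<xi>. Lnorm r1 (\<lambda>x. out_op ?N \<tau> a F (x, \<xi>)))
      \<le> ennreal (C1 * alpha_tau CARD('d) r1 r2 \<tau>) * (Lnorm q (\<lambda>z. Lnorm p (\<lambda>\<zeta>. a (z, \<zeta>))) * Lnorm r2 (\<lambda>\<xi>. Lnorm r1 (\<lambda>x. F (x, \<xi>))))"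
    using out_op_bound[OF e qp rp order_refl, where 'a="real ^ 'd"] by auto
  obtain B where B: "sbd M M B g" using schwartz_sbd[OF g(1)] by blast
  have B0: "0 \<le> B" by (rule sbd_nonneg[OF B])
  let ?n = "LINT z|lborel. (cmod (\<Phi> z))\<^sup>2"
  have n0: "0 < ?n" by (rule window_norm_pos[OF P])
  \<comment> \<open>\<open>Cm\<close> returns from \<open>\<mu>\<close> to \<open>m\<close>,
    \<open>B\<close> is the seminorm bound of the window \<open>g\<close>, and the energy of
    \<open>\<Phi>\<close> normalizes the pairing. The summand 1 only keeps \<open>D\<close>
    positive.\<close>
  define D where "D = Cm * (K * B / ?n + 1)"
  have D0: "0 < D" using Cm K(1) B0 n0 by (simp add: D_def add_nonneg_pos)
  have tempered: "f \<in> tempered" "a \<in> tempered"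
    if "f \<in> modulation_space g r1 r2 m" "a \<in> wiener_space \<Phi> p (v \<circ> symplectic_J) q" for f a
    using that by (auto simp: modulation_space_def wiener_space_def)
  have out: "Lnorm r2 (\<lambda>\<xi>. Lnorm r1 (\<lambda>x. out_op ?N \<tau> (aa a) (F f) (x, \<xi>)))
      \<le> ennreal (C1 * alpha_tau CARD('d) r1 r2 \<tau>) * (wiener_norm \<Phi> p (v \<circ> symplectic_J) q a * modulation_norm g r1 r2 m f)"
    if \<tau>: "\<tau> \<in> {0<..<1}" and a: "a \<in> tempered" and f: "f \<in> tempered" for \<tau> a f
  proof -
    have am: "aa a \<in> borel_measurable borel"
      unfolding aa_def symplectic_J_def
      by (intro measurable_compose[OF _ measurable_ennreal] borel_measurable_continuous_onI continuous_intros stft_continuous[OF a P(1)]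
          continuous_on_compose2[OF vc]) auto
    have Fm: "F f \<in> borel_measurable borel"
      unfolding F_def
      by (intro measurable_compose[OF _ measurable_ennreal] borel_measurable_continuous_onI continuous_intros stft_continuous[OF f g(1)] \<mu>(1))
    have "Lnorm q (\<lambda>z. Lnorm p (\<lambda>\<zeta>. aa a (z, \<zeta>))) = wiener_norm \<Phi> p (v \<circ> symplectic_J) q a"
      by (simp add: aa_def wiener_norm_def)
    moreover have "Lnorm r2 (\<lambda>\<xi>. Lnorm r1 (\<lambda>x. F f (x, \<xi>))) \<le> modulation_norm g r1 r2 m f"
      unfolding modulation_norm_def F_def by (intro Lnorm_mono e ennreal_leI) (simp add: mult_left_mono \<mu>m)
    ultimately show ?thesis
      using C1(2)[OF _ _ am Fm, of \<tau>] \<tau> by (auto elim!: order_trans intro!: mult_left_mono)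
  qed
  \<comment> \<open>An everywhere infinite majorant would have infinite mixed norm, contradicting
    \<open>out\<close> with finite norms of \<open>a\<close> and \<open>f\<close>. The point found
    depends on \<open>\<tau>\<close>, \<open>a\<close> and \<open>f\<close>, but it serves only
    convergence and temperedness and does not enter the final constant.\<close>
  have fin: "\<exists>w0. out_op ?N \<tau> (aa a) (F f) w0 < \<infinity>"
    if \<tau>: "\<tau> \<in> {0<..<1}" and a: "a \<in> wiener_space \<Phi> p (v \<circ> symplectic_J) q" and f: "f \<in> modulation_space g r1 r2 m" for \<tau> a f
  proof (rule ccontr)
    assume "\<not> ?thesis"
    then have "out_op ?N \<tau> (aa a) (F f) w = top" for w by (metis infinity_ennreal_def less_top)
    then have "Lnorm r2 (\<lambda>\<xi>. Lnorm r1 (\<lambda>x. out_op ?N \<tau> (aa a) (F f) (x, \<xi>))) = top"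
      by (simp add: Lnorm_top_function e)
    with out[OF \<tau> tempered(2,1)[OF f a]] a f show False
      by (auto simp: wiener_space_def modulation_space_def top_unique ennreal_mult_eq_top_iff)
  qed
  have core: "\<And>h. h \<in> schwartz \<Longrightarrow> integrable lborel (\<lambda>W. stft \<Phi> a (fst W) (snd W) * cnj (stft \<Phi> (tau_wigner_dist \<tau> (dist_of_fun h) f) (fst W) (snd W)))"
    "op_tau \<tau> \<Phi> a f \<in> tempered"
    "\<And>h w A. h \<in> schwartz \<Longrightarrow> sbd M M A h \<Longrightarrow>
      ennreal (cmod (op_tau \<tau> \<Phi> a f (\<lambda>x. cnj (tfshift w h x))) * \<mu> w) \<le> ennreal (K * A / ?n) * out_op ?N \<tau> (aa a) (F f) w"
    if \<tau>: "\<tau> \<in> {0<..<1}" and a: "a \<in> wiener_space \<Phi> p (v \<circ> symplectic_J) q" and f: "f \<in> modulation_space g r1 r2 m" for \<tau> a f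
  proof -
    have \<tau>': "0 \<le> \<tau>" "\<tau> \<le> 1" "\<tau> \<in> {0..1}" using \<tau> by auto
    obtain w0 where w0: "out_op ?N \<tau> (aa a) (F f) w0 < \<infinity>" using fin[OF \<tau> a f] by blast
    note t = tempered(2,1)[OF f a]
    note c = op_tau_tempered[OF g P \<tau>'(1,2) t \<mu>(2) K(1) K(2)[OF \<tau>'(3) t] w0]
    show "\<And>h. h \<in> schwartz \<Longrightarrow> integrable lborel (\<lambda>W. stft \<Phi> a (fst W) (snd W) * cnj (stft \<Phi> (tau_wigner_dist \<tau> (dist_of_fun h) f) (fst W) (snd W)))"
      by (rule c(1))
    show "op_tau \<tau> \<Phi> a f \<in> tempered" by (rule c(2))
    show "\<And>h w A. h \<in> schwartz \<Longrightarrow> sbd M M A h \<Longrightarrow>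
      ennreal (cmod (op_tau \<tau> \<Phi> a f (\<lambda>x. cnj (tfshift w h x))) * \<mu> w) \<le> ennreal (K * A / ?n) * out_op ?N \<tau> (aa a) (F f) w"
      by (rule c(3))
  qed
  have norm_bound: "modulation_norm g r1 r2 m (op_tau \<tau> \<Phi> a f)
      \<le> ennreal (D * C1 * alpha_tau CARD('d) r1 r2 \<tau>) * wiener_norm \<Phi> p (v \<circ> symplectic_J) q a * modulation_norm g r1 r2 m f"
    if \<tau>: "\<tau> \<in> {0<..<1}" and a: "a \<in> wiener_space \<Phi> p (v \<circ> symplectic_J) q" and f: "f \<in> modulation_space g r1 r2 m" for \<tau> a f
  proof -
    let ?O = "out_op ?N \<tau> (aa a) (F f)"
    have \<alpha>: "0 \<le> alpha_tau CARD('d) r1 r2 \<tau>" by (simp add: alpha_tau_def)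
    have pt: "ennreal (cmod (stft g (op_tau \<tau> \<Phi> a f) x \<xi>) * m (x, \<xi>)) \<le> ennreal D * ?O (x, \<xi>)" for x \<xi>
    proof -
      let ?c = "cmod (stft g (op_tau \<tau> \<Phi> a f) x \<xi>)"
      have "?c * m (x, \<xi>) \<le> Cm * (?c * \<mu> (x, \<xi>))"
        using mult_left_mono[OF \<mu>m(2), of ?c "(x, \<xi>)"] by (simp add: mult_ac)
      then have "ennreal (?c * m (x, \<xi>)) \<le> ennreal Cm * ennreal (?c * \<mu> (x, \<xi>))"
        using Cm by (simp add: ennreal_leI flip: ennreal_mult')
      also have "\<dots> \<le> ennreal Cm * (ennreal (K * B / ?n) * ?O (x, \<xi>))"
        \<comment> \<open>The pointwise bound is used with \<open>h = g\<close>, so its left side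
          contains the short-time Fourier transform of \<open>op_tau \<tau> \<Phi> a f\<close>
          itself.\<close>
        using core(3)[OF \<tau> a f g(1) B, of "(x, \<xi>)"] by (intro mult_left_mono) (simp_all add: stft_tfshift)
      also have "\<dots> = ennreal (Cm * (K * B / ?n)) * ?O (x, \<xi>)"
        using Cm by (subst ennreal_mult') (simp_all add: mult.assoc)
      also have "\<dots> \<le> ennreal D * ?O (x, \<xi>)"
        unfolding D_def using Cm by (intro mult_right_mono ennreal_leI mult_left_mono) auto
      finally show ?thesis .
    qed
    have "modulation_norm g r1 r2 m (op_tau \<tau> \<Phi> a f) \<le> Lnorm r2 (\<lambda>\<xi>. Lnorm r1 (\<lambda>x. ennreal D * ?O (x, \<xi>)))"
      unfolding modulation_norm_def by (intro Lnorm_mono e pt)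
    also have "\<dots> \<le> Lnorm r2 (\<lambda>\<xi>. ennreal D * Lnorm r1 (\<lambda>x. ?O (x, \<xi>)))"
      by (intro Lnorm_mono Lnorm_cmult_le e) (use D0 in auto)
    also have "\<dots> \<le> ennreal D * Lnorm r2 (\<lambda>\<xi>. Lnorm r1 (\<lambda>x. ?O (x, \<xi>)))"
      by (intro Lnorm_cmult_le e) (use D0 in auto)
    also have "\<dots> \<le> ennreal D * (ennreal (C1 * alpha_tau CARD('d) r1 r2 \<tau>) * (wiener_norm \<Phi> p (v \<circ> symplectic_J) q a * modulation_norm g r1 r2 m f))"
      by (intro mult_left_mono out[OF \<tau> tempered(2,1)[OF f a]]) simp
    also have "\<dots> = ennreal (D * C1 * alpha_tau CARD('d) r1 r2 \<tau>) * wiener_norm \<Phi> p (v \<circ> symplectic_J) q a * modulation_norm g r1 r2 m f"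
      using D0 C1(1) \<alpha> by (simp add: ennreal_mult' mult.assoc)
    finally show ?thesis .
  qed
  show ?thesis
  proof (intro exI[of _ "D * C1"] conjI ballI allI)
    show "0 < D * C1" using D0 C1(1) by simp
  next
    fix \<tau> :: real and a and f h :: "real ^ 'd \<Rightarrow> complex" assume \<tau>: "\<tau> \<in> {0<..<1::real}" and a: "a \<in> wiener_space \<Phi> p (v \<circ> symplectic_J) q"
      and fh: "f \<in> schwartz" "h \<in> schwartz"
    show "duality (op_tau \<tau> \<Phi> a (dist_of_fun f)) h = duality a (tau_wigner \<tau> h f)"
      by (rule op_tau_duality[OF fh P]) (use \<tau> a in \<open>auto simp: wiener_space_def\<close>)
  next
    fix \<tau> :: real and a c and f1 f2 :: "(real ^ 'd \<Rightarrow> complex) \<Rightarrow> complex" and \<psi> :: "real ^ 'd \<Rightarrow> complex"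
    assume \<tau>: "\<tau> \<in> {0<..<1::real}" and a: "a \<in> wiener_space \<Phi> p (v \<circ> symplectic_J) q"
      and f: "f1 \<in> modulation_space g r1 r2 m" "f2 \<in> modulation_space g r1 r2 m" and \<psi>: "\<psi> \<in> schwartz"
    show "op_tau \<tau> \<Phi> a (\<lambda>\<phi>. f1 \<phi> + c * f2 \<phi>) \<psi> = op_tau \<tau> \<Phi> a f1 \<psi> + c * op_tau \<tau> \<Phi> a f2 \<psi>"
      by (rule op_tau_linear[OF g P(1) _ _ tempered(1)[OF f(1) a] tempered(1)[OF f(2) a] \<psi>
            core(1)[OF \<tau> a f(1) schwartz_cnj[OF \<psi>]] core(1)[OF \<tau> a f(2) schwartz_cnj[OF \<psi>]]]) (use \<tau> in auto)
  next
    fix \<tau> :: real and a and f :: "(real ^ 'd \<Rightarrow> complex) \<Rightarrow> complex"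
    assume \<tau>: "\<tau> \<in> {0<..<1::real}" and a: "a \<in> wiener_space \<Phi> p (v \<circ> symplectic_J) q" and f: "f \<in> modulation_space g r1 r2 m"
    show "modulation_norm g r1 r2 m (op_tau \<tau> \<Phi> a f)
      \<le> ennreal (D * C1 * alpha_tau CARD('d) r1 r2 \<tau>) * wiener_norm \<Phi> p (v \<circ> symplectic_J) q a * modulation_norm g r1 r2 m f"
      by (rule norm_bound[OF \<tau> a f])
    also have "\<dots> < top" using a f by (simp add: wiener_space_def modulation_space_def ennreal_mult_less_top)
    finally show "op_tau \<tau> \<Phi> a f \<in> modulation_space g r1 r2 m"
      using core(2)[OF \<tau> a f] by (simp add: modulation_space_def)
  qed
qed

end
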